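(* Let $(\mathcal{M},\otimes,\mathbf{1},\sigma)$ be an abelian symmetric monoidal category that satisfies the faithful coflatness condition and the faithful flatness condition. Then the category $\mathsf{Hopf}_{\mathrm{coc}}(\mathcal{M})$ of cocommutative Hopf monoids in $\mathcal{M}$ is regular.
   Context: Associativity and unit constraints are suppressed. An abelian symmetric monoidal category is a symmetric monoidal category $(\mathcal{M},\otimes,\mathbf{1},\sigma)$ such that $\mathcal{M}$ is abelian and, for every object $M$, the functors $M\otimes(-)$ and $(-)\otimes M$ are additive and exact. $\mathsf{Hopf}_{\mathrm{coc}}(\mathcal{M})$: objects are Hopf monoids $(A,m_A,u_A,\Delta_A,\varepsilon_A,S_A)$ in $\mathcal{M}$ with $\sigma_{A,A}\Delta_A=\Delta_A$; morphisms are morphisms of Hopf monoids. For $A$ in $\mathsf{Hopf}_{\mathrm{coc}}(\mathcal{M})$, the category $\mathsf{Comon}_{\mathrm{coc}}({}_A\mathcal{M})$ has as objects the cocommutative comonoids $Q$ in $\mathcal{M}$ with a left $A$-action $\mu_Q:A\otimes Q\to Q$ such that $\Delta_Q,\varepsilon_Q$ are left $A$-linear, where $Q\otimes Q$ has action $(\mu_Q\otimes\mu_Q)(\mathrm{Id}_A\otimes\sigma_{A,Q}\otimes\mathrm{Id}_Q)(\Delta_A\otimes\mathrm{Id}_{Q\otimes Q})$ and $\mathbf{1}$ has action $\varepsilon_A$; morphisms are the left $A$-linear comonoid morphisms. $A$ is an object of it via $m_A$. Cotensor product: for a right $Q$-comodule $(V,\rho_V)$ and a left $Q$-comodule $(W,\lambda_W)$,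 $V\square_Q W$ is the equalizer in $\mathcal{M}$ of $\rho_V\otimes\mathrm{Id}_W,\ \mathrm{Id}_V\otimes\lambda_W: V\otimes W\to V\otimes Q\otimes W$; this gives functors $(-)\square_Q W:\mathcal{M}^Q\to\mathcal{M}$ from right $Q$-comodules. Balanced tensor product: for a monoid $K$, a right $K$-module $(M,\nu_M)$ and a left $K$-module $(X,\mu_X)$, $M\otimes_K X$ is the coequalizer in $\mathcal{M}$ of $\nu_M\otimes\mathrm{Id}_X,\ \mathrm{Id}_M\otimes\mu_X:M\otimes K\otimes X\to M\otimes X$; this gives functors $(-)\otimes_K X:\mathcal{M}_K\to\mathcal{M}$ from right $K$-modules. Faithful coflatness condition: for any $A$ in $\mathsf{Hopf}_{\mathrm{coc}}(\mathcal{M})$ and any morphism $\pi:A\to Q$ in $\mathsf{Comon}_{\mathrm{coc}}({}_A\mathcal{M})$ which is an epimorphism in $\mathcal{M}$, the functor $(-)\square_Q A$ preserves and reflects epimorphisms, where $A$ is a left $Q$-comodule via $(\pi\otimes\mathrm{Id}_A)\Delta_A$. Faithful flatness condition: for any $A$ in $\mathsf{Hopf}_{\mathrm{coc}}(\mathcal{M})$ and any morphism $i:K\to A$ in $\mathsf{Hopf}_{\mathrm{coc}}(\mathcal{M})$ which is a monomorphism in $\mathcal{M}$, the functor $(-)\otimes_K A$ preserves and reflects monomorphisms, where $A$ is a left $K$-module via $m_A(i\otimes\mathrm{Id}_A)$. A category is regular if it has finite limits, every morphism factors as a regular epimorphism (a coequalizer of some pair) followed by a monomorphism, and regular epimorphisms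 are stable under pullbacks. *)

theory Defs
  imports "HOL-Algebra.Group"
begin

section \<open>Categories\<close>

record ('o, 'm) cat =
  Ob :: "'o set"
  Ar :: "'m set"
  Dom :: "'m \<Rightarrow> 'o"
  Cod :: "'m \<Rightarrow> 'o"
  Ide :: "'o \<Rightarrow> 'm" ("\<i>\<index>")
  Comp :: "'m \<Rightarrow> 'm \<Rightarrow> 'm" (infixr "\<cdot>\<index>" 55)

definition Hom :: "('o, 'm, 'z) cat_scheme \<Rightarrow> 'o \<Rightarrow> 'o \<Rightarrow> 'm set" where
  "Hom C A B = {f \<in> Ar C. Dom C f = A \<and> Cod C f = B}"

locale category =
  fixes C :: "('o, 'm, 'z) cat_scheme" (structure)
  assumes dom_in: "f \<in> Ar C \<Longrightarrow> Dom C f \<in> Ob C"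
    and cod_in: "f \<in> Ar C \<Longrightarrow> Cod C f \<in> Ob C"
    and ide_in: "A \<in> Ob C \<Longrightarrow> \<i> A \<in> Hom C A A"
    and comp_in: "\<lbrakk>f \<in> Hom C A B; g \<in> Hom C B D\<rbrakk> \<Longrightarrow> g \<cdot> f \<in> Hom C A D"
    and comp_ide_left: "f \<in> Hom C A B \<Longrightarrow> \<i> B \<cdot> f = f"
    and comp_ide_right: "f \<in> Hom C A B \<Longrightarrow> f \<cdot> \<i> A = f"
    and comp_assoc: "\<lbrakk>f \<in> Hom C A B; g \<in> Hom C B D; h \<in> Hom C D E\<rbrakk>
      \<Longrightarrow> (h \<cdot> g) \<cdot> f = h \<cdot> (g \<cdot> f)"

context
  fixes C :: "('o, 'm, 'z) cat_scheme" (structure)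
begin

definition monic :: "'m \<Rightarrow> bool" where
  "monic f \<longleftrightarrow> f \<in> Ar C \<and>
    (\<forall>X. \<forall>g \<in> Hom C X (Dom C f). \<forall>h \<in> Hom C X (Dom C f). f \<cdot> g = f \<cdot> h \<longrightarrow> g = h)"

definition epic :: "'m \<Rightarrow> bool" where
  "epic f \<longleftrightarrow> f \<in> Ar C \<and>
    (\<forall>X. \<forall>g \<in> Hom C (Cod C f) X. \<forall>h \<in> Hom C (Cod C f) X. g \<cdot> f = h \<cdot> f \<longrightarrow> g = h)"

definition inverse_arrows :: "'m \<Rightarrow> 'm \<Rightarrow> bool" where
  "inverse_arrows f g \<longleftrightarrow> f \<in> Ar C \<and> g \<in> Hom C (Cod C f) (Dom C f) \<and>
    g \<cdot> f = \<i> (Dom C f) \<and> f \<cdot> g = \<i> (Cod C f)"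

definition iso_arrow :: "'m \<Rightarrow> bool" where
  "iso_arrow f \<longleftrightarrow> (\<exists>g. inverse_arrows f g)"

definition inv_arrow :: "'m \<Rightarrow> 'm" where
  "inv_arrow f = (THE g. inverse_arrows f g)"

definition parallel :: "'m \<Rightarrow> 'm \<Rightarrow> bool" where
  "parallel f g \<longleftrightarrow> f \<in> Ar C \<and> g \<in> Ar C \<and> Dom C f = Dom C g \<and> Cod C f = Cod C g"

definition is_equalizer :: "'m \<Rightarrow> 'm \<Rightarrow> 'm \<Rightarrow> bool" where
  "is_equalizer e f g \<longleftrightarrow> parallel f g \<and> e \<in> Ar C \<and> Cod C e = Dom C f \<and> f \<cdot> e = g \<cdot> e \<and>
    (\<forall>X. \<forall>h \<in> Hom C X (Dom C f). f \<cdot> h = g \<cdot> h \<longrightarrow> (\<exists>!k. k \<in> Hom C X (Dom C e) \<and> e \<cdot> k = h))"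

definition is_coequalizer :: "'m \<Rightarrow> 'm \<Rightarrow> 'm \<Rightarrow> bool" where
  "is_coequalizer q f g \<longleftrightarrow> parallel f g \<and> q \<in> Ar C \<and> Dom C q = Cod C f \<and> q \<cdot> f = q \<cdot> g \<and>
    (\<forall>X. \<forall>h \<in> Hom C (Cod C f) X. h \<cdot> f = h \<cdot> g \<longrightarrow> (\<exists>!k. k \<in> Hom C (Cod C q) X \<and> k \<cdot> q = h))"

definition regular_epi :: "'m \<Rightarrow> bool" where
  "regular_epi q \<longleftrightarrow> (\<exists>f g. is_coequalizer q f g)"

definition is_pullback :: "'m \<Rightarrow> 'm \<Rightarrow> 'm \<Rightarrow> 'm \<Rightarrow> bool" where
  "is_pullback f g p q \<longleftrightarrow> f \<in> Ar C \<and> g \<in> Ar C \<and> p \<in> Ar C \<and> q \<in> Ar C \<and>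
    Cod C f = Cod C g \<and> Cod C p = Dom C f \<and> Cod C q = Dom C g \<and> Dom C p = Dom C q \<and>
    f \<cdot> p = g \<cdot> q \<and>
    (\<forall>X. \<forall>h \<in> Hom C X (Dom C f). \<forall>k \<in> Hom C X (Dom C g). f \<cdot> h = g \<cdot> k \<longrightarrow>
      (\<exists>!l. l \<in> Hom C X (Dom C p) \<and> p \<cdot> l = h \<and> q \<cdot> l = k))"

definition zero_object :: "'o \<Rightarrow> bool" where
  "zero_object Z \<longleftrightarrow> Z \<in> Ob C \<and>
    (\<forall>A \<in> Ob C. (\<exists>!f. f \<in> Hom C A Z) \<and> (\<exists>!f. f \<in> Hom C Z A))"

end

record ('o, 'm, 'p, 'n) cat_functor =
  FO :: "'o \<Rightarrow> 'p"
  FA :: "'m \<Rightarrow> 'n"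

definition is_functor ::
  "('o, 'm, 'z) cat_scheme \<Rightarrow> ('p, 'n, 'y) cat_scheme \<Rightarrow> ('o, 'm, 'p, 'n) cat_functor \<Rightarrow> bool" where
  "is_functor C D F \<longleftrightarrow> category C \<and> category D \<and>
    (\<forall>A \<in> Ob C. FO F A \<in> Ob D \<and> FA F (Ide C A) = Ide D (FO F A)) \<and>
    (\<forall>f \<in> Ar C. FA F f \<in> Hom D (FO F (Dom C f)) (FO F (Cod C f))) \<and>
    (\<forall>f \<in> Ar C. \<forall>g \<in> Ar C. Dom C g = Cod C f \<longrightarrow>
      FA F (Comp C g f) = Comp D (FA F g) (FA F f))"

definition preserves_epis ::
  "('o, 'm, 'z) cat_scheme \<Rightarrow> ('p, 'n, 'y) cat_scheme \<Rightarrow> ('o, 'm, 'p, 'n) cat_functor \<Rightarrow> bool" where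
  "preserves_epis C D F \<longleftrightarrow> (\<forall>f \<in> Ar C. epic C f \<longrightarrow> epic D (FA F f))"

definition reflects_epis ::
  "('o, 'm, 'z) cat_scheme \<Rightarrow> ('p, 'n, 'y) cat_scheme \<Rightarrow> ('o, 'm, 'p, 'n) cat_functor \<Rightarrow> bool" where
  "reflects_epis C D F \<longleftrightarrow> (\<forall>f \<in> Ar C. epic D (FA F f) \<longrightarrow> epic C f)"

definition preserves_monos ::
  "('o, 'm, 'z) cat_scheme \<Rightarrow> ('p, 'n, 'y) cat_scheme \<Rightarrow> ('o, 'm, 'p, 'n) cat_functor \<Rightarrow> bool" where
  "preserves_monos C D F \<longleftrightarrow> (\<forall>f \<in> Ar C. monic C f \<longrightarrow> monic D (FA F f))"

definition reflects_monos ::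
  "('o, 'm, 'z) cat_scheme \<Rightarrow> ('p, 'n, 'y) cat_scheme \<Rightarrow> ('o, 'm, 'p, 'n) cat_functor \<Rightarrow> bool" where
  "reflects_monos C D F \<longleftrightarrow> (\<forall>f \<in> Ar C. monic D (FA F f) \<longrightarrow> monic C f)"


section \<open>Regular categories\<close>

definition is_cone ::
  "('i, 'j, 'y) cat_scheme \<Rightarrow> ('o, 'm, 'z) cat_scheme \<Rightarrow> ('i, 'j, 'o, 'm) cat_functor \<Rightarrow>
    'o \<Rightarrow> ('i \<Rightarrow> 'm) \<Rightarrow> bool" where
  "is_cone J C F L p \<longleftrightarrow> L \<in> Ob C \<and> (\<forall>i \<in> Ob J. p i \<in> Hom C L (FO F i)) \<and>
    (\<forall>u \<in> Ar J. Comp C (FA F u) (p (Dom J u)) = p (Cod J u))"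

definition is_limit ::
  "('i, 'j, 'y) cat_scheme \<Rightarrow> ('o, 'm, 'z) cat_scheme \<Rightarrow> ('i, 'j, 'o, 'm) cat_functor \<Rightarrow>
    'o \<Rightarrow> ('i \<Rightarrow> 'm) \<Rightarrow> bool" where
  "is_limit J C F L p \<longleftrightarrow> is_cone J C F L p \<and>
    (\<forall>X q. is_cone J C F X q \<longrightarrow>
      (\<exists>!h. h \<in> Hom C X L \<and> (\<forall>i \<in> Ob J. Comp C (p i) h = q i)))"

text \<open>Every finite category is isomorphic to one whose objects and arrows are natural numbers, so
  it is no restriction to index diagrams by categories of type \<^typ>\<open>(nat, nat) cat\<close>. Finitely many
  arrows entail finitely many objects, because of the identities.\<close>

definition has_finite_limits :: "('o, 'm, 'z) cat_scheme \<Rightarrow> bool" where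
  "has_finite_limits C \<longleftrightarrow>
    (\<forall>(J :: (nat, nat) cat) F. category J \<and> finite (Ar J) \<and> is_functor J C F \<longrightarrow>
      (\<exists>L p. is_limit J C F L p))"

locale regular_category = category C for C :: "('o, 'm, 'z) cat_scheme" (structure) +
  assumes finite_limits: "has_finite_limits C"
    and regular_epi_mono_factorization:
      "f \<in> Ar C \<Longrightarrow> \<exists>e m. regular_epi C e \<and> monic C m \<and> Cod C e = Dom C m \<and> f = m \<cdot> e"
    and regular_epi_pullback_stable:
      "\<lbrakk>is_pullback C f g p q; regular_epi C f\<rbrakk> \<Longrightarrow> regular_epi C q"


section \<open>Abelian categories\<close>

record ('o, 'm) preadditive_cat = "('o, 'm) cat" +
  Add :: "'m \<Rightarrow> 'm \<Rightarrow> 'm" (infixl "\<oplus>\<index>" 52)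
  Zero :: "'o \<Rightarrow> 'o \<Rightarrow> 'm" ("\<zero>\<index>")

locale preadditive_category = category C
  for C :: "('o, 'm, 'z) preadditive_cat_scheme" (structure) +
  assumes hom_group: "\<lbrakk>A \<in> Ob C; B \<in> Ob C\<rbrakk>
      \<Longrightarrow> comm_group \<lparr>carrier = Hom C A B, monoid.mult = (\<oplus>), one = \<zero> A B\<rparr>"
    and comp_add_left: "\<lbrakk>f \<in> Hom C A B; g \<in> Hom C B D; h \<in> Hom C B D\<rbrakk>
      \<Longrightarrow> (g \<oplus> h) \<cdot> f = (g \<cdot> f) \<oplus> (h \<cdot> f)"
    and comp_add_right: "\<lbrakk>f \<in> Hom C A B; g \<in> Hom C A B; h \<in> Hom C B D\<rbrakk>
      \<Longrightarrow> h \<cdot> (f \<oplus> g) = (h \<cdot> f) \<oplus> (h \<cdot> g)"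

context
  fixes C :: "('o, 'm, 'z) preadditive_cat_scheme" (structure)
begin

definition is_kernel :: "'m \<Rightarrow> 'm \<Rightarrow> bool" where
  "is_kernel k f \<longleftrightarrow> is_equalizer C k f (\<zero> (Dom C f) (Cod C f))"

definition is_cokernel :: "'m \<Rightarrow> 'm \<Rightarrow> bool" where
  "is_cokernel c f \<longleftrightarrow> is_coequalizer C c f (\<zero> (Dom C f) (Cod C f))"

definition is_biproduct :: "'o \<Rightarrow> 'o \<Rightarrow> 'o \<Rightarrow> 'm \<Rightarrow> 'm \<Rightarrow> 'm \<Rightarrow> 'm \<Rightarrow> bool" where
  "is_biproduct A B P i j p q \<longleftrightarrow>
    i \<in> Hom C A P \<and> j \<in> Hom C B P \<and> p \<in> Hom C P A \<and> q \<in> Hom C P B \<and>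
    p \<cdot> i = \<i> A \<and> q \<cdot> j = \<i> B \<and> q \<cdot> i = \<zero> A B \<and> p \<cdot> j = \<zero> B A \<and>
    (i \<cdot> p) \<oplus> (j \<cdot> q) = \<i> P"

definition short_exact :: "'m \<Rightarrow> 'm \<Rightarrow> bool" where
  "short_exact f g \<longleftrightarrow> is_kernel f g \<and> is_cokernel g f"

end

locale abelian_category = preadditive_category C
  for C :: "('o, 'm, 'z) preadditive_cat_scheme" (structure) +
  assumes has_zero_object: "\<exists>Z. zero_object C Z"
    and has_biproducts: "\<lbrakk>A \<in> Ob C; B \<in> Ob C\<rbrakk> \<Longrightarrow> \<exists>P i j p q. is_biproduct C A B P i j p q"
    and has_kernels: "f \<in> Ar C \<Longrightarrow> \<exists>k. is_kernel C k f"
    and has_cokernels: "f \<in> Ar C \<Longrightarrow> \<exists>c. is_cokernel C c f"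
    and monic_is_kernel: "monic C f \<Longrightarrow> \<exists>g. is_kernel C f g"
    and epic_is_cokernel: "epic C f \<Longrightarrow> \<exists>g. is_cokernel C f g"

definition additive_functor ::
  "('o, 'm, 'z) preadditive_cat_scheme \<Rightarrow> ('p, 'n, 'y) preadditive_cat_scheme \<Rightarrow>
    ('o, 'm, 'p, 'n) cat_functor \<Rightarrow> bool" where
  "additive_functor C D F \<longleftrightarrow> is_functor C D F \<and>
    (\<forall>f g. parallel C f g \<longrightarrow> FA F (Add C f g) = Add D (FA F f) (FA F g))"

definition exact_functor ::
  "('o, 'm, 'z) preadditive_cat_scheme \<Rightarrow> ('p, 'n, 'y) preadditive_cat_scheme \<Rightarrow>
    ('o, 'm, 'p, 'n) cat_functor \<Rightarrow> bool" where
  "exact_functor C D F \<longleftrightarrow> is_functor C D F \<and>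
    (\<forall>f g. short_exact C f g \<longrightarrow> short_exact D (FA F f) (FA F g))"


section \<open>Symmetric monoidal categories\<close>

text \<open>The constraints are explicit:
  \<open>\<a> X Y Z : (X \<otimes> Y) \<otimes> Z \<rightarrow> X \<otimes> (Y \<otimes> Z)\<close>, \<open>\<l> X : \<I> \<otimes> X \<rightarrow> X\<close>, \<open>\<r> X : X \<otimes> \<I> \<rightarrow> X\<close> and
  \<open>\<s> X Y : X \<otimes> Y \<rightarrow> Y \<otimes> X\<close>. The tensor product is written \<open>\<otimes>\<^sub>o\<close> on objects and \<open>\<otimes>\<^sub>a\<close> on arrows.\<close>

record ('o, 'm) sym_mon_cat = "('o, 'm) preadditive_cat" +
  TenO :: "'o \<Rightarrow> 'o \<Rightarrow> 'o" (infixr "\<otimes>\<^sub>o\<index>" 70)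
  TenA :: "'m \<Rightarrow> 'm \<Rightarrow> 'm" (infixr "\<otimes>\<^sub>a\<index>" 70)
  UnitO :: "'o" ("\<I>\<index>")
  Assoc :: "'o \<Rightarrow> 'o \<Rightarrow> 'o \<Rightarrow> 'm" ("\<a>\<index>")
  LUnit :: "'o \<Rightarrow> 'm" ("\<l>\<index>")
  RUnit :: "'o \<Rightarrow> 'm" ("\<r>\<index>")
  Sym :: "'o \<Rightarrow> 'o \<Rightarrow> 'm" ("\<s>\<index>")

locale monoidal_category = category M
  for M :: "('o, 'm, 'z) sym_mon_cat_scheme" (structure) +
  assumes tensor_ob: "\<lbrakk>X \<in> Ob M; Y \<in> Ob M\<rbrakk> \<Longrightarrow> X \<otimes>\<^sub>o Y \<in> Ob M"
    and tensor_ar: "\<lbrakk>f \<in> Hom M X X'; g \<in> Hom M Y Y'\<rbrakk>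
      \<Longrightarrow> f \<otimes>\<^sub>a g \<in> Hom M (X \<otimes>\<^sub>o Y) (X' \<otimes>\<^sub>o Y')"
    and tensor_ide: "\<lbrakk>X \<in> Ob M; Y \<in> Ob M\<rbrakk> \<Longrightarrow> \<i> X \<otimes>\<^sub>a \<i> Y = \<i> (X \<otimes>\<^sub>o Y)"
    and tensor_comp: "\<lbrakk>f \<in> Hom M X X'; f' \<in> Hom M X' X''; g \<in> Hom M Y Y'; g' \<in> Hom M Y' Y''\<rbrakk>
      \<Longrightarrow> (f' \<cdot> f) \<otimes>\<^sub>a (g' \<cdot> g) = (f' \<otimes>\<^sub>a g') \<cdot> (f \<otimes>\<^sub>a g)"
    and unit_ob: "\<I> \<in> Ob M"
    and assoc_in: "\<lbrakk>X \<in> Ob M; Y \<in> Ob M; Z \<in> Ob M\<rbrakk>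
      \<Longrightarrow> \<a> X Y Z \<in> Hom M ((X \<otimes>\<^sub>o Y) \<otimes>\<^sub>o Z) (X \<otimes>\<^sub>o (Y \<otimes>\<^sub>o Z))"
    and assoc_iso: "\<lbrakk>X \<in> Ob M; Y \<in> Ob M; Z \<in> Ob M\<rbrakk> \<Longrightarrow> iso_arrow M (\<a> X Y Z)"
    and assoc_natural: "\<lbrakk>f \<in> Hom M X X'; g \<in> Hom M Y Y'; h \<in> Hom M Z Z'\<rbrakk>
      \<Longrightarrow> \<a> X' Y' Z' \<cdot> ((f \<otimes>\<^sub>a g) \<otimes>\<^sub>a h) = (f \<otimes>\<^sub>a (g \<otimes>\<^sub>a h)) \<cdot> \<a> X Y Z"
    and lunit_in: "X \<in> Ob M \<Longrightarrow> \<l> X \<in> Hom M (\<I> \<otimes>\<^sub>o X) X"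
    and lunit_iso: "X \<in> Ob M \<Longrightarrow> iso_arrow M (\<l> X)"
    and lunit_natural: "f \<in> Hom M X X' \<Longrightarrow> \<l> X' \<cdot> (\<i> \<I> \<otimes>\<^sub>a f) = f \<cdot> \<l> X"
    and runit_in: "X \<in> Ob M \<Longrightarrow> \<r> X \<in> Hom M (X \<otimes>\<^sub>o \<I>) X"
    and runit_iso: "X \<in> Ob M \<Longrightarrow> iso_arrow M (\<r> X)"
    and runit_natural: "f \<in> Hom M X X' \<Longrightarrow> \<r> X' \<cdot> (f \<otimes>\<^sub>a \<i> \<I>) = f \<cdot> \<r> X"
    and pentagon: "\<lbrakk>W \<in> Ob M; X \<in> Ob M; Y \<in> Ob M; Z \<in> Ob M\<rbrakk>
      \<Longrightarrow> \<a> W X (Y \<otimes>\<^sub>o Z) \<cdot> \<a> (W \<otimes>\<^sub>o X) Y Z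
        = (\<i> W \<otimes>\<^sub>a \<a> X Y Z) \<cdot> \<a> W (X \<otimes>\<^sub>o Y) Z \<cdot> (\<a> W X Y \<otimes>\<^sub>a \<i> Z)"
    and triangle: "\<lbrakk>X \<in> Ob M; Y \<in> Ob M\<rbrakk>
      \<Longrightarrow> (\<i> X \<otimes>\<^sub>a \<l> Y) \<cdot> \<a> X \<I> Y = \<r> X \<otimes>\<^sub>a \<i> Y"

locale symmetric_monoidal_category = monoidal_category M
  for M :: "('o, 'm, 'z) sym_mon_cat_scheme" (structure) +
  assumes sym_in: "\<lbrakk>X \<in> Ob M; Y \<in> Ob M\<rbrakk> \<Longrightarrow> \<s> X Y \<in> Hom M (X \<otimes>\<^sub>o Y) (Y \<otimes>\<^sub>o X)"
    and sym_natural: "\<lbrakk>f \<in> Hom M X X'; g \<in> Hom M Y Y'\<rbrakk>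
      \<Longrightarrow> \<s> X' Y' \<cdot> (f \<otimes>\<^sub>a g) = (g \<otimes>\<^sub>a f) \<cdot> \<s> X Y"
    and sym_sym: "\<lbrakk>X \<in> Ob M; Y \<in> Ob M\<rbrakk> \<Longrightarrow> \<s> Y X \<cdot> \<s> X Y = \<i> (X \<otimes>\<^sub>o Y)"
    and hexagon: "\<lbrakk>X \<in> Ob M; Y \<in> Ob M; Z \<in> Ob M\<rbrakk>
      \<Longrightarrow> \<a> Y Z X \<cdot> \<s> X (Y \<otimes>\<^sub>o Z) \<cdot> \<a> X Y Z
        = (\<i> Y \<otimes>\<^sub>a \<s> X Z) \<cdot> \<a> Y X Z \<cdot> (\<s> X Y \<otimes>\<^sub>a \<i> Z)"

definition tensor_left :: "('o, 'm, 'z) sym_mon_cat_scheme \<Rightarrow> 'o \<Rightarrow> ('o, 'm, 'o, 'm) cat_functor" where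
  "tensor_left M X = \<lparr>FO = \<lambda>Y. TenO M X Y, FA = \<lambda>f. TenA M (Ide M X) f\<rparr>"

definition tensor_right :: "('o, 'm, 'z) sym_mon_cat_scheme \<Rightarrow> 'o \<Rightarrow> ('o, 'm, 'o, 'm) cat_functor" where
  "tensor_right M X = \<lparr>FO = \<lambda>Y. TenO M Y X, FA = \<lambda>f. TenA M f (Ide M X)\<rparr>"

locale abelian_symmetric_monoidal_category =
  abelian_category M + symmetric_monoidal_category M
  for M :: "('o, 'm, 'z) sym_mon_cat_scheme" (structure) +
  assumes tensor_left_additive: "X \<in> Ob M \<Longrightarrow> additive_functor M M (tensor_left M X)"
    and tensor_right_additive: "X \<in> Ob M \<Longrightarrow> additive_functor M M (tensor_right M X)"
    and tensor_left_exact: "X \<in> Ob M \<Longrightarrow> exact_functor M M (tensor_left M X)"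
    and tensor_right_exact: "X \<in> Ob M \<Longrightarrow> exact_functor M M (tensor_right M X)"


section \<open>Categories of objects with structure\<close>

text \<open>The category with object set \<open>X\<close>, where \<open>U\<close> gives underlying objects and \<open>H x y\<close> consists of
  the arrows of \<open>C\<close> that are admissible as morphisms from \<open>x\<close> to \<open>y\<close>. Its arrows are the triples
  \<open>(x, f, y)\<close>, since \<open>f\<close> alone does not determine the structures on its domain and codomain.\<close>

definition structured_cat ::
  "('o, 'm, 'z) cat_scheme \<Rightarrow> 'x set \<Rightarrow> ('x \<Rightarrow> 'o) \<Rightarrow> ('x \<Rightarrow> 'x \<Rightarrow> 'm set) \<Rightarrow>
    ('x, 'x \<times> 'm \<times> 'x) cat" where
  "structured_cat C X U H =
    \<lparr>Ob = X,
     Ar = {(x, f, y). x \<in> X \<and> y \<in> X \<and> f \<in> H x y},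
     Dom = (\<lambda>(x, f, y). x),
     Cod = (\<lambda>(x, f, y). y),
     Ide = (\<lambda>x. (x, Ide C (U x), x)),
     Comp = (\<lambda>(y, g, z) (x, f, y'). (x, Comp C g f, z))\<rparr>"

record ('o, 'm) hopf =
  h_obj :: "'o"
  h_mult :: "'m"
  h_unit :: "'m"
  h_comult :: "'m"
  h_counit :: "'m"
  h_antipode :: "'m"

record ('o, 'm) module_comonoid =
  q_obj :: "'o"
  q_comult :: "'m"
  q_counit :: "'m"
  q_action :: "'m"

context
  fixes M :: "('o, 'm, 'z) sym_mon_cat_scheme" (structure)
begin

text \<open>\<open>Id \<otimes> \<sigma> \<otimes> Id : (X \<otimes> Y) \<otimes> (Z \<otimes> W) \<rightarrow> (X \<otimes> Z) \<otimes> (Y \<otimes> W)\<close>\<close>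

definition interchange :: "'o \<Rightarrow> 'o \<Rightarrow> 'o \<Rightarrow> 'o \<Rightarrow> 'm" where
  "interchange X Y Z W =
    inv_arrow M (\<a> X Z (Y \<otimes>\<^sub>o W)) \<cdot>
    (\<i> X \<otimes>\<^sub>a (\<a> Z Y W \<cdot> (\<s> Y Z \<otimes>\<^sub>a \<i> W) \<cdot> inv_arrow M (\<a> Y Z W))) \<cdot>
    \<a> X Y (Z \<otimes>\<^sub>o W)"


subsection \<open>Cocommutative Hopf monoids\<close>

definition is_monoid :: "'o \<Rightarrow> 'm \<Rightarrow> 'm \<Rightarrow> bool" where
  "is_monoid A m u \<longleftrightarrow> A \<in> Ob M \<and> m \<in> Hom M (A \<otimes>\<^sub>o A) A \<and> u \<in> Hom M \<I> A \<and>
    m \<cdot> (m \<otimes>\<^sub>a \<i> A) = m \<cdot> (\<i> A \<otimes>\<^sub>a m) \<cdot> \<a> A A A \<and>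
    m \<cdot> (u \<otimes>\<^sub>a \<i> A) = \<l> A \<and>
    m \<cdot> (\<i> A \<otimes>\<^sub>a u) = \<r> A"

definition is_comonoid :: "'o \<Rightarrow> 'm \<Rightarrow> 'm \<Rightarrow> bool" where
  "is_comonoid A d e \<longleftrightarrow> A \<in> Ob M \<and> d \<in> Hom M A (A \<otimes>\<^sub>o A) \<and> e \<in> Hom M A \<I> \<and>
    \<a> A A A \<cdot> (d \<otimes>\<^sub>a \<i> A) \<cdot> d = (\<i> A \<otimes>\<^sub>a d) \<cdot> d \<and>
    \<l> A \<cdot> (e \<otimes>\<^sub>a \<i> A) \<cdot> d = \<i> A \<and>
    \<r> A \<cdot> (\<i> A \<otimes>\<^sub>a e) \<cdot> d = \<i> A"

definition cocommutative :: "'o \<Rightarrow> 'm \<Rightarrow> bool" where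
  "cocommutative A d \<longleftrightarrow> \<s> A A \<cdot> d = d"

definition is_bimonoid :: "'o \<Rightarrow> 'm \<Rightarrow> 'm \<Rightarrow> 'm \<Rightarrow> 'm \<Rightarrow> bool" where
  "is_bimonoid A m u d e \<longleftrightarrow> is_monoid A m u \<and> is_comonoid A d e \<and>
    d \<cdot> m = (m \<otimes>\<^sub>a m) \<cdot> interchange A A A A \<cdot> (d \<otimes>\<^sub>a d) \<and>
    d \<cdot> u = (u \<otimes>\<^sub>a u) \<cdot> inv_arrow M (\<l> \<I>) \<and>
    e \<cdot> m = \<l> \<I> \<cdot> (e \<otimes>\<^sub>a e) \<and>
    e \<cdot> u = \<i> \<I>"

definition is_hopf_monoid :: "('o, 'm) hopf \<Rightarrow> bool" where
  "is_hopf_monoid A \<longleftrightarrow>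
    is_bimonoid (h_obj A) (h_mult A) (h_unit A) (h_comult A) (h_counit A) \<and>
    h_antipode A \<in> Hom M (h_obj A) (h_obj A) \<and>
    h_mult A \<cdot> (h_antipode A \<otimes>\<^sub>a \<i> (h_obj A)) \<cdot> h_comult A = h_unit A \<cdot> h_counit A \<and>
    h_mult A \<cdot> (\<i> (h_obj A) \<otimes>\<^sub>a h_antipode A) \<cdot> h_comult A = h_unit A \<cdot> h_counit A"

definition comonoid_hom :: "'o \<Rightarrow> 'm \<Rightarrow> 'm \<Rightarrow> 'o \<Rightarrow> 'm \<Rightarrow> 'm \<Rightarrow> 'm \<Rightarrow> bool" where
  "comonoid_hom A d e B d' e' f \<longleftrightarrow> f \<in> Hom M A B \<and> d' \<cdot> f = (f \<otimes>\<^sub>a f) \<cdot> d \<and> e' \<cdot> f = e"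

definition monoid_hom :: "'o \<Rightarrow> 'm \<Rightarrow> 'm \<Rightarrow> 'o \<Rightarrow> 'm \<Rightarrow> 'm \<Rightarrow> 'm \<Rightarrow> bool" where
  "monoid_hom A m u B m' u' f \<longleftrightarrow> f \<in> Hom M A B \<and> f \<cdot> m = m' \<cdot> (f \<otimes>\<^sub>a f) \<and> f \<cdot> u = u'"

text \<open>Compatibility with the antipodes is automatic.\<close>

definition hopf_hom :: "('o, 'm) hopf \<Rightarrow> ('o, 'm) hopf \<Rightarrow> 'm \<Rightarrow> bool" where
  "hopf_hom A B f \<longleftrightarrow>
    monoid_hom (h_obj A) (h_mult A) (h_unit A) (h_obj B) (h_mult B) (h_unit B) f \<and>
    comonoid_hom (h_obj A) (h_comult A) (h_counit A) (h_obj B) (h_comult B) (h_counit B) f"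

definition Hopf_coc :: "(('o, 'm) hopf, ('o, 'm) hopf \<times> 'm \<times> ('o, 'm) hopf) cat" where
  "Hopf_coc = structured_cat M
    {A. is_hopf_monoid A \<and> cocommutative (h_obj A) (h_comult A)}
    h_obj (\<lambda>A B. {f. hopf_hom A B f})"


subsection \<open>Modules and comodules\<close>

definition is_left_module :: "'o \<Rightarrow> 'm \<Rightarrow> 'm \<Rightarrow> 'o \<Rightarrow> 'm \<Rightarrow> bool" where
  "is_left_module K m u X a \<longleftrightarrow> X \<in> Ob M \<and> a \<in> Hom M (K \<otimes>\<^sub>o X) X \<and>
    a \<cdot> (m \<otimes>\<^sub>a \<i> X) = a \<cdot> (\<i> K \<otimes>\<^sub>a a) \<cdot> \<a> K K X \<and>
    a \<cdot> (u \<otimes>\<^sub>a \<i> X) = \<l> X"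

definition is_right_module :: "'o \<Rightarrow> 'm \<Rightarrow> 'm \<Rightarrow> 'o \<Rightarrow> 'm \<Rightarrow> bool" where
  "is_right_module K m u X a \<longleftrightarrow> X \<in> Ob M \<and> a \<in> Hom M (X \<otimes>\<^sub>o K) X \<and>
    a \<cdot> (a \<otimes>\<^sub>a \<i> K) = a \<cdot> (\<i> X \<otimes>\<^sub>a m) \<cdot> \<a> X K K \<and>
    a \<cdot> (\<i> X \<otimes>\<^sub>a u) = \<r> X"

definition is_right_comodule :: "'o \<Rightarrow> 'm \<Rightarrow> 'm \<Rightarrow> 'o \<Rightarrow> 'm \<Rightarrow> bool" where
  "is_right_comodule Q d e V c \<longleftrightarrow> V \<in> Ob M \<and> c \<in> Hom M V (V \<otimes>\<^sub>o Q) \<and>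
    \<a> V Q Q \<cdot> (c \<otimes>\<^sub>a \<i> Q) \<cdot> c = (\<i> V \<otimes>\<^sub>a d) \<cdot> c \<and>
    \<r> V \<cdot> (\<i> V \<otimes>\<^sub>a e) \<cdot> c = \<i> V"

definition Right_modules :: "'o \<Rightarrow> 'm \<Rightarrow> 'm \<Rightarrow> ('o \<times> 'm, ('o \<times> 'm) \<times> 'm \<times> ('o \<times> 'm)) cat" where
  "Right_modules K m u = structured_cat M {(X, a). is_right_module K m u X a} fst
    (\<lambda>(X, a) (Y, b). {f \<in> Hom M X Y. f \<cdot> a = b \<cdot> (f \<otimes>\<^sub>a \<i> K)})"

definition Right_comodules :: "'o \<Rightarrow> 'm \<Rightarrow> 'm \<Rightarrow> ('o \<times> 'm, ('o \<times> 'm) \<times> 'm \<times> ('o \<times> 'm)) cat" where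
  "Right_comodules Q d e = structured_cat M {(V, c). is_right_comodule Q d e V c} fst
    (\<lambda>(V, c) (W, c'). {f \<in> Hom M V W. c' \<cdot> f = (f \<otimes>\<^sub>a \<i> Q) \<cdot> c})"

definition diagonal_action :: "('o, 'm) hopf \<Rightarrow> 'o \<Rightarrow> 'm \<Rightarrow> 'm" where
  "diagonal_action A Q a =
    (a \<otimes>\<^sub>a a) \<cdot> interchange (h_obj A) (h_obj A) Q Q \<cdot> (h_comult A \<otimes>\<^sub>a \<i> (Q \<otimes>\<^sub>o Q))"

definition trivial_action :: "('o, 'm) hopf \<Rightarrow> 'm" where
  "trivial_action A = h_counit A \<cdot> \<r> (h_obj A)"

definition left_linear :: "'o \<Rightarrow> 'm \<Rightarrow> 'm \<Rightarrow> 'm \<Rightarrow> bool" where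
  "left_linear K a b f \<longleftrightarrow> f \<cdot> a = b \<cdot> (\<i> K \<otimes>\<^sub>a f)"

definition is_coc_module_comonoid :: "('o, 'm) hopf \<Rightarrow> ('o, 'm) module_comonoid \<Rightarrow> bool" where
  "is_coc_module_comonoid A Q \<longleftrightarrow>
    is_comonoid (q_obj Q) (q_comult Q) (q_counit Q) \<and>
    cocommutative (q_obj Q) (q_comult Q) \<and>
    is_left_module (h_obj A) (h_mult A) (h_unit A) (q_obj Q) (q_action Q) \<and>
    left_linear (h_obj A) (q_action Q) (diagonal_action A (q_obj Q) (q_action Q)) (q_comult Q) \<and>
    left_linear (h_obj A) (q_action Q) (trivial_action A) (q_counit Q)"

definition Comon_coc :: "('o, 'm) hopf \<Rightarrow>
    (('o, 'm) module_comonoid, ('o, 'm) module_comonoid \<times> 'm \<times> ('o, 'm) module_comonoid) cat" where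
  "Comon_coc A = structured_cat M {Q. is_coc_module_comonoid A Q} q_obj
    (\<lambda>Q R. {f. comonoid_hom (q_obj Q) (q_comult Q) (q_counit Q)
                  (q_obj R) (q_comult R) (q_counit R) f \<and>
                left_linear (h_obj A) (q_action Q) (q_action R) f})"

definition regular_module_comonoid :: "('o, 'm) hopf \<Rightarrow> ('o, 'm) module_comonoid" where
  "regular_module_comonoid A =
    \<lparr>q_obj = h_obj A, q_comult = h_comult A, q_counit = h_counit A, q_action = h_mult A\<rparr>"


subsection \<open>Cotensor product and balanced tensor product\<close>

text \<open>The equalizer and the coequalizer are chosen by Hilbert choice. The arrow of \<open>M\<close> that embeds
  \<open>V \<box>\<^sub>Q W\<close> into \<open>V \<otimes> W\<close> is chosen, and \<open>V \<box>\<^sub>Q W\<close> is its domain; dually for \<open>X \<otimes>\<^sub>K Y\<close>. The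
  action on arrows is the induced arrow.\<close>

definition cotensor_incl :: "'o \<Rightarrow> 'o \<Rightarrow> 'm \<Rightarrow> 'o \<times> 'm \<Rightarrow> 'm" where
  "cotensor_incl Q W c' = (\<lambda>(V, c). SOME e.
    is_equalizer M e (\<a> V Q W \<cdot> (c \<otimes>\<^sub>a \<i> W)) (\<i> V \<otimes>\<^sub>a c'))"

definition cotensor :: "'o \<Rightarrow> 'o \<Rightarrow> 'm \<Rightarrow>
    ('o \<times> 'm, ('o \<times> 'm) \<times> 'm \<times> ('o \<times> 'm), 'o, 'm) cat_functor" where
  "cotensor Q W c' =
    \<lparr>FO = \<lambda>v. Dom M (cotensor_incl Q W c' v),
     FA = \<lambda>(v, f, v'). THE g.
       g \<in> Hom M (Dom M (cotensor_incl Q W c' v)) (Dom M (cotensor_incl Q W c' v')) \<and>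
       cotensor_incl Q W c' v' \<cdot> g = (f \<otimes>\<^sub>a \<i> W) \<cdot> cotensor_incl Q W c' v\<rparr>"

definition balanced_proj :: "'o \<Rightarrow> 'o \<Rightarrow> 'm \<Rightarrow> 'o \<times> 'm \<Rightarrow> 'm" where
  "balanced_proj K Y b = (\<lambda>(X, a). SOME q.
    is_coequalizer M q (a \<otimes>\<^sub>a \<i> Y) ((\<i> X \<otimes>\<^sub>a b) \<cdot> \<a> X K Y))"

definition balanced_tensor :: "'o \<Rightarrow> 'o \<Rightarrow> 'm \<Rightarrow>
    ('o \<times> 'm, ('o \<times> 'm) \<times> 'm \<times> ('o \<times> 'm), 'o, 'm) cat_functor" where
  "balanced_tensor K Y b =
    \<lparr>FO = \<lambda>x. Cod M (balanced_proj K Y b x),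
     FA = \<lambda>(x, f, x'). THE g.
       g \<in> Hom M (Cod M (balanced_proj K Y b x)) (Cod M (balanced_proj K Y b x')) \<and>
       g \<cdot> balanced_proj K Y b x = balanced_proj K Y b x' \<cdot> (f \<otimes>\<^sub>a \<i> Y)\<rparr>"


subsection \<open>Faithful coflatness and faithful flatness\<close>

definition faithful_coflatness :: bool where
  "faithful_coflatness \<longleftrightarrow>
    (\<forall>A \<in> Ob Hopf_coc. \<forall>Q \<pi>.
      (regular_module_comonoid A, \<pi>, Q) \<in> Ar (Comon_coc A) \<and> epic M \<pi> \<longrightarrow>
      (let R = Right_comodules (q_obj Q) (q_comult Q) (q_counit Q);
           F = cotensor (q_obj Q) (h_obj A) ((\<pi> \<otimes>\<^sub>a \<i> (h_obj A)) \<cdot> h_comult A)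
       in preserves_epis R M F \<and> reflects_epis R M F))"

definition faithful_flatness :: bool where
  "faithful_flatness \<longleftrightarrow>
    (\<forall>A \<in> Ob Hopf_coc. \<forall>K i.
      (K, i, A) \<in> Ar Hopf_coc \<and> monic M i \<longrightarrow>
      (let R = Right_modules (h_obj K) (h_mult K) (h_unit K);
           F = balanced_tensor (h_obj K) (h_obj A) (h_mult A \<cdot> (i \<otimes>\<^sub>a \<i> (h_obj A)))
       in preserves_monos R M F \<and> reflects_monos R M F))"

end

end

theory Submission
  imports Defs
begin

text \<open>Cocommutative Hopf monoids are the internal groups in the category of cocommutative comonoids, in
  which the tensor product is the categorical product. Hence products are tensor products, and the
  equalizer of \<open>f, g : A \<rightarrow> B\<close> is the equalizer in \<open>M\<close> of \<open>(Id \<otimes> f)\<Delta>\<close> and \<open>(Id \<otimes> g)\<Delta>\<close>, which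
  inherits a Hopf structure by exactness of \<open>\<otimes>\<close>. So does the image in \<open>M\<close> of a Hopf morphism. It
  remains to show, for a Hopf morphism \<open>\<pi> : A \<rightarrow> Q\<close> that is an epimorphism in \<open>M\<close>, that \<open>\<pi>\<close> is the
  coequalizer of its kernel pair and that its base changes are epimorphisms in \<open>M\<close>. Both amount to some
  morphism of \<open>Q\<close>-comodules being an epimorphism. As \<open>(-) \<box>\<^sub>Q A\<close> reflects epimorphisms, this may be
  checked after cotensoring with \<open>A\<close>, where \<open>(x, a) \<mapsto> (x, a, a)\<close> gives a section.\<close>

section \<open>Arrow calculus: monomorphisms, epimorphisms, equalizers and coequalizers\<close>

section \<open>Categories\<close>

text \<open>Faithful coflatness speaks about colinear arrows of \<open>M\<close>, which need not be
  morphisms of comonoids. Each pullback is therefore described twice: by its universal property for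
  Hopf morphisms, and as an equalizer in \<open>M\<close> tested against arbitrary arrows. The
  second description identifies it with a cotensor product inside \<open>X \<otimes> A\<close>. The
  equalizer of \<open>f\<close> and \<open>g\<close> themselves in \<open>M\<close> would not serve,
  since it need not be closed under the comultiplication; the equalizer of their graphs is, by
  coassociativity and cocommutativity. That \<open>\<pi>\<close> coequalizes its kernel pair
  universally is already a fact about \<open>M\<close>: the difference of the two projections covers
  the kernel of \<open>\<pi>\<close>, whose cokernel is \<open>\<pi>\<close>. An image factorization
  then shows that regular epimorphisms of Hopf monoids are exactly the Hopf morphisms that are epic
  in \<open>M\<close>, which turns their stability under pullback into a question about
  \<open>M\<close>.\<close>

context category
begin

text \<open>Membership in a hom set is dissolved into equations for \<open>Dom\<close> and
  \<open>Cod\<close>, so that typing conditions of composites are decided by rewriting and no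
  intermediate object has to be guessed.\<close>

lemma in_Hom [simp]: "f \<in> Hom C A B \<longleftrightarrow> f \<in> Ar C \<and> Dom C f = A \<and> Cod C f = B"
  by (auto simp: Hom_def)

lemma dom_ob [simp]: "f \<in> Ar C \<Longrightarrow> Dom C f \<in> Ob C"
  by (rule dom_in)

lemma cod_ob [simp]: "f \<in> Ar C \<Longrightarrow> Cod C f \<in> Ob C"
  by (rule cod_in)

lemma ide_simps [simp]:
  assumes "A \<in> Ob C"
  shows "\<i> A \<in> Ar C" "Dom C (\<i> A) = A" "Cod C (\<i> A) = A"
  using ide_in[OF assms] by auto

lemma comp_simps [simp]:
  assumes "f \<in> Ar C" "g \<in> Ar C" "Dom C g = Cod C f"
  shows "g \<cdot> f \<in> Ar C" "Dom C (g \<cdot> f) = Dom C f" "Cod C (g \<cdot> f) = Cod C g"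
  using comp_in[of f "Dom C f" "Cod C f" g "Cod C g"] assms by auto

lemma ide_comp [simp]: "\<lbrakk>f \<in> Ar C; Cod C f = B\<rbrakk> \<Longrightarrow> \<i> B \<cdot> f = f"
  using comp_ide_left[of f "Dom C f" B] by auto

lemma comp_ide [simp]: "\<lbrakk>f \<in> Ar C; Dom C f = A\<rbrakk> \<Longrightarrow> f \<cdot> \<i> A = f"
  using comp_ide_right[of f A "Cod C f"] by auto

lemma assoc [simp]:
  "\<lbrakk>f \<in> Ar C; g \<in> Ar C; h \<in> Ar C; Dom C g = Cod C f; Dom C h = Cod C g\<rbrakk>
    \<Longrightarrow> (h \<cdot> g) \<cdot> f = h \<cdot> (g \<cdot> f)"
  using comp_assoc[of f "Dom C f" "Cod C f" g "Cod C g" h "Cod C h"] by auto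

text \<open>Composites are kept nested to the right, where an equation for
  \<open>g \<cdot> f\<close> no longer matches once a further arrow precedes it.
  \<open>[THEN reassoc]\<close> produces the version that does match.\<close>

lemma reassoc:
  "\<lbrakk>g \<cdot> f = k; f \<in> Ar C; g \<in> Ar C; Dom C g = Cod C f; x \<in> Ar C; Cod C x = Dom C f\<rbrakk>
    \<Longrightarrow> g \<cdot> (f \<cdot> x) = k \<cdot> x"
  by (metis assoc)

lemma monic_cancel:
  "\<lbrakk>monic C f; f \<cdot> g = f \<cdot> h; g \<in> Ar C; h \<in> Ar C; Cod C g = Dom C f; Cod C h = Dom C f;
    Dom C g = Dom C h\<rbrakk> \<Longrightarrow> g = h"
  unfolding monic_def by auto

lemma epic_cancel:
  "\<lbrakk>epic C f; g \<cdot> f = h \<cdot> f; g \<in> Ar C; h \<in> Ar C; Dom C g = Cod C f; Dom C h = Cod C f;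
    Cod C g = Cod C h\<rbrakk> \<Longrightarrow> g = h"
  unfolding epic_def by auto

lemma monic_ar: "monic C f \<Longrightarrow> f \<in> Ar C"
  by (simp add: monic_def)

lemma epic_ar: "epic C f \<Longrightarrow> f \<in> Ar C"
  by (simp add: epic_def)

lemma monicI:
  assumes "f \<in> Ar C"
    and "\<And>X g h. \<lbrakk>g \<in> Hom C X (Dom C f); h \<in> Hom C X (Dom C f); f \<cdot> g = f \<cdot> h\<rbrakk> \<Longrightarrow> g = h"
  shows "monic C f"
  unfolding monic_def using assms by blast

lemma epicI:
  assumes "f \<in> Ar C"
    and "\<And>X g h. \<lbrakk>g \<in> Hom C (Cod C f) X; h \<in> Hom C (Cod C f) X; g \<cdot> f = h \<cdot> f\<rbrakk> \<Longrightarrow> g = h"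
  shows "epic C f"
  unfolding epic_def using assms by blast

lemma monic_comp:
  assumes "monic C f" "monic C g" "Dom C g = Cod C f"
  shows "monic C (g \<cdot> f)"
proof -
  have ar: "f \<in> Ar C" "g \<in> Ar C"
    using assms monic_ar by auto
  show ?thesis
  proof (rule monicI)
    show "g \<cdot> f \<in> Ar C"
      using ar assms(3) by simp
    fix X h k
    assume h: "h \<in> Hom C X (Dom C (g \<cdot> f))" "k \<in> Hom C X (Dom C (g \<cdot> f))"
      and eq: "(g \<cdot> f) \<cdot> h = (g \<cdot> f) \<cdot> k"
    have "f \<cdot> h = f \<cdot> k"
      using eq h ar assms(3) by - (rule monic_cancel[OF assms(2)], auto)
    then show "h = k"
      using h ar assms(3) by - (rule monic_cancel[OF assms(1)], auto)
  qed
qed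

lemma epic_comp:
  assumes "epic C f" "epic C g" "Dom C g = Cod C f"
  shows "epic C (g \<cdot> f)"
proof -
  have ar: "f \<in> Ar C" "g \<in> Ar C"
    using assms epic_ar by auto
  show ?thesis
  proof (rule epicI)
    show "g \<cdot> f \<in> Ar C"
      using ar assms(3) by simp
    fix X h k
    assume h: "h \<in> Hom C (Cod C (g \<cdot> f)) X" "k \<in> Hom C (Cod C (g \<cdot> f)) X"
      and eq: "h \<cdot> (g \<cdot> f) = k \<cdot> (g \<cdot> f)"
    have "h \<cdot> g = k \<cdot> g"
      using eq h ar assms(3) by - (rule epic_cancel[OF assms(1)], auto)
    then show "h = k"
      using h ar assms(3) by - (rule epic_cancel[OF assms(2)], auto)
  qed
qed

lemma split_epic:
  assumes "f \<in> Ar C" "s \<in> Ar C" "Dom C f = Cod C s" "f \<cdot> s = \<i> (Cod C f)"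
  shows "epic C f"
proof (rule epicI)
  fix X g h
  assume gh: "g \<in> Hom C (Cod C f) X" "h \<in> Hom C (Cod C f) X" "g \<cdot> f = h \<cdot> f"
  have "g \<cdot> (f \<cdot> s) = h \<cdot> (f \<cdot> s)"
    using reassoc[OF gh(3), of s] gh assms(1-3) by simp
  then show "g = h"
    using gh assms by simp
qed fact

text \<open>\<open>inv_arrow\<close> is a definite description, so uniqueness of inverses has to
  come before any statement about it.\<close>

lemma inverse_arrows_inv:
  assumes "iso_arrow C f"
  shows "inverse_arrows C f (inv_arrow C f)"
proof -
  obtain g where g: "inverse_arrows C f g"
    using assms by (auto simp: iso_arrow_def)
  have "h = g" if "inverse_arrows C f h" for h
  proof -
    have h: "f \<in> Ar C" "g \<in> Ar C" "h \<in> Ar C" "Dom C g = Cod C f" "Cod C g = Dom C f"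
      "Dom C h = Cod C f" "Cod C h = Dom C f" "f \<cdot> g = \<i> (Cod C f)" "h \<cdot> f = \<i> (Dom C f)"
      using that g by (auto simp: inverse_arrows_def)
    have "h = h \<cdot> (f \<cdot> g)"
      using h by simp
    also have "\<dots> = g"
      using h assoc[of g f h] by simp
    finally show ?thesis .
  qed
  then show ?thesis
    using g unfolding inv_arrow_def by (metis theI)
qed

lemma inv_arrow_simps:
  assumes "iso_arrow C f"
  shows "f \<in> Ar C" "inv_arrow C f \<in> Ar C" "Dom C (inv_arrow C f) = Cod C f"
    "Cod C (inv_arrow C f) = Dom C f"
    "inv_arrow C f \<cdot> f = \<i> (Dom C f)" "f \<cdot> inv_arrow C f = \<i> (Cod C f)"
  using inverse_arrows_inv[OF assms] by (auto simp: inverse_arrows_def)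

lemma iso_monic:
  assumes "iso_arrow C f"
  shows "monic C f"
proof (rule monicI)
  note inv = inv_arrow_simps[OF assms]
  show "f \<in> Ar C"
    by (rule inv)
  fix X g h
  assume gh: "g \<in> Hom C X (Dom C f)" "h \<in> Hom C X (Dom C f)" "f \<cdot> g = f \<cdot> h"
  have "inv_arrow C f \<cdot> (f \<cdot> k) = k" if "k \<in> Hom C X (Dom C f)" for k
    by (subst reassoc[OF inv(5)]) (use that inv in auto)
  then show "g = h"
    using gh by metis
qed

lemma iso_epic: "iso_arrow C f \<Longrightarrow> epic C f"
  by (rule split_epic[of f "inv_arrow C f"]) (auto simp: inv_arrow_simps)

lemma equalizer_simps:
  assumes "is_equalizer C e f g"
  shows "e \<in> Ar C" "f \<in> Ar C" "g \<in> Ar C" "Dom C f = Cod C e" "Dom C g = Cod C e"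
    "Cod C g = Cod C f" "f \<cdot> e = g \<cdot> e"
  using assms by (auto simp: is_equalizer_def parallel_def)

lemma equalizer_ex1:
  "\<lbrakk>is_equalizer C e f g; h \<in> Hom C X (Dom C f); f \<cdot> h = g \<cdot> h\<rbrakk>
    \<Longrightarrow> \<exists>!k. k \<in> Hom C X (Dom C e) \<and> e \<cdot> k = h"
  unfolding is_equalizer_def by (elim conjE, drule spec, drule (1) bspec, drule (1) mp)

lemma equalizer_lift:
  assumes "is_equalizer C e f g" "h \<in> Ar C" "Cod C h = Cod C e" "f \<cdot> h = g \<cdot> h"
  obtains k where "k \<in> Hom C (Dom C h) (Dom C e)" "e \<cdot> k = h"
proof -
  have "h \<in> Hom C (Dom C h) (Dom C f)"
    using assms(2,3) equalizer_simps[OF assms(1)] by simp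
  then show thesis
    using equalizer_ex1[OF assms(1)] assms(4) that by blast
qed

lemma equalizer_monic:
  assumes "is_equalizer C e f g"
  shows "monic C e"
proof (rule monicI)
  note simps = equalizer_simps[OF assms]
  fix X h k
  assume h: "h \<in> Hom C X (Dom C e)" "k \<in> Hom C X (Dom C e)" and eq: "e \<cdot> h = e \<cdot> k"
  have "\<exists>!l. l \<in> Hom C X (Dom C e) \<and> e \<cdot> l = e \<cdot> h"
    using h simps reassoc[OF simps(7), of h] by (intro equalizer_ex1[OF assms]) auto
  then show "h = k"
    using h eq by metis
qed (rule equalizer_simps[OF assms])

text \<open>Monicity of \<open>e\<close> accounts for uniqueness, so that only the existence of
  factorizations is left to be supplied.\<close>

lemma equalizerI:
  assumes "f \<in> Hom C A B" "g \<in> Hom C A B" "monic C e" "Cod C e = A" "f \<cdot> e = g \<cdot> e"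
    and "\<And>h. \<lbrakk>h \<in> Ar C; Cod C h = A; f \<cdot> h = g \<cdot> h\<rbrakk> \<Longrightarrow> \<exists>k \<in> Hom C (Dom C h) (Dom C e). e \<cdot> k = h"
  shows "is_equalizer C e f g"
  unfolding is_equalizer_def parallel_def
proof (intro conjI allI ballI impI)
  fix X h
  assume h: "h \<in> Hom C X (Dom C f)" "f \<cdot> h = g \<cdot> h"
  obtain k where k: "k \<in> Hom C X (Dom C e)" "e \<cdot> k = h"
    using assms(6)[of h] assms(1) h by auto
  show "\<exists>!k. k \<in> Hom C X (Dom C e) \<and> e \<cdot> k = h"
  proof (rule ex1I[of _ k])
    fix l
    assume "l \<in> Hom C X (Dom C e) \<and> e \<cdot> l = h"
    then show "l = k"
      using k monic_ar[OF assms(3)] by - (rule monic_cancel[OF assms(3)], auto)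
  qed (use k in blast)
qed (use assms monic_ar in auto)

lemma coequalizer_simps:
  assumes "is_coequalizer C q f g"
  shows "q \<in> Ar C" "f \<in> Ar C" "g \<in> Ar C" "Dom C q = Cod C f" "Cod C g = Cod C f"
    "Dom C g = Dom C f" "q \<cdot> f = q \<cdot> g"
  using assms by (auto simp: is_coequalizer_def parallel_def)

lemma coequalizer_ex1:
  "\<lbrakk>is_coequalizer C q f g; h \<in> Hom C (Cod C f) X; h \<cdot> f = h \<cdot> g\<rbrakk>
    \<Longrightarrow> \<exists>!k. k \<in> Hom C (Cod C q) X \<and> k \<cdot> q = h"
  unfolding is_coequalizer_def by (elim conjE, drule spec, drule (1) bspec, drule (1) mp)

lemma coequalizer_desc:
  assumes "is_coequalizer C q f g" "h \<in> Ar C" "Dom C h = Dom C q" "h \<cdot> f = h \<cdot> g"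
  obtains k where "k \<in> Hom C (Cod C q) (Cod C h)" "k \<cdot> q = h"
proof -
  have "h \<in> Hom C (Cod C f) (Cod C h)"
    using assms(2,3) coequalizer_simps[OF assms(1)] by simp
  then show thesis
    using coequalizer_ex1[OF assms(1)] assms(4) that by blast
qed

lemma coequalizer_epic:
  assumes "is_coequalizer C q f g"
  shows "epic C q"
proof (rule epicI)
  note simps = coequalizer_simps[OF assms]
  fix X h k
  assume h: "h \<in> Hom C (Cod C q) X" "k \<in> Hom C (Cod C q) X" and eq: "h \<cdot> q = k \<cdot> q"
  have "(h \<cdot> q) \<cdot> f = (h \<cdot> q) \<cdot> g"
    using h simps by simp
  then have "\<exists>!l. l \<in> Hom C (Cod C q) X \<and> l \<cdot> q = h \<cdot> q"
    using h simps by (intro coequalizer_ex1[OF assms]) auto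
  then show "h = k"
    using h eq by metis
qed (rule coequalizer_simps[OF assms])

end


section \<open>Differences of arrows, kernels and cokernels\<close>

section \<open>Abelian categories\<close>

context preadditive_category
begin

lemma add_simps [simp]:
  assumes "f \<in> Ar C" "g \<in> Ar C" "Dom C g = Dom C f" "Cod C g = Cod C f"
  shows "f \<oplus> g \<in> Ar C" "Dom C (f \<oplus> g) = Dom C f" "Cod C (f \<oplus> g) = Cod C f"
proof -
  interpret G: comm_group "\<lparr>carrier = Hom C (Dom C f) (Cod C f), monoid.mult = (\<oplus>),
      one = \<zero> (Dom C f) (Cod C f)\<rparr>"
    using assms by (intro hom_group) auto
  show "f \<oplus> g \<in> Ar C" "Dom C (f \<oplus> g) = Dom C f" "Cod C (f \<oplus> g) = Cod C f"
    using G.m_closed[of f g] assms by auto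
qed

lemma zero_simps [simp]:
  assumes "A \<in> Ob C" "B \<in> Ob C"
  shows "\<zero> A B \<in> Ar C" "Dom C (\<zero> A B) = A" "Cod C (\<zero> A B) = B"
proof -
  interpret G: comm_group "\<lparr>carrier = Hom C A B, monoid.mult = (\<oplus>), one = \<zero> A B\<rparr>"
    using assms by (rule hom_group)
  show "\<zero> A B \<in> Ar C" "Dom C (\<zero> A B) = A" "Cod C (\<zero> A B) = B"
    using G.one_closed by auto
qed

lemma zero_add [simp]:
  assumes "f \<in> Ar C" "Dom C f = A" "Cod C f = B"
  shows "\<zero> A B \<oplus> f = f"
proof -
  interpret G: comm_group "\<lparr>carrier = Hom C A B, monoid.mult = (\<oplus>), one = \<zero> A B\<rparr>"
    using assms by (intro hom_group) auto
  show ?thesis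
    using G.l_one[of f] assms by simp
qed

lemma add_cancel:
  assumes "f \<in> Hom C A B" "g \<in> Hom C A B" "h \<in> Hom C A B" "f \<oplus> h = g \<oplus> h"
  shows "f = g"
proof -
  interpret G: comm_group "\<lparr>carrier = Hom C A B, monoid.mult = (\<oplus>), one = \<zero> A B\<rparr>"
    using assms by (intro hom_group) auto
  show ?thesis
    using G.right_cancel[of h f g] assms by simp
qed

text \<open>The signature has no subtraction; \<open>f - g\<close> is represented throughout by an
  arrow \<open>d\<close> with \<open>d \<oplus> g = f\<close>.\<close>

lemma ex_difference:
  assumes "f \<in> Hom C A B" "g \<in> Hom C A B"
  obtains d where "d \<in> Hom C A B" "d \<oplus> g = f"
proof -
  interpret G: comm_group "\<lparr>carrier = Hom C A B, monoid.mult = (\<oplus>), one = \<zero> A B\<rparr>"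
    using assms by (intro hom_group) auto
  let ?G = "\<lparr>carrier = Hom C A B, monoid.mult = (\<oplus>), one = \<zero> A B\<rparr>"
  have "f \<oplus> m_inv ?G g \<in> Hom C A B"
    using G.m_closed[of f "m_inv ?G g"] G.inv_closed[of g] assms by simp
  moreover have "(f \<oplus> m_inv ?G g) \<oplus> g = f"
    using G.m_assoc[of f "m_inv ?G g" g] G.inv_closed[of g] G.l_inv[of g] G.r_one[of f] assms
    by simp
  ultimately show thesis
    by (rule that)
qed

lemma zero_comp [simp]:
  assumes "f \<in> Ar C" "Cod C f = B" "D \<in> Ob C"
  shows "\<zero> B D \<cdot> f = \<zero> (Dom C f) D"
proof (rule add_cancel[where h = "\<zero> B D \<cdot> f"])
  have B: "B \<in> Ob C"
    using assms by auto
  have "(\<zero> B D \<oplus> \<zero> B D) \<cdot> f = (\<zero> B D \<cdot> f) \<oplus> (\<zero> B D \<cdot> f)"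
    using assms B by (intro comp_add_left) auto
  then show "\<zero> B D \<cdot> f \<oplus> \<zero> B D \<cdot> f = \<zero> (Dom C f) D \<oplus> \<zero> B D \<cdot> f"
    using assms B by simp
qed (use assms in auto)

lemma comp_zero [simp]:
  assumes "f \<in> Ar C" "Dom C f = B" "A \<in> Ob C"
  shows "f \<cdot> \<zero> A B = \<zero> A (Cod C f)"
proof (rule add_cancel[where h = "f \<cdot> \<zero> A B"])
  have B: "B \<in> Ob C"
    using assms by auto
  have "f \<cdot> (\<zero> A B \<oplus> \<zero> A B) = (f \<cdot> \<zero> A B) \<oplus> (f \<cdot> \<zero> A B)"
    using assms B by (intro comp_add_right) auto
  then show "f \<cdot> \<zero> A B \<oplus> f \<cdot> \<zero> A B = \<zero> A (Cod C f) \<oplus> f \<cdot> \<zero> A B"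
    using assms B by simp
qed (use assms in auto)

text \<open>Read with \<open>d\<close> as the difference of \<open>d \<oplus> g\<close> and
  \<open>g\<close>, this trades equalizers for kernels. The next lemma is its dual.\<close>

lemma difference_comp_eq_zero_iff:
  assumes "d \<in> Hom C A B" "g \<in> Hom C A B" "x \<in> Hom C X A"
  shows "d \<cdot> x = \<zero> X B \<longleftrightarrow> (d \<oplus> g) \<cdot> x = g \<cdot> x"
proof -
  have ob: "X \<in> Ob C" "B \<in> Ob C"
    using assms by auto
  have eq: "(d \<oplus> g) \<cdot> x = (d \<cdot> x) \<oplus> (g \<cdot> x)"
    using assms by (intro comp_add_left) auto
  have "d \<cdot> x = \<zero> X B" if "(d \<cdot> x) \<oplus> (g \<cdot> x) = g \<cdot> x"
    using assms ob that by - (rule add_cancel[where h = "g \<cdot> x"], auto)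
  then show ?thesis
    unfolding eq using assms by auto
qed

lemma comp_difference_eq_zero_iff:
  assumes "d \<in> Hom C A B" "g \<in> Hom C A B" "x \<in> Hom C B X"
  shows "x \<cdot> d = \<zero> A X \<longleftrightarrow> x \<cdot> (d \<oplus> g) = x \<cdot> g"
proof -
  have ob: "X \<in> Ob C" "A \<in> Ob C"
    using assms by auto
  have eq: "x \<cdot> (d \<oplus> g) = (x \<cdot> d) \<oplus> (x \<cdot> g)"
    using assms by (intro comp_add_right) auto
  have "x \<cdot> d = \<zero> A X" if "(x \<cdot> d) \<oplus> (x \<cdot> g) = x \<cdot> g"
    using assms ob that by - (rule add_cancel[where h = "x \<cdot> g"], auto)
  then show ?thesis
    unfolding eq using assms by auto
qed

lemma monic_if_kernel_trivial:
  assumes "f \<in> Hom C A B" "\<And>X x. \<lbrakk>x \<in> Hom C X A; f \<cdot> x = \<zero> X B\<rbrakk> \<Longrightarrow> x = \<zero> X A"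
  shows "monic C f"
proof (rule monicI)
  fix X g h
  assume gh: "g \<in> Hom C X (Dom C f)" "h \<in> Hom C X (Dom C f)" "f \<cdot> g = f \<cdot> h"
  then obtain d where d: "d \<in> Hom C X A" "d \<oplus> h = g"
    using assms(1) ex_difference[of g X A h] by auto
  have "f \<cdot> d = \<zero> X B"
    using comp_difference_eq_zero_iff[of d X A h f B] gh d assms(1) by auto
  then have "d = \<zero> X A"
    using assms d by blast
  then show "g = h"
    using d gh assms(1) by auto
qed (use assms in simp)

lemma epic_if_cokernel_trivial:
  assumes "f \<in> Hom C A B" "\<And>X x. \<lbrakk>x \<in> Hom C B X; x \<cdot> f = \<zero> A X\<rbrakk> \<Longrightarrow> x = \<zero> B X"
  shows "epic C f"
proof (rule epicI)
  fix X g h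
  assume gh: "g \<in> Hom C (Cod C f) X" "h \<in> Hom C (Cod C f) X" "g \<cdot> f = h \<cdot> f"
  then obtain d where d: "d \<in> Hom C B X" "d \<oplus> h = g"
    using assms(1) ex_difference[of g B X h] by auto
  have "d \<cdot> f = \<zero> A X"
    using difference_comp_eq_zero_iff[of d B X h f A] gh d assms(1) by auto
  then have "d = \<zero> B X"
    using assms d by blast
  then show "g = h"
    using d gh assms(1) by auto
qed (use assms in simp)

lemma kernel_simps:
  assumes "is_kernel C k f"
  shows "k \<in> Ar C" "f \<in> Ar C" "Dom C f = Cod C k" "f \<cdot> k = \<zero> (Dom C k) (Cod C f)"
  using equalizer_simps[OF assms[unfolded is_kernel_def]] by auto

lemma kernel_monic: "is_kernel C k f \<Longrightarrow> monic C k"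
  unfolding is_kernel_def by (rule equalizer_monic)

lemma kernel_lift:
  assumes "is_kernel C k f" "h \<in> Ar C" "Cod C h = Cod C k" "f \<cdot> h = \<zero> (Dom C h) (Cod C f)"
  obtains l where "l \<in> Hom C (Dom C h) (Dom C k)" "k \<cdot> l = h"
  using equalizer_lift[OF assms(1)[unfolded is_kernel_def] assms(2,3)] assms(2-4)
    kernel_simps[OF assms(1)] by auto

lemma kernelI:
  assumes "f \<in> Hom C A B" "monic C k" "Cod C k = A" "f \<cdot> k = \<zero> (Dom C k) B"
    and "\<And>h. \<lbrakk>h \<in> Ar C; Cod C h = A; f \<cdot> h = \<zero> (Dom C h) B\<rbrakk>
      \<Longrightarrow> \<exists>l \<in> Hom C (Dom C h) (Dom C k). k \<cdot> l = h"
  shows "is_kernel C k f"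
  unfolding is_kernel_def
proof (rule equalizerI)
  fix h
  assume "h \<in> Ar C" "Cod C h = A" "f \<cdot> h = \<zero> (Dom C f) (Cod C f) \<cdot> h"
  then show "\<exists>l \<in> Hom C (Dom C h) (Dom C k). k \<cdot> l = h"
    using assms(1) by (intro assms(5)) auto
qed (use assms monic_ar in auto)

lemma cokernel_simps:
  assumes "is_cokernel C c f"
  shows "c \<in> Ar C" "f \<in> Ar C" "Dom C c = Cod C f" "c \<cdot> f = \<zero> (Dom C f) (Cod C c)"
  using coequalizer_simps[OF assms[unfolded is_cokernel_def]] by auto

lemma cokernel_epic: "is_cokernel C c f \<Longrightarrow> epic C c"
  unfolding is_cokernel_def by (rule coequalizer_epic)

lemma cokernel_desc:
  assumes "is_cokernel C c f" "h \<in> Ar C" "Dom C h = Dom C c" "h \<cdot> f = \<zero> (Dom C f) (Cod C h)"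
  obtains l where "l \<in> Hom C (Cod C c) (Cod C h)" "l \<cdot> c = h"
  using coequalizer_desc[OF assms(1)[unfolded is_cokernel_def] assms(2,3)] assms(2-4)
    cokernel_simps[OF assms(1)] by auto

lemma cokernelI:
  assumes "f \<in> Hom C A B" "epic C c" "Dom C c = B" "c \<cdot> f = \<zero> A (Cod C c)"
    and "\<And>h. \<lbrakk>h \<in> Ar C; Dom C h = B; h \<cdot> f = \<zero> A (Cod C h)\<rbrakk>
      \<Longrightarrow> \<exists>l \<in> Hom C (Cod C c) (Cod C h). l \<cdot> c = h"
  shows "is_cokernel C c f"
  unfolding is_cokernel_def is_coequalizer_def parallel_def
proof (intro conjI allI ballI impI)
  fix X h
  assume h: "h \<in> Hom C (Cod C f) X" "h \<cdot> f = h \<cdot> \<zero> (Dom C f) (Cod C f)"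
  have hh: "h \<in> Ar C" "Dom C h = B" "h \<cdot> f = \<zero> A (Cod C h)" and X: "Cod C h = X"
    using h assms(1) by auto
  obtain k where k: "k \<in> Hom C (Cod C c) X" "k \<cdot> c = h"
    using assms(5)[OF hh, unfolded X] by (rule bexE)
  show "\<exists>!k. k \<in> Hom C (Cod C c) X \<and> k \<cdot> c = h"
  proof (rule ex1I[of _ k])
    fix l
    assume "l \<in> Hom C (Cod C c) X \<and> l \<cdot> c = h"
    then show "l = k"
      using k epic_ar[OF assms(2)] by - (rule epic_cancel[OF assms(2)], auto)
  qed (use k in blast)
qed (use assms epic_ar in auto)

end

section \<open>Image factorizations and exact functors\<close>

context abelian_category
begin

text \<open>\<open>f\<close> is the kernel of some \<open>g\<close>, and \<open>g\<close> factors
  through the cokernel \<open>c\<close>. Whatever \<open>c\<close> kills is thus killed by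
  \<open>g\<close> and lifts along \<open>f\<close>.\<close>

lemma monic_kernel_cokernel:
  assumes "monic C f" "is_cokernel C c f"
  shows "is_kernel C f c"
proof -
  obtain g where g: "is_kernel C f g"
    using assms(1) monic_is_kernel by auto
  note f = kernel_simps[OF g] and c = cokernel_simps[OF assms(2)]
  obtain l where l: "l \<in> Hom C (Cod C c) (Cod C g)" "l \<cdot> c = g"
    using cokernel_desc[OF assms(2), of g] f c by auto
  show ?thesis
  proof (rule kernelI)
    fix h
    assume h: "h \<in> Ar C" "Cod C h = Dom C c" "c \<cdot> h = \<zero> (Dom C h) (Cod C c)"
    have "g \<cdot> h = l \<cdot> (c \<cdot> h)"
      using l(2) assoc[of h c l] h l(1) c by auto
    then show "\<exists>l\<in>Hom C (Dom C h) (Dom C f). f \<cdot> l = h"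
      using h l(1) c f by - (rule kernel_lift[OF g, of h], (auto)[3], (rule bexI, assumption+))
  qed (use assms f c in auto)
qed

lemma epic_cokernel_kernel:
  assumes "epic C f" "is_kernel C k f"
  shows "is_cokernel C f k"
proof -
  obtain g where g: "is_cokernel C f g"
    using assms(1) epic_is_cokernel by auto
  note f = cokernel_simps[OF g] and k = kernel_simps[OF assms(2)]
  obtain l where l: "l \<in> Hom C (Dom C g) (Dom C k)" "k \<cdot> l = g"
    using kernel_lift[OF assms(2), of g] f k by auto
  show ?thesis
  proof (rule cokernelI)
    fix h
    assume h: "h \<in> Ar C" "Dom C h = Cod C k" "h \<cdot> k = \<zero> (Dom C k) (Cod C h)"
    have "h \<cdot> g = (h \<cdot> k) \<cdot> l"
      using l h(1,2) k by auto
    then show "\<exists>l\<in>Hom C (Cod C f) (Cod C h). l \<cdot> f = h"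
      using h l k f by - (rule cokernel_desc[OF g, of h], (auto)[3], (rule bexI, assumption+))
  qed (use assms f k in auto)
qed

text \<open>If \<open>m\<close> kills \<open>x\<close>, then \<open>m\<close> factors through the
  cokernel \<open>q\<close> of \<open>x\<close>. Since \<open>q \<cdot> x\<close> is zero, it is
  enough to find a left inverse of \<open>q\<close>.\<close>

lemma coimage_monic:
  assumes "f \<in> Hom C A B" "is_kernel C k f" "is_cokernel C e k" "m \<in> Hom C (Cod C e) B" "m \<cdot> e = f"
  shows "monic C m"
proof (rule monic_if_kernel_trivial[OF assms(4)])
  note k = kernel_simps[OF assms(2)] and e = cokernel_simps[OF assms(3)]
  fix X x
  assume x: "x \<in> Hom C X (Cod C e)" "m \<cdot> x = \<zero> X B"
  obtain q where q: "is_cokernel C q x"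
    using has_cokernels x(1) by auto
  note qs = cokernel_simps[OF q]
  obtain m' where m': "m' \<in> Hom C (Cod C q) B" "m' \<cdot> q = m"
    using cokernel_desc[OF q, of m] x qs assms(4) by auto
  have "epic C (q \<cdot> e)"
    using cokernel_epic[OF assms(3)] cokernel_epic[OF q] qs x by (intro epic_comp) auto
  \<comment> \<open>The epimorphism \<open>q \<cdot> e\<close> is a cokernel of some
    \<open>h\<close>. As \<open>f\<close> factors through \<open>q \<cdot> e\<close>, it kills
    \<open>h\<close>; hence \<open>h\<close> factors through the kernel \<open>k\<close>, so
    \<open>e\<close> kills \<open>h\<close> as well. The resulting factorization of \<open>e\<close>
    through \<open>q \<cdot> e\<close> is the left inverse of \<open>q\<close>.\<close>
  then obtain h where h: "is_cokernel C (q \<cdot> e) h"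
    using epic_is_cokernel by auto
  note hs = cokernel_simps[OF h]
  have qe: "Dom C q = Cod C e"
    using qs x by auto
  have hcod: "Cod C h = Dom C e" "h \<in> Ar C" "Dom C h \<in> Ob C"
    using hs qe qs e by auto
  have "f \<cdot> h = m' \<cdot> ((q \<cdot> e) \<cdot> h)"
    unfolding assms(5)[symmetric] m'(2)[symmetric] using m'(1) qs qe e hcod by simp
  also have "\<dots> = \<zero> (Dom C h) B"
    using hs m'(1) qs qe e hcod by simp
  finally obtain h' where h': "h' \<in> Hom C (Dom C h) (Dom C k)" "k \<cdot> h' = h"
    using kernel_lift[OF assms(2), of h] hcod e k assms(1) by auto
  have "e \<cdot> h = (e \<cdot> k) \<cdot> h'"
    using h' e(1-3) k(1-3) by auto
  also have "\<dots> = \<zero> (Dom C h) (Cod C e)"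
    using h' e k by simp
  finally obtain l where l: "l \<in> Hom C (Cod C (q \<cdot> e)) (Cod C e)" "l \<cdot> (q \<cdot> e) = e"
    using cokernel_desc[OF h, of e] hcod e qe qs by auto
  have "l \<cdot> q = \<i> (Cod C e)"
    using l e qs(1) qe by - (rule epic_cancel[OF cokernel_epic[OF assms(3)]], auto)
  moreover have "l \<cdot> (q \<cdot> x) = \<zero> X (Cod C e)"
    using qs x(1) l(1) qe e dom_ob[of x] by simp
  moreover have "l \<cdot> (q \<cdot> x) = (l \<cdot> q) \<cdot> x"
    using qs(1) x(1) l(1) qe e by simp
  ultimately show "x = \<zero> X (Cod C e)"
    using x by simp
qed

lemma epi_mono_factorization:
  assumes "f \<in> Ar C"
  obtains e m where "epic C e" "monic C m" "Dom C m = Cod C e" "m \<cdot> e = f"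
proof -
  obtain k where k: "is_kernel C k f"
    using has_kernels assms by auto
  obtain e where e: "is_cokernel C e k"
    using has_cokernels kernel_simps[OF k] by auto
  note ks = kernel_simps[OF k] and es = cokernel_simps[OF e]
  obtain m where m: "m \<in> Hom C (Cod C e) (Cod C f)" "m \<cdot> e = f"
    using cokernel_desc[OF e, of f] ks es by auto
  show thesis
    using that[of e m] cokernel_epic[OF e] m
      coimage_monic[of f "Dom C f" "Cod C f" k e m] assms k e by auto
qed

text \<open>As \<open>e\<close> is a cokernel of some \<open>h\<close>, the diagonal exists once
  \<open>a \<cdot> h\<close> is zero, and this may be checked after the monomorphism
  \<open>m\<close>. The operations on the image of a Hopf morphism are defined as such
  diagonals.\<close>

lemma epi_mono_fill_in:
  assumes "epic C e" "monic C m" "a \<in> Hom C (Dom C e) (Dom C m)" "b \<in> Hom C (Cod C e) (Cod C m)"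
    and "m \<cdot> a = b \<cdot> e"
  obtains c where "c \<in> Hom C (Cod C e) (Dom C m)" "c \<cdot> e = a" "m \<cdot> c = b"
proof -
  obtain h where h: "is_cokernel C e h"
    using assms(1) epic_is_cokernel by auto
  note hs = cokernel_simps[OF h] and ms = monic_ar[OF assms(2)]
  have "m \<cdot> (a \<cdot> h) = b \<cdot> (e \<cdot> h)"
    using reassoc[OF assms(5), of h] hs assms(3,4) ms by simp
  also have "\<dots> = m \<cdot> \<zero> (Dom C h) (Dom C m)"
    using assms(4) hs ms by simp
  finally have "a \<cdot> h = \<zero> (Dom C h) (Dom C m)"
    using assms(3) hs ms by - (rule monic_cancel[OF assms(2)], auto)
  then obtain c where c: "c \<in> Hom C (Cod C e) (Dom C m)" "c \<cdot> e = a"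
    using cokernel_desc[OF h, of a] assms(3) by auto
  have "m \<cdot> c = b"
    using assms(4,5) c hs ms by - (rule epic_cancel[OF assms(1)], auto)
  then show thesis
    using that c by auto
qed

lemma ex_equalizer:
  assumes "f \<in> Hom C A B" "g \<in> Hom C A B"
  obtains e where "is_equalizer C e f g"
proof -
  obtain d where d: "d \<in> Hom C A B" "d \<oplus> g = f"
    using assms by (rule ex_difference)
  obtain e where e: "is_kernel C e d"
    using has_kernels d by auto
  note es = kernel_simps[OF e]
  have iff: "d \<cdot> x = \<zero> (Dom C x) B \<longleftrightarrow> f \<cdot> x = g \<cdot> x" if "x \<in> Ar C" "Cod C x = A" for x
    using difference_comp_eq_zero_iff[of d A B g x "Dom C x"] that assms d by auto
  have "is_equalizer C e f g"
  proof (rule equalizerI[OF assms kernel_monic[OF e]])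
    show "f \<cdot> e = g \<cdot> e"
      using iff[of e] es d by auto
    fix h
    assume "h \<in> Ar C" "Cod C h = A" "f \<cdot> h = g \<cdot> h"
    then show "\<exists>k\<in>Hom C (Dom C h) (Dom C e). e \<cdot> k = h"
      using iff[of h] es d by - (rule kernel_lift[OF e, of h], (auto)[3], (rule bexI, assumption+))
  qed (use es d in auto)
  then show thesis
    by (rule that)
qed

text \<open>Exactness is only assumed for short exact sequences; an arbitrary kernel is reduced to that
  case by factoring the arrow as a cokernel followed by a monomorphism.\<close>

lemma exact_functor_monic:
  assumes "exact_functor C C F" "monic C m"
  shows "monic C (FA F m)"
proof -
  obtain c where c: "is_cokernel C c m"
    using has_cokernels monic_ar[OF assms(2)] by auto
  then have "short_exact C m c"
    using monic_kernel_cokernel assms(2) by (auto simp: short_exact_def)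
  then have "short_exact C (FA F m) (FA F c)"
    using assms(1) by (auto simp: exact_functor_def)
  then show ?thesis
    using kernel_monic by (auto simp: short_exact_def)
qed

lemma exact_functor_epic:
  assumes "exact_functor C C F" "epic C e"
  shows "epic C (FA F e)"
proof -
  obtain k where k: "is_kernel C k e"
    using has_kernels epic_ar[OF assms(2)] by auto
  then have "short_exact C k e"
    using epic_cokernel_kernel assms(2) by (auto simp: short_exact_def)
  then have "short_exact C (FA F k) (FA F e)"
    using assms(1) by (auto simp: exact_functor_def)
  then show ?thesis
    using cokernel_epic by (auto simp: short_exact_def)
qed

lemma exact_functor_kernel:
  assumes "exact_functor C C F" "is_kernel C k f"
  shows "is_kernel C (FA F k) (FA F f)"
proof -
  note ks = kernel_simps[OF assms(2)]
  obtain e where e: "is_cokernel C e k"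
    using has_cokernels ks by auto
  note es = cokernel_simps[OF e]
  obtain m where m: "m \<in> Hom C (Cod C e) (Cod C f)" "m \<cdot> e = f"
    using cokernel_desc[OF e, of f] ks es by auto
  have m_monic: "monic C m"
    using coimage_monic[of f "Dom C f" "Cod C f" k e m] ks assms(2) e m by auto
  have "short_exact C k e"
    using e monic_kernel_cokernel[OF kernel_monic[OF assms(2)]] by (auto simp: short_exact_def)
  then have ke: "is_kernel C (FA F k) (FA F e)"
    using assms(1) by (auto simp: exact_functor_def short_exact_def)
  have F: "FA F f = FA F m \<cdot> FA F e" "FA F m \<in> Hom C (FO F (Cod C e)) (FO F (Cod C f))"
    "FA F e \<in> Hom C (FO F (Cod C k)) (FO F (Cod C e))"
    "FA F k \<in> Hom C (FO F (Dom C k)) (FO F (Cod C k))"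
    using assms(1) m es ks unfolding exact_functor_def is_functor_def by auto
  have ob: "FO F (Dom C k) \<in> Ob C" "FO F (Cod C e) \<in> Ob C" "FO F (Cod C f) \<in> Ob C"
    using F(2-4) dom_ob[of "FA F k"] dom_ob[of "FA F m"] cod_ob[of "FA F m"] by auto
  have Fm: "monic C (FA F m)"
    using exact_functor_monic assms(1) m_monic by blast
  note kes = kernel_simps[OF ke]
  show ?thesis
  proof (rule kernelI)
    show "monic C (FA F k)"
      using ke kernel_monic by blast
    have "FA F m \<cdot> (FA F e \<cdot> FA F k) = \<zero> (Dom C (FA F k)) (Cod C (FA F f))"
      unfolding kes(4) using F ob by auto
    then show "FA F f \<cdot> FA F k = \<zero> (Dom C (FA F k)) (Cod C (FA F f))"
      using F ob by simp
    fix h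
    assume h: "h \<in> Ar C" "Cod C h = Dom C (FA F f)" "FA F f \<cdot> h = \<zero> (Dom C h) (Cod C (FA F f))"
    \<comment> \<open>\<open>FA F m\<close> is monic and can be cancelled, so a kernel of
      \<open>FA F e\<close> is also a kernel of \<open>FA F f\<close>.\<close>
    have "FA F m \<cdot> (FA F e \<cdot> h) = FA F m \<cdot> \<zero> (Dom C h) (FO F (Cod C e))"
      using F ob h by auto
    then have "FA F e \<cdot> h = \<zero> (Dom C h) (FO F (Cod C e))"
      using F ob h by - (rule monic_cancel[OF Fm], auto)
    then show "\<exists>l\<in>Hom C (Dom C h) (Dom C (FA F k)). FA F k \<cdot> l = h"
      using F ob h by - (rule kernel_lift[OF ke, of h], (auto)[3], (rule bexI, assumption+))
  qed (use F in auto)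
qed

text \<open>An equalizer is the kernel of a difference, and additivity makes the image of the
  difference a difference of the images.\<close>

lemma exact_functor_equalizer:
  assumes "exact_functor C C F" "additive_functor C C F" "is_equalizer C e f g"
  shows "is_equalizer C (FA F e) (FA F f) (FA F g)"
proof -
  note es = equalizer_simps[OF assms(3)]
  obtain d where d: "d \<in> Hom C (Cod C e) (Cod C f)" "d \<oplus> g = f"
    using ex_difference[of f "Cod C e" "Cod C f" g] es by auto
  have iff: "d \<cdot> x = \<zero> (Dom C x) (Cod C f) \<longleftrightarrow> f \<cdot> x = g \<cdot> x" if "x \<in> Ar C" "Cod C x = Cod C e" for x
    using difference_comp_eq_zero_iff[of d "Cod C e" "Cod C f" g x "Dom C x"] that es d by auto
  have "is_kernel C e d"
  proof (rule kernelI[OF d(1) equalizer_monic[OF assms(3)]])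
    show "d \<cdot> e = \<zero> (Dom C e) (Cod C f)"
      using iff[of e] es by auto
    fix h
    assume "h \<in> Ar C" "Cod C h = Cod C e" "d \<cdot> h = \<zero> (Dom C h) (Cod C f)"
    then show "\<exists>l\<in>Hom C (Dom C h) (Dom C e). e \<cdot> l = h"
      using iff[of h] by - (rule equalizer_lift[OF assms(3), of h], (auto)[3], (rule bexI, assumption+))
  qed auto
  then have k: "is_kernel C (FA F e) (FA F d)"
    using assms(1) exact_functor_kernel by blast
  have F: "FA F f \<in> Hom C (FO F (Cod C e)) (FO F (Cod C f))"
    "FA F g \<in> Hom C (FO F (Cod C e)) (FO F (Cod C f))"
    "FA F d \<in> Hom C (FO F (Cod C e)) (FO F (Cod C f))"
    "FA F e \<in> Hom C (FO F (Dom C e)) (FO F (Cod C e))"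
    using assms(1) d es unfolding exact_functor_def is_functor_def by auto
  have "parallel C d g"
    using d(1) es(2-6) by (simp add: parallel_def)
  then have Fd: "FA F d \<oplus> FA F g = FA F f"
    using assms(2) d(2) unfolding additive_functor_def by metis
  have Fiff: "FA F d \<cdot> x = \<zero> (Dom C x) (FO F (Cod C f)) \<longleftrightarrow> FA F f \<cdot> x = FA F g \<cdot> x"
    if "x \<in> Ar C" "Cod C x = FO F (Cod C e)" for x
    using difference_comp_eq_zero_iff[of "FA F d" "FO F (Cod C e)" "FO F (Cod C f)" "FA F g" x "Dom C x"]
      that F Fd by auto
  show ?thesis
  proof (rule equalizerI[OF F(1,2) kernel_monic[OF k]])
    show "FA F f \<cdot> FA F e = FA F g \<cdot> FA F e"
      using Fiff[of "FA F e"] F kernel_simps[OF k] by auto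
    fix h
    assume "h \<in> Ar C" "Cod C h = FO F (Cod C e)" "FA F f \<cdot> h = FA F g \<cdot> h"
    then show "\<exists>l\<in>Hom C (Dom C h) (Dom C (FA F e)). FA F e \<cdot> l = h"
      using Fiff[of h] F by - (rule kernel_lift[OF k, of h], (auto)[3], (rule bexI, assumption+))
  qed (use F in auto)
qed

end

section \<open>Symmetric monoidal categories\<close>

context category
begin

lemma iso_comp:
  assumes "iso_arrow C f" "iso_arrow C g" "Dom C g = Cod C f"
  shows "iso_arrow C (g \<cdot> f)"
proof -
  note f = inv_arrow_simps[OF assms(1)] and g = inv_arrow_simps[OF assms(2)]
  have "inverse_arrows C (g \<cdot> f) (inv_arrow C f \<cdot> inv_arrow C g)"
    using f g assms(3) reassoc[OF g(5), of f] reassoc[OF f(6), of "inv_arrow C g"]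
    by (simp add: inverse_arrows_def)
  then show ?thesis
    by (auto simp: iso_arrow_def)
qed

end

section \<open>Coherence laws that follow from the pentagon and the triangle\<close>

context monoidal_category
begin

abbreviation associnv ("\<a>\<^sup>-") where "\<a>\<^sup>- X Y Z \<equiv> inv_arrow M (\<a> X Y Z)"
abbreviation lunitinv ("\<l>\<^sup>-") where "\<l>\<^sup>- X \<equiv> inv_arrow M (\<l> X)"
abbreviation runitinv ("\<r>\<^sup>-") where "\<r>\<^sup>- X \<equiv> inv_arrow M (\<r> X)"

declare tensor_ob [simp] unit_ob [simp] tensor_ide [simp]

lemma tensor_simps [simp]:
  assumes "f \<in> Ar M" "g \<in> Ar M"
  shows "f \<otimes>\<^sub>a g \<in> Ar M" "Dom M (f \<otimes>\<^sub>a g) = Dom M f \<otimes>\<^sub>o Dom M g"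
    "Cod M (f \<otimes>\<^sub>a g) = Cod M f \<otimes>\<^sub>o Cod M g"
  using tensor_ar[of f "Dom M f" "Cod M f" g "Dom M g" "Cod M g"] assms by auto

lemma tensor_comp_tensor:
  "\<lbrakk>f \<in> Ar M; f' \<in> Ar M; g \<in> Ar M; g' \<in> Ar M; Dom M f' = Cod M f; Dom M g' = Cod M g\<rbrakk>
    \<Longrightarrow> (f' \<otimes>\<^sub>a g') \<cdot> (f \<otimes>\<^sub>a g) = (f' \<cdot> f) \<otimes>\<^sub>a (g' \<cdot> g)"
  using tensor_comp[of f "Dom M f" "Cod M f" f' "Cod M f'" g "Dom M g" "Cod M g" g' "Cod M g'"]
  by simp

text \<open>Whiskering by an identity is distributed over composites by default. The general
  interchange law \<open>tensor_comp_tensor\<close> merges tensors in the opposite direction and is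
  added only where needed, in places with the distributing rules switched off.\<close>

lemma whisker_left_comp [simp]:
  "\<lbrakk>X \<in> Ob M; f \<in> Ar M; g \<in> Ar M; Dom M g = Cod M f\<rbrakk>
    \<Longrightarrow> \<i> X \<otimes>\<^sub>a (g \<cdot> f) = (\<i> X \<otimes>\<^sub>a g) \<cdot> (\<i> X \<otimes>\<^sub>a f)"
  by (simp add: tensor_comp_tensor)

lemma whisker_right_comp [simp]:
  "\<lbrakk>X \<in> Ob M; f \<in> Ar M; g \<in> Ar M; Dom M g = Cod M f\<rbrakk>
    \<Longrightarrow> (g \<cdot> f) \<otimes>\<^sub>a \<i> X = (g \<otimes>\<^sub>a \<i> X) \<cdot> (f \<otimes>\<^sub>a \<i> X)"
  by (simp add: tensor_comp_tensor)

lemma whisker_left: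
  "\<lbrakk>g \<cdot> f = k; X \<in> Ob M; f \<in> Ar M; g \<in> Ar M; Dom M g = Cod M f\<rbrakk>
    \<Longrightarrow> (\<i> X \<otimes>\<^sub>a g) \<cdot> (\<i> X \<otimes>\<^sub>a f) = \<i> X \<otimes>\<^sub>a k"
  by (simp add: tensor_comp_tensor)

lemma whisker_right:
  "\<lbrakk>g \<cdot> f = k; X \<in> Ob M; f \<in> Ar M; g \<in> Ar M; Dom M g = Cod M f\<rbrakk>
    \<Longrightarrow> (g \<otimes>\<^sub>a \<i> X) \<cdot> (f \<otimes>\<^sub>a \<i> X) = k \<otimes>\<^sub>a \<i> X"
  by (simp add: tensor_comp_tensor)

lemma assoc_simps [simp]:
  assumes "X \<in> Ob M" "Y \<in> Ob M" "Z \<in> Ob M"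
  shows "\<a> X Y Z \<in> Ar M" "Dom M (\<a> X Y Z) = (X \<otimes>\<^sub>o Y) \<otimes>\<^sub>o Z"
    "Cod M (\<a> X Y Z) = X \<otimes>\<^sub>o (Y \<otimes>\<^sub>o Z)"
    "\<a>\<^sup>- X Y Z \<in> Ar M" "Dom M (\<a>\<^sup>- X Y Z) = X \<otimes>\<^sub>o (Y \<otimes>\<^sub>o Z)"
    "Cod M (\<a>\<^sup>- X Y Z) = (X \<otimes>\<^sub>o Y) \<otimes>\<^sub>o Z"
    "\<a> X Y Z \<cdot> \<a>\<^sup>- X Y Z = \<i> (X \<otimes>\<^sub>o (Y \<otimes>\<^sub>o Z))"
    "\<a>\<^sup>- X Y Z \<cdot> \<a> X Y Z = \<i> ((X \<otimes>\<^sub>o Y) \<otimes>\<^sub>o Z)"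
  using assoc_in[OF assms] inv_arrow_simps[OF assoc_iso[OF assms]] by auto

lemma lunit_simps [simp]:
  assumes "X \<in> Ob M"
  shows "\<l> X \<in> Ar M" "Dom M (\<l> X) = \<I> \<otimes>\<^sub>o X" "Cod M (\<l> X) = X"
    "\<l>\<^sup>- X \<in> Ar M" "Dom M (\<l>\<^sup>- X) = X" "Cod M (\<l>\<^sup>- X) = \<I> \<otimes>\<^sub>o X"
    "\<l> X \<cdot> \<l>\<^sup>- X = \<i> X" "\<l>\<^sup>- X \<cdot> \<l> X = \<i> (\<I> \<otimes>\<^sub>o X)"
  using lunit_in[OF assms] inv_arrow_simps[OF lunit_iso[OF assms]] by auto

lemma runit_simps [simp]:
  assumes "X \<in> Ob M"
  shows "\<r> X \<in> Ar M" "Dom M (\<r> X) = X \<otimes>\<^sub>o \<I>" "Cod M (\<r> X) = X"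
    "\<r>\<^sup>- X \<in> Ar M" "Dom M (\<r>\<^sup>- X) = X" "Cod M (\<r>\<^sup>- X) = X \<otimes>\<^sub>o \<I>"
    "\<r> X \<cdot> \<r>\<^sup>- X = \<i> X" "\<r>\<^sup>- X \<cdot> \<r> X = \<i> (X \<otimes>\<^sub>o \<I>)"
  using runit_in[OF assms] inv_arrow_simps[OF runit_iso[OF assms]] by auto

lemmas iso_cancel [simp] =
  assoc_simps(7,8)[THEN reassoc] lunit_simps(7,8)[THEN reassoc] runit_simps(7,8)[THEN reassoc]

lemma iso_cancel_whiskered [simp]:
  assumes "W \<in> Ob M" "X \<in> Ob M" "Y \<in> Ob M" "Z \<in> Ob M"
  shows "(\<i> W \<otimes>\<^sub>a \<a> X Y Z) \<cdot> (\<i> W \<otimes>\<^sub>a \<a>\<^sup>- X Y Z) = \<i> (W \<otimes>\<^sub>o (X \<otimes>\<^sub>o (Y \<otimes>\<^sub>o Z)))"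
    "(\<i> W \<otimes>\<^sub>a \<a>\<^sup>- X Y Z) \<cdot> (\<i> W \<otimes>\<^sub>a \<a> X Y Z) = \<i> (W \<otimes>\<^sub>o ((X \<otimes>\<^sub>o Y) \<otimes>\<^sub>o Z))"
    "(\<a> X Y Z \<otimes>\<^sub>a \<i> W) \<cdot> (\<a>\<^sup>- X Y Z \<otimes>\<^sub>a \<i> W) = \<i> ((X \<otimes>\<^sub>o (Y \<otimes>\<^sub>o Z)) \<otimes>\<^sub>o W)"
    "(\<a>\<^sup>- X Y Z \<otimes>\<^sub>a \<i> W) \<cdot> (\<a> X Y Z \<otimes>\<^sub>a \<i> W) = \<i> (((X \<otimes>\<^sub>o Y) \<otimes>\<^sub>o Z) \<otimes>\<^sub>o W)"
  by (simp_all add: assms tensor_comp_tensor)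

lemma unit_cancel_whiskered [simp]:
  assumes "W \<in> Ob M" "X \<in> Ob M"
  shows "(\<i> W \<otimes>\<^sub>a \<l> X) \<cdot> (\<i> W \<otimes>\<^sub>a \<l>\<^sup>- X) = \<i> (W \<otimes>\<^sub>o X)"
    "(\<i> W \<otimes>\<^sub>a \<l>\<^sup>- X) \<cdot> (\<i> W \<otimes>\<^sub>a \<l> X) = \<i> (W \<otimes>\<^sub>o (\<I> \<otimes>\<^sub>o X))"
    "(\<l> X \<otimes>\<^sub>a \<i> W) \<cdot> (\<l>\<^sup>- X \<otimes>\<^sub>a \<i> W) = \<i> (X \<otimes>\<^sub>o W)"
    "(\<l>\<^sup>- X \<otimes>\<^sub>a \<i> W) \<cdot> (\<l> X \<otimes>\<^sub>a \<i> W) = \<i> ((\<I> \<otimes>\<^sub>o X) \<otimes>\<^sub>o W)"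
    "(\<i> W \<otimes>\<^sub>a \<r> X) \<cdot> (\<i> W \<otimes>\<^sub>a \<r>\<^sup>- X) = \<i> (W \<otimes>\<^sub>o X)"
    "(\<r> X \<otimes>\<^sub>a \<i> W) \<cdot> (\<r>\<^sup>- X \<otimes>\<^sub>a \<i> W) = \<i> (X \<otimes>\<^sub>o W)"
  by (simp_all add: assms tensor_comp_tensor)

lemmas iso_cancel_whiskered_reassoc [simp] =
  iso_cancel_whiskered[THEN reassoc] unit_cancel_whiskered[THEN reassoc]

lemma iso_tensor:
  assumes "iso_arrow M f" "iso_arrow M g"
  shows "iso_arrow M (f \<otimes>\<^sub>a g)"
proof -
  note f = inv_arrow_simps[OF assms(1)] and g = inv_arrow_simps[OF assms(2)]
  have "inverse_arrows M (f \<otimes>\<^sub>a g) (inv_arrow M f \<otimes>\<^sub>a inv_arrow M g)"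
    using f g by (simp add: inverse_arrows_def tensor_comp_tensor)
  then show ?thesis
    by (auto simp: iso_arrow_def)
qed

lemma iso_ide: "X \<in> Ob M \<Longrightarrow> iso_arrow M (\<i> X)"
  unfolding iso_arrow_def inverse_arrows_def by (rule exI[of _ "\<i> X"]) simp

lemma assoc_nat:
  "\<lbrakk>f \<in> Ar M; g \<in> Ar M; h \<in> Ar M; Cod M f = X'; Cod M g = Y'; Cod M h = Z'\<rbrakk>
    \<Longrightarrow> \<a> X' Y' Z' \<cdot> ((f \<otimes>\<^sub>a g) \<otimes>\<^sub>a h) = (f \<otimes>\<^sub>a (g \<otimes>\<^sub>a h)) \<cdot> \<a> (Dom M f) (Dom M g) (Dom M h)"
  using assoc_natural[of f "Dom M f" X' g "Dom M g" Y' h "Dom M h" Z'] by simp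

lemma assoc_nat_ide:
  "\<lbrakk>X \<in> Ob M; Y \<in> Ob M; h \<in> Ar M; Cod M h = Z'\<rbrakk>
    \<Longrightarrow> \<a> X Y Z' \<cdot> (\<i> (X \<otimes>\<^sub>o Y) \<otimes>\<^sub>a h) = (\<i> X \<otimes>\<^sub>a (\<i> Y \<otimes>\<^sub>a h)) \<cdot> \<a> X Y (Dom M h)"
  using assoc_nat[of "\<i> X" "\<i> Y" h X Y Z'] by simp

text \<open>A naturality square still commutes after its two parallel isomorphisms are inverted;
  this gives naturality of the inverse associator.\<close>

lemma iso_conjugate:
  assumes "a' \<cdot> f = g \<cdot> a" "a \<cdot> b = \<i> (Dom M g)" "b' \<cdot> a' = \<i> (Cod M f)"
    "f \<in> Ar M" "g \<in> Ar M" "a \<in> Ar M" "b \<in> Ar M" "a' \<in> Ar M" "b' \<in> Ar M"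
    "Dom M a = Dom M f" "Cod M a = Dom M g" "Dom M a' = Cod M f" "Cod M a' = Cod M g"
    "Dom M b = Dom M g" "Cod M b = Dom M f" "Dom M b' = Cod M g" "Cod M b' = Cod M f"
  shows "b' \<cdot> g = f \<cdot> b"
proof -
  have "b' \<cdot> g = b' \<cdot> (g \<cdot> (a \<cdot> b))"
    using assms by simp
  also have "\<dots> = b' \<cdot> ((g \<cdot> a) \<cdot> b)"
    using assms(4-) by simp
  also have "\<dots> = (b' \<cdot> a') \<cdot> (f \<cdot> b)"
    unfolding assms(1)[symmetric] using assms(4-) by simp
  also have "\<dots> = f \<cdot> b"
    unfolding assms(3) using assms(4-) by simp
  finally show ?thesis .
qed

lemma associnv_nat:
  assumes "f \<in> Ar M" "g \<in> Ar M" "h \<in> Ar M" "Cod M f = X'" "Cod M g = Y'" "Cod M h = Z'"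
  shows "\<a>\<^sup>- X' Y' Z' \<cdot> (f \<otimes>\<^sub>a (g \<otimes>\<^sub>a h))
    = ((f \<otimes>\<^sub>a g) \<otimes>\<^sub>a h) \<cdot> \<a>\<^sup>- (Dom M f) (Dom M g) (Dom M h)"
proof -
  have "X' \<in> Ob M" "Y' \<in> Ob M" "Z' \<in> Ob M"
    using assms by auto
  then show ?thesis
    using assms by (intro iso_conjugate[OF assoc_nat[OF assms]]) simp_all
qed

lemma associnv_nat_ide:
  "\<lbrakk>f \<in> Ar M; Y \<in> Ob M; Z \<in> Ob M; Cod M f = X'\<rbrakk>
    \<Longrightarrow> \<a>\<^sup>- X' Y Z \<cdot> (f \<otimes>\<^sub>a \<i> (Y \<otimes>\<^sub>o Z)) = ((f \<otimes>\<^sub>a \<i> Y) \<otimes>\<^sub>a \<i> Z) \<cdot> \<a>\<^sup>- (Dom M f) Y Z"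
  using associnv_nat[of f "\<i> Y" "\<i> Z" X' Y Z] by simp

lemma lunit_nat:
  "\<lbrakk>f \<in> Ar M; Cod M f = X'\<rbrakk> \<Longrightarrow> \<l> X' \<cdot> (\<i> \<I> \<otimes>\<^sub>a f) = f \<cdot> \<l> (Dom M f)"
  using lunit_natural[of f "Dom M f" X'] by simp

lemma runit_nat:
  "\<lbrakk>f \<in> Ar M; Cod M f = X'\<rbrakk> \<Longrightarrow> \<r> X' \<cdot> (f \<otimes>\<^sub>a \<i> \<I>) = f \<cdot> \<r> (Dom M f)"
  using runit_natural[of f "Dom M f" X'] by simp

lemmas naturality_reassoc = assoc_nat[THEN reassoc] assoc_nat_ide[THEN reassoc]
  associnv_nat[THEN reassoc] associnv_nat_ide[THEN reassoc]
  lunit_nat[THEN reassoc] runit_nat[THEN reassoc]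

lemmas naturality = assoc_nat assoc_nat_ide associnv_nat associnv_nat_ide lunit_nat runit_nat naturality_reassoc

lemma interchange_law:
  "\<lbrakk>f \<in> Ar M; g \<in> Ar M; Dom M f = A; Cod M f = B; Dom M g = X; Cod M g = Y\<rbrakk>
    \<Longrightarrow> (\<i> B \<otimes>\<^sub>a g) \<cdot> (f \<otimes>\<^sub>a \<i> X) = (f \<otimes>\<^sub>a \<i> Y) \<cdot> (\<i> A \<otimes>\<^sub>a g)"
  using dom_ob[of f] cod_ob[of f] dom_ob[of g] cod_ob[of g] by (simp add: tensor_comp_tensor)

text \<open>Naturality of the invertible \<open>\<l>\<close> recovers \<open>f\<close> from
  \<open>\<i> \<I> \<otimes>\<^sub>a f\<close>. Unit laws may hence be proved after tensoring with
  \<open>\<I>\<close>, where the triangle becomes applicable.\<close>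

lemma unit_tensor_faithful:
  assumes "\<i> \<I> \<otimes>\<^sub>a f = \<i> \<I> \<otimes>\<^sub>a g" "f \<in> Ar M" "g \<in> Ar M" "Cod M f = Cod M g" "Dom M f = Dom M g"
  shows "f = g"
proof -
  have "f \<cdot> \<l> (Dom M f) = g \<cdot> \<l> (Dom M f)"
    using lunit_nat[of f "Cod M f"] lunit_nat[of g "Cod M g"] assms by simp
  then show ?thesis
    using assms(2-) by - (rule epic_cancel[OF iso_epic[OF lunit_iso[of "Dom M f"]]], simp_all)
qed

lemma tensor_unit_faithful:
  assumes "f \<otimes>\<^sub>a \<i> \<I> = g \<otimes>\<^sub>a \<i> \<I>" "f \<in> Ar M" "g \<in> Ar M" "Cod M f = Cod M g" "Dom M f = Dom M g"
  shows "f = g"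
proof -
  have "f \<cdot> \<r> (Dom M f) = g \<cdot> \<r> (Dom M f)"
    using runit_nat[of f "Cod M f"] runit_nat[of g "Cod M g"] assms by simp
  then show ?thesis
    using assms(2-) by - (rule epic_cancel[OF iso_epic[OF runit_iso[of "Dom M f"]]], simp_all)
qed

text \<open>Kelly's argument: after tensoring with \<open>\<I>\<close> on the left, both sides agree
  when preceded by the isomorphism \<open>?E\<close>, by the pentagon, two instances of the triangle
  and naturality.\<close>

lemma lunit_tensor:
  assumes X: "X \<in> Ob M" and Y: "Y \<in> Ob M"
  shows "\<l> (X \<otimes>\<^sub>o Y) \<cdot> \<a> \<I> X Y = \<l> X \<otimes>\<^sub>a \<i> Y"
proof (rule unit_tensor_faithful)
  let ?E = "\<a> \<I> (\<I> \<otimes>\<^sub>o X) Y \<cdot> (\<a> \<I> \<I> X \<otimes>\<^sub>a \<i> Y)"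
  have E: "epic M ?E"
    using X Y by (intro iso_epic iso_comp iso_tensor assoc_iso iso_ide) auto
  have "(\<i> \<I> \<otimes>\<^sub>a (\<l> (X \<otimes>\<^sub>o Y) \<cdot> \<a> \<I> X Y)) \<cdot> ?E
    = (\<i> \<I> \<otimes>\<^sub>a \<l> (X \<otimes>\<^sub>o Y)) \<cdot> (\<a> \<I> \<I> (X \<otimes>\<^sub>o Y) \<cdot> \<a> (\<I> \<otimes>\<^sub>o \<I>) X Y)"
    using X Y by (simp add: pentagon)
  also have "\<dots> = (\<r> \<I> \<otimes>\<^sub>a \<i> (X \<otimes>\<^sub>o Y)) \<cdot> \<a> (\<I> \<otimes>\<^sub>o \<I>) X Y"
    using X Y triangle[THEN reassoc, of \<I> "X \<otimes>\<^sub>o Y"] by simp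
  also have "\<dots> = \<a> \<I> X Y \<cdot> ((\<r> \<I> \<otimes>\<^sub>a \<i> X) \<otimes>\<^sub>a \<i> Y)"
    using X Y by (simp add: naturality)
  also have "\<dots> = \<a> \<I> X Y \<cdot> (((\<i> \<I> \<otimes>\<^sub>a \<l> X) \<cdot> \<a> \<I> \<I> X) \<otimes>\<^sub>a \<i> Y)"
    using X Y triangle[of \<I> X] by (simp del: whisker_right_comp)
  also have "\<dots> = (\<i> \<I> \<otimes>\<^sub>a (\<l> X \<otimes>\<^sub>a \<i> Y)) \<cdot> ?E"
    using X Y by (simp add: naturality)
  finally show "\<i> \<I> \<otimes>\<^sub>a (\<l> (X \<otimes>\<^sub>o Y) \<cdot> \<a> \<I> X Y) = \<i> \<I> \<otimes>\<^sub>a (\<l> X \<otimes>\<^sub>a \<i> Y)"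
    using X Y by - (rule epic_cancel[OF E], simp_all)
qed (use X Y in auto)

text \<open>The mirror image of the preceding argument: tensor with \<open>\<I>\<close> on the right
  and cancel an associator that follows.\<close>

lemma runit_tensor:
  assumes X: "X \<in> Ob M" and Y: "Y \<in> Ob M"
  shows "(\<i> X \<otimes>\<^sub>a \<r> Y) \<cdot> \<a> X Y \<I> = \<r> (X \<otimes>\<^sub>o Y)"
proof (rule tensor_unit_faithful)
  have m: "monic M (\<a> X Y \<I>)"
    using X Y by (intro iso_monic assoc_iso) auto
  have "\<a> X Y \<I> \<cdot> (((\<i> X \<otimes>\<^sub>a \<r> Y) \<cdot> \<a> X Y \<I>) \<otimes>\<^sub>a \<i> \<I>)
    = (\<i> X \<otimes>\<^sub>a (\<r> Y \<otimes>\<^sub>a \<i> \<I>)) \<cdot> (\<a> X (Y \<otimes>\<^sub>o \<I>) \<I> \<cdot> (\<a> X Y \<I> \<otimes>\<^sub>a \<i> \<I>))"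
    using X Y by (simp add: naturality)
  also have "\<dots> = (\<i> X \<otimes>\<^sub>a ((\<i> Y \<otimes>\<^sub>a \<l> \<I>) \<cdot> \<a> Y \<I> \<I>)) \<cdot> (\<a> X (Y \<otimes>\<^sub>o \<I>) \<I> \<cdot> (\<a> X Y \<I> \<otimes>\<^sub>a \<i> \<I>))"
    using X Y triangle[of Y \<I>] by (simp del: whisker_left_comp)
  also have "\<dots> = (\<i> X \<otimes>\<^sub>a (\<i> Y \<otimes>\<^sub>a \<l> \<I>)) \<cdot> (\<a> X Y (\<I> \<otimes>\<^sub>o \<I>) \<cdot> \<a> (X \<otimes>\<^sub>o Y) \<I> \<I>)"
    using X Y by (simp add: pentagon)
  also have "\<dots> = \<a> X Y \<I> \<cdot> ((\<i> (X \<otimes>\<^sub>o Y) \<otimes>\<^sub>a \<l> \<I>) \<cdot> \<a> (X \<otimes>\<^sub>o Y) \<I> \<I>)"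
    using X Y by (simp add: naturality)
  also have "\<dots> = \<a> X Y \<I> \<cdot> (\<r> (X \<otimes>\<^sub>o Y) \<otimes>\<^sub>a \<i> \<I>)"
    using X Y triangle[of "X \<otimes>\<^sub>o Y" \<I>] by simp
  finally show "((\<i> X \<otimes>\<^sub>a \<r> Y) \<cdot> \<a> X Y \<I>) \<otimes>\<^sub>a \<i> \<I> = \<r> (X \<otimes>\<^sub>o Y) \<otimes>\<^sub>a \<i> \<I>"
    using X Y by - (rule monic_cancel[OF m], simp_all)
qed (use X Y in auto)

lemma lunit_unit_tensor: "X \<in> Ob M \<Longrightarrow> \<l> (\<I> \<otimes>\<^sub>o X) = \<i> \<I> \<otimes>\<^sub>a \<l> X"
  using lunit_nat[of "\<l> X" X] by - (rule monic_cancel[OF iso_monic[OF lunit_iso[of X]]], simp_all)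

text \<open>Tensored with \<open>\<I>\<close> on the right, \<open>\<l> \<I>\<close> becomes
  \<open>\<l> (\<I> \<otimes>\<^sub>o \<I>) \<cdot> \<a> \<I> \<I> \<I>\<close>. Here
  \<open>\<l> (\<I> \<otimes>\<^sub>o \<I>)\<close> equals
  \<open>\<i> \<I> \<otimes>\<^sub>a \<l> \<I>\<close>, and the triangle turns the composite into
  \<open>\<r> \<I> \<otimes>\<^sub>a \<i> \<I>\<close>.\<close>

lemma lunit_eq_runit: "\<l> \<I> = \<r> \<I>"
  by (rule tensor_unit_faithful)
    (use lunit_tensor[of \<I> \<I>] triangle[of \<I> \<I>] lunit_unit_tensor[of \<I>] in simp_all)

text \<open>This and the next two laws are the pentagon with some associators moved to the other
  side, in the shapes that arise when a transposition is pushed through associators.\<close>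

lemma pentagon_whiskered_inv:
  assumes W: "W \<in> Ob M" and X: "X \<in> Ob M" and Y: "Y \<in> Ob M" and Z: "Z \<in> Ob M"
  shows "(\<i> W \<otimes>\<^sub>a \<a>\<^sup>- X Y Z) \<cdot> \<a> W X (Y \<otimes>\<^sub>o Z)
    = \<a> W (X \<otimes>\<^sub>o Y) Z \<cdot> (\<a> W X Y \<otimes>\<^sub>a \<i> Z) \<cdot> \<a>\<^sup>- (W \<otimes>\<^sub>o X) Y Z"
proof -
  have "(\<i> W \<otimes>\<^sub>a \<a>\<^sup>- X Y Z) \<cdot> \<a> W X (Y \<otimes>\<^sub>o Z)
    = (\<i> W \<otimes>\<^sub>a \<a>\<^sup>- X Y Z) \<cdot> (\<a> W X (Y \<otimes>\<^sub>o Z) \<cdot> \<a> (W \<otimes>\<^sub>o X) Y Z) \<cdot> \<a>\<^sup>- (W \<otimes>\<^sub>o X) Y Z"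
    using assms by simp
  also have "\<dots> = \<a> W (X \<otimes>\<^sub>o Y) Z \<cdot> (\<a> W X Y \<otimes>\<^sub>a \<i> Z) \<cdot> \<a>\<^sup>- (W \<otimes>\<^sub>o X) Y Z"
    unfolding pentagon[OF assms] using assms by simp
  finally show ?thesis .
qed

lemma pentagon_inv:
  assumes W: "W \<in> Ob M" and X: "X \<in> Ob M" and Y: "Y \<in> Ob M" and Z: "Z \<in> Ob M"
  shows "\<a>\<^sup>- (W \<otimes>\<^sub>o X) Y Z \<cdot> \<a>\<^sup>- W X (Y \<otimes>\<^sub>o Z) \<cdot> (\<i> W \<otimes>\<^sub>a \<a> X Y Z)
    = (\<a>\<^sup>- W X Y \<otimes>\<^sub>a \<i> Z) \<cdot> \<a>\<^sup>- W (X \<otimes>\<^sub>o Y) Z"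
proof -
  have "\<a>\<^sup>- (W \<otimes>\<^sub>o X) Y Z \<cdot> \<a>\<^sup>- W X (Y \<otimes>\<^sub>o Z) \<cdot> (\<i> W \<otimes>\<^sub>a \<a> X Y Z)
    = \<a>\<^sup>- (W \<otimes>\<^sub>o X) Y Z \<cdot> \<a>\<^sup>- W X (Y \<otimes>\<^sub>o Z) \<cdot>
      ((\<i> W \<otimes>\<^sub>a \<a> X Y Z) \<cdot> \<a> W (X \<otimes>\<^sub>o Y) Z \<cdot> (\<a> W X Y \<otimes>\<^sub>a \<i> Z)) \<cdot>
      (\<a>\<^sup>- W X Y \<otimes>\<^sub>a \<i> Z) \<cdot> \<a>\<^sup>- W (X \<otimes>\<^sub>o Y) Z"
    using assms by simp
  also have "\<dots> = (\<a>\<^sup>- W X Y \<otimes>\<^sub>a \<i> Z) \<cdot> \<a>\<^sup>- W (X \<otimes>\<^sub>o Y) Z"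
    unfolding pentagon[OF assms, symmetric] using assms by simp
  finally show ?thesis .
qed

lemma pentagon_move_inv:
  assumes W: "W \<in> Ob M" and X: "X \<in> Ob M" and Y: "Y \<in> Ob M" and Z: "Z \<in> Ob M"
  shows "\<a> (W \<otimes>\<^sub>o X) Y Z \<cdot> (\<a>\<^sup>- W X Y \<otimes>\<^sub>a \<i> Z)
    = \<a>\<^sup>- W X (Y \<otimes>\<^sub>o Z) \<cdot> (\<i> W \<otimes>\<^sub>a \<a> X Y Z) \<cdot> \<a> W (X \<otimes>\<^sub>o Y) Z"
proof -
  have "\<a> (W \<otimes>\<^sub>o X) Y Z \<cdot> (\<a>\<^sup>- W X Y \<otimes>\<^sub>a \<i> Z)
    = \<a>\<^sup>- W X (Y \<otimes>\<^sub>o Z) \<cdot> (\<a> W X (Y \<otimes>\<^sub>o Z) \<cdot> \<a> (W \<otimes>\<^sub>o X) Y Z) \<cdot> (\<a>\<^sup>- W X Y \<otimes>\<^sub>a \<i> Z)"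
    using assms by simp
  also have "\<dots> = \<a>\<^sup>- W X (Y \<otimes>\<^sub>o Z) \<cdot> (\<i> W \<otimes>\<^sub>a \<a> X Y Z) \<cdot> \<a> W (X \<otimes>\<^sub>o Y) Z"
    unfolding pentagon[OF assms] using assms by simp
  finally show ?thesis .
qed

text \<open>Calculations are made with right nested tensor products: the structure maps \<open>dup\<close>, \<open>del\<close> and \<open>swap\<close>
  act on the leftmost factors and are whiskered by the rest \<open>Z\<close>, so that associativity constraints
  do not occur between them.\<close>

definition dup :: "'o \<Rightarrow> 'm \<Rightarrow> 'o \<Rightarrow> 'm" where
  "dup A d Z = \<a> A A Z \<cdot> (d \<otimes>\<^sub>a \<i> Z)"

definition del :: "'m \<Rightarrow> 'o \<Rightarrow> 'm" where
  "del e Z = \<l> Z \<cdot> (e \<otimes>\<^sub>a \<i> Z)"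

lemma dup_simps [simp]:
  assumes "d \<in> Ar M" "Cod M d = A \<otimes>\<^sub>o A" "A \<in> Ob M" "Z \<in> Ob M"
  shows "dup A d Z \<in> Ar M" "Dom M (dup A d Z) = Dom M d \<otimes>\<^sub>o Z"
    "Cod M (dup A d Z) = A \<otimes>\<^sub>o (A \<otimes>\<^sub>o Z)"
  using assms by (simp_all add: dup_def)

lemma del_simps [simp]:
  assumes "e \<in> Ar M" "Cod M e = \<I>" "Z \<in> Ob M"
  shows "del e Z \<in> Ar M" "Dom M (del e Z) = Dom M e \<otimes>\<^sub>o Z" "Cod M (del e Z) = Z"
  using assms by (simp_all add: del_def)

lemma dup_nat:
  assumes "d \<in> Ar M" "Cod M d = A \<otimes>\<^sub>o A" "Dom M d = D" "A \<in> Ob M" "h \<in> Ar M" "Cod M h = Z'"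
  shows "dup A d Z' \<cdot> (\<i> D \<otimes>\<^sub>a h) = (\<i> A \<otimes>\<^sub>a (\<i> A \<otimes>\<^sub>a h)) \<cdot> dup A d (Dom M h)"
  using assms interchange_law[of d h D "A \<otimes>\<^sub>o A" "Dom M h" Z'] dom_ob[of d] dom_ob[of h] cod_ob[of h]
    assoc_nat_ide[THEN reassoc, of A A h Z' "d \<otimes>\<^sub>a \<i> (Dom M h)"]
  by (simp add: dup_def)

lemma del_nat:
  assumes "e \<in> Ar M" "Cod M e = \<I>" "Dom M e = D" "h \<in> Ar M" "Cod M h = Z'"
  shows "del e Z' \<cdot> (\<i> D \<otimes>\<^sub>a h) = h \<cdot> del e (Dom M h)"
  using assms interchange_law[of e h D \<I> "Dom M h" Z'] dom_ob[of e] dom_ob[of h] cod_ob[of h]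
    lunit_nat[THEN reassoc, of h Z' "e \<otimes>\<^sub>a \<i> (Dom M h)"]
  by (simp add: del_def)

lemma is_comonoid_simps:
  assumes "is_comonoid M A d e"
  shows "A \<in> Ob M" "d \<in> Ar M" "Dom M d = A" "Cod M d = A \<otimes>\<^sub>o A" "e \<in> Ar M" "Dom M e = A"
    "Cod M e = \<I>" "dup A d A \<cdot> d = (\<i> A \<otimes>\<^sub>a d) \<cdot> d" "del e A \<cdot> d = \<i> A"
    "\<r> A \<cdot> (\<i> A \<otimes>\<^sub>a e) \<cdot> d = \<i> A"
  using assms by (simp_all add: is_comonoid_def dup_def del_def)

text \<open>The pentagon moves the associators past each other until ordinary coassociativity,
  whiskered by \<open>Z\<close>, remains.\<close>

lemma dup_dup:
  assumes "is_comonoid M A d e" and Z: "Z \<in> Ob M"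
  shows "dup A d (A \<otimes>\<^sub>o Z) \<cdot> dup A d Z = (\<i> A \<otimes>\<^sub>a dup A d Z) \<cdot> dup A d Z"
proof -
  note A = is_comonoid_simps[OF assms(1)]
  have "dup A d (A \<otimes>\<^sub>o Z) \<cdot> dup A d Z
    = (\<a> A A (A \<otimes>\<^sub>o Z) \<cdot> \<a> (A \<otimes>\<^sub>o A) A Z) \<cdot> ((d \<otimes>\<^sub>a \<i> A) \<otimes>\<^sub>a \<i> Z) \<cdot> (d \<otimes>\<^sub>a \<i> Z)"
    using A(1-4) Z assoc_nat[THEN reassoc, of d "\<i> A" "\<i> Z" "A \<otimes>\<^sub>o A" A Z "d \<otimes>\<^sub>a \<i> Z"]
    by (simp add: dup_def)
  also have "\<dots> = (\<i> A \<otimes>\<^sub>a \<a> A A Z) \<cdot> \<a> A (A \<otimes>\<^sub>o A) Z \<cdot> ((dup A d A \<cdot> d) \<otimes>\<^sub>a \<i> Z)"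
    using A(1-4) Z by (simp add: dup_def pentagon)
  also have "\<dots> = (\<i> A \<otimes>\<^sub>a dup A d Z) \<cdot> dup A d Z"
    unfolding A(8) using A(1-4) Z by (simp add: dup_def naturality)
  finally show ?thesis .
qed

text \<open>The left counit law rests on the derived law \<open>lunit_tensor\<close>, its right
  counterpart below on the triangle.\<close>

lemma del_dup:
  assumes "is_comonoid M A d e" and Z: "Z \<in> Ob M"
  shows "del e (A \<otimes>\<^sub>o Z) \<cdot> dup A d Z = \<i> (A \<otimes>\<^sub>o Z)"
proof -
  note A = is_comonoid_simps[OF assms(1)]
  have "del e (A \<otimes>\<^sub>o Z) \<cdot> dup A d Z
    = (\<l> (A \<otimes>\<^sub>o Z) \<cdot> \<a> \<I> A Z) \<cdot> ((e \<otimes>\<^sub>a \<i> A) \<otimes>\<^sub>a \<i> Z) \<cdot> (d \<otimes>\<^sub>a \<i> Z)"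
    using A(1-7) Z assoc_nat[THEN reassoc, of e "\<i> A" "\<i> Z" \<I> A Z "d \<otimes>\<^sub>a \<i> Z"]
    by (simp add: dup_def del_def)
  also have "\<dots> = (del e A \<cdot> d) \<otimes>\<^sub>a \<i> Z"
    using A(1-7) Z by (simp add: del_def lunit_tensor)
  finally show ?thesis
    unfolding A(9) using A(1) Z by simp
qed

lemma whiskered_del_dup:
  assumes "is_comonoid M A d e" and Z: "Z \<in> Ob M"
  shows "(\<i> A \<otimes>\<^sub>a del e Z) \<cdot> dup A d Z = \<i> (A \<otimes>\<^sub>o Z)"
proof -
  note A = is_comonoid_simps[OF assms(1)]
  have "(\<i> A \<otimes>\<^sub>a del e Z) \<cdot> dup A d Z
    = ((\<i> A \<otimes>\<^sub>a \<l> Z) \<cdot> \<a> A \<I> Z) \<cdot> ((\<i> A \<otimes>\<^sub>a e) \<otimes>\<^sub>a \<i> Z) \<cdot> (d \<otimes>\<^sub>a \<i> Z)"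
    using A(1-7) Z assoc_nat[THEN reassoc, of "\<i> A" e "\<i> Z" A \<I> Z "d \<otimes>\<^sub>a \<i> Z"]
    by (simp add: dup_def del_def)
  also have "\<dots> = (\<r> A \<cdot> (\<i> A \<otimes>\<^sub>a e) \<cdot> d) \<otimes>\<^sub>a \<i> Z"
    using A(1-7) Z by (simp add: triangle)
  finally show ?thesis
    unfolding A(10) using A(1) Z by simp
qed

end

section \<open>Transpositions of adjacent tensor factors\<close>

context symmetric_monoidal_category
begin

lemma sym_simps [simp]:
  assumes "X \<in> Ob M" "Y \<in> Ob M"
  shows "\<s> X Y \<in> Ar M" "Dom M (\<s> X Y) = X \<otimes>\<^sub>o Y" "Cod M (\<s> X Y) = Y \<otimes>\<^sub>o X"
    "\<s> Y X \<cdot> \<s> X Y = \<i> (X \<otimes>\<^sub>o Y)"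
  using sym_in[OF assms] sym_sym[OF assms] by auto

lemma sym_cancel_whiskered [simp]:
  assumes "X \<in> Ob M" "Y \<in> Ob M" "Z \<in> Ob M"
  shows "(\<s> Y X \<otimes>\<^sub>a \<i> Z) \<cdot> (\<s> X Y \<otimes>\<^sub>a \<i> Z) = \<i> ((X \<otimes>\<^sub>o Y) \<otimes>\<^sub>o Z)"
    "(\<i> Z \<otimes>\<^sub>a \<s> Y X) \<cdot> (\<i> Z \<otimes>\<^sub>a \<s> X Y) = \<i> (Z \<otimes>\<^sub>o (X \<otimes>\<^sub>o Y))"
  using assms by (simp_all add: tensor_comp_tensor)

lemmas sym_cancel [simp] = sym_simps(4)[THEN reassoc] sym_cancel_whiskered[THEN reassoc]

lemma sym_nat:
  "\<lbrakk>f \<in> Ar M; g \<in> Ar M; Cod M f = X'; Cod M g = Y'\<rbrakk>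
    \<Longrightarrow> \<s> X' Y' \<cdot> (f \<otimes>\<^sub>a g) = (g \<otimes>\<^sub>a f) \<cdot> \<s> (Dom M f) (Dom M g)"
  using sym_natural[of f "Dom M f" X' g "Dom M g" Y'] by simp

lemma sym_iso: "\<lbrakk>X \<in> Ob M; Y \<in> Ob M\<rbrakk> \<Longrightarrow> iso_arrow M (\<s> X Y)"
  unfolding iso_arrow_def inverse_arrows_def by (rule exI[of _ "\<s> Y X"]) simp

text \<open>Compatibility of symmetry and unit comes from the hexagon for
  \<open>X, \<I>, \<I>\<close>: after tensoring with \<open>\<I>\<close> and composing with the
  invertible \<open>\<s> X \<I>\<close>, both sides coincide.\<close>

lemma lunit_sym:
  assumes X: "X \<in> Ob M"
  shows "\<l> X \<cdot> \<s> X \<I> = \<r> X"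
proof (rule tensor_unit_faithful)
  have m: "monic M (\<s> X \<I>)"
    using X by (intro iso_monic sym_iso) auto
  have "\<s> X \<I> \<cdot> (\<r> X \<otimes>\<^sub>a \<i> \<I>) = (\<s> X \<I> \<cdot> (\<i> X \<otimes>\<^sub>a \<l> \<I>)) \<cdot> \<a> X \<I> \<I>"
    using X triangle[of X \<I>] by simp
  also have "\<dots> = (\<l> \<I> \<otimes>\<^sub>a \<i> X) \<cdot> \<s> X (\<I> \<otimes>\<^sub>o \<I>) \<cdot> \<a> X \<I> \<I>"
    using X sym_nat[of "\<i> X" "\<l> \<I>" X \<I>] by simp
  also have "\<dots> = \<l> (\<I> \<otimes>\<^sub>o X) \<cdot> (\<a> \<I> \<I> X \<cdot> \<s> X (\<I> \<otimes>\<^sub>o \<I>) \<cdot> \<a> X \<I> \<I>)"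
    using X by (simp add: lunit_tensor[symmetric])
  also have "\<dots> = \<l> (\<I> \<otimes>\<^sub>o X) \<cdot> ((\<i> \<I> \<otimes>\<^sub>a \<s> X \<I>) \<cdot> \<a> \<I> X \<I> \<cdot> (\<s> X \<I> \<otimes>\<^sub>a \<i> \<I>))"
    using X by (simp add: hexagon)
  also have "\<dots> = \<s> X \<I> \<cdot> (\<l> (X \<otimes>\<^sub>o \<I>) \<cdot> \<a> \<I> X \<I>) \<cdot> (\<s> X \<I> \<otimes>\<^sub>a \<i> \<I>)"
    using X by (simp add: naturality)
  also have "\<dots> = \<s> X \<I> \<cdot> ((\<l> X \<cdot> \<s> X \<I>) \<otimes>\<^sub>a \<i> \<I>)"
    using X by (simp add: lunit_tensor)
  finally show "(\<l> X \<cdot> \<s> X \<I>) \<otimes>\<^sub>a \<i> \<I> = \<r> X \<otimes>\<^sub>a \<i> \<I>"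
    using X by - (rule monic_cancel[OF m], simp_all)
qed (use X in auto)

lemma runit_sym:
  assumes X: "X \<in> Ob M"
  shows "\<r> X \<cdot> \<s> \<I> X = \<l> X"
proof -
  have "\<r> X \<cdot> \<s> \<I> X = (\<l> X \<cdot> \<s> X \<I>) \<cdot> \<s> \<I> X"
    using X by (simp only: lunit_sym)
  then show ?thesis
    using X by simp
qed

definition swap :: "'o \<Rightarrow> 'o \<Rightarrow> 'o \<Rightarrow> 'm" where
  "swap X Y Z = \<a> Y X Z \<cdot> (\<s> X Y \<otimes>\<^sub>a \<i> Z) \<cdot> \<a>\<^sup>- X Y Z"

lemma swap_simps [simp]:
  assumes "X \<in> Ob M" "Y \<in> Ob M" "Z \<in> Ob M"
  shows "swap X Y Z \<in> Ar M" "Dom M (swap X Y Z) = X \<otimes>\<^sub>o (Y \<otimes>\<^sub>o Z)"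
    "Cod M (swap X Y Z) = Y \<otimes>\<^sub>o (X \<otimes>\<^sub>o Z)"
    "swap Y X Z \<cdot> swap X Y Z = \<i> (X \<otimes>\<^sub>o (Y \<otimes>\<^sub>o Z))"
  using assms by (simp_all add: swap_def)

lemma swap_nat:
  assumes "f \<in> Ar M" "g \<in> Ar M" "h \<in> Ar M" "Cod M f = X'" "Cod M g = Y'" "Cod M h = Z'"
  shows "swap X' Y' Z' \<cdot> (f \<otimes>\<^sub>a (g \<otimes>\<^sub>a h)) = (g \<otimes>\<^sub>a (f \<otimes>\<^sub>a h)) \<cdot> swap (Dom M f) (Dom M g) (Dom M h)"
proof -
  have ob: "X' \<in> Ob M" "Y' \<in> Ob M" "Z' \<in> Ob M" "Dom M f \<in> Ob M" "Dom M g \<in> Ob M" "Dom M h \<in> Ob M"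
    using assms by auto
  have s: "(\<s> X' Y' \<otimes>\<^sub>a \<i> Z') \<cdot> ((f \<otimes>\<^sub>a g) \<otimes>\<^sub>a h)
    = ((g \<otimes>\<^sub>a f) \<otimes>\<^sub>a h) \<cdot> (\<s> (Dom M f) (Dom M g) \<otimes>\<^sub>a \<i> (Dom M h))"
    using assms ob by (simp add: tensor_comp_tensor sym_nat)
  show ?thesis
    using assms ob associnv_nat[OF assms] s[THEN reassoc]
      assoc_nat[THEN reassoc, of g f h Y' X' Z']
    by (simp add: swap_def)
qed

lemma swap_push:
  assumes "X \<in> Ob M" "Y \<in> Ob M" "h \<in> Ar M" "Dom M h = Z"
  shows "(\<i> Y \<otimes>\<^sub>a (\<i> X \<otimes>\<^sub>a h)) \<cdot> swap X Y Z = swap X Y (Cod M h) \<cdot> (\<i> X \<otimes>\<^sub>a (\<i> Y \<otimes>\<^sub>a h))"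
  using swap_nat[of "\<i> X" "\<i> Y" h X Y "Cod M h"] assms by simp

text \<open>This is the hexagon in whiskered form: passing \<open>Y \<otimes> Z\<close> at once
  amounts to passing \<open>Y\<close> and then \<open>Z\<close>. It is the source of all laws that
  move a transposition past a comultiplication.\<close>

lemma swap_tensor:
  assumes X: "X \<in> Ob M" and Y: "Y \<in> Ob M" and Z: "Z \<in> Ob M" and W: "W \<in> Ob M"
  shows "\<a> Y Z (X \<otimes>\<^sub>o W) \<cdot> swap X (Y \<otimes>\<^sub>o Z) W
    = (\<i> Y \<otimes>\<^sub>a swap X Z W) \<cdot> swap X Y (Z \<otimes>\<^sub>o W) \<cdot> (\<i> X \<otimes>\<^sub>a \<a> Y Z W)"
proof -
  have "\<a> Y Z (X \<otimes>\<^sub>o W) \<cdot> swap X (Y \<otimes>\<^sub>o Z) W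
    = (\<a> Y Z (X \<otimes>\<^sub>o W) \<cdot> \<a> (Y \<otimes>\<^sub>o Z) X W) \<cdot> (\<s> X (Y \<otimes>\<^sub>o Z) \<otimes>\<^sub>a \<i> W) \<cdot> \<a>\<^sup>- X (Y \<otimes>\<^sub>o Z) W"
    using assms by (simp add: swap_def)
  also have "\<dots> = (\<i> Y \<otimes>\<^sub>a \<a> Z X W) \<cdot> \<a> Y (Z \<otimes>\<^sub>o X) W \<cdot>
      ((\<a> Y Z X \<cdot> \<s> X (Y \<otimes>\<^sub>o Z) \<cdot> \<a> X Y Z) \<otimes>\<^sub>a \<i> W) \<cdot> (\<a>\<^sup>- X Y Z \<otimes>\<^sub>a \<i> W) \<cdot> \<a>\<^sup>- X (Y \<otimes>\<^sub>o Z) W"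
    using assms by (simp add: pentagon)
  also have "\<dots> = (\<i> Y \<otimes>\<^sub>a \<a> Z X W) \<cdot> (\<i> Y \<otimes>\<^sub>a (\<s> X Z \<otimes>\<^sub>a \<i> W)) \<cdot> \<a> Y (X \<otimes>\<^sub>o Z) W \<cdot>
      (\<a> Y X Z \<otimes>\<^sub>a \<i> W) \<cdot> ((\<s> X Y \<otimes>\<^sub>a \<i> Z) \<otimes>\<^sub>a \<i> W) \<cdot> (\<a>\<^sup>- X Y Z \<otimes>\<^sub>a \<i> W) \<cdot> \<a>\<^sup>- X (Y \<otimes>\<^sub>o Z) W"
    unfolding hexagon[OF X Y Z] using assms by (simp add: naturality)
  also have "\<dots> = (\<i> Y \<otimes>\<^sub>a swap X Z W) \<cdot> swap X Y (Z \<otimes>\<^sub>o W) \<cdot> (\<i> X \<otimes>\<^sub>a \<a> Y Z W)"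
    using assms
    by (simp add: swap_def pentagon_whiskered_inv[THEN reassoc] associnv_nat_ide[THEN reassoc] pentagon_inv)
  finally show ?thesis .
qed

text \<open>Up to associators, a transposition tensored with \<open>Z\<close> is the transposition
  with the longer rest \<open>W \<otimes> Z\<close>. This is needed when the comultiplication of a
  tensor product is itself whiskered.\<close>

lemma swap_whiskered:
  assumes X: "X \<in> Ob M" and Y: "Y \<in> Ob M" and Z: "Z \<in> Ob M" and W: "W \<in> Ob M"
  shows "(\<i> Y \<otimes>\<^sub>a \<a> X W Z) \<cdot> \<a> Y (X \<otimes>\<^sub>o W) Z \<cdot> (swap X Y W \<otimes>\<^sub>a \<i> Z)
    = swap X Y (W \<otimes>\<^sub>o Z) \<cdot> (\<i> X \<otimes>\<^sub>a \<a> Y W Z) \<cdot> \<a> X (Y \<otimes>\<^sub>o W) Z"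
proof -
  have "(\<i> Y \<otimes>\<^sub>a \<a> X W Z) \<cdot> \<a> Y (X \<otimes>\<^sub>o W) Z \<cdot> (swap X Y W \<otimes>\<^sub>a \<i> Z)
    = ((\<i> Y \<otimes>\<^sub>a \<a> X W Z) \<cdot> \<a> Y (X \<otimes>\<^sub>o W) Z \<cdot> (\<a> Y X W \<otimes>\<^sub>a \<i> Z)) \<cdot>
      ((\<s> X Y \<otimes>\<^sub>a \<i> W) \<otimes>\<^sub>a \<i> Z) \<cdot> (\<a>\<^sup>- X Y W \<otimes>\<^sub>a \<i> Z)"
    using assms by (simp add: swap_def)
  also have "\<dots> = swap X Y (W \<otimes>\<^sub>o Z) \<cdot> (\<i> X \<otimes>\<^sub>a \<a> Y W Z) \<cdot> \<a> X (Y \<otimes>\<^sub>o W) Z"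
    unfolding pentagon[OF Y X W Z, symmetric] using assms
    by (simp add: swap_def naturality pentagon_move_inv)
  finally show ?thesis .
qed

lemma swap_dup:
  assumes d: "d \<in> Ar M" "Dom M d = D" "Cod M d = A \<otimes>\<^sub>o A" and A: "A \<in> Ob M"
    and X: "X \<in> Ob M" and Z: "Z \<in> Ob M"
  shows "dup A d (X \<otimes>\<^sub>o Z) \<cdot> swap X D Z
    = (\<i> A \<otimes>\<^sub>a swap X A Z) \<cdot> swap X A (A \<otimes>\<^sub>o Z) \<cdot> (\<i> X \<otimes>\<^sub>a dup A d Z)"
proof -
  have D: "D \<in> Ob M"
    using d by auto
  have "(d \<otimes>\<^sub>a \<i> (X \<otimes>\<^sub>o Z)) \<cdot> swap X D Z = swap X (A \<otimes>\<^sub>o A) Z \<cdot> (\<i> X \<otimes>\<^sub>a (d \<otimes>\<^sub>a \<i> Z))"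
    using swap_nat[of "\<i> X" d "\<i> Z" X "A \<otimes>\<^sub>o A" Z] d A X Z by simp
  then have "dup A d (X \<otimes>\<^sub>o Z) \<cdot> swap X D Z
    = (\<a> A A (X \<otimes>\<^sub>o Z) \<cdot> swap X (A \<otimes>\<^sub>o A) Z) \<cdot> (\<i> X \<otimes>\<^sub>a (d \<otimes>\<^sub>a \<i> Z))"
    using d A X Z D by (simp add: dup_def)
  then show ?thesis
    using d A X Z by (simp add: dup_def swap_tensor)
qed

text \<open>\<open>swap_dup\<close> with the transpositions carried to the other side, which is
  possible because they are mutually inverse.\<close>

lemma whiskered_dup_swap:
  assumes d: "d \<in> Ar M" "Dom M d = D" "Cod M d = A \<otimes>\<^sub>o A" and A: "A \<in> Ob M"
    and Y: "Y \<in> Ob M" and Z: "Z \<in> Ob M"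
  shows "(\<i> Y \<otimes>\<^sub>a dup A d Z) \<cdot> swap D Y Z
    = swap A Y (A \<otimes>\<^sub>o Z) \<cdot> (\<i> A \<otimes>\<^sub>a swap A Y Z) \<cdot> dup A d (Y \<otimes>\<^sub>o Z)"
proof -
  have D: "D \<in> Ob M"
    using d by auto
  have c: "(\<i> A \<otimes>\<^sub>a swap A Y Z) \<cdot> (\<i> A \<otimes>\<^sub>a swap Y A Z) = \<i> (A \<otimes>\<^sub>o (Y \<otimes>\<^sub>o (A \<otimes>\<^sub>o Z)))"
    using A Y Z by (simp add: tensor_comp_tensor)
  have "swap A Y (A \<otimes>\<^sub>o Z) \<cdot> (\<i> A \<otimes>\<^sub>a swap A Y Z) \<cdot> dup A d (Y \<otimes>\<^sub>o Z)
    = swap A Y (A \<otimes>\<^sub>o Z) \<cdot> (\<i> A \<otimes>\<^sub>a swap A Y Z) \<cdot> (dup A d (Y \<otimes>\<^sub>o Z) \<cdot> swap Y D Z) \<cdot> swap D Y Z"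
    using d A Y Z D by simp
  also have "\<dots> = (\<i> Y \<otimes>\<^sub>a dup A d Z) \<cdot> swap D Y Z"
    unfolding swap_dup[OF d A Y Z]
    using d A Y Z D c[THEN reassoc] swap_simps(4)[THEN reassoc, of Y A "A \<otimes>\<^sub>o Z"] by simp
  finally show ?thesis ..
qed

lemma del_swap:
  assumes e: "e \<in> Ar M" "Dom M e = D" "Cod M e = \<I>" and X: "X \<in> Ob M" and Z: "Z \<in> Ob M"
  shows "del e (X \<otimes>\<^sub>o Z) \<cdot> swap X D Z = \<i> X \<otimes>\<^sub>a del e Z"
proof -
  have D: "D \<in> Ob M"
    using e by auto
  have "(e \<otimes>\<^sub>a \<i> (X \<otimes>\<^sub>o Z)) \<cdot> swap X D Z = swap X \<I> Z \<cdot> (\<i> X \<otimes>\<^sub>a (e \<otimes>\<^sub>a \<i> Z))"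
    using swap_nat[of "\<i> X" e "\<i> Z" X \<I> Z] e X Z by simp
  moreover have "\<l> (X \<otimes>\<^sub>o Z) \<cdot> swap X \<I> Z = \<i> X \<otimes>\<^sub>a \<l> Z"
  proof -
    have "\<l> (X \<otimes>\<^sub>o Z) \<cdot> swap X \<I> Z = (\<l> (X \<otimes>\<^sub>o Z) \<cdot> \<a> \<I> X Z) \<cdot> (\<s> X \<I> \<otimes>\<^sub>a \<i> Z) \<cdot> \<a>\<^sup>- X \<I> Z"
      using X Z by (simp add: swap_def)
    also have "\<dots> = ((\<l> X \<cdot> \<s> X \<I>) \<otimes>\<^sub>a \<i> Z) \<cdot> \<a>\<^sup>- X \<I> Z"
      using X Z by (simp add: lunit_tensor)
    also have "\<dots> = ((\<i> X \<otimes>\<^sub>a \<l> Z) \<cdot> \<a> X \<I> Z) \<cdot> \<a>\<^sup>- X \<I> Z"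
      using X Z by (simp only: lunit_sym triangle)
    finally show ?thesis
      using X Z by simp
  qed
  ultimately show ?thesis
    using e X Z D reassoc[of "\<l> (X \<otimes>\<^sub>o Z)" "swap X \<I> Z"] by (simp add: del_def)
qed

lemma whiskered_del_swap:
  assumes e: "e \<in> Ar M" "Dom M e = D" "Cod M e = \<I>" and Y: "Y \<in> Ob M" and Z: "Z \<in> Ob M"
  shows "(\<i> Y \<otimes>\<^sub>a del e Z) \<cdot> swap D Y Z = del e (Y \<otimes>\<^sub>o Z)"
proof -
  have "D \<in> Ob M"
    using e by auto
  then show ?thesis
    unfolding del_swap[OF e Y Z, symmetric] using e Y Z by simp
qed

lemma swap_dup_cocommutative:
  assumes "is_comonoid M A d e" "cocommutative M A d" and Z: "Z \<in> Ob M"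
  shows "swap A A Z \<cdot> dup A d Z = dup A d Z"
proof -
  note A = is_comonoid_simps[OF assms(1)]
  have "(\<s> A A \<otimes>\<^sub>a \<i> Z) \<cdot> (d \<otimes>\<^sub>a \<i> Z) = d \<otimes>\<^sub>a \<i> Z"
    using assms(2) A Z by (simp add: tensor_comp_tensor cocommutative_def)
  then show ?thesis
    using A Z by (simp add: swap_def dup_def)
qed

lemma interchange_eq:
  "\<lbrakk>X \<in> Ob M; Y \<in> Ob M; Z \<in> Ob M; W \<in> Ob M\<rbrakk>
    \<Longrightarrow> interchange M X Y Z W = \<a>\<^sup>- X Z (Y \<otimes>\<^sub>o W) \<cdot> (\<i> X \<otimes>\<^sub>a swap Y Z W) \<cdot> \<a> X Y (Z \<otimes>\<^sub>o W)"
  by (simp add: interchange_def swap_def)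

lemma interchange_simps [simp]:
  assumes "X \<in> Ob M" "Y \<in> Ob M" "Z \<in> Ob M" "W \<in> Ob M"
  shows "interchange M X Y Z W \<in> Ar M"
    "Dom M (interchange M X Y Z W) = (X \<otimes>\<^sub>o Y) \<otimes>\<^sub>o (Z \<otimes>\<^sub>o W)"
    "Cod M (interchange M X Y Z W) = (X \<otimes>\<^sub>o Z) \<otimes>\<^sub>o (Y \<otimes>\<^sub>o W)"
    "interchange M X Z Y W \<cdot> interchange M X Y Z W = \<i> ((X \<otimes>\<^sub>o Y) \<otimes>\<^sub>o (Z \<otimes>\<^sub>o W))"
  using assms whisker_left[OF swap_simps(4), THEN reassoc, of Y Z W X]
  by (simp_all add: interchange_eq)

lemma interchange_nat:
  assumes "f \<in> Ar M" "g \<in> Ar M" "h \<in> Ar M" "k \<in> Ar M"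
    "Cod M f = X'" "Cod M g = Y'" "Cod M h = Z'" "Cod M k = W'"
  shows "interchange M X' Y' Z' W' \<cdot> ((f \<otimes>\<^sub>a g) \<otimes>\<^sub>a (h \<otimes>\<^sub>a k))
    = ((f \<otimes>\<^sub>a h) \<otimes>\<^sub>a (g \<otimes>\<^sub>a k)) \<cdot> interchange M (Dom M f) (Dom M g) (Dom M h) (Dom M k)"
proof -
  have ob: "X' \<in> Ob M" "Y' \<in> Ob M" "Z' \<in> Ob M" "W' \<in> Ob M"
    "Dom M f \<in> Ob M" "Dom M g \<in> Ob M" "Dom M h \<in> Ob M" "Dom M k \<in> Ob M"
    using assms by auto
  have s: "(\<i> X' \<otimes>\<^sub>a swap Y' Z' W') \<cdot> (f \<otimes>\<^sub>a (g \<otimes>\<^sub>a (h \<otimes>\<^sub>a k)))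
    = (f \<otimes>\<^sub>a (h \<otimes>\<^sub>a (g \<otimes>\<^sub>a k))) \<cdot> (\<i> (Dom M f) \<otimes>\<^sub>a swap (Dom M g) (Dom M h) (Dom M k))"
    using assms ob by (simp add: tensor_comp_tensor swap_nat)
  show ?thesis
    using assms ob assoc_nat[of f g "h \<otimes>\<^sub>a k" X' Y' "Z' \<otimes>\<^sub>o W'"] s[THEN reassoc]
      associnv_nat[THEN reassoc, of f h "g \<otimes>\<^sub>a k" X' Z' "Y' \<otimes>\<^sub>o W'"]
    by (simp add: interchange_eq)
qed

end

section \<open>Cocommutative comonoids\<close>

record ('o, 'm) comonoid =
  co_obj :: "'o"
  co_comult :: "'m"
  co_counit :: "'m"

section \<open>Tensor products of cocommutative comonoids\<close>

context symmetric_monoidal_category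
begin

lemma sym_tensor:
  assumes X: "X \<in> Ob M" and Y: "Y \<in> Ob M" and Z: "Z \<in> Ob M"
  shows "\<a> Y Z X \<cdot> \<s> X (Y \<otimes>\<^sub>o Z) = (\<i> Y \<otimes>\<^sub>a \<s> X Z) \<cdot> swap X Y Z"
proof -
  have "\<a> Y Z X \<cdot> \<s> X (Y \<otimes>\<^sub>o Z) = (\<a> Y Z X \<cdot> \<s> X (Y \<otimes>\<^sub>o Z) \<cdot> \<a> X Y Z) \<cdot> \<a>\<^sup>- X Y Z"
    using assms by simp
  then show ?thesis
    unfolding hexagon[OF assms] using assms by (simp add: swap_def)
qed

lemma tensor_sym:
  assumes X: "X \<in> Ob M" and Y: "Y \<in> Ob M" and Z: "Z \<in> Ob M"
  shows "\<s> (Y \<otimes>\<^sub>o Z) X = swap Y X Z \<cdot> (\<i> Y \<otimes>\<^sub>a \<s> Z X) \<cdot> \<a> Y Z X"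
proof -
  have "swap Y X Z \<cdot> (\<i> Y \<otimes>\<^sub>a \<s> Z X) \<cdot> \<a> Y Z X
    = swap Y X Z \<cdot> (\<i> Y \<otimes>\<^sub>a \<s> Z X) \<cdot> (\<a> Y Z X \<cdot> \<s> X (Y \<otimes>\<^sub>o Z)) \<cdot> \<s> (Y \<otimes>\<^sub>o Z) X"
    using assms by simp
  also have "\<dots> = \<s> (Y \<otimes>\<^sub>o Z) X"
    unfolding sym_tensor[OF assms] using assms swap_simps(4)[THEN reassoc, of X Y Z] by simp
  finally show ?thesis ..
qed

lemma tensor_swap:
  assumes X: "X \<in> Ob M" and Y: "Y \<in> Ob M" and Z: "Z \<in> Ob M" and W: "W \<in> Ob M"
  shows "(\<i> X \<otimes>\<^sub>a \<a> Y Z W) \<cdot> swap (Y \<otimes>\<^sub>o Z) X W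
    = swap Y X (Z \<otimes>\<^sub>o W) \<cdot> (\<i> Y \<otimes>\<^sub>a swap Z X W) \<cdot> \<a> Y Z (X \<otimes>\<^sub>o W)"
proof -
  have c: "(\<i> Y \<otimes>\<^sub>a swap Z X W) \<cdot> (\<i> Y \<otimes>\<^sub>a swap X Z W) = \<i> (Y \<otimes>\<^sub>o (X \<otimes>\<^sub>o (Z \<otimes>\<^sub>o W)))"
    using assms by (simp add: tensor_comp_tensor)
  have "swap Y X (Z \<otimes>\<^sub>o W) \<cdot> (\<i> Y \<otimes>\<^sub>a swap Z X W) \<cdot> \<a> Y Z (X \<otimes>\<^sub>o W)
    = swap Y X (Z \<otimes>\<^sub>o W) \<cdot> (\<i> Y \<otimes>\<^sub>a swap Z X W) \<cdot> (\<a> Y Z (X \<otimes>\<^sub>o W) \<cdot> swap X (Y \<otimes>\<^sub>o Z) W) \<cdot>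
      swap (Y \<otimes>\<^sub>o Z) X W"
    using assms by simp
  also have "\<dots> = (\<i> X \<otimes>\<^sub>a \<a> Y Z W) \<cdot> swap (Y \<otimes>\<^sub>o Z) X W"
    unfolding swap_tensor[OF assms]
    using assms c[THEN reassoc] swap_simps(4)[THEN reassoc, of X Y "Z \<otimes>\<^sub>o W"] by simp
  finally show ?thesis ..
qed

definition coc :: "('o, 'm) comonoid \<Rightarrow> bool" where
  "coc C \<longleftrightarrow> is_comonoid M (co_obj C) (co_comult C) (co_counit C) \<and>
    cocommutative M (co_obj C) (co_comult C)"

definition chom :: "('o, 'm) comonoid \<Rightarrow> ('o, 'm) comonoid \<Rightarrow> 'm \<Rightarrow> bool" where
  "chom C D f \<longleftrightarrow> comonoid_hom M (co_obj C) (co_comult C) (co_counit C)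
    (co_obj D) (co_comult D) (co_counit D) f"

definition tensor_comonoid (infixr "\<boxtimes>" 70) where
  "C \<boxtimes> D = \<lparr>co_obj = co_obj C \<otimes>\<^sub>o co_obj D,
    co_comult = interchange M (co_obj C) (co_obj C) (co_obj D) (co_obj D) \<cdot> (co_comult C \<otimes>\<^sub>a co_comult D),
    co_counit = \<l> \<I> \<cdot> (co_counit C \<otimes>\<^sub>a co_counit D)\<rparr>"

definition unit_comonoid :: "('o, 'm) comonoid" where
  "unit_comonoid = \<lparr>co_obj = \<I>, co_comult = \<l>\<^sup>- \<I>, co_counit = \<i> \<I>\<rparr>"

lemma coc_simps [simp]:
  assumes "coc C"
  shows "co_obj C \<in> Ob M" "co_comult C \<in> Ar M" "Dom M (co_comult C) = co_obj C"
    "Cod M (co_comult C) = co_obj C \<otimes>\<^sub>o co_obj C" "co_counit C \<in> Ar M"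
    "Dom M (co_counit C) = co_obj C" "Cod M (co_counit C) = \<I>"
  using is_comonoid_simps(1-7)[OF assms[unfolded coc_def, THEN conjunct1]] by simp_all

lemma coc_comonoid: "coc C \<Longrightarrow> is_comonoid M (co_obj C) (co_comult C) (co_counit C)"
  by (simp add: coc_def)

lemmas coc_laws = is_comonoid_simps(8-10)[OF coc_comonoid] dup_dup[OF coc_comonoid]
  del_dup[OF coc_comonoid] whiskered_del_dup[OF coc_comonoid]

lemma coc_sym: "coc C \<Longrightarrow> \<s> (co_obj C) (co_obj C) \<cdot> co_comult C = co_comult C"
  by (simp add: coc_def cocommutative_def)

lemma coc_swap_dup:
  "\<lbrakk>coc C; Z \<in> Ob M\<rbrakk>
    \<Longrightarrow> swap (co_obj C) (co_obj C) Z \<cdot> dup (co_obj C) (co_comult C) Z = dup (co_obj C) (co_comult C) Z"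
  using swap_dup_cocommutative unfolding coc_def by blast

lemma tensor_comonoid_obj [simp]: "co_obj (C \<boxtimes> D) = co_obj C \<otimes>\<^sub>o co_obj D"
  by (simp add: tensor_comonoid_def)

lemma unit_comonoid_simps [simp]:
  "co_obj unit_comonoid = \<I>" "co_comult unit_comonoid = \<l>\<^sup>- \<I>" "co_counit unit_comonoid = \<i> \<I>"
  by (simp_all add: unit_comonoid_def)

lemma tensor_counit: "co_counit (C \<boxtimes> D) = \<l> \<I> \<cdot> (co_counit C \<otimes>\<^sub>a co_counit D)"
  by (simp add: tensor_comonoid_def)

lemma tensor_comult:
  "co_comult (C \<boxtimes> D) = interchange M (co_obj C) (co_obj C) (co_obj D) (co_obj D) \<cdot>
    (co_comult C \<otimes>\<^sub>a co_comult D)"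
  by (simp add: tensor_comonoid_def)

lemma tensor_comult_simps [simp]:
  assumes "coc C" "coc D"
  shows "co_comult (C \<boxtimes> D) \<in> Ar M" "Dom M (co_comult (C \<boxtimes> D)) = co_obj C \<otimes>\<^sub>o co_obj D"
    "Cod M (co_comult (C \<boxtimes> D)) = (co_obj C \<otimes>\<^sub>o co_obj D) \<otimes>\<^sub>o (co_obj C \<otimes>\<^sub>o co_obj D)"
    "co_counit (C \<boxtimes> D) \<in> Ar M" "Dom M (co_counit (C \<boxtimes> D)) = co_obj C \<otimes>\<^sub>o co_obj D"
    "Cod M (co_counit (C \<boxtimes> D)) = \<I>"
  using assms by (simp_all add: tensor_comult tensor_counit)

text \<open>On elements this is \<open>a \<otimes> b \<mapsto> a1 \<otimes> b1 \<otimes> a2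
  \<otimes> b2\<close>, assembled by splitting \<open>a\<close>, splitting \<open>b\<close>, and
  transposing \<open>a2\<close> with \<open>b1\<close>.\<close>

lemma tensor_comult_nested:
  assumes C: "coc C" and D: "coc D"
  defines "A \<equiv> co_obj C" and "B \<equiv> co_obj D"
  shows "\<a> A B (A \<otimes>\<^sub>o B) \<cdot> co_comult (C \<boxtimes> D)
    = (\<i> A \<otimes>\<^sub>a swap A B B) \<cdot> (\<i> A \<otimes>\<^sub>a (\<i> A \<otimes>\<^sub>a co_comult D)) \<cdot> dup A (co_comult C) B"
proof -
  have ob: "A \<in> Ob M" "B \<in> Ob M"
    using C D by (auto simp: A_def B_def)
  have split: "co_comult C \<otimes>\<^sub>a co_comult D = (\<i> (A \<otimes>\<^sub>o A) \<otimes>\<^sub>a co_comult D) \<cdot> (co_comult C \<otimes>\<^sub>a \<i> B)"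
    using C D ob by (simp add: tensor_comp_tensor A_def B_def del: tensor_ide)
  show ?thesis
    unfolding tensor_comult split
    using C D ob assoc_nat_ide[THEN reassoc, of A A "co_comult D" "B \<otimes>\<^sub>o B" "co_comult C \<otimes>\<^sub>a \<i> B"]
    by (simp add: interchange_eq dup_def flip: A_def B_def)
qed

text \<open>The same in front of a rest \<open>Z\<close>, fully flattened. Coassociativity needs it
  on the side where the comultiplication is applied to the left factor.\<close>

lemma tensor_comult_whiskered:
  assumes C: "coc C" and D: "coc D" and Z: "Z \<in> Ob M"
  defines "A \<equiv> co_obj C" and "B \<equiv> co_obj D"
  shows "\<a> A B (A \<otimes>\<^sub>o (B \<otimes>\<^sub>o Z)) \<cdot> (\<i> (A \<otimes>\<^sub>o B) \<otimes>\<^sub>a \<a> A B Z) \<cdot>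
      dup (A \<otimes>\<^sub>o B) (co_comult (C \<boxtimes> D)) Z
    = (\<i> A \<otimes>\<^sub>a swap A B (B \<otimes>\<^sub>o Z)) \<cdot> (\<i> A \<otimes>\<^sub>a (\<i> A \<otimes>\<^sub>a dup B (co_comult D) Z)) \<cdot>
      dup A (co_comult C) (B \<otimes>\<^sub>o Z) \<cdot> \<a> A B Z"
proof -
  let ?\<Delta> = "co_comult (C \<boxtimes> D)" and ?d = "co_comult C" and ?d' = "co_comult D"
  have ob: "A \<in> Ob M" "B \<in> Ob M"
    using C D by (auto simp: A_def B_def)
  have t: "?\<Delta> \<in> Ar M" "Dom M ?\<Delta> = A \<otimes>\<^sub>o B" "Cod M ?\<Delta> = (A \<otimes>\<^sub>o B) \<otimes>\<^sub>o (A \<otimes>\<^sub>o B)"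
    "?d \<in> Ar M" "Dom M ?d = A" "Cod M ?d = A \<otimes>\<^sub>o A" "?d' \<in> Ar M" "Dom M ?d' = B" "Cod M ?d' = B \<otimes>\<^sub>o B"
    using C D by (auto simp: A_def B_def)
  have "\<a> A B (A \<otimes>\<^sub>o (B \<otimes>\<^sub>o Z)) \<cdot> (\<i> (A \<otimes>\<^sub>o B) \<otimes>\<^sub>a \<a> A B Z) \<cdot> dup (A \<otimes>\<^sub>o B) ?\<Delta> Z
    = (\<i> A \<otimes>\<^sub>a (\<i> B \<otimes>\<^sub>a \<a> A B Z)) \<cdot> (\<a> A B ((A \<otimes>\<^sub>o B) \<otimes>\<^sub>o Z) \<cdot> \<a> (A \<otimes>\<^sub>o B) (A \<otimes>\<^sub>o B) Z) \<cdot> (?\<Delta> \<otimes>\<^sub>a \<i> Z)"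
    using t ob Z by (simp add: dup_def naturality)
  also have "\<dots> = (\<i> A \<otimes>\<^sub>a (\<i> B \<otimes>\<^sub>a \<a> A B Z)) \<cdot> (\<i> A \<otimes>\<^sub>a \<a> B (A \<otimes>\<^sub>o B) Z) \<cdot>
      \<a> A (B \<otimes>\<^sub>o (A \<otimes>\<^sub>o B)) Z \<cdot> ((\<a> A B (A \<otimes>\<^sub>o B) \<cdot> ?\<Delta>) \<otimes>\<^sub>a \<i> Z)"
    using t ob Z by (simp add: pentagon)
  also have "\<dots> = (\<i> A \<otimes>\<^sub>a ((\<i> B \<otimes>\<^sub>a \<a> A B Z) \<cdot> \<a> B (A \<otimes>\<^sub>o B) Z \<cdot> (swap A B B \<otimes>\<^sub>a \<i> Z))) \<cdot>
      \<a> A (A \<otimes>\<^sub>o (B \<otimes>\<^sub>o B)) Z \<cdot> ((\<i> A \<otimes>\<^sub>a (\<i> A \<otimes>\<^sub>a ?d')) \<otimes>\<^sub>a \<i> Z) \<cdot> (dup A ?d B \<otimes>\<^sub>a \<i> Z)"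
    unfolding tensor_comult_nested[OF C D, folded A_def B_def]
    using t ob Z by (simp add: naturality)
  also have "\<dots> = (\<i> A \<otimes>\<^sub>a swap A B (B \<otimes>\<^sub>o Z)) \<cdot> (\<i> A \<otimes>\<^sub>a (\<i> A \<otimes>\<^sub>a dup B ?d' Z)) \<cdot>
      ((\<i> A \<otimes>\<^sub>a \<a> A B Z) \<cdot> \<a> A (A \<otimes>\<^sub>o B) Z \<cdot> (\<a> A A B \<otimes>\<^sub>a \<i> Z)) \<cdot> ((?d \<otimes>\<^sub>a \<i> B) \<otimes>\<^sub>a \<i> Z)"
    unfolding swap_whiskered[OF ob(1,2) Z ob(2)]
    using t ob Z assoc_nat[THEN whisker_left, THEN reassoc, of "\<i> A" ?d' "\<i> Z" A "B \<otimes>\<^sub>o B" Z A]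
    by (simp add: dup_def naturality)
  also have "\<dots> = (\<i> A \<otimes>\<^sub>a swap A B (B \<otimes>\<^sub>o Z)) \<cdot> (\<i> A \<otimes>\<^sub>a (\<i> A \<otimes>\<^sub>a dup B ?d' Z)) \<cdot>
      dup A ?d (B \<otimes>\<^sub>o Z) \<cdot> \<a> A B Z"
    unfolding pentagon[OF ob(1,1,2) Z, symmetric]
    using t ob Z by (simp add: dup_def naturality)
  finally show ?thesis .
qed

lemma del_tensor_counit:
  assumes C: "coc C" and D: "coc D" and Z: "Z \<in> Ob M"
  shows "del (co_counit (C \<boxtimes> D)) Z
    = del (co_counit D) Z \<cdot> del (co_counit C) (co_obj D \<otimes>\<^sub>o Z) \<cdot> \<a> (co_obj C) (co_obj D) Z"
proof -
  let ?e = "co_counit C" and ?e' = "co_counit D" and ?A = "co_obj C" and ?B = "co_obj D"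
  have "del (co_counit (C \<boxtimes> D)) Z = \<l> Z \<cdot> (\<l> (\<I> \<otimes>\<^sub>o Z) \<cdot> \<a> \<I> \<I> Z) \<cdot> ((?e \<otimes>\<^sub>a ?e') \<otimes>\<^sub>a \<i> Z)"
    using C D Z by (simp add: del_def tensor_counit lunit_tensor)
  also have "\<dots> = \<l> Z \<cdot> \<l> (\<I> \<otimes>\<^sub>o Z) \<cdot> (?e \<otimes>\<^sub>a (?e' \<otimes>\<^sub>a \<i> Z)) \<cdot> \<a> ?A ?B Z"
    using C D Z by (simp add: naturality)
  also have "?e \<otimes>\<^sub>a (?e' \<otimes>\<^sub>a \<i> Z) = (\<i> \<I> \<otimes>\<^sub>a (?e' \<otimes>\<^sub>a \<i> Z)) \<cdot> (?e \<otimes>\<^sub>a \<i> (?B \<otimes>\<^sub>o Z))"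
    using C D Z by (simp add: tensor_comp_tensor del: tensor_ide)
  finally show ?thesis
    using C D Z by (simp add: del_def naturality)
qed

text \<open>Cocommutativity and coassociativity are checked after a flattening isomorphism, where
  both sides are composites of \<open>dup\<close>, \<open>swap\<close> and whiskered
  comultiplications of the two factors.\<close>

lemma tensor_coc:
  assumes C: "coc C" and D: "coc D"
  shows "coc (C \<boxtimes> D)"
proof -
  let ?A = "co_obj C" and ?B = "co_obj D" and ?d = "co_comult C" and ?d' = "co_comult D"
  let ?\<Delta> = "co_comult (C \<boxtimes> D)" and ?\<epsilon> = "co_counit (C \<boxtimes> D)" and ?T = "co_obj C \<otimes>\<^sub>o co_obj D"
  note nested = tensor_comult_nested[OF C D]
  have cocomm: "\<s> ?T ?T \<cdot> ?\<Delta> = ?\<Delta>"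
  proof (rule monic_cancel[where f = "\<a> ?A ?B ?T"])
    show "monic M (\<a> ?A ?B ?T)"
      using C D by (intro iso_monic assoc_iso) auto
    have c: "(\<i> ?A \<otimes>\<^sub>a swap ?B ?A ?B) \<cdot> (\<i> ?A \<otimes>\<^sub>a swap ?A ?B ?B) = \<i> (?A \<otimes>\<^sub>o (?A \<otimes>\<^sub>o (?B \<otimes>\<^sub>o ?B)))"
      using C D by (simp add: tensor_comp_tensor)
    have "\<a> ?A ?B ?T \<cdot> (\<s> ?T ?T \<cdot> ?\<Delta>)
      = (\<i> ?A \<otimes>\<^sub>a swap ?A ?B ?B) \<cdot> (\<i> ?A \<otimes>\<^sub>a (\<i> ?A \<otimes>\<^sub>a \<s> ?B ?B)) \<cdot>
        ((\<i> ?A \<otimes>\<^sub>a \<a> ?A ?B ?B) \<cdot> swap ?T ?A ?B) \<cdot> ?\<Delta>"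
      using C D sym_tensor[THEN reassoc, of ?T ?A ?B ?\<Delta>] by (simp add: tensor_sym[of ?B ?A ?B])
    also have "\<dots> = (\<i> ?A \<otimes>\<^sub>a swap ?A ?B ?B) \<cdot> (\<i> ?A \<otimes>\<^sub>a (\<i> ?A \<otimes>\<^sub>a \<s> ?B ?B)) \<cdot>
        swap ?A ?A (?B \<otimes>\<^sub>o ?B) \<cdot> (\<i> ?A \<otimes>\<^sub>a (\<i> ?A \<otimes>\<^sub>a ?d')) \<cdot> dup ?A ?d ?B"
      using C D c[THEN reassoc] by (simp add: tensor_swap nested)
    also have "swap ?A ?A (?B \<otimes>\<^sub>o ?B) \<cdot> (\<i> ?A \<otimes>\<^sub>a (\<i> ?A \<otimes>\<^sub>a ?d')) \<cdot> dup ?A ?d ?B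
      = (\<i> ?A \<otimes>\<^sub>a (\<i> ?A \<otimes>\<^sub>a ?d')) \<cdot> dup ?A ?d ?B"
      using C D swap_push[THEN reassoc, of ?A ?A ?d' ?B "dup ?A ?d ?B"] by (simp add: coc_swap_dup)
    also have "(\<i> ?A \<otimes>\<^sub>a swap ?A ?B ?B) \<cdot> (\<i> ?A \<otimes>\<^sub>a (\<i> ?A \<otimes>\<^sub>a \<s> ?B ?B)) \<cdot> \<dots> = \<a> ?A ?B ?T \<cdot> ?\<Delta>"
      using C D whisker_left[OF whisker_left[OF coc_sym[OF D]], THEN reassoc, of ?A ?A "dup ?A ?d ?B"]
      by (simp add: nested)
    finally show "\<a> ?A ?B ?T \<cdot> (\<s> ?T ?T \<cdot> ?\<Delta>) = \<a> ?A ?B ?T \<cdot> ?\<Delta>" .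
  qed (use C D in auto)
  have counit: "\<l> ?T \<cdot> (?\<epsilon> \<otimes>\<^sub>a \<i> ?T) \<cdot> ?\<Delta> = \<i> ?T"
  proof -
    have "\<l> ?T \<cdot> (?\<epsilon> \<otimes>\<^sub>a \<i> ?T) \<cdot> ?\<Delta> = del ?\<epsilon> ?T \<cdot> ?\<Delta>"
      using C D by (simp add: del_def)
    also have "\<dots> = del (co_counit D) ?T \<cdot> (del (co_counit C) (?B \<otimes>\<^sub>o ?T) \<cdot> (\<i> ?A \<otimes>\<^sub>a swap ?A ?B ?B)) \<cdot>
        (\<i> ?A \<otimes>\<^sub>a (\<i> ?A \<otimes>\<^sub>a ?d')) \<cdot> dup ?A ?d ?B"
      using C D by (simp add: del_tensor_counit nested)
    also have "\<dots> = (\<i> ?A \<otimes>\<^sub>a del (co_counit D) ?B) \<cdot> (\<i> ?A \<otimes>\<^sub>a ?d')"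
      using C D by (simp add: del_nat del_nat[THEN reassoc] del_swap[THEN reassoc] coc_laws)
    also have "\<dots> = \<i> ?T"
      using C D whisker_left[OF coc_laws(2)[OF D], of ?A] by simp
    finally show ?thesis .
  qed
  \<comment> \<open>The symmetry turns the right counit law into the left one and is then absorbed
    by cocommutativity.\<close>
  have "\<r> ?T \<cdot> (\<i> ?T \<otimes>\<^sub>a ?\<epsilon>) \<cdot> \<s> ?T ?T \<cdot> ?\<Delta> = \<l> ?T \<cdot> (?\<epsilon> \<otimes>\<^sub>a \<i> ?T) \<cdot> ?\<Delta>"
    using C D sym_nat[of ?\<epsilon> "\<i> ?T" \<I> ?T] sym_nat[THEN reassoc, of ?\<epsilon> "\<i> ?T" \<I> ?T ?\<Delta>]
      runit_sym[THEN reassoc, of ?T "(?\<epsilon> \<otimes>\<^sub>a \<i> ?T) \<cdot> ?\<Delta>"] by simp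
  then have counit': "\<r> ?T \<cdot> (\<i> ?T \<otimes>\<^sub>a ?\<epsilon>) \<cdot> ?\<Delta> = \<i> ?T"
    using cocomm counit by simp
  have coassoc: "\<a> ?T ?T ?T \<cdot> (?\<Delta> \<otimes>\<^sub>a \<i> ?T) \<cdot> ?\<Delta> = (\<i> ?T \<otimes>\<^sub>a ?\<Delta>) \<cdot> ?\<Delta>"
  proof (rule monic_cancel[where f = "\<a> ?A ?B (?A \<otimes>\<^sub>o (?B \<otimes>\<^sub>o ?T)) \<cdot> (\<i> ?T \<otimes>\<^sub>a \<a> ?A ?B ?T)"])
    let ?J = "\<a> ?A ?B (?A \<otimes>\<^sub>o (?B \<otimes>\<^sub>o ?T)) \<cdot> (\<i> ?T \<otimes>\<^sub>a \<a> ?A ?B ?T)"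
    show "monic M ?J"
      using C D by (intro iso_monic iso_comp iso_tensor assoc_iso iso_ide) auto
    \<comment> \<open>Both sides send \<open>a \<otimes> b\<close> to \<open>a1 \<otimes> b1
      \<otimes> a2 \<otimes> b2 \<otimes> a3 \<otimes> b3\<close>. The equations \<open>L\<close>
      and \<open>R\<close> bring them to the same order of splittings and transpositions.\<close>
    have "?J \<cdot> (\<a> ?T ?T ?T \<cdot> (?\<Delta> \<otimes>\<^sub>a \<i> ?T) \<cdot> ?\<Delta>)
      = (\<a> ?A ?B (?A \<otimes>\<^sub>o (?B \<otimes>\<^sub>o ?T)) \<cdot> (\<i> ?T \<otimes>\<^sub>a \<a> ?A ?B ?T) \<cdot> dup ?T ?\<Delta> ?T) \<cdot> ?\<Delta>"
      using C D by (simp add: dup_def)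
    also have "\<dots> = (\<i> ?A \<otimes>\<^sub>a swap ?A ?B (?B \<otimes>\<^sub>o ?T)) \<cdot> (\<i> ?A \<otimes>\<^sub>a (\<i> ?A \<otimes>\<^sub>a dup ?B ?d' ?T)) \<cdot>
        (dup ?A ?d (?B \<otimes>\<^sub>o ?T) \<cdot> (\<i> ?A \<otimes>\<^sub>a swap ?A ?B ?B)) \<cdot> (\<i> ?A \<otimes>\<^sub>a (\<i> ?A \<otimes>\<^sub>a ?d')) \<cdot> dup ?A ?d ?B"
      using C D by (simp add: tensor_comult_whiskered nested)
    also have "\<dots> = (\<i> ?A \<otimes>\<^sub>a swap ?A ?B (?B \<otimes>\<^sub>o ?T)) \<cdot>
        (\<i> ?A \<otimes>\<^sub>a (\<i> ?A \<otimes>\<^sub>a (dup ?B ?d' ?T \<cdot> swap ?A ?B ?B \<cdot> (\<i> ?A \<otimes>\<^sub>a ?d')))) \<cdot>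
        (\<i> ?A \<otimes>\<^sub>a dup ?A ?d ?B) \<cdot> dup ?A ?d ?B"
      using C D by (simp add: dup_nat dup_nat[THEN reassoc] coc_laws)
    also have "dup ?B ?d' ?T \<cdot> swap ?A ?B ?B \<cdot> (\<i> ?A \<otimes>\<^sub>a ?d')
      = (\<i> ?B \<otimes>\<^sub>a swap ?A ?B ?B) \<cdot> swap ?A ?B (?B \<otimes>\<^sub>o ?B) \<cdot> (\<i> ?A \<otimes>\<^sub>a (dup ?B ?d' ?B \<cdot> ?d'))"
      using C D by (simp add: swap_dup[THEN reassoc])
    finally have L: "?J \<cdot> (\<a> ?T ?T ?T \<cdot> (?\<Delta> \<otimes>\<^sub>a \<i> ?T) \<cdot> ?\<Delta>)
      = (\<i> ?A \<otimes>\<^sub>a (swap ?A ?B (?B \<otimes>\<^sub>o ?T) \<cdot> (\<i> ?A \<otimes>\<^sub>a (\<i> ?B \<otimes>\<^sub>a swap ?A ?B ?B)) \<cdot>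
          (\<i> ?A \<otimes>\<^sub>a swap ?A ?B (?B \<otimes>\<^sub>o ?B)) \<cdot>
          (\<i> ?A \<otimes>\<^sub>a (\<i> ?A \<otimes>\<^sub>a ((\<i> ?B \<otimes>\<^sub>a ?d') \<cdot> ?d'))) \<cdot> dup ?A ?d ?B)) \<cdot> dup ?A ?d ?B"
      using C D by (simp add: coc_laws)
    have "?J \<cdot> ((\<i> ?T \<otimes>\<^sub>a ?\<Delta>) \<cdot> ?\<Delta>)
      = (\<i> ?A \<otimes>\<^sub>a (\<i> ?B \<otimes>\<^sub>a (\<a> ?A ?B ?T \<cdot> ?\<Delta>))) \<cdot> (\<a> ?A ?B ?T \<cdot> ?\<Delta>)"
      using C D by (simp add: naturality)
    also have "\<dots> = (\<i> ?A \<otimes>\<^sub>a (\<i> ?B \<otimes>\<^sub>a ((\<i> ?A \<otimes>\<^sub>a swap ?A ?B ?B) \<cdot> (\<i> ?A \<otimes>\<^sub>a (\<i> ?A \<otimes>\<^sub>a ?d'))))) \<cdot>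
        (\<i> ?A \<otimes>\<^sub>a ((\<i> ?B \<otimes>\<^sub>a dup ?A ?d ?B) \<cdot> swap ?A ?B ?B)) \<cdot> (\<i> ?A \<otimes>\<^sub>a (\<i> ?A \<otimes>\<^sub>a ?d')) \<cdot> dup ?A ?d ?B"
      unfolding nested using C D by simp
    also have "(\<i> ?B \<otimes>\<^sub>a dup ?A ?d ?B) \<cdot> swap ?A ?B ?B
      = swap ?A ?B (?A \<otimes>\<^sub>o ?B) \<cdot> (\<i> ?A \<otimes>\<^sub>a swap ?A ?B ?B) \<cdot> dup ?A ?d (?B \<otimes>\<^sub>o ?B)"
      using C D by (simp add: whiskered_dup_swap)
    finally have "?J \<cdot> ((\<i> ?T \<otimes>\<^sub>a ?\<Delta>) \<cdot> ?\<Delta>)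
      = (\<i> ?A \<otimes>\<^sub>a ((\<i> ?B \<otimes>\<^sub>a (\<i> ?A \<otimes>\<^sub>a (swap ?A ?B ?B \<cdot> (\<i> ?A \<otimes>\<^sub>a ?d')))) \<cdot>
          swap ?A ?B (?A \<otimes>\<^sub>o ?B) \<cdot> (\<i> ?A \<otimes>\<^sub>a swap ?A ?B ?B) \<cdot> (dup ?A ?d (?B \<otimes>\<^sub>o ?B) \<cdot> (\<i> ?A \<otimes>\<^sub>a ?d')))) \<cdot>
        dup ?A ?d ?B"
      using C D by simp
    also have "dup ?A ?d (?B \<otimes>\<^sub>o ?B) \<cdot> (\<i> ?A \<otimes>\<^sub>a ?d') = (\<i> ?A \<otimes>\<^sub>a (\<i> ?A \<otimes>\<^sub>a ?d')) \<cdot> dup ?A ?d ?B"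
      using C D by (simp add: dup_nat)
    also have "(\<i> ?B \<otimes>\<^sub>a (\<i> ?A \<otimes>\<^sub>a (swap ?A ?B ?B \<cdot> (\<i> ?A \<otimes>\<^sub>a ?d')))) \<cdot>
          swap ?A ?B (?A \<otimes>\<^sub>o ?B) \<cdot> (\<i> ?A \<otimes>\<^sub>a swap ?A ?B ?B) \<cdot> (\<i> ?A \<otimes>\<^sub>a (\<i> ?A \<otimes>\<^sub>a ?d')) \<cdot> dup ?A ?d ?B
      = swap ?A ?B (?B \<otimes>\<^sub>o ?T) \<cdot> (\<i> ?A \<otimes>\<^sub>a (\<i> ?B \<otimes>\<^sub>a swap ?A ?B ?B)) \<cdot>
          (\<i> ?A \<otimes>\<^sub>a ((\<i> ?B \<otimes>\<^sub>a (\<i> ?A \<otimes>\<^sub>a ?d')) \<cdot> swap ?A ?B ?B)) \<cdot>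
          (\<i> ?A \<otimes>\<^sub>a (\<i> ?A \<otimes>\<^sub>a ?d')) \<cdot> dup ?A ?d ?B"
      using C D by (simp add: swap_push[THEN reassoc])
    also have "(\<i> ?B \<otimes>\<^sub>a (\<i> ?A \<otimes>\<^sub>a ?d')) \<cdot> swap ?A ?B ?B
      = swap ?A ?B (?B \<otimes>\<^sub>o ?B) \<cdot> (\<i> ?A \<otimes>\<^sub>a (\<i> ?B \<otimes>\<^sub>a ?d'))"
      using C D by (simp add: swap_push)
    finally have R: "?J \<cdot> ((\<i> ?T \<otimes>\<^sub>a ?\<Delta>) \<cdot> ?\<Delta>)
      = (\<i> ?A \<otimes>\<^sub>a (swap ?A ?B (?B \<otimes>\<^sub>o ?T) \<cdot> (\<i> ?A \<otimes>\<^sub>a (\<i> ?B \<otimes>\<^sub>a swap ?A ?B ?B)) \<cdot>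
          (\<i> ?A \<otimes>\<^sub>a (swap ?A ?B (?B \<otimes>\<^sub>o ?B) \<cdot> (\<i> ?A \<otimes>\<^sub>a (\<i> ?B \<otimes>\<^sub>a ?d')))) \<cdot>
          (\<i> ?A \<otimes>\<^sub>a (\<i> ?A \<otimes>\<^sub>a ?d')) \<cdot> dup ?A ?d ?B)) \<cdot> dup ?A ?d ?B" .
    show "?J \<cdot> (\<a> ?T ?T ?T \<cdot> (?\<Delta> \<otimes>\<^sub>a \<i> ?T) \<cdot> ?\<Delta>) = ?J \<cdot> ((\<i> ?T \<otimes>\<^sub>a ?\<Delta>) \<cdot> ?\<Delta>)"
      unfolding L R using C D by simp
  qed (use C D in auto)
  show ?thesis
    unfolding coc_def is_comonoid_def cocommutative_def
    using C D cocomm counit counit' coassoc by simp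
qed

lemma unit_coc [simp]: "coc unit_comonoid"
proof -
  \<comment> \<open>Since \<open>\<l> \<I>\<close> is monic and equals \<open>\<r> \<I>\<close>, the
    law \<open>lunit_sym\<close> forces the symmetry of the unit with itself to be trivial.\<close>
  have sym: "\<s> \<I> \<I> = \<i> (\<I> \<otimes>\<^sub>o \<I>)"
    using lunit_sym[of \<I>] by - (rule monic_cancel[OF iso_monic[OF lunit_iso[of \<I>]]], simp_all add: lunit_eq_runit)
  have a: "\<a> \<I> \<I> \<I> \<cdot> (\<l>\<^sup>- \<I> \<otimes>\<^sub>a \<i> \<I>) = \<i> \<I> \<otimes>\<^sub>a \<l>\<^sup>- \<I>"
  proof -
    have "\<a> \<I> \<I> \<I> \<cdot> (\<l>\<^sup>- \<I> \<otimes>\<^sub>a \<i> \<I>)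
      = (\<i> \<I> \<otimes>\<^sub>a \<l>\<^sup>- \<I>) \<cdot> ((\<i> \<I> \<otimes>\<^sub>a \<l> \<I>) \<cdot> \<a> \<I> \<I> \<I>) \<cdot> (\<l>\<^sup>- \<I> \<otimes>\<^sub>a \<i> \<I>)"
      by simp
    also have "\<dots> = \<i> \<I> \<otimes>\<^sub>a \<l>\<^sup>- \<I>"
      by (simp add: triangle lunit_eq_runit[symmetric])
    finally show ?thesis .
  qed
  show ?thesis
    using a reassoc[OF a, of "\<l>\<^sup>- \<I>"] lunit_eq_runit sym
    by (simp add: coc_def is_comonoid_def cocommutative_def)
qed

lemma chomD:
  assumes "chom C D f"
  shows "f \<in> Ar M" "Dom M f = co_obj C" "Cod M f = co_obj D"
    "co_comult D \<cdot> f = (f \<otimes>\<^sub>a f) \<cdot> co_comult C" "co_counit D \<cdot> f = co_counit C"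
  using assms by (simp_all add: chom_def comonoid_hom_def)

lemma chomI:
  assumes "f \<in> Ar M" "Dom M f = co_obj C" "Cod M f = co_obj D"
    "co_comult D \<cdot> f = (f \<otimes>\<^sub>a f) \<cdot> co_comult C" "co_counit D \<cdot> f = co_counit C"
  shows "chom C D f"
  using assms by (simp add: chom_def comonoid_hom_def)

lemma chom_ide: "coc C \<Longrightarrow> chom C C (\<i> (co_obj C))"
  by (rule chomI) simp_all

lemma chom_comp:
  assumes "chom C D f" "chom D E g" "coc C" "coc D" "coc E"
  shows "chom C E (g \<cdot> f)"
proof (rule chomI)
  note f = chomD[OF assms(1)] and g = chomD[OF assms(2)]
  have "co_comult E \<cdot> (g \<cdot> f) = (g \<otimes>\<^sub>a g) \<cdot> (co_comult D \<cdot> f)"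
    using g(4)[THEN reassoc, of f] f(1-3) g(1-3) assms by simp
  also have "\<dots> = ((g \<otimes>\<^sub>a g) \<cdot> (f \<otimes>\<^sub>a f)) \<cdot> co_comult C"
    unfolding f(4) using f(1-3) g(1-3) assms by simp
  finally show "co_comult E \<cdot> (g \<cdot> f) = ((g \<cdot> f) \<otimes>\<^sub>a (g \<cdot> f)) \<cdot> co_comult C"
    using f(1-3) g(1-3) by (simp add: tensor_comp_tensor)
  show "co_counit E \<cdot> (g \<cdot> f) = co_counit C"
    using g(5)[THEN reassoc, of f] f(1-3,5) g(1-3) assms by simp
qed (use chomD[OF assms(1)] chomD[OF assms(2)] in simp_all)

text \<open>This serves for the shear map of a Hopf monoid, whose inverse involves the antipode and
  is not visibly a comonoid morphism.\<close>

lemma chom_inverse: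
  assumes f: "chom C D f" and C: "coc C" and D: "coc D"
    and g: "g \<in> Ar M" "Dom M g = co_obj D" "Cod M g = co_obj C"
    and gf: "g \<cdot> f = \<i> (co_obj C)" and fg: "f \<cdot> g = \<i> (co_obj D)"
  shows "chom D C g"
proof (rule chomI)
  note fs = chomD[OF f]
  have "co_comult C \<cdot> g = ((g \<otimes>\<^sub>a g) \<cdot> (f \<otimes>\<^sub>a f)) \<cdot> (co_comult C \<cdot> g)"
    using fs(1-3) g gf C by (simp add: tensor_comp_tensor)
  also have "\<dots> = (g \<otimes>\<^sub>a g) \<cdot> (co_comult D \<cdot> f) \<cdot> g"
    unfolding fs(4) using fs(1-3) g C by simp
  also have "\<dots> = (g \<otimes>\<^sub>a g) \<cdot> co_comult D"
    using fs(1-3) g fg D by simp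
  finally show "co_comult C \<cdot> g = (g \<otimes>\<^sub>a g) \<cdot> co_comult D" .
  have "co_counit C \<cdot> g = (co_counit D \<cdot> f) \<cdot> g"
    by (simp add: fs(5))
  then show "co_counit C \<cdot> g = co_counit D"
    using fs(1-3) g fg D by simp
qed (use g in simp_all)

lemma chom_tensor:
  assumes f: "chom C C' f" and g: "chom D D' g" and coc: "coc C" "coc C'" "coc D" "coc D'"
  shows "chom (C \<boxtimes> D) (C' \<boxtimes> D') (f \<otimes>\<^sub>a g)"
proof (rule chomI)
  note fs = chomD[OF f] and gs = chomD[OF g]
  have "co_comult (C' \<boxtimes> D') \<cdot> (f \<otimes>\<^sub>a g)
    = interchange M (co_obj C') (co_obj C') (co_obj D') (co_obj D') \<cdot>
      ((co_comult C' \<cdot> f) \<otimes>\<^sub>a (co_comult D' \<cdot> g))"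
    using fs(1-3) gs(1-3) coc by (simp add: tensor_comult tensor_comp_tensor)
  also have "\<dots> = (interchange M (co_obj C') (co_obj C') (co_obj D') (co_obj D') \<cdot>
      ((f \<otimes>\<^sub>a f) \<otimes>\<^sub>a (g \<otimes>\<^sub>a g))) \<cdot> (co_comult C \<otimes>\<^sub>a co_comult D)"
    unfolding fs(4) gs(4) using fs(1-3) gs(1-3) coc by (simp add: tensor_comp_tensor[symmetric])
  also have "\<dots> = ((f \<otimes>\<^sub>a g) \<otimes>\<^sub>a (f \<otimes>\<^sub>a g)) \<cdot> co_comult (C \<boxtimes> D)"
    using fs(1-3) gs(1-3) coc by (simp add: tensor_comult interchange_nat)
  finally show "co_comult (C' \<boxtimes> D') \<cdot> (f \<otimes>\<^sub>a g) = ((f \<otimes>\<^sub>a g) \<otimes>\<^sub>a (f \<otimes>\<^sub>a g)) \<cdot> co_comult (C \<boxtimes> D)" .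
  show "co_counit (C' \<boxtimes> D') \<cdot> (f \<otimes>\<^sub>a g) = co_counit (C \<boxtimes> D)"
    using fs gs coc by (simp add: tensor_counit tensor_comp_tensor)
qed (use chomD[OF f] chomD[OF g] coc in simp_all)

text \<open>Composing the left counit law with the counit gives the claim up to
  \<open>\<l> \<I>\<close>. Together with the next lemma this makes the unit comonoid
  terminal.\<close>

lemma chom_counit:
  assumes "coc C"
  shows "chom C unit_comonoid (co_counit C)"
proof (rule chomI)
  let ?e = "co_counit C" and ?d = "co_comult C" and ?A = "co_obj C"
  have "\<l> \<I> \<cdot> (?e \<otimes>\<^sub>a ?e) \<cdot> ?d = ?e \<cdot> (del ?e ?A \<cdot> ?d)"
  proof -
    have "?e \<otimes>\<^sub>a ?e = (\<i> \<I> \<otimes>\<^sub>a ?e) \<cdot> (?e \<otimes>\<^sub>a \<i> ?A)"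
      using assms by (simp add: tensor_comp_tensor)
    then show ?thesis
      using assms by (simp add: del_def naturality)
  qed
  then have "\<l> \<I> \<cdot> (?e \<otimes>\<^sub>a ?e) \<cdot> ?d = ?e"
    using assms by (simp add: coc_laws)
  then have "\<l>\<^sup>- \<I> \<cdot> ?e = \<l>\<^sup>- \<I> \<cdot> (\<l> \<I> \<cdot> (?e \<otimes>\<^sub>a ?e) \<cdot> ?d)"
    by simp
  then show "co_comult unit_comonoid \<cdot> ?e = (?e \<otimes>\<^sub>a ?e) \<cdot> ?d"
    using assms by simp
qed (use assms in simp_all)

lemma chom_unit_unique: "\<lbrakk>chom C unit_comonoid f; coc C\<rbrakk> \<Longrightarrow> f = co_counit C"
  using chomD[of C unit_comonoid f] by simp

text \<open>The product projections are built from counits and unitors, so the unitors have to be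
  comonoid morphisms.\<close>

lemma chom_lunit:
  assumes "coc C"
  shows "chom (unit_comonoid \<boxtimes> C) C (\<l> (co_obj C))"
proof (rule chomI)
  let ?d = "co_comult C" and ?A = "co_obj C" and ?\<Delta> = "co_comult (unit_comonoid \<boxtimes> C)"
  have "(\<l> ?A \<otimes>\<^sub>a \<l> ?A) \<cdot> ?\<Delta>
    = (\<i> ?A \<otimes>\<^sub>a \<l> ?A) \<cdot> (\<l> ?A \<otimes>\<^sub>a \<i> (\<I> \<otimes>\<^sub>o ?A)) \<cdot> ?\<Delta>"
    using assms reassoc[of "\<i> ?A \<otimes>\<^sub>a \<l> ?A" "\<l> ?A \<otimes>\<^sub>a \<i> (\<I> \<otimes>\<^sub>o ?A)" "\<l> ?A \<otimes>\<^sub>a \<l> ?A" ?\<Delta>]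
    by (simp add: tensor_comp_tensor)
  also have "\<dots> = (\<i> ?A \<otimes>\<^sub>a \<l> ?A) \<cdot> \<l> (?A \<otimes>\<^sub>o (\<I> \<otimes>\<^sub>o ?A)) \<cdot> (\<a> \<I> ?A (\<I> \<otimes>\<^sub>o ?A) \<cdot> ?\<Delta>)"
    using assms lunit_tensor[THEN reassoc, of ?A "\<I> \<otimes>\<^sub>o ?A" ?\<Delta>] by simp
  also have "\<dots> = ((\<i> ?A \<otimes>\<^sub>a del (\<i> \<I>) ?A) \<cdot> swap \<I> ?A ?A) \<cdot> \<l> (\<I> \<otimes>\<^sub>o (?A \<otimes>\<^sub>o ?A)) \<cdot>
      (\<i> \<I> \<otimes>\<^sub>a (\<i> \<I> \<otimes>\<^sub>a ?d)) \<cdot> dup \<I> (\<l>\<^sup>- \<I>) ?A"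
    using assms tensor_comult_nested[OF unit_coc assms] by (simp add: naturality del_def)
  also have "\<dots> = \<l> (?A \<otimes>\<^sub>o ?A) \<cdot> (\<i> \<I> \<otimes>\<^sub>a ?d) \<cdot> (\<l> (\<I> \<otimes>\<^sub>o ?A) \<cdot> dup \<I> (\<l>\<^sup>- \<I>) ?A)"
    using assms by (simp add: whiskered_del_swap naturality) (simp add: del_def naturality)
  also have "\<l> (\<I> \<otimes>\<^sub>o ?A) \<cdot> dup \<I> (\<l>\<^sup>- \<I>) ?A = \<i> (\<I> \<otimes>\<^sub>o ?A)"
    using assms lunit_tensor[THEN reassoc, of \<I> ?A "\<l>\<^sup>- \<I> \<otimes>\<^sub>a \<i> ?A"] by (simp add: dup_def)
  finally show "?d \<cdot> \<l> ?A = (\<l> ?A \<otimes>\<^sub>a \<l> ?A) \<cdot> ?\<Delta>"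
    using assms by (simp add: naturality)
  show "co_counit C \<cdot> \<l> ?A = co_counit (unit_comonoid \<boxtimes> C)"
    using assms by (simp add: tensor_counit naturality)
qed (use assms in simp_all)

lemma chom_runit:
  assumes "coc C"
  shows "chom (C \<boxtimes> unit_comonoid) C (\<r> (co_obj C))"
proof (rule chomI)
  let ?d = "co_comult C" and ?A = "co_obj C" and ?\<Delta> = "co_comult (C \<boxtimes> unit_comonoid)"
  have "(\<r> ?A \<otimes>\<^sub>a \<r> ?A) \<cdot> ?\<Delta>
    = (\<i> ?A \<otimes>\<^sub>a \<r> ?A) \<cdot> (\<r> ?A \<otimes>\<^sub>a \<i> (?A \<otimes>\<^sub>o \<I>)) \<cdot> ?\<Delta>"
    using assms reassoc[of "\<i> ?A \<otimes>\<^sub>a \<r> ?A" "\<r> ?A \<otimes>\<^sub>a \<i> (?A \<otimes>\<^sub>o \<I>)" "\<r> ?A \<otimes>\<^sub>a \<r> ?A" ?\<Delta>]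
    by (simp add: tensor_comp_tensor)
  also have "\<dots> = (\<i> ?A \<otimes>\<^sub>a \<r> ?A) \<cdot> (\<i> ?A \<otimes>\<^sub>a \<l> (?A \<otimes>\<^sub>o \<I>)) \<cdot> (\<a> ?A \<I> (?A \<otimes>\<^sub>o \<I>) \<cdot> ?\<Delta>)"
    using assms triangle[THEN reassoc, of ?A "?A \<otimes>\<^sub>o \<I>" ?\<Delta>] by simp
  also have "\<dots> = (\<i> ?A \<otimes>\<^sub>a \<r> ?A) \<cdot> (\<i> ?A \<otimes>\<^sub>a (del (\<i> \<I>) (?A \<otimes>\<^sub>o \<I>) \<cdot> swap ?A \<I> \<I>)) \<cdot>
      (\<i> ?A \<otimes>\<^sub>a (\<i> ?A \<otimes>\<^sub>a \<l>\<^sup>- \<I>)) \<cdot> dup ?A ?d \<I>"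
    using assms tensor_comult_nested[OF assms unit_coc] by (simp add: del_def)
  also have "del (\<i> \<I>) (?A \<otimes>\<^sub>o \<I>) \<cdot> swap ?A \<I> \<I> = \<i> ?A \<otimes>\<^sub>a \<l> \<I>"
    using assms by (simp add: del_swap) (simp add: del_def)
  also have "(\<i> ?A \<otimes>\<^sub>a \<r> ?A) \<cdot> (\<i> ?A \<otimes>\<^sub>a (\<i> ?A \<otimes>\<^sub>a \<l> \<I>)) \<cdot>
      (\<i> ?A \<otimes>\<^sub>a (\<i> ?A \<otimes>\<^sub>a \<l>\<^sup>- \<I>)) \<cdot> dup ?A ?d \<I> = (\<i> ?A \<otimes>\<^sub>a \<r> ?A) \<cdot> dup ?A ?d \<I>"
    using assms whisker_left[OF unit_cancel_whiskered(1), THEN reassoc, of ?A \<I> ?A "dup ?A ?d \<I>"]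
    by simp
  also have "\<dots> = \<r> (?A \<otimes>\<^sub>o ?A) \<cdot> (?d \<otimes>\<^sub>a \<i> \<I>)"
    using assms runit_tensor[THEN reassoc, of ?A ?A "?d \<otimes>\<^sub>a \<i> \<I>"] by (simp add: dup_def)
  finally show "?d \<cdot> \<r> ?A = (\<r> ?A \<otimes>\<^sub>a \<r> ?A) \<cdot> ?\<Delta>"
    using assms by (simp add: naturality)
  show "co_counit C \<cdot> \<r> ?A = co_counit (C \<boxtimes> unit_comonoid)"
    using assms by (simp add: tensor_counit lunit_eq_runit naturality)
qed (use assms in simp_all)

section \<open>The tensor product as categorical product of cocommutative comonoids\<close>

definition pr1 :: "('o, 'm) comonoid \<Rightarrow> ('o, 'm) comonoid \<Rightarrow> 'm" where
  "pr1 C D = \<r> (co_obj C) \<cdot> (\<i> (co_obj C) \<otimes>\<^sub>a co_counit D)"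

definition pr2 :: "('o, 'm) comonoid \<Rightarrow> ('o, 'm) comonoid \<Rightarrow> 'm" where
  "pr2 C D = \<l> (co_obj D) \<cdot> (co_counit C \<otimes>\<^sub>a \<i> (co_obj D))"

definition pair :: "('o, 'm) comonoid \<Rightarrow> 'm \<Rightarrow> 'm \<Rightarrow> 'm" where
  "pair X f g = (f \<otimes>\<^sub>a g) \<cdot> co_comult X"

lemma pr_simps [simp]:
  assumes "coc C" "coc D"
  shows "pr1 C D \<in> Ar M" "Dom M (pr1 C D) = co_obj C \<otimes>\<^sub>o co_obj D" "Cod M (pr1 C D) = co_obj C"
    "pr2 C D \<in> Ar M" "Dom M (pr2 C D) = co_obj C \<otimes>\<^sub>o co_obj D" "Cod M (pr2 C D) = co_obj D"
  using assms by (simp_all add: pr1_def pr2_def)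

lemma pair_simps [simp]:
  assumes "coc X" "f \<in> Ar M" "g \<in> Ar M" "Dom M f = co_obj X" "Dom M g = co_obj X"
  shows "pair X f g \<in> Ar M" "Dom M (pair X f g) = co_obj X"
    "Cod M (pair X f g) = Cod M f \<otimes>\<^sub>o Cod M g"
  using assms by (simp_all add: pair_def)

lemma chom_pr1: "\<lbrakk>coc C; coc D\<rbrakk> \<Longrightarrow> chom (C \<boxtimes> D) C (pr1 C D)"
  unfolding pr1_def
  by (rule chom_comp[OF chom_tensor[OF chom_ide chom_counit] chom_runit]) (simp_all add: tensor_coc)

lemma chom_pr2: "\<lbrakk>coc C; coc D\<rbrakk> \<Longrightarrow> chom (C \<boxtimes> D) D (pr2 C D)"
  unfolding pr2_def
  by (rule chom_comp[OF chom_tensor[OF chom_counit chom_ide] chom_lunit]) (simp_all add: tensor_coc)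

text \<open>Here cocommutativity is decisive: comultiplying \<open>a1 \<otimes> a2\<close> in
  \<open>C \<boxtimes> C\<close> gives the order \<open>a1, a3, a2, a4\<close>, while applying the
  comultiplication to each factor gives \<open>a1, a2, a3, a4\<close>.\<close>

lemma chom_comult:
  assumes "coc C"
  shows "chom C (C \<boxtimes> C) (co_comult C)"
proof (rule chomI)
  let ?d = "co_comult C" and ?A = "co_obj C" and ?\<Delta> = "co_comult (C \<boxtimes> C)"
  have "\<a> ?A ?A (?A \<otimes>\<^sub>o ?A) \<cdot> (?\<Delta> \<cdot> ?d)
    = (\<i> ?A \<otimes>\<^sub>a swap ?A ?A ?A) \<cdot> (\<i> ?A \<otimes>\<^sub>a (\<i> ?A \<otimes>\<^sub>a ?d)) \<cdot> (dup ?A ?d ?A \<cdot> ?d)"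
    using assms tensor_comult_nested[OF assms assms, THEN reassoc, of ?d] by simp
  also have "\<dots> = (\<i> ?A \<otimes>\<^sub>a (swap ?A ?A ?A \<cdot> (\<i> ?A \<otimes>\<^sub>a ?d) \<cdot> ?d)) \<cdot> ?d"
    using assms by (simp add: coc_laws)
  also have "swap ?A ?A ?A \<cdot> (\<i> ?A \<otimes>\<^sub>a ?d) \<cdot> ?d = swap ?A ?A ?A \<cdot> (dup ?A ?d ?A \<cdot> ?d)"
    using assms by (simp add: coc_laws)
  also have "\<dots> = dup ?A ?d ?A \<cdot> ?d"
    by (rule reassoc[OF coc_swap_dup]) (use assms in simp_all)
  also have "\<dots> = (\<i> ?A \<otimes>\<^sub>a ?d) \<cdot> ?d"
    using assms by (simp add: coc_laws)
  also have "(\<i> ?A \<otimes>\<^sub>a ((\<i> ?A \<otimes>\<^sub>a ?d) \<cdot> ?d)) \<cdot> ?d = (\<i> ?A \<otimes>\<^sub>a (\<i> ?A \<otimes>\<^sub>a ?d)) \<cdot> (dup ?A ?d ?A \<cdot> ?d)"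
    using assms by (simp add: coc_laws)
  also have "\<dots> = \<a> ?A ?A (?A \<otimes>\<^sub>o ?A) \<cdot> ((\<i> (?A \<otimes>\<^sub>o ?A) \<otimes>\<^sub>a ?d) \<cdot> (?d \<otimes>\<^sub>a \<i> ?A)) \<cdot> ?d"
    using assms by (simp add: dup_def naturality)
  also have "(\<i> (?A \<otimes>\<^sub>o ?A) \<otimes>\<^sub>a ?d) \<cdot> (?d \<otimes>\<^sub>a \<i> ?A) = ?d \<otimes>\<^sub>a ?d"
    using assms by (simp add: tensor_comp_tensor del: tensor_ide)
  finally have eq: "\<a> ?A ?A (?A \<otimes>\<^sub>o ?A) \<cdot> (?\<Delta> \<cdot> ?d) = \<a> ?A ?A (?A \<otimes>\<^sub>o ?A) \<cdot> ((?d \<otimes>\<^sub>a ?d) \<cdot> ?d)" .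
  show "?\<Delta> \<cdot> ?d = (?d \<otimes>\<^sub>a ?d) \<cdot> ?d"
    by (rule monic_cancel[OF iso_monic[OF assoc_iso] eq]) (use assms in simp_all)
  show "co_counit (C \<boxtimes> C) \<cdot> ?d = co_counit C"
    using assms chomD(4)[OF chom_counit[OF assms]] reassoc[of "\<l> \<I>" "\<l>\<^sup>- \<I>" "\<i> \<I>" "co_counit C"]
    by (simp add: tensor_counit flip: chomD(4)[OF chom_counit[OF assms], simplified])
qed (use assms in simp_all)

lemma chom_pair:
  assumes "chom X C f" "chom X D g" "coc X" "coc C" "coc D"
  shows "chom X (C \<boxtimes> D) (pair X f g)"
  unfolding pair_def
  by (rule chom_comp[OF chom_comult chom_tensor[OF assms(1,2)]]) (use assms in \<open>simp_all add: tensor_coc\<close>)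

text \<open>The discarded component \<open>g\<close> preserves the counit and disappears by the
  counit law; the retained component \<open>f\<close> passes through naturality of
  \<open>\<r>\<close>.\<close>

lemma pr1_pair:
  assumes X: "coc X" and C: "coc C" and D: "coc D"
    and f: "f \<in> Ar M" "Dom M f = co_obj X" "Cod M f = co_obj C" and g: "chom X D g"
  shows "pr1 C D \<cdot> pair X f g = f"
proof -
  note gs = chomD[OF g]
  have "(\<i> (co_obj C) \<otimes>\<^sub>a co_counit D) \<cdot> (f \<otimes>\<^sub>a g) = (f \<otimes>\<^sub>a \<i> \<I>) \<cdot> (\<i> (co_obj X) \<otimes>\<^sub>a co_counit X)"
    using assms gs by (simp add: tensor_comp_tensor)
  then have "pr1 C D \<cdot> pair X f g
    = (\<r> (co_obj C) \<cdot> (f \<otimes>\<^sub>a \<i> \<I>)) \<cdot> (\<i> (co_obj X) \<otimes>\<^sub>a co_counit X) \<cdot> co_comult X"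
    using assms gs(1-3) reassoc[of "\<i> (co_obj C) \<otimes>\<^sub>a co_counit D" "f \<otimes>\<^sub>a g"]
    by (simp add: pr1_def pair_def)
  also have "\<dots> = f \<cdot> (\<r> (co_obj X) \<cdot> (\<i> (co_obj X) \<otimes>\<^sub>a co_counit X) \<cdot> co_comult X)"
    using assms by (simp add: naturality)
  finally show ?thesis
    using assms by (simp add: coc_laws)
qed

lemma pr2_pair:
  assumes X: "coc X" and C: "coc C" and D: "coc D"
    and g: "g \<in> Ar M" "Dom M g = co_obj X" "Cod M g = co_obj D" and f: "chom X C f"
  shows "pr2 C D \<cdot> pair X f g = g"
proof -
  note fs = chomD[OF f]
  have "(co_counit C \<otimes>\<^sub>a \<i> (co_obj D)) \<cdot> (f \<otimes>\<^sub>a g) = (\<i> \<I> \<otimes>\<^sub>a g) \<cdot> (co_counit X \<otimes>\<^sub>a \<i> (co_obj X))"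
    using assms fs by (simp add: tensor_comp_tensor)
  then have "pr2 C D \<cdot> pair X f g
    = (\<l> (co_obj D) \<cdot> (\<i> \<I> \<otimes>\<^sub>a g)) \<cdot> (co_counit X \<otimes>\<^sub>a \<i> (co_obj X)) \<cdot> co_comult X"
    using assms fs(1-3) reassoc[of "co_counit C \<otimes>\<^sub>a \<i> (co_obj D)" "f \<otimes>\<^sub>a g"]
    by (simp add: pr2_def pair_def)
  also have "\<dots> = g \<cdot> (del (co_counit X) (co_obj X) \<cdot> co_comult X)"
    using assms by (simp add: naturality del_def)
  finally show ?thesis
    using assms by (simp add: coc_laws)
qed

lemma pr1_whiskered:
  assumes C: "coc C" and D: "coc D" and Z: "Z \<in> Ob M"
  shows "pr1 C D \<otimes>\<^sub>a \<i> Z = (\<i> (co_obj C) \<otimes>\<^sub>a del (co_counit D) Z) \<cdot> \<a> (co_obj C) (co_obj D) Z"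
proof -
  have "pr1 C D \<otimes>\<^sub>a \<i> Z = (\<r> (co_obj C) \<otimes>\<^sub>a \<i> Z) \<cdot> ((\<i> (co_obj C) \<otimes>\<^sub>a co_counit D) \<otimes>\<^sub>a \<i> Z)"
    using assms by (simp add: pr1_def)
  then show ?thesis
    using assms by (simp add: triangle[symmetric] del_def naturality)
qed

text \<open>On elements \<open>a \<otimes> b \<mapsto> a1 \<otimes> a2 \<otimes> b\<close>: the
  first copy of \<open>b\<close> is erased by its counit. Pairings that begin with
  \<open>pr1\<close> are computed through this.\<close>

lemma pr1_comult:
  assumes C: "coc C" and D: "coc D"
  shows "(pr1 C D \<otimes>\<^sub>a \<i> (co_obj C \<otimes>\<^sub>o co_obj D)) \<cdot> co_comult (C \<boxtimes> D)
    = dup (co_obj C) (co_comult C) (co_obj D)"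
proof -
  let ?A = "co_obj C" and ?B = "co_obj D"
  have "(pr1 C D \<otimes>\<^sub>a \<i> (?A \<otimes>\<^sub>o ?B)) \<cdot> co_comult (C \<boxtimes> D)
    = (\<i> ?A \<otimes>\<^sub>a (del (co_counit D) (?A \<otimes>\<^sub>o ?B) \<cdot> swap ?A ?B ?B \<cdot> (\<i> ?A \<otimes>\<^sub>a co_comult D))) \<cdot>
      dup ?A (co_comult C) ?B"
    using assms by (simp add: pr1_whiskered tensor_comult_nested)
  also have "del (co_counit D) (?A \<otimes>\<^sub>o ?B) \<cdot> swap ?A ?B ?B \<cdot> (\<i> ?A \<otimes>\<^sub>a co_comult D)
    = \<i> ?A \<otimes>\<^sub>a (del (co_counit D) ?B \<cdot> co_comult D)"
    using assms by (simp add: del_swap[THEN reassoc])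
  finally show ?thesis
    using assms by (simp add: coc_laws)
qed

lemma pair_pr:
  assumes C: "coc C" and D: "coc D"
  shows "pair (C \<boxtimes> D) (pr1 C D) (pr2 C D) = \<i> (co_obj C \<otimes>\<^sub>o co_obj D)"
proof -
  let ?A = "co_obj C" and ?B = "co_obj D"
  have "pr1 C D \<otimes>\<^sub>a pr2 C D = (\<i> ?A \<otimes>\<^sub>a pr2 C D) \<cdot> (pr1 C D \<otimes>\<^sub>a \<i> (?A \<otimes>\<^sub>o ?B))"
    using assms by (simp add: tensor_comp_tensor)
  then have "pair (C \<boxtimes> D) (pr1 C D) (pr2 C D) = (\<i> ?A \<otimes>\<^sub>a pr2 C D) \<cdot> dup ?A (co_comult C) ?B"
    using assms pr1_comult[OF assms] by (simp add: pair_def)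
  then show ?thesis
    using assms coc_laws(6)[OF C, of ?B] by (simp add: pr2_def del_def)
qed

lemma pair_comp:
  assumes "chom Y X h" "coc Y" "coc X" "f \<in> Ar M" "g \<in> Ar M" "Dom M f = co_obj X" "Dom M g = co_obj X"
  shows "pair X f g \<cdot> h = pair Y (f \<cdot> h) (g \<cdot> h)"
proof -
  note h = chomD[OF assms(1)]
  have "pair X f g \<cdot> h = (f \<otimes>\<^sub>a g) \<cdot> (co_comult X \<cdot> h)"
    using assms h(1-3) by (simp add: pair_def)
  then show ?thesis
    unfolding h(4) using assms(2-) h(1-3) reassoc[of "f \<otimes>\<^sub>a g" "h \<otimes>\<^sub>a h" _ "co_comult Y"]
    by (simp add: pair_def tensor_comp_tensor)
qed

lemma tensor_pair:
  assumes "coc X" "f \<in> Ar M" "g \<in> Ar M" "Dom M f = co_obj X" "Dom M g = co_obj X"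
    "h \<in> Ar M" "k \<in> Ar M" "Dom M h = Cod M f" "Dom M k = Cod M g"
  shows "(h \<otimes>\<^sub>a k) \<cdot> pair X f g = pair X (h \<cdot> f) (k \<cdot> g)"
  using assms reassoc[of "h \<otimes>\<^sub>a k" "f \<otimes>\<^sub>a g" _ "co_comult X"] by (simp add: pair_def tensor_comp_tensor)

lemma pair_eta:
  assumes "chom X (C \<boxtimes> D) h" "coc X" "coc C" "coc D"
  shows "pair X (pr1 C D \<cdot> h) (pr2 C D \<cdot> h) = h"
proof -
  note h = chomD[OF assms(1)]
  have "pair X (pr1 C D \<cdot> h) (pr2 C D \<cdot> h) = pair (C \<boxtimes> D) (pr1 C D) (pr2 C D) \<cdot> h"
    using assms by (simp add: pair_comp[OF assms(1)] tensor_coc)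
  then show ?thesis
    using assms h(1-3) by (simp add: pair_pr)
qed

lemma chom_tensor_eqI:
  assumes "chom X (C \<boxtimes> D) h" "chom X (C \<boxtimes> D) k" "coc X" "coc C" "coc D"
    "pr1 C D \<cdot> h = pr1 C D \<cdot> k" "pr2 C D \<cdot> h = pr2 C D \<cdot> k"
  shows "h = k"
  using pair_eta[OF assms(1,3-5)] pair_eta[OF assms(2-5)] unfolding assms(6,7) by (rule subst)

text \<open>Instead of computing with comultiplications, the associator is recognised as the
  canonical pairing of projections, which is a comonoid morphism by the universal property.\<close>

lemma chom_assoc:
  assumes C: "coc C" and D: "coc D" and E: "coc E"
  shows "chom ((C \<boxtimes> D) \<boxtimes> E) (C \<boxtimes> (D \<boxtimes> E)) (\<a> (co_obj C) (co_obj D) (co_obj E))"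
proof -
  let ?A = "co_obj C" and ?B = "co_obj D" and ?Z = "co_obj E" and ?T = "(C \<boxtimes> D) \<boxtimes> E"
  let ?P1 = "pr1 (C \<boxtimes> D) E" and ?P2 = "pr2 (C \<boxtimes> D) E" and ?p1 = "pr1 C D" and ?p2 = "pr2 C D"
  note CD = tensor_coc[OF C D] and DE = tensor_coc[OF D E] and T = tensor_coc[OF tensor_coc[OF C D] E]
  have hom: "chom ?T (C \<boxtimes> (D \<boxtimes> E)) (pair ?T (?p1 \<cdot> ?P1) (pair ?T (?p2 \<cdot> ?P1) ?P2))"
    by (intro chom_pair chom_comp[OF chom_pr1] chom_pr1 chom_pr2 C D E CD DE T)
  have "pair ?T (?p2 \<cdot> ?P1) ?P2 = (?p2 \<otimes>\<^sub>a \<i> ?Z) \<cdot> pair ?T ?P1 ?P2"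
    using C D E CD T by (simp add: tensor_pair)
  also have "\<dots> = ?p2 \<otimes>\<^sub>a \<i> ?Z"
    using C D E CD by (simp add: pair_pr)
  finally have "pair ?T (?p1 \<cdot> ?P1) (pair ?T (?p2 \<cdot> ?P1) ?P2)
    = (((?p1 \<otimes>\<^sub>a (?p2 \<otimes>\<^sub>a \<i> ?Z)) \<cdot> (?P1 \<otimes>\<^sub>a \<i> (co_obj ?T))) \<cdot> co_comult ?T)"
    using C D E CD T by (simp add: pair_def tensor_comp_tensor)
  also have "\<dots> = (?p1 \<otimes>\<^sub>a (?p2 \<otimes>\<^sub>a \<i> ?Z)) \<cdot> dup (?A \<otimes>\<^sub>o ?B) (co_comult (C \<boxtimes> D)) ?Z"
    using C D E CD T pr1_comult[OF CD E] by simp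
  also have "\<dots> = \<a> ?A ?B ?Z \<cdot> (pair (C \<boxtimes> D) ?p1 ?p2 \<otimes>\<^sub>a \<i> ?Z)"
    using C D E CD assoc_nat[THEN reassoc, of ?p1 ?p2 "\<i> ?Z" ?A ?B ?Z] by (simp add: dup_def pair_def)
  also have "\<dots> = \<a> ?A ?B ?Z"
    using C D E by (simp add: pair_pr)
  finally show ?thesis
    using hom by simp
qed

end

section \<open>Cocommutative Hopf monoids\<close>

definition hopf_comonoid :: "('o, 'm) hopf \<Rightarrow> ('o, 'm) comonoid" where
  "hopf_comonoid A = \<lparr>co_obj = h_obj A, co_comult = h_comult A, co_counit = h_counit A\<rparr>"

lemma hopf_comonoid_simps [simp]:
  "co_obj (hopf_comonoid A) = h_obj A" "co_comult (hopf_comonoid A) = h_comult A"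
  "co_counit (hopf_comonoid A) = h_counit A"
  by (simp_all add: hopf_comonoid_def)

section \<open>Cocommutative Hopf monoids as internal groups of comonoids\<close>

context symmetric_monoidal_category
begin

definition chopf :: "('o, 'm) hopf \<Rightarrow> bool" where
  "chopf A \<longleftrightarrow> is_hopf_monoid M A \<and> cocommutative M (h_obj A) (h_comult A)"

text \<open>The bimonoid axioms are regrouped to say that multiplication and unit are comonoid
  morphisms. For the antipode this is a theorem, \<open>chom_antipode\<close>.\<close>

lemma chopf_iff:
  "chopf A \<longleftrightarrow> coc (hopf_comonoid A) \<and> is_monoid M (h_obj A) (h_mult A) (h_unit A) \<and>
    chom (hopf_comonoid A \<boxtimes> hopf_comonoid A) (hopf_comonoid A) (h_mult A) \<and>
    chom unit_comonoid (hopf_comonoid A) (h_unit A) \<and>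
    h_antipode A \<in> Hom M (h_obj A) (h_obj A) \<and>
    h_mult A \<cdot> (h_antipode A \<otimes>\<^sub>a \<i> (h_obj A)) \<cdot> h_comult A = h_unit A \<cdot> h_counit A \<and>
    h_mult A \<cdot> (\<i> (h_obj A) \<otimes>\<^sub>a h_antipode A) \<cdot> h_comult A = h_unit A \<cdot> h_counit A"
  unfolding chopf_def is_hopf_monoid_def is_bimonoid_def coc_def chom_def comonoid_hom_def is_monoid_def
  by (auto simp: tensor_comult tensor_counit)

lemma chopfD:
  assumes "chopf A"
  shows "coc (hopf_comonoid A)" "chom (hopf_comonoid A \<boxtimes> hopf_comonoid A) (hopf_comonoid A) (h_mult A)"
    "chom unit_comonoid (hopf_comonoid A) (h_unit A)"
    "h_mult A \<cdot> (h_mult A \<otimes>\<^sub>a \<i> (h_obj A)) = h_mult A \<cdot> (\<i> (h_obj A) \<otimes>\<^sub>a h_mult A) \<cdot> \<a> (h_obj A) (h_obj A) (h_obj A)"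
    "h_mult A \<cdot> (h_unit A \<otimes>\<^sub>a \<i> (h_obj A)) = \<l> (h_obj A)"
    "h_mult A \<cdot> (\<i> (h_obj A) \<otimes>\<^sub>a h_unit A) = \<r> (h_obj A)"
    "h_mult A \<cdot> (h_antipode A \<otimes>\<^sub>a \<i> (h_obj A)) \<cdot> h_comult A = h_unit A \<cdot> h_counit A"
    "h_mult A \<cdot> (\<i> (h_obj A) \<otimes>\<^sub>a h_antipode A) \<cdot> h_comult A = h_unit A \<cdot> h_counit A"
  using assms by (simp_all add: chopf_iff is_monoid_def)

lemma chopf_simps [simp]:
  assumes "chopf A"
  shows "h_obj A \<in> Ob M"
    "h_mult A \<in> Ar M" "Dom M (h_mult A) = h_obj A \<otimes>\<^sub>o h_obj A" "Cod M (h_mult A) = h_obj A"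
    "h_unit A \<in> Ar M" "Dom M (h_unit A) = \<I>" "Cod M (h_unit A) = h_obj A"
    "h_comult A \<in> Ar M" "Dom M (h_comult A) = h_obj A" "Cod M (h_comult A) = h_obj A \<otimes>\<^sub>o h_obj A"
    "h_counit A \<in> Ar M" "Dom M (h_counit A) = h_obj A" "Cod M (h_counit A) = \<I>"
    "h_antipode A \<in> Ar M" "Dom M (h_antipode A) = h_obj A" "Cod M (h_antipode A) = h_obj A"
  using assms coc_simps[OF chopfD(1)[OF assms]] chomD(1-3)[OF chopfD(2)[OF assms]]
    chomD(1-3)[OF chopfD(3)[OF assms]]
  by (simp_all add: chopf_iff)

lemma hopf_homD:
  assumes "hopf_hom M A B f"
  shows "chom (hopf_comonoid A) (hopf_comonoid B) f" "f \<in> Ar M" "Dom M f = h_obj A" "Cod M f = h_obj B"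
    "f \<cdot> h_mult A = h_mult B \<cdot> (f \<otimes>\<^sub>a f)" "f \<cdot> h_unit A = h_unit B"
    "h_comult B \<cdot> f = (f \<otimes>\<^sub>a f) \<cdot> h_comult A" "h_counit B \<cdot> f = h_counit A"
  using assms by (simp_all add: hopf_hom_def chom_def monoid_hom_def comonoid_hom_def)

lemma hopf_homI:
  assumes "chom (hopf_comonoid A) (hopf_comonoid B) f" "f \<cdot> h_mult A = h_mult B \<cdot> (f \<otimes>\<^sub>a f)"
    "f \<cdot> h_unit A = h_unit B"
  shows "hopf_hom M A B f"
  using assms by (simp add: hopf_hom_def chom_def monoid_hom_def comonoid_hom_def)

lemma hopf_hom_comp:
  assumes "hopf_hom M A B f" "hopf_hom M B C g" "chopf A" "chopf B" "chopf C"
  shows "hopf_hom M A C (g \<cdot> f)"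
proof (rule hopf_homI)
  note f = hopf_homD[OF assms(1)] and g = hopf_homD[OF assms(2)]
  show "chom (hopf_comonoid A) (hopf_comonoid C) (g \<cdot> f)"
    using f(1) g(1) assms(3-5) chopfD(1) chom_comp by blast
  have "(g \<cdot> f) \<cdot> h_mult A = (g \<cdot> h_mult B) \<cdot> (f \<otimes>\<^sub>a f)"
    using f(2-5) g(2-4) assms(3-5) by simp
  then show "(g \<cdot> f) \<cdot> h_mult A = h_mult C \<cdot> ((g \<cdot> f) \<otimes>\<^sub>a (g \<cdot> f))"
    unfolding g(5) using f(2-4) g(2-4) assms(3-5) by (simp add: tensor_comp_tensor)
  show "(g \<cdot> f) \<cdot> h_unit A = h_unit C"
    using f(2-4,6) g(2-4,6) assms(3-5) by simp
qed

lemma hopf_hom_ide: "chopf A \<Longrightarrow> hopf_hom M A A (\<i> (h_obj A))"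
  using chom_ide[OF chopfD(1), of A] by (intro hopf_homI) simp_all

section \<open>Convolution, the shear map and the antipode\<close>

definition convolution :: "('o, 'm) comonoid \<Rightarrow> ('o, 'm) hopf \<Rightarrow> 'm \<Rightarrow> 'm \<Rightarrow> 'm" where
  "convolution C A f g = h_mult A \<cdot> (f \<otimes>\<^sub>a g) \<cdot> co_comult C"

lemma convolution_assoc:
  assumes C: "coc C" and A: "chopf A"
    and f: "f \<in> Hom M (co_obj C) (h_obj A)" and g: "g \<in> Hom M (co_obj C) (h_obj A)"
    and h: "h \<in> Hom M (co_obj C) (h_obj A)"
  shows "convolution C A (convolution C A f g) h = convolution C A f (convolution C A g h)"
proof -
  let ?m = "h_mult A" and ?d = "co_comult C" and ?A = "h_obj A" and ?C = "co_obj C"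
  have "(?m \<cdot> (f \<otimes>\<^sub>a g) \<cdot> ?d) \<otimes>\<^sub>a h = (?m \<otimes>\<^sub>a \<i> ?A) \<cdot> ((f \<otimes>\<^sub>a g) \<otimes>\<^sub>a h) \<cdot> (?d \<otimes>\<^sub>a \<i> ?C)"
    using C A f g h by (simp add: tensor_comp_tensor)
  then have "convolution C A (convolution C A f g) h
    = (?m \<cdot> (?m \<otimes>\<^sub>a \<i> ?A)) \<cdot> ((f \<otimes>\<^sub>a g) \<otimes>\<^sub>a h) \<cdot> (?d \<otimes>\<^sub>a \<i> ?C) \<cdot> ?d"
    using C A f g h by (simp add: convolution_def)
  also have "\<dots> = ?m \<cdot> (\<i> ?A \<otimes>\<^sub>a ?m) \<cdot> (f \<otimes>\<^sub>a (g \<otimes>\<^sub>a h)) \<cdot> (dup ?C ?d ?C \<cdot> ?d)"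
    using C A f g h assoc_nat[THEN reassoc, of f g h ?A ?A ?A] by (simp add: chopfD(4) dup_def)
  also have "\<dots> = ?m \<cdot> ((\<i> ?A \<otimes>\<^sub>a ?m) \<cdot> (f \<otimes>\<^sub>a (g \<otimes>\<^sub>a h)) \<cdot> (\<i> ?C \<otimes>\<^sub>a ?d)) \<cdot> ?d"
    unfolding coc_laws(1)[OF C] using C A f g h by simp
  also have "(\<i> ?A \<otimes>\<^sub>a ?m) \<cdot> (f \<otimes>\<^sub>a (g \<otimes>\<^sub>a h)) \<cdot> (\<i> ?C \<otimes>\<^sub>a ?d) = f \<otimes>\<^sub>a (?m \<cdot> (g \<otimes>\<^sub>a h) \<cdot> ?d)"
    using C A f g h by (simp add: tensor_comp_tensor)
  finally show ?thesis
    by (simp add: convolution_def)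
qed

lemma convolution_unit_left:
  assumes C: "coc C" and A: "chopf A" and f: "f \<in> Hom M (co_obj C) (h_obj A)"
  shows "convolution C A (h_unit A \<cdot> co_counit C) f = f"
proof -
  have "(h_unit A \<cdot> co_counit C) \<otimes>\<^sub>a f = (h_unit A \<otimes>\<^sub>a \<i> (h_obj A)) \<cdot> (\<i> \<I> \<otimes>\<^sub>a f) \<cdot> (co_counit C \<otimes>\<^sub>a \<i> (co_obj C))"
    using assms by (simp add: tensor_comp_tensor)
  then have "convolution C A (h_unit A \<cdot> co_counit C) f
    = (h_mult A \<cdot> (h_unit A \<otimes>\<^sub>a \<i> (h_obj A))) \<cdot> (\<i> \<I> \<otimes>\<^sub>a f) \<cdot> (co_counit C \<otimes>\<^sub>a \<i> (co_obj C)) \<cdot> co_comult C"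
    using assms by (simp add: convolution_def)
  also have "\<dots> = f \<cdot> (del (co_counit C) (co_obj C) \<cdot> co_comult C)"
    using assms by (simp add: chopfD(5) naturality del_def)
  finally show ?thesis
    using assms by (simp add: coc_laws)
qed

lemma convolution_unit_right:
  assumes C: "coc C" and A: "chopf A" and f: "f \<in> Hom M (co_obj C) (h_obj A)"
  shows "convolution C A f (h_unit A \<cdot> co_counit C) = f"
proof -
  have "f \<otimes>\<^sub>a (h_unit A \<cdot> co_counit C) = (\<i> (h_obj A) \<otimes>\<^sub>a h_unit A) \<cdot> (f \<otimes>\<^sub>a \<i> \<I>) \<cdot> (\<i> (co_obj C) \<otimes>\<^sub>a co_counit C)"
    using assms by (simp add: tensor_comp_tensor)
  then have "convolution C A f (h_unit A \<cdot> co_counit C)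
    = (h_mult A \<cdot> (\<i> (h_obj A) \<otimes>\<^sub>a h_unit A)) \<cdot> (f \<otimes>\<^sub>a \<i> \<I>) \<cdot> (\<i> (co_obj C) \<otimes>\<^sub>a co_counit C) \<cdot> co_comult C"
    using assms by (simp add: convolution_def)
  also have "\<dots> = f \<cdot> (\<r> (co_obj C) \<cdot> (\<i> (co_obj C) \<otimes>\<^sub>a co_counit C) \<cdot> co_comult C)"
    using assms by (simp add: chopfD(6) naturality)
  finally show ?thesis
    using assms by (simp add: coc_laws)
qed

text \<open>Both sides are convolution inverses of \<open>f\<close>.\<close>

lemma hopf_hom_antipode:
  assumes f: "hopf_hom M A B f" and A: "chopf A" and B: "chopf B"
  shows "f \<cdot> h_antipode A = h_antipode B \<cdot> f"
proof -
  let ?C = "hopf_comonoid A" and ?S = "h_antipode A" and ?S' = "h_antipode B" and ?d = "h_comult A"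
  note fs = hopf_homD[OF f] and C = chopfD(1)[OF A]
  have "(f \<cdot> ?S) \<otimes>\<^sub>a f = (f \<otimes>\<^sub>a f) \<cdot> (?S \<otimes>\<^sub>a \<i> (h_obj A))"
    using fs A by (simp add: tensor_comp_tensor)
  then have "convolution ?C B (f \<cdot> ?S) f = (h_mult B \<cdot> (f \<otimes>\<^sub>a f)) \<cdot> (?S \<otimes>\<^sub>a \<i> (h_obj A)) \<cdot> ?d"
    using fs A B by (simp add: convolution_def)
  also have "\<dots> = f \<cdot> (h_mult A \<cdot> (?S \<otimes>\<^sub>a \<i> (h_obj A)) \<cdot> ?d)"
    unfolding fs(5)[symmetric] using fs(2-4) A B by simp
  also have "\<dots> = (f \<cdot> h_unit A) \<cdot> h_counit A"
    unfolding chopfD(7)[OF A] using fs(2-4) A by simp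
  finally have left: "convolution ?C B (f \<cdot> ?S) f = h_unit B \<cdot> h_counit A"
    unfolding fs(6) .
  have "f \<otimes>\<^sub>a (?S' \<cdot> f) = (\<i> (h_obj B) \<otimes>\<^sub>a ?S') \<cdot> (f \<otimes>\<^sub>a f)"
    using fs B by (simp add: tensor_comp_tensor)
  then have "convolution ?C B f (?S' \<cdot> f) = (h_mult B \<cdot> (\<i> (h_obj B) \<otimes>\<^sub>a ?S') \<cdot> h_comult B) \<cdot> f"
    using fs A B by (simp add: convolution_def)
  then have right: "convolution ?C B f (?S' \<cdot> f) = h_unit B \<cdot> h_counit A"
    unfolding chopfD(8)[OF B] using fs B by simp
  have "f \<cdot> ?S = convolution ?C B (f \<cdot> ?S) (convolution ?C B f (?S' \<cdot> f))"
    unfolding right using convolution_unit_right[OF C B, of "f \<cdot> ?S"] fs A by simp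
  also have "\<dots> = convolution ?C B (convolution ?C B (f \<cdot> ?S) f) (?S' \<cdot> f)"
    by (rule convolution_assoc[OF C B, symmetric]) (use fs A B in simp_all)
  also have "\<dots> = ?S' \<cdot> f"
    unfolding left using convolution_unit_left[OF C B, of "?S' \<cdot> f"] fs B by simp
  finally show ?thesis .
qed

text \<open>On elements \<open>shear A f\<close> is \<open>a \<otimes> b \<mapsto> a\<^sub>1 \<otimes> f(a\<^sub>2) b\<close>.\<close>

definition shear :: "('o, 'm) hopf \<Rightarrow> 'm \<Rightarrow> 'm" where
  "shear A f = (\<i> (h_obj A) \<otimes>\<^sub>a (h_mult A \<cdot> (f \<otimes>\<^sub>a \<i> (h_obj A)))) \<cdot> dup (h_obj A) (h_comult A) (h_obj A)"

text \<open>Both sides are \<open>a \<otimes> b \<mapsto> a1 \<otimes> f(a2) g(a3) b\<close>. Thus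
  \<open>shear A\<close> carries convolution inverses to inverse arrows, and in particular inverts
  the shear of the identity by the shear of the antipode.\<close>

lemma shear_comp:
  assumes A: "chopf A" and f: "f \<in> Hom M (h_obj A) (h_obj A)" and g: "g \<in> Hom M (h_obj A) (h_obj A)"
  shows "shear A f \<cdot> shear A g = shear A (convolution (hopf_comonoid A) A f g)"
proof -
  let ?A = "h_obj A" and ?m = "h_mult A" and ?d = "h_comult A"
  let ?D = "dup (h_obj A) (h_comult A)"
  note C = chopfD(1)[OF A]
  have "shear A f \<cdot> shear A g
    = (\<i> ?A \<otimes>\<^sub>a (?m \<cdot> (f \<otimes>\<^sub>a \<i> ?A))) \<cdot>
      ((?D ?A \<cdot> (\<i> ?A \<otimes>\<^sub>a (?m \<cdot> (g \<otimes>\<^sub>a \<i> ?A)))) \<cdot> ?D ?A)"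
    using A f g by (simp add: shear_def)
  also have "?D ?A \<cdot> (\<i> ?A \<otimes>\<^sub>a (?m \<cdot> (g \<otimes>\<^sub>a \<i> ?A)))
    = (\<i> ?A \<otimes>\<^sub>a (\<i> ?A \<otimes>\<^sub>a (?m \<cdot> (g \<otimes>\<^sub>a \<i> ?A)))) \<cdot> ?D (?A \<otimes>\<^sub>o ?A)"
    by (subst dup_nat) (use A g in simp_all)
  also have "(\<i> ?A \<otimes>\<^sub>a (?m \<cdot> (f \<otimes>\<^sub>a \<i> ?A))) \<cdot> (((\<i> ?A \<otimes>\<^sub>a (\<i> ?A \<otimes>\<^sub>a (?m \<cdot> (g \<otimes>\<^sub>a \<i> ?A)))) \<cdot> ?D (?A \<otimes>\<^sub>o ?A)) \<cdot> ?D ?A)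
    = (\<i> ?A \<otimes>\<^sub>a (?m \<cdot> ((f \<otimes>\<^sub>a \<i> ?A) \<cdot> (\<i> ?A \<otimes>\<^sub>a (?m \<cdot> (g \<otimes>\<^sub>a \<i> ?A)))) \<cdot> ?D ?A)) \<cdot> ?D ?A"
    using A f g dup_dup[OF coc_comonoid[OF C], of ?A] by simp
  also have "(f \<otimes>\<^sub>a \<i> ?A) \<cdot> (\<i> ?A \<otimes>\<^sub>a (?m \<cdot> (g \<otimes>\<^sub>a \<i> ?A))) = (\<i> ?A \<otimes>\<^sub>a ?m) \<cdot> (f \<otimes>\<^sub>a (g \<otimes>\<^sub>a \<i> ?A))"
    using A f g by (simp add: tensor_comp_tensor del: whisker_left_comp)
  also have "?m \<cdot> ((\<i> ?A \<otimes>\<^sub>a ?m) \<cdot> (f \<otimes>\<^sub>a (g \<otimes>\<^sub>a \<i> ?A))) \<cdot> ?D ?A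
    = (?m \<cdot> (\<i> ?A \<otimes>\<^sub>a ?m) \<cdot> \<a> ?A ?A ?A) \<cdot> ((f \<otimes>\<^sub>a g) \<otimes>\<^sub>a \<i> ?A) \<cdot> (?d \<otimes>\<^sub>a \<i> ?A)"
    using A f g assoc_nat[THEN reassoc, of f g "\<i> ?A" ?A ?A ?A "?d \<otimes>\<^sub>a \<i> ?A"] by (simp add: dup_def)
  also have "\<dots> = ?m \<cdot> (convolution (hopf_comonoid A) A f g \<otimes>\<^sub>a \<i> ?A)"
    unfolding chopfD(4)[OF A, symmetric] using A f g by (simp add: convolution_def)
  finally show ?thesis
    by (simp add: shear_def)
qed

lemma shear_unit:
  assumes A: "chopf A"
  shows "shear A (h_unit A \<cdot> h_counit A) = \<i> (h_obj A \<otimes>\<^sub>o h_obj A)"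
proof -
  have "h_mult A \<cdot> ((h_unit A \<cdot> h_counit A) \<otimes>\<^sub>a \<i> (h_obj A)) = del (h_counit A) (h_obj A)"
    using A chopfD(5)[OF A, THEN reassoc, of "h_counit A \<otimes>\<^sub>a \<i> (h_obj A)"] by (simp add: del_def)
  then show ?thesis
    using A coc_laws(6)[OF chopfD(1)[OF A], of "h_obj A"] by (simp add: shear_def)
qed

text \<open>The shear map \<open>a \<otimes> b \<mapsto> a\<^sub>1 \<otimes> a\<^sub>2 b\<close> is an invertible comonoid morphism, so its inverse
  \<open>a \<otimes> b \<mapsto> a\<^sub>1 \<otimes> S(a\<^sub>2) b\<close> is one as well, and \<open>S\<close> is recovered from the inverse.\<close>

lemma chom_antipode:
  assumes A: "chopf A"
  shows "chom (hopf_comonoid A) (hopf_comonoid A) (h_antipode A)"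
proof -
  let ?C = "hopf_comonoid A" and ?A = "h_obj A" and ?S = "h_antipode A" and ?m = "h_mult A"
  note C = chopfD(1)[OF A] and CC = tensor_coc[OF chopfD(1)[OF A] chopfD(1)[OF A]]
  \<comment> \<open>The shear of the identity is the pairing of the first projection with the
    multiplication, hence a comonoid morphism.\<close>
  have "pr1 ?C ?C \<otimes>\<^sub>a ?m = (\<i> ?A \<otimes>\<^sub>a ?m) \<cdot> (pr1 ?C ?C \<otimes>\<^sub>a \<i> (?A \<otimes>\<^sub>o ?A))"
    using A C by (simp add: tensor_comp_tensor)
  then have "pair (?C \<boxtimes> ?C) (pr1 ?C ?C) ?m = shear A (\<i> ?A)"
    using A C CC pr1_comult[OF C C] by (simp add: pair_def shear_def)
  then have shear: "chom (?C \<boxtimes> ?C) (?C \<boxtimes> ?C) (shear A (\<i> ?A))"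
    using chom_pair[OF chom_pr1[OF C C] chopfD(2)[OF A] CC C C] by simp
  have "chom (?C \<boxtimes> ?C) (?C \<boxtimes> ?C) (shear A ?S)"
  proof (rule chom_inverse[OF shear CC CC])
    show "shear A ?S \<cdot> shear A (\<i> ?A) = \<i> (co_obj (?C \<boxtimes> ?C))"
      using A by (simp add: shear_comp convolution_def chopfD(7) shear_unit)
    show "shear A (\<i> ?A) \<cdot> shear A ?S = \<i> (co_obj (?C \<boxtimes> ?C))"
      using A by (simp add: shear_comp convolution_def chopfD(8) shear_unit)
  qed (use A in \<open>simp_all add: shear_def\<close>)
  then have "chom (?C \<boxtimes> ?C) ?C (pr2 ?C ?C \<cdot> shear A ?S)"
    using chom_comp chom_pr2 C CC by blast
  also have "pr2 ?C ?C \<cdot> shear A ?S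
    = (del (h_counit A) ?A \<cdot> (\<i> ?A \<otimes>\<^sub>a (?m \<cdot> (?S \<otimes>\<^sub>a \<i> ?A)))) \<cdot> dup ?A (h_comult A) ?A"
    using A by (simp add: pr2_def del_def shear_def)
  also have "\<dots> = (?m \<cdot> (?S \<otimes>\<^sub>a \<i> ?A)) \<cdot> (del (h_counit A) (?A \<otimes>\<^sub>o ?A) \<cdot> dup ?A (h_comult A) ?A)"
    using A by (simp add: del_nat del: whisker_left_comp)
  also have "\<dots> = ?m \<cdot> (?S \<otimes>\<^sub>a \<i> ?A)"
    using A coc_laws(5)[OF C, of ?A] by simp
  \<comment> \<open>The map \<open>a \<otimes> b \<mapsto> S(a) b\<close> is evaluated at
    \<open>b = 1\<close>, by pairing the identity with the unit composed with the counit.\<close>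
  finally have "chom ?C ?C ((?m \<cdot> (?S \<otimes>\<^sub>a \<i> ?A)) \<cdot> pair ?C (\<i> ?A) (h_unit A \<cdot> h_counit A))"
    by (rule chom_comp[rotated])
      (use C CC A chom_ide[OF C] chom_counit[OF C] chopfD(3)[OF A] in
        \<open>auto intro!: chom_pair chom_comp[where D = unit_comonoid]\<close>)
  also have "(?m \<cdot> (?S \<otimes>\<^sub>a \<i> ?A)) \<cdot> pair ?C (\<i> ?A) (h_unit A \<cdot> h_counit A)
    = ?m \<cdot> ((?S \<otimes>\<^sub>a \<i> ?A) \<cdot> pair ?C (\<i> ?A) (h_unit A \<cdot> h_counit A))"
    using A C by simp
  also have "\<dots> = convolution ?C A ?S (h_unit A \<cdot> h_counit A)"
    using A C by (subst tensor_pair) (simp_all add: pair_def convolution_def)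
  also have "\<dots> = ?S"
    using convolution_unit_right[OF C A, of ?S] A by simp
  finally show ?thesis .
qed

text \<open>Every Hopf axiom is an equation between comonoid morphisms into \<open>H\<close>, so it
  can be verified after the members of a jointly monic family of structure preserving arrows into
  Hopf monoids. Products use the two projections, subobjects a single monomorphism, the unit object
  no arrow at all.\<close>

lemma chopf_of_jointly_monic:
  assumes H: "coc (hopf_comonoid H)"
    and mult: "chom (hopf_comonoid H \<boxtimes> hopf_comonoid H) (hopf_comonoid H) (h_mult H)"
    and unit: "chom unit_comonoid (hopf_comonoid H) (h_unit H)"
    and antipode: "chom (hopf_comonoid H) (hopf_comonoid H) (h_antipode H)"
    and family: "\<And>f A. (f, A) \<in> F \<Longrightarrow> chopf A \<and> hopf_hom M H A f \<and> f \<cdot> h_antipode H = h_antipode A \<cdot> f"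
    and joint: "\<And>X h k. \<lbrakk>coc X; chom X (hopf_comonoid H) h; chom X (hopf_comonoid H) k;
      \<And>f A. (f, A) \<in> F \<Longrightarrow> f \<cdot> h = f \<cdot> k\<rbrakk> \<Longrightarrow> h = k"
  shows "chopf H"
proof -
  let ?C = "hopf_comonoid H" and ?H = "h_obj H" and ?m = "h_mult H" and ?u = "h_unit H"
  let ?S = "h_antipode H" and ?d = "h_comult H" and ?e = "h_counit H"
  note CC = tensor_coc[OF H H]
  note Hs = coc_simps[OF H, simplified] and ms = chomD(1-3)[OF mult, simplified]
    and us = chomD(1-3)[OF unit, simplified] and Ss = chomD(1-3)[OF antipode, simplified]
  note t = Hs ms us Ss
  note homs = chom_ide[OF H, simplified] mult unit antipode chom_assoc[OF H H H, simplified]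
    chom_comult[OF H, simplified] chom_counit[OF H, simplified] chom_lunit[OF H, simplified]
    chom_runit[OF H, simplified]
  have assoc: "?m \<cdot> (?m \<otimes>\<^sub>a \<i> ?H) = ?m \<cdot> (\<i> ?H \<otimes>\<^sub>a ?m) \<cdot> \<a> ?H ?H ?H"
  proof (rule joint)
    show "coc ((?C \<boxtimes> ?C) \<boxtimes> ?C)"
      by (intro tensor_coc H)
    show "chom ((?C \<boxtimes> ?C) \<boxtimes> ?C) ?C (?m \<cdot> (?m \<otimes>\<^sub>a \<i> ?H))"
      by (rule chom_comp[OF chom_tensor[OF mult homs(1)] mult]) (intro tensor_coc H CC)+
    show "chom ((?C \<boxtimes> ?C) \<boxtimes> ?C) ?C (?m \<cdot> (\<i> ?H \<otimes>\<^sub>a ?m) \<cdot> \<a> ?H ?H ?H)"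
      by (rule chom_comp[OF chom_comp[OF homs(5) chom_tensor[OF homs(1) mult]] mult])
        (intro tensor_coc H CC)+
    fix f A
    assume "(f, A) \<in> F"
    then have A: "chopf A" and f: "hopf_hom M H A f"
      using family by auto
    note fs = hopf_homD[OF f]
    have "f \<cdot> (?m \<cdot> (?m \<otimes>\<^sub>a \<i> ?H)) = (f \<cdot> ?m) \<cdot> (?m \<otimes>\<^sub>a \<i> ?H)"
      using fs(2-4) t by simp
    also have "\<dots> = h_mult A \<cdot> ((f \<cdot> ?m) \<otimes>\<^sub>a f)"
      unfolding fs(5) using fs A t by (simp add: tensor_comp_tensor)
    also have "\<dots> = (h_mult A \<cdot> (h_mult A \<otimes>\<^sub>a \<i> (h_obj A))) \<cdot> ((f \<otimes>\<^sub>a f) \<otimes>\<^sub>a f)"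
      unfolding fs(5) using fs A t by (simp add: tensor_comp_tensor)
    also have "\<dots> = h_mult A \<cdot> ((\<i> (h_obj A) \<otimes>\<^sub>a h_mult A) \<cdot> (f \<otimes>\<^sub>a (f \<otimes>\<^sub>a f))) \<cdot> \<a> ?H ?H ?H"
      unfolding chopfD(4)[OF A] using fs A t by (simp add: naturality)
    also have "(\<i> (h_obj A) \<otimes>\<^sub>a h_mult A) \<cdot> (f \<otimes>\<^sub>a (f \<otimes>\<^sub>a f)) = (f \<otimes>\<^sub>a f) \<cdot> (\<i> ?H \<otimes>\<^sub>a ?m)"
      using fs A t by (simp add: tensor_comp_tensor)
    also have "h_mult A \<cdot> \<dots> \<cdot> \<a> ?H ?H ?H = (f \<cdot> ?m) \<cdot> (\<i> ?H \<otimes>\<^sub>a ?m) \<cdot> \<a> ?H ?H ?H"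
      unfolding fs(5) using fs A t by simp
    finally show "f \<cdot> (?m \<cdot> (?m \<otimes>\<^sub>a \<i> ?H)) = f \<cdot> (?m \<cdot> (\<i> ?H \<otimes>\<^sub>a ?m) \<cdot> \<a> ?H ?H ?H)"
      using fs(2-4) t by simp
  qed
  have unit_left: "?m \<cdot> (?u \<otimes>\<^sub>a \<i> ?H) = \<l> ?H"
  proof (rule joint)
    show "coc (unit_comonoid \<boxtimes> ?C)"
      by (intro tensor_coc H unit_coc)
    show "chom (unit_comonoid \<boxtimes> ?C) ?C (?m \<cdot> (?u \<otimes>\<^sub>a \<i> ?H))"
      by (rule chom_comp[OF chom_tensor[OF unit homs(1)] mult]) (intro tensor_coc H CC unit_coc)+
    fix f A
    assume "(f, A) \<in> F"
    then have A: "chopf A" and f: "hopf_hom M H A f"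
      using family by auto
    note fs = hopf_homD[OF f]
    have "f \<cdot> (?m \<cdot> (?u \<otimes>\<^sub>a \<i> ?H)) = (f \<cdot> ?m) \<cdot> (?u \<otimes>\<^sub>a \<i> ?H)"
      using fs(2-4) t by simp
    also have "\<dots> = h_mult A \<cdot> ((f \<cdot> ?u) \<otimes>\<^sub>a f)"
      unfolding fs(5) using fs(2-4) A t by (simp add: tensor_comp_tensor)
    also have "\<dots> = (h_mult A \<cdot> (h_unit A \<otimes>\<^sub>a \<i> (h_obj A))) \<cdot> (\<i> \<I> \<otimes>\<^sub>a f)"
      unfolding fs(6) using fs(2-4) A t by (simp add: tensor_comp_tensor)
    also have "\<dots> = f \<cdot> \<l> ?H"
      unfolding chopfD(5)[OF A] using fs A t by (simp add: naturality)
    finally show "f \<cdot> (?m \<cdot> (?u \<otimes>\<^sub>a \<i> ?H)) = f \<cdot> \<l> ?H" .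
  qed (rule homs)
  have unit_right: "?m \<cdot> (\<i> ?H \<otimes>\<^sub>a ?u) = \<r> ?H"
  proof (rule joint)
    show "coc (?C \<boxtimes> unit_comonoid)"
      by (intro tensor_coc H unit_coc)
    show "chom (?C \<boxtimes> unit_comonoid) ?C (?m \<cdot> (\<i> ?H \<otimes>\<^sub>a ?u))"
      by (rule chom_comp[OF chom_tensor[OF homs(1) unit] mult]) (intro tensor_coc H CC unit_coc)+
    fix f A
    assume "(f, A) \<in> F"
    then have A: "chopf A" and f: "hopf_hom M H A f"
      using family by auto
    note fs = hopf_homD[OF f]
    have "f \<cdot> (?m \<cdot> (\<i> ?H \<otimes>\<^sub>a ?u)) = (f \<cdot> ?m) \<cdot> (\<i> ?H \<otimes>\<^sub>a ?u)"
      using fs(2-4) t by simp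
    also have "\<dots> = h_mult A \<cdot> (f \<otimes>\<^sub>a (f \<cdot> ?u))"
      unfolding fs(5) using fs(2-4) A t by (simp add: tensor_comp_tensor)
    also have "\<dots> = (h_mult A \<cdot> (\<i> (h_obj A) \<otimes>\<^sub>a h_unit A)) \<cdot> (f \<otimes>\<^sub>a \<i> \<I>)"
      unfolding fs(6) using fs(2-4) A t by (simp add: tensor_comp_tensor)
    also have "\<dots> = f \<cdot> \<r> ?H"
      unfolding chopfD(6)[OF A] using fs A t by (simp add: naturality)
    finally show "f \<cdot> (?m \<cdot> (\<i> ?H \<otimes>\<^sub>a ?u)) = f \<cdot> \<r> ?H" .
  qed (rule homs)
  \<comment> \<open>Before \<open>joint\<close> applies to the antipode laws, both sides must be
    comonoid morphisms. This is why the antipode is required to be one, and on the left it also uses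
    that the comultiplication is one.\<close>
  have ue: "chom ?C ?C (?u \<cdot> ?e)"
    by (rule chom_comp[OF homs(7) unit]) (intro H unit_coc)+
  have antipode_left: "?m \<cdot> (?S \<otimes>\<^sub>a \<i> ?H) \<cdot> ?d = ?u \<cdot> ?e"
  proof (rule joint[OF H _ ue])
    show "chom ?C ?C (?m \<cdot> (?S \<otimes>\<^sub>a \<i> ?H) \<cdot> ?d)"
      by (rule chom_comp[OF chom_comp[OF homs(6) chom_tensor[OF antipode homs(1)]] mult]) (intro H CC)+
    fix f A
    assume "(f, A) \<in> F"
    then have A: "chopf A" and f: "hopf_hom M H A f" and fS: "f \<cdot> ?S = h_antipode A \<cdot> f"
      using family by auto
    note fs = hopf_homD[OF f]
    have "f \<cdot> (?m \<cdot> (?S \<otimes>\<^sub>a \<i> ?H) \<cdot> ?d) = (f \<cdot> ?m) \<cdot> (?S \<otimes>\<^sub>a \<i> ?H) \<cdot> ?d"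
      using fs(2-4) t by simp
    also have "\<dots> = h_mult A \<cdot> ((f \<otimes>\<^sub>a f) \<cdot> (?S \<otimes>\<^sub>a \<i> ?H)) \<cdot> ?d"
      unfolding fs(5) using fs(2-4) A t by simp
    also have "(f \<otimes>\<^sub>a f) \<cdot> (?S \<otimes>\<^sub>a \<i> ?H) = (f \<cdot> ?S) \<otimes>\<^sub>a f"
      using fs(2-4) t by (simp add: tensor_comp_tensor)
    also have "\<dots> = (h_antipode A \<otimes>\<^sub>a \<i> (h_obj A)) \<cdot> (f \<otimes>\<^sub>a f)"
      unfolding fS using fs(2-4) A t by (simp add: tensor_comp_tensor)
    also have "h_mult A \<cdot> \<dots> \<cdot> ?d = (h_mult A \<cdot> (h_antipode A \<otimes>\<^sub>a \<i> (h_obj A)) \<cdot> h_comult A) \<cdot> f"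
      using fs A t by simp
    also have "\<dots> = (f \<cdot> ?u) \<cdot> ?e"
      unfolding chopfD(7)[OF A] fs(6) using fs A t by simp
    finally show "f \<cdot> (?m \<cdot> (?S \<otimes>\<^sub>a \<i> ?H) \<cdot> ?d) = f \<cdot> (?u \<cdot> ?e)"
      using fs(2-4) t by simp
  qed
  have antipode_right: "?m \<cdot> (\<i> ?H \<otimes>\<^sub>a ?S) \<cdot> ?d = ?u \<cdot> ?e"
  proof (rule joint[OF H _ ue])
    show "chom ?C ?C (?m \<cdot> (\<i> ?H \<otimes>\<^sub>a ?S) \<cdot> ?d)"
      by (rule chom_comp[OF chom_comp[OF homs(6) chom_tensor[OF homs(1) antipode]] mult]) (intro H CC)+
    fix f A
    assume "(f, A) \<in> F"
    then have A: "chopf A" and f: "hopf_hom M H A f" and fS: "f \<cdot> ?S = h_antipode A \<cdot> f"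
      using family by auto
    note fs = hopf_homD[OF f]
    have "f \<cdot> (?m \<cdot> (\<i> ?H \<otimes>\<^sub>a ?S) \<cdot> ?d) = (f \<cdot> ?m) \<cdot> (\<i> ?H \<otimes>\<^sub>a ?S) \<cdot> ?d"
      using fs(2-4) t by simp
    also have "\<dots> = h_mult A \<cdot> ((f \<otimes>\<^sub>a f) \<cdot> (\<i> ?H \<otimes>\<^sub>a ?S)) \<cdot> ?d"
      unfolding fs(5) using fs(2-4) A t by simp
    also have "(f \<otimes>\<^sub>a f) \<cdot> (\<i> ?H \<otimes>\<^sub>a ?S) = f \<otimes>\<^sub>a (f \<cdot> ?S)"
      using fs(2-4) t by (simp add: tensor_comp_tensor)
    also have "\<dots> = (\<i> (h_obj A) \<otimes>\<^sub>a h_antipode A) \<cdot> (f \<otimes>\<^sub>a f)"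
      unfolding fS using fs(2-4) A t by (simp add: tensor_comp_tensor)
    also have "h_mult A \<cdot> \<dots> \<cdot> ?d = (h_mult A \<cdot> (\<i> (h_obj A) \<otimes>\<^sub>a h_antipode A) \<cdot> h_comult A) \<cdot> f"
      using fs A t by simp
    also have "\<dots> = (f \<cdot> ?u) \<cdot> ?e"
      unfolding chopfD(8)[OF A] fs(6) using fs A t by simp
    finally show "f \<cdot> (?m \<cdot> (\<i> ?H \<otimes>\<^sub>a ?S) \<cdot> ?d) = f \<cdot> (?u \<cdot> ?e)"
      using fs(2-4) t by simp
  qed
  show ?thesis
    unfolding chopf_iff is_monoid_def
    using H mult unit t assoc unit_left unit_right antipode_left antipode_right by simp
qed

section \<open>Terminal object and binary products of cocommutative Hopf monoids\<close>

definition unit_hopf :: "('o, 'm) hopf" where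
  "unit_hopf = \<lparr>h_obj = \<I>, h_mult = \<l> \<I>, h_unit = \<i> \<I>, h_comult = \<l>\<^sup>- \<I>, h_counit = \<i> \<I>,
    h_antipode = \<i> \<I>\<rparr>"

lemma hopf_comonoid_unit_hopf: "hopf_comonoid unit_hopf = unit_comonoid"
  by (simp add: hopf_comonoid_def unit_comonoid_def unit_hopf_def)

text \<open>The empty family is jointly monic because the unit comonoid is terminal.\<close>

lemma chopf_unit: "chopf unit_hopf"
proof (rule chopf_of_jointly_monic[where F = "{}"], unfold hopf_comonoid_unit_hopf)
  show "chom (unit_comonoid \<boxtimes> unit_comonoid) unit_comonoid (h_mult unit_hopf)"
    using chom_lunit[OF unit_coc] by (simp add: unit_hopf_def)
  show "chom unit_comonoid unit_comonoid (h_unit unit_hopf)"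
    "chom unit_comonoid unit_comonoid (h_antipode unit_hopf)"
    using chom_ide[OF unit_coc] by (simp_all add: unit_hopf_def)
  show "h = k" if "coc X" "chom X unit_comonoid h" "chom X unit_comonoid k" for X h k
    using that chom_unit_unique by metis
qed simp_all

lemma hopf_hom_counit:
  assumes "chopf A"
  shows "hopf_hom M A unit_hopf (h_counit A)"
proof (rule hopf_homI, unfold hopf_comonoid_unit_hopf)
  show "chom (hopf_comonoid A) unit_comonoid (h_counit A)"
    using chom_counit[OF chopfD(1)[OF assms]] by simp
  show "h_counit A \<cdot> h_mult A = h_mult unit_hopf \<cdot> (h_counit A \<otimes>\<^sub>a h_counit A)"
    using chomD(5)[OF chopfD(2)[OF assms]] by (simp add: unit_hopf_def tensor_counit)
  show "h_counit A \<cdot> h_unit A = h_unit unit_hopf"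
    using chomD(5)[OF chopfD(3)[OF assms]] by (simp add: unit_hopf_def)
qed

lemma hopf_hom_unit_unique:
  assumes "hopf_hom M A unit_hopf f" "chopf A"
  shows "f = h_counit A"
  using chom_unit_unique[of "hopf_comonoid A" f] hopf_homD(1)[OF assms(1)] chopfD(1)[OF assms(2)]
  by (simp add: hopf_comonoid_unit_hopf)

text \<open>The operations are componentwise, but given as pairings rather than by
  \<open>interchange\<close>, so that their composites with the projections are known from the
  universal property.\<close>

definition prod_hopf :: "('o, 'm) hopf \<Rightarrow> ('o, 'm) hopf \<Rightarrow> ('o, 'm) hopf" where
  "prod_hopf A B = (let C = hopf_comonoid A; D = hopf_comonoid B; T = C \<boxtimes> D in
    \<lparr>h_obj = co_obj T,
     h_mult = pair (T \<boxtimes> T) (h_mult A \<cdot> (pr1 C D \<otimes>\<^sub>a pr1 C D)) (h_mult B \<cdot> (pr2 C D \<otimes>\<^sub>a pr2 C D)),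
     h_unit = pair unit_comonoid (h_unit A) (h_unit B),
     h_comult = co_comult T, h_counit = co_counit T,
     h_antipode = pair T (h_antipode A \<cdot> pr1 C D) (h_antipode B \<cdot> pr2 C D)\<rparr>)"

abbreviation hpr1 where "hpr1 A B \<equiv> pr1 (hopf_comonoid A) (hopf_comonoid B)"
abbreviation hpr2 where "hpr2 A B \<equiv> pr2 (hopf_comonoid A) (hopf_comonoid B)"

lemma hopf_comonoid_prod_hopf: "hopf_comonoid (prod_hopf A B) = hopf_comonoid A \<boxtimes> hopf_comonoid B"
  by (simp add: hopf_comonoid_def prod_hopf_def tensor_comonoid_def Let_def)

lemma prod_hopf_homs:
  assumes A: "chopf A" and B: "chopf B"
  shows chom_prod_mult: "chom ((hopf_comonoid A \<boxtimes> hopf_comonoid B) \<boxtimes> (hopf_comonoid A \<boxtimes> hopf_comonoid B))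
      (hopf_comonoid A \<boxtimes> hopf_comonoid B) (h_mult (prod_hopf A B))"
    and chom_prod_unit: "chom unit_comonoid (hopf_comonoid A \<boxtimes> hopf_comonoid B) (h_unit (prod_hopf A B))"
    and chom_prod_antipode: "chom (hopf_comonoid A \<boxtimes> hopf_comonoid B) (hopf_comonoid A \<boxtimes> hopf_comonoid B)
      (h_antipode (prod_hopf A B))"
    and hopf_hom_pr1: "hopf_hom M (prod_hopf A B) A (hpr1 A B)"
    and hopf_hom_pr2: "hopf_hom M (prod_hopf A B) B (hpr2 A B)"
    and pr1_antipode: "hpr1 A B \<cdot> h_antipode (prod_hopf A B) = h_antipode A \<cdot> hpr1 A B"
    and pr2_antipode: "hpr2 A B \<cdot> h_antipode (prod_hopf A B) = h_antipode B \<cdot> hpr2 A B"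
proof -
  let ?C = "hopf_comonoid A" and ?D = "hopf_comonoid B" and ?P = "prod_hopf A B"
  let ?T = "hopf_comonoid A \<boxtimes> hopf_comonoid B"
  note C = chopfD(1)[OF A] and D = chopfD(1)[OF B]
  note T = tensor_coc[OF C D]
  note TT = tensor_coc[OF T T]
  have 1: "chom (?T \<boxtimes> ?T) ?C (h_mult A \<cdot> (hpr1 A B \<otimes>\<^sub>a hpr1 A B))"
    by (rule chom_comp[OF chom_tensor[OF chom_pr1 chom_pr1] chopfD(2)[OF A]]) (intro C D T TT tensor_coc)+
  have 2: "chom (?T \<boxtimes> ?T) ?D (h_mult B \<cdot> (hpr2 A B \<otimes>\<^sub>a hpr2 A B))"
    by (rule chom_comp[OF chom_tensor[OF chom_pr2 chom_pr2] chopfD(2)[OF B]]) (intro C D T TT tensor_coc)+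
  have 3: "chom ?T ?C (h_antipode A \<cdot> hpr1 A B)"
    by (rule chom_comp[OF chom_pr1 chom_antipode[OF A]]) (intro C D T)+
  have 4: "chom ?T ?D (h_antipode B \<cdot> hpr2 A B)"
    by (rule chom_comp[OF chom_pr2 chom_antipode[OF B]]) (intro C D T)+
  note u = chopfD(3)[OF A] chopfD(3)[OF B]
  show "chom (?T \<boxtimes> ?T) ?T (h_mult ?P)"
    using chom_pair[OF 1 2 TT C D] by (simp add: prod_hopf_def Let_def)
  show "chom unit_comonoid ?T (h_unit ?P)"
    using chom_pair[OF u unit_coc C D] by (simp add: prod_hopf_def Let_def)
  show "chom ?T ?T (h_antipode ?P)"
    using chom_pair[OF 3 4 T C D] by (simp add: prod_hopf_def Let_def)
  show "hopf_hom M ?P A (hpr1 A B)"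
  proof (rule hopf_homI)
    show "chom (hopf_comonoid ?P) ?C (hpr1 A B)"
      using chom_pr1[OF C D] by (simp add: hopf_comonoid_prod_hopf)
    show "hpr1 A B \<cdot> h_mult ?P = h_mult A \<cdot> (hpr1 A B \<otimes>\<^sub>a hpr1 A B)"
      using pr1_pair[OF TT C D chomD(1-3)[OF 1] 2] by (simp add: prod_hopf_def Let_def)
    show "hpr1 A B \<cdot> h_unit ?P = h_unit A"
      using pr1_pair[OF unit_coc C D chomD(1-3)[OF u(1)] u(2)] by (simp add: prod_hopf_def Let_def)
  qed
  show "hopf_hom M ?P B (hpr2 A B)"
  proof (rule hopf_homI)
    show "chom (hopf_comonoid ?P) ?D (hpr2 A B)"
      using chom_pr2[OF C D] by (simp add: hopf_comonoid_prod_hopf)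
    show "hpr2 A B \<cdot> h_mult ?P = h_mult B \<cdot> (hpr2 A B \<otimes>\<^sub>a hpr2 A B)"
      using pr2_pair[OF TT C D chomD(1-3)[OF 2] 1] by (simp add: prod_hopf_def Let_def)
    show "hpr2 A B \<cdot> h_unit ?P = h_unit B"
      using pr2_pair[OF unit_coc C D chomD(1-3)[OF u(2)] u(1)] by (simp add: prod_hopf_def Let_def)
  qed
  show "hpr1 A B \<cdot> h_antipode ?P = h_antipode A \<cdot> hpr1 A B"
    using pr1_pair[OF T C D chomD(1-3)[OF 3] 4] by (simp add: prod_hopf_def Let_def)
  show "hpr2 A B \<cdot> h_antipode ?P = h_antipode B \<cdot> hpr2 A B"
    using pr2_pair[OF T C D chomD(1-3)[OF 4] 3] by (simp add: prod_hopf_def Let_def)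
qed

lemma chopf_prod:
  assumes A: "chopf A" and B: "chopf B"
  shows "chopf (prod_hopf A B)"
proof (rule chopf_of_jointly_monic[where F = "{(hpr1 A B, A), (hpr2 A B, B)}"])
  note C = chopfD(1)[OF A] and D = chopfD(1)[OF B]
  show "h = k" if "coc X" "chom X (hopf_comonoid (prod_hopf A B)) h"
    "chom X (hopf_comonoid (prod_hopf A B)) k"
    "\<And>f E. (f, E) \<in> {(hpr1 A B, A), (hpr2 A B, B)} \<Longrightarrow> f \<cdot> h = f \<cdot> k" for X h k
    using that(1-3) that(4)[of "hpr1 A B" A] that(4)[of "hpr2 A B" B]
    by (intro chom_tensor_eqI[OF _ _ _ C D, of X h k]) (simp_all add: hopf_comonoid_prod_hopf)
qed (use prod_hopf_homs[OF A B] tensor_coc[OF chopfD(1)[OF A] chopfD(1)[OF B]] A B in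
    \<open>auto simp: hopf_comonoid_prod_hopf\<close>)

text \<open>Each compatibility equates two comonoid morphisms into a product and is verified after
  the two projections.\<close>

lemma hopf_hom_pair:
  assumes A: "chopf A" and B: "chopf B" and X: "chopf X"
    and f: "hopf_hom M X A f" and g: "hopf_hom M X B g"
  shows "hopf_hom M X (prod_hopf A B) (pair (hopf_comonoid X) f g)"
    and "hpr1 A B \<cdot> pair (hopf_comonoid X) f g = f" and "hpr2 A B \<cdot> pair (hopf_comonoid X) f g = g"
proof -
  let ?C = "hopf_comonoid A" and ?D = "hopf_comonoid B" and ?X = "hopf_comonoid X"
  let ?h = "pair ?X f g" and ?P = "prod_hopf A B"
  note C = chopfD(1)[OF A] and D = chopfD(1)[OF B] and cX = chopfD(1)[OF X]
  note fs = hopf_homD[OF f] and gs = hopf_homD[OF g] and P = chopf_prod[OF A B]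
  note p = hopf_homD[OF hopf_hom_pr1[OF A B]] and q = hopf_homD[OF hopf_hom_pr2[OF A B]]
  have h: "chom ?X (?C \<boxtimes> ?D) ?h"
    by (rule chom_pair[OF fs(1) gs(1) cX C D])
  show ph: "hpr1 A B \<cdot> ?h = f"
    using fs gs by (intro pr1_pair[OF cX C D]) simp_all
  show qh: "hpr2 A B \<cdot> ?h = g"
    using fs gs by (intro pr2_pair[OF cX C D]) simp_all
  note hs = chomD(1-3)[OF h, simplified]
  have ob: "h_obj ?P = h_obj A \<otimes>\<^sub>o h_obj B"
    by (simp add: prod_hopf_def Let_def)
  show "hopf_hom M X ?P ?h"
  proof (rule hopf_homI)
    show "chom ?X (hopf_comonoid ?P) ?h"
      using h by (simp add: hopf_comonoid_prod_hopf)
    show "?h \<cdot> h_mult X = h_mult ?P \<cdot> (?h \<otimes>\<^sub>a ?h)"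
    proof (rule chom_tensor_eqI[OF _ _ tensor_coc[OF cX cX] C D])
      show "chom (?X \<boxtimes> ?X) (?C \<boxtimes> ?D) (?h \<cdot> h_mult X)"
        by (rule chom_comp[OF chopfD(2)[OF X] h]) (intro cX C D tensor_coc)+
      show "chom (?X \<boxtimes> ?X) (?C \<boxtimes> ?D) (h_mult ?P \<cdot> (?h \<otimes>\<^sub>a ?h))"
        by (rule chom_comp[OF chom_tensor[OF h h] chom_prod_mult[OF A B]]) (intro cX C D tensor_coc)+
      have "hpr1 A B \<cdot> (?h \<cdot> h_mult X) = (hpr1 A B \<cdot> ?h) \<cdot> h_mult X"
        using C D X hs by simp
      also have "\<dots> = h_mult A \<cdot> ((hpr1 A B \<cdot> ?h) \<otimes>\<^sub>a (hpr1 A B \<cdot> ?h))"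
        unfolding ph by (rule fs)
      also have "\<dots> = (hpr1 A B \<cdot> h_mult ?P) \<cdot> (?h \<otimes>\<^sub>a ?h)"
        unfolding p(5) using A C D hs by (simp add: tensor_comp_tensor)
      finally show "hpr1 A B \<cdot> (?h \<cdot> h_mult X) = hpr1 A B \<cdot> (h_mult ?P \<cdot> (?h \<otimes>\<^sub>a ?h))"
        using C D hs P ob by simp
      have "hpr2 A B \<cdot> (?h \<cdot> h_mult X) = (hpr2 A B \<cdot> ?h) \<cdot> h_mult X"
        using C D X hs by simp
      also have "\<dots> = h_mult B \<cdot> ((hpr2 A B \<cdot> ?h) \<otimes>\<^sub>a (hpr2 A B \<cdot> ?h))"
        unfolding qh by (rule gs)
      also have "\<dots> = (hpr2 A B \<cdot> h_mult ?P) \<cdot> (?h \<otimes>\<^sub>a ?h)"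
        unfolding q(5) using B C D hs by (simp add: tensor_comp_tensor)
      finally show "hpr2 A B \<cdot> (?h \<cdot> h_mult X) = hpr2 A B \<cdot> (h_mult ?P \<cdot> (?h \<otimes>\<^sub>a ?h))"
        using C D hs P ob by simp
    qed
    show "?h \<cdot> h_unit X = h_unit ?P"
    proof (rule chom_tensor_eqI[OF _ chom_prod_unit[OF A B] unit_coc C D])
      show "chom unit_comonoid (?C \<boxtimes> ?D) (?h \<cdot> h_unit X)"
        by (rule chom_comp[OF chopfD(3)[OF X] h]) (intro cX C D tensor_coc unit_coc)+
      have "hpr1 A B \<cdot> (?h \<cdot> h_unit X) = (hpr1 A B \<cdot> ?h) \<cdot> h_unit X"
        using C D X hs by simp
      then show "hpr1 A B \<cdot> (?h \<cdot> h_unit X) = hpr1 A B \<cdot> h_unit ?P"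
        unfolding ph p(6) fs(6) .
      have "hpr2 A B \<cdot> (?h \<cdot> h_unit X) = (hpr2 A B \<cdot> ?h) \<cdot> h_unit X"
        using C D X hs by simp
      then show "hpr2 A B \<cdot> (?h \<cdot> h_unit X) = hpr2 A B \<cdot> h_unit ?P"
        unfolding qh q(6) gs(6) .
    qed
  qed
qed

lemma hopf_hom_prod_eqI:
  assumes "hopf_hom M X (prod_hopf A B) h" "hopf_hom M X (prod_hopf A B) k"
    "chopf X" "chopf A" "chopf B" "hpr1 A B \<cdot> h = hpr1 A B \<cdot> k" "hpr2 A B \<cdot> h = hpr2 A B \<cdot> k"
  shows "h = k"
  using chom_tensor_eqI[of "hopf_comonoid X" "hopf_comonoid A" "hopf_comonoid B" h k]
    hopf_homD(1)[OF assms(1)] hopf_homD(1)[OF assms(2)] chopfD(1)[OF assms(3)] chopfD(1)[OF assms(4)]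
    chopfD(1)[OF assms(5)] assms(6,7)
  by (simp add: hopf_comonoid_prod_hopf)

end

section \<open>Subobjects and images of cocommutative Hopf monoids\<close>

context abelian_symmetric_monoidal_category
begin

lemma tensor_monic:
  assumes "monic M f" "X \<in> Ob M"
  shows "monic M (\<i> X \<otimes>\<^sub>a f)" "monic M (f \<otimes>\<^sub>a \<i> X)"
  using exact_functor_monic[OF tensor_left_exact[OF assms(2)] assms(1)]
    exact_functor_monic[OF tensor_right_exact[OF assms(2)] assms(1)]
  by (simp_all add: tensor_left_def tensor_right_def)

lemma tensor_epic:
  assumes "epic M f" "X \<in> Ob M"
  shows "epic M (\<i> X \<otimes>\<^sub>a f)" "epic M (f \<otimes>\<^sub>a \<i> X)"
  using exact_functor_epic[OF tensor_left_exact[OF assms(2)] assms(1)]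
    exact_functor_epic[OF tensor_right_exact[OF assms(2)] assms(1)]
  by (simp_all add: tensor_left_def tensor_right_def)

lemma tensor_equalizer:
  assumes "is_equalizer M e f g" "X \<in> Ob M"
  shows "is_equalizer M (\<i> X \<otimes>\<^sub>a e) (\<i> X \<otimes>\<^sub>a f) (\<i> X \<otimes>\<^sub>a g)"
    "is_equalizer M (e \<otimes>\<^sub>a \<i> X) (f \<otimes>\<^sub>a \<i> X) (g \<otimes>\<^sub>a \<i> X)"
  using exact_functor_equalizer[OF tensor_left_exact[OF assms(2)] tensor_left_additive[OF assms(2)] assms(1)]
    exact_functor_equalizer[OF tensor_right_exact[OF assms(2)] tensor_right_additive[OF assms(2)] assms(1)]
  by (simp_all add: tensor_left_def tensor_right_def)

lemma tensor_monic_monic: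
  assumes "monic M f" "monic M g"
  shows "monic M (f \<otimes>\<^sub>a g)"
proof -
  note ar = monic_ar[OF assms(1)] monic_ar[OF assms(2)]
  have "monic M ((f \<otimes>\<^sub>a \<i> (Cod M g)) \<cdot> (\<i> (Dom M f) \<otimes>\<^sub>a g))"
    using assms ar by (intro monic_comp tensor_monic) simp_all
  then show ?thesis
    using ar by (simp add: tensor_comp_tensor)
qed

lemma tensor_epic_epic:
  assumes "epic M f" "epic M g"
  shows "epic M (f \<otimes>\<^sub>a g)"
proof -
  note ar = epic_ar[OF assms(1)] epic_ar[OF assms(2)]
  have "epic M ((f \<otimes>\<^sub>a \<i> (Cod M g)) \<cdot> (\<i> (Dom M f) \<otimes>\<^sub>a g))"
    using assms ar by (intro epic_comp tensor_epic) simp_all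
  then show ?thesis
    using ar by (simp add: tensor_comp_tensor)
qed

text \<open>By exactness of the tensor product, \<open>i \<otimes> i\<close> and
  \<open>i \<otimes> (i \<otimes> i)\<close> are monic. The laws of \<open>B\<close> therefore
  restrict to \<open>E\<close>, and the right counit law again follows from the left one by
  cocommutativity.\<close>

lemma coc_sub:
  assumes B: "coc B" and i: "monic M i" "Dom M i = co_obj E" "Cod M i = co_obj B"
    and d: "co_comult E \<in> Hom M (co_obj E) (co_obj E \<otimes>\<^sub>o co_obj E)"
    and di: "co_comult B \<cdot> i = (i \<otimes>\<^sub>a i) \<cdot> co_comult E" and e: "co_counit E = co_counit B \<cdot> i"
  shows "coc E" "chom E B i"
proof -
  let ?E = "co_obj E" and ?B = "co_obj B" and ?d = "co_comult E" and ?d' = "co_comult B"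
  have t: "i \<in> Ar M" "?E \<in> Ob M"
    using monic_ar[OF i(1)] i dom_ob[of i] by auto
  have ii: "monic M (i \<otimes>\<^sub>a i)" "monic M (i \<otimes>\<^sub>a (i \<otimes>\<^sub>a i))"
    using i by (auto intro!: tensor_monic_monic)
  have coassoc: "\<a> ?E ?E ?E \<cdot> (?d \<otimes>\<^sub>a \<i> ?E) \<cdot> ?d = (\<i> ?E \<otimes>\<^sub>a ?d) \<cdot> ?d"
  proof (rule monic_cancel[OF ii(2)])
    have l: "((i \<otimes>\<^sub>a i) \<otimes>\<^sub>a i) \<cdot> (?d \<otimes>\<^sub>a \<i> ?E) = (?d' \<otimes>\<^sub>a \<i> ?B) \<cdot> (i \<otimes>\<^sub>a i)"
      using B t i(2,3) d di by (simp add: tensor_comp_tensor)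
    have r: "(i \<otimes>\<^sub>a (i \<otimes>\<^sub>a i)) \<cdot> (\<i> ?E \<otimes>\<^sub>a ?d) = (\<i> ?B \<otimes>\<^sub>a ?d') \<cdot> (i \<otimes>\<^sub>a i)"
      using B t i(2,3) d di by (simp add: tensor_comp_tensor)
    have "(i \<otimes>\<^sub>a (i \<otimes>\<^sub>a i)) \<cdot> (\<a> ?E ?E ?E \<cdot> (?d \<otimes>\<^sub>a \<i> ?E) \<cdot> ?d)
      = \<a> ?B ?B ?B \<cdot> (((i \<otimes>\<^sub>a i) \<otimes>\<^sub>a i) \<cdot> (?d \<otimes>\<^sub>a \<i> ?E)) \<cdot> ?d"
      using B t i(2,3) d assoc_nat[THEN reassoc, of i i i ?B ?B ?B "(?d \<otimes>\<^sub>a \<i> ?E) \<cdot> ?d"] by simp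
    also have "\<dots> = \<a> ?B ?B ?B \<cdot> (?d' \<otimes>\<^sub>a \<i> ?B) \<cdot> (?d' \<cdot> i)"
      unfolding l di using B t i(2,3) d by simp
    also have "\<dots> = (dup ?B ?d' ?B \<cdot> ?d') \<cdot> i"
      using B t i(2,3) by (simp add: dup_def)
    also have "\<dots> = (\<i> ?B \<otimes>\<^sub>a ?d') \<cdot> (?d' \<cdot> i)"
      unfolding coc_laws(1)[OF B] using B t i(2,3) by simp
    also have "\<dots> = ((i \<otimes>\<^sub>a (i \<otimes>\<^sub>a i)) \<cdot> (\<i> ?E \<otimes>\<^sub>a ?d)) \<cdot> ?d"
      unfolding r di using B t i(2,3) d by simp
    finally show "(i \<otimes>\<^sub>a (i \<otimes>\<^sub>a i)) \<cdot> (\<a> ?E ?E ?E \<cdot> (?d \<otimes>\<^sub>a \<i> ?E) \<cdot> ?d)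
      = (i \<otimes>\<^sub>a (i \<otimes>\<^sub>a i)) \<cdot> ((\<i> ?E \<otimes>\<^sub>a ?d) \<cdot> ?d)"
      using B t i(2,3) d by simp
  qed (use B t i d in simp_all)
  have cocomm: "\<s> ?E ?E \<cdot> ?d = ?d"
  proof (rule monic_cancel[OF ii(1)])
    have "(i \<otimes>\<^sub>a i) \<cdot> (\<s> ?E ?E \<cdot> ?d) = \<s> ?B ?B \<cdot> (?d' \<cdot> i)"
      unfolding di using B t i(2,3) d sym_nat[THEN reassoc, of i i ?B ?B ?d] by simp
    also have "\<dots> = (\<s> ?B ?B \<cdot> ?d') \<cdot> i"
      using B t i(2,3) by simp
    also have "\<dots> = (i \<otimes>\<^sub>a i) \<cdot> ?d"
      unfolding coc_sym[OF B] by (rule di)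
    finally show "(i \<otimes>\<^sub>a i) \<cdot> (\<s> ?E ?E \<cdot> ?d) = (i \<otimes>\<^sub>a i) \<cdot> ?d" .
  qed (use B t i d in simp_all)
  have counit: "\<l> ?E \<cdot> (co_counit E \<otimes>\<^sub>a \<i> ?E) \<cdot> ?d = \<i> ?E"
  proof (rule monic_cancel[OF i(1)])
    have "i \<cdot> (\<l> ?E \<cdot> (co_counit E \<otimes>\<^sub>a \<i> ?E) \<cdot> ?d)
      = \<l> ?B \<cdot> ((\<i> \<I> \<otimes>\<^sub>a i) \<cdot> (co_counit E \<otimes>\<^sub>a \<i> ?E)) \<cdot> ?d"
      using B t i(2,3) d e lunit_nat[THEN reassoc, of i ?B "(co_counit E \<otimes>\<^sub>a \<i> ?E) \<cdot> ?d"] by simp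
    also have "(\<i> \<I> \<otimes>\<^sub>a i) \<cdot> (co_counit E \<otimes>\<^sub>a \<i> ?E) = (co_counit B \<otimes>\<^sub>a \<i> ?B) \<cdot> (i \<otimes>\<^sub>a i)"
      using B t i(2,3) d e by (simp add: tensor_comp_tensor del: whisker_right_comp)
    also have "\<l> ?B \<cdot> \<dots> \<cdot> ?d = del (co_counit B) ?B \<cdot> (?d' \<cdot> i)"
      unfolding di using B t i(2,3) d by (simp add: del_def)
    also have "\<dots> = (del (co_counit B) ?B \<cdot> ?d') \<cdot> i"
      using B t i(2,3) by simp
    finally show "i \<cdot> (\<l> ?E \<cdot> (co_counit E \<otimes>\<^sub>a \<i> ?E) \<cdot> ?d) = i \<cdot> \<i> ?E"
      unfolding coc_laws(2)[OF B] using t i(2,3) B by simp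
  qed (use B t i d e in simp_all)
  have counit': "\<r> ?E \<cdot> (\<i> ?E \<otimes>\<^sub>a co_counit E) \<cdot> ?d = \<i> ?E"
  proof -
    have te: "co_counit E \<in> Ar M" "Dom M (co_counit E) = ?E" "Cod M (co_counit E) = \<I>"
      using B t i(2,3) e by simp_all
    have "\<r> ?E \<cdot> (\<i> ?E \<otimes>\<^sub>a co_counit E) \<cdot> (\<s> ?E ?E \<cdot> ?d) = \<l> ?E \<cdot> (co_counit E \<otimes>\<^sub>a \<i> ?E) \<cdot> ?d"
      using t d te sym_nat[THEN reassoc, of "co_counit E" "\<i> ?E" \<I> ?E ?d]
        runit_sym[THEN reassoc, of ?E "(co_counit E \<otimes>\<^sub>a \<i> ?E) \<cdot> ?d"] by simp
    then show ?thesis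
      unfolding cocomm counit .
  qed
  show "coc E"
    unfolding coc_def is_comonoid_def cocommutative_def
    using B t i d e coassoc cocomm counit counit' by simp
  show "chom E B i"
    using t i di e by (intro chomI) simp_all
qed

lemma chom_lift:
  assumes i: "chom E B i" "monic M i" and h: "h \<in> Ar M" "Dom M h = co_obj X" "Cod M h = co_obj E"
    and ih: "chom X B (i \<cdot> h)" and coc: "coc X" "coc E" "coc B"
  shows "chom X E h"
proof (rule chomI)
  note ii = chomD[OF i(1)] and hs = chomD[OF ih]
  show "co_comult E \<cdot> h = (h \<otimes>\<^sub>a h) \<cdot> co_comult X"
  proof (rule monic_cancel[OF tensor_monic_monic[OF i(2) i(2)]])
    have "(i \<otimes>\<^sub>a i) \<cdot> (co_comult E \<cdot> h) = (co_comult B \<cdot> i) \<cdot> h"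
      unfolding ii(4) using coc h ii(1-3) by simp
    also have "\<dots> = co_comult B \<cdot> (i \<cdot> h)"
      using coc h ii(1-3) by simp
    also have "\<dots> = (i \<otimes>\<^sub>a i) \<cdot> ((h \<otimes>\<^sub>a h) \<cdot> co_comult X)"
      unfolding hs(4) using coc h ii(1-3) reassoc[of "i \<otimes>\<^sub>a i" "h \<otimes>\<^sub>a h" _ "co_comult X"]
      by (simp add: tensor_comp_tensor)
    finally show "(i \<otimes>\<^sub>a i) \<cdot> (co_comult E \<cdot> h) = (i \<otimes>\<^sub>a i) \<cdot> ((h \<otimes>\<^sub>a h) \<cdot> co_comult X)" .
  qed (use coc h ii(1-3) in simp_all)
  have "co_counit E \<cdot> h = co_counit B \<cdot> (i \<cdot> h)"
    unfolding ii(5)[symmetric] using coc h ii(1-3) by simp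
  then show "co_counit E \<cdot> h = co_counit X"
    unfolding hs(5) .
qed (use h in simp_all)

text \<open>The operations of \<open>E\<close> are comonoid morphisms because their composites with
  the monomorphism \<open>i\<close> are, and \<open>i\<close> alone is a jointly monic
  family.\<close>

lemma chopf_sub:
  assumes B: "chopf B" and i: "monic M i" "Dom M i = h_obj E" "Cod M i = h_obj B"
    and ty: "h_mult E \<in> Hom M (h_obj E \<otimes>\<^sub>o h_obj E) (h_obj E)" "h_unit E \<in> Hom M \<I> (h_obj E)"
      "h_comult E \<in> Hom M (h_obj E) (h_obj E \<otimes>\<^sub>o h_obj E)" "h_antipode E \<in> Hom M (h_obj E) (h_obj E)"
    and mult: "i \<cdot> h_mult E = h_mult B \<cdot> (i \<otimes>\<^sub>a i)" and unit: "i \<cdot> h_unit E = h_unit B"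
    and comult: "h_comult B \<cdot> i = (i \<otimes>\<^sub>a i) \<cdot> h_comult E" and counit: "h_counit E = h_counit B \<cdot> i"
    and antipode: "i \<cdot> h_antipode E = h_antipode B \<cdot> i"
  shows "chopf E" "hopf_hom M E B i"
proof -
  let ?E = "hopf_comonoid E" and ?B = "hopf_comonoid B"
  note cB = chopfD(1)[OF B]
  have E: "coc ?E" and ci: "chom ?E ?B i"
    using coc_sub[OF cB, of i ?E] i ty comult counit by simp_all
  show hom: "hopf_hom M E B i"
    by (rule hopf_homI[OF ci mult unit])
  show "chopf E"
  proof (rule chopf_of_jointly_monic[where F = "{(i, B)}", OF E])
    show "chom (?E \<boxtimes> ?E) ?E (h_mult E)"
    proof (rule chom_lift[OF ci i(1)])
      show "chom (?E \<boxtimes> ?E) ?B (i \<cdot> h_mult E)"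
        unfolding mult by (rule chom_comp[OF chom_tensor[OF ci ci] chopfD(2)[OF B]]) (intro E cB tensor_coc)+
    qed (use ty E cB tensor_coc in simp_all)
    show "chom unit_comonoid ?E (h_unit E)"
      using chopfD(3)[OF B] by (intro chom_lift[OF ci i(1)]) (use ty E cB unit in simp_all)
    show "chom ?E ?E (h_antipode E)"
      by (rule chom_lift[OF ci i(1)])
        (use ty E cB antipode chom_comp[OF ci chom_antipode[OF B] E cB cB] in simp_all)
    show "chopf A \<and> hopf_hom M E A f \<and> f \<cdot> h_antipode E = h_antipode A \<cdot> f"
      if "(f, A) \<in> {(i, B)}" for f A
      using that B hom antipode by simp
    show "h = k" if "coc X" "chom X ?E h" "chom X ?E k"
      "\<And>f A. (f, A) \<in> {(i, B)} \<Longrightarrow> f \<cdot> h = f \<cdot> k" for X h k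
      by (rule monic_cancel[OF i(1)])
        (use that(4)[of i B] chomD(1-3)[OF that(2)] chomD(1-3)[OF that(3)] i in simp_all)
  qed
qed

lemma hopf_hom_lift:
  assumes i: "hopf_hom M E B i" "monic M i" and h: "h \<in> Ar M" "Dom M h = h_obj X" "Cod M h = h_obj E"
    and ih: "hopf_hom M X B (i \<cdot> h)" and X: "chopf X" and E: "chopf E" and B: "chopf B"
  shows "hopf_hom M X E h"
proof (rule hopf_homI)
  note ii = hopf_homD[OF i(1)] and hs = hopf_homD[OF ih]
  show "chom (hopf_comonoid X) (hopf_comonoid E) h"
    by (rule chom_lift[OF ii(1) i(2)]) (use h hs(1) chopfD(1)[OF X] chopfD(1)[OF E] chopfD(1)[OF B] in simp_all)
  show "h \<cdot> h_mult X = h_mult E \<cdot> (h \<otimes>\<^sub>a h)"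
  proof (rule monic_cancel[OF i(2)])
    have "i \<cdot> (h \<cdot> h_mult X) = h_mult B \<cdot> ((i \<cdot> h) \<otimes>\<^sub>a (i \<cdot> h))"
      unfolding hs(5)[symmetric] using X h ii(2-4) by simp
    also have "\<dots> = (i \<cdot> h_mult E) \<cdot> (h \<otimes>\<^sub>a h)"
      unfolding ii(5) using B h ii(2-4) by (simp add: tensor_comp_tensor)
    finally show "i \<cdot> (h \<cdot> h_mult X) = i \<cdot> (h_mult E \<cdot> (h \<otimes>\<^sub>a h))"
      using E h ii(2-4) by simp
  qed (use X E B h ii(2-4) in simp_all)
  show "h \<cdot> h_unit X = h_unit E"
    by (rule monic_cancel[OF i(2)]) (use X E B h ii(2-4,6) hs(6) in simp_all)
qed

text \<open>Multiplication, comultiplication and antipode are diagonal fillers between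
  \<open>e\<close> or \<open>e \<otimes> e\<close> and \<open>m\<close> or
  \<open>m \<otimes> m\<close>, which are epic and monic by exactness. The square for the antipode
  commutes because Hopf morphisms preserve antipodes.\<close>

lemma hopf_image:
  assumes f: "hopf_hom M A B f" and A: "chopf A" and B: "chopf B"
  obtains E e m where "chopf E" "hopf_hom M A E e" "hopf_hom M E B m" "epic M e" "monic M m" "m \<cdot> e = f"
proof -
  note fs = hopf_homD[OF f]
  obtain e m where em: "epic M e" "monic M m" "Dom M m = Cod M e" "m \<cdot> e = f"
    using epi_mono_factorization[OF fs(2)] by blast
  note ea = epic_ar[OF em(1)] and ma = monic_ar[OF em(2)]
  have ed: "Dom M e = h_obj A" "Cod M m = h_obj B"
    using em(3,4) ea ma fs(2-4) comp_simps[OF ea ma em(3)] by simp_all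
  let ?I = "Cod M e"
  have I: "?I \<in> Ob M"
    using ea by simp
  note ee = tensor_epic_epic[OF em(1) em(1)] and mm = tensor_monic_monic[OF em(2) em(2)]
  have fm: "m \<cdot> (e \<cdot> x) = f \<cdot> x" if "x \<in> Ar M" "Cod M x = h_obj A" for x
    using reassoc[OF em(4)] that ea ma em(3) ed by simp
  have ff: "(m \<otimes>\<^sub>a m) \<cdot> (e \<otimes>\<^sub>a e) = f \<otimes>\<^sub>a f"
    using em(3,4) ea ma by (simp add: tensor_comp_tensor)
  obtain mu where mu: "mu \<in> Hom M (?I \<otimes>\<^sub>o ?I) ?I" "mu \<cdot> (e \<otimes>\<^sub>a e) = e \<cdot> h_mult A"
    "m \<cdot> mu = h_mult B \<cdot> (m \<otimes>\<^sub>a m)"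
  proof (rule epi_mono_fill_in[OF ee em(2)])
    show "m \<cdot> (e \<cdot> h_mult A) = (h_mult B \<cdot> (m \<otimes>\<^sub>a m)) \<cdot> (e \<otimes>\<^sub>a e)"
      using fm[of "h_mult A"] fs(5) A B ea ma em(3) ed ff by simp
  qed (use A B ea ma em(3) ed in simp_all)
  obtain d where d: "d \<in> Hom M ?I (?I \<otimes>\<^sub>o ?I)" "d \<cdot> e = (e \<otimes>\<^sub>a e) \<cdot> h_comult A"
    "(m \<otimes>\<^sub>a m) \<cdot> d = h_comult B \<cdot> m"
  proof (rule epi_mono_fill_in[OF em(1) mm])
    show "(m \<otimes>\<^sub>a m) \<cdot> ((e \<otimes>\<^sub>a e) \<cdot> h_comult A) = (h_comult B \<cdot> m) \<cdot> e"
      using fs(7) A B ea ma em(3,4) ed reassoc[OF ff, of "h_comult A"] by simp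
  qed (use A B ea ma em(3) ed in simp_all)
  obtain S where S: "S \<in> Hom M ?I ?I" "S \<cdot> e = e \<cdot> h_antipode A" "m \<cdot> S = h_antipode B \<cdot> m"
  proof (rule epi_mono_fill_in[OF em(1,2)])
    show "m \<cdot> (e \<cdot> h_antipode A) = (h_antipode B \<cdot> m) \<cdot> e"
      using fm[of "h_antipode A"] hopf_hom_antipode[OF f A B] A B ea ma em(3,4) ed by simp
  qed (use A B ea ma em(3) ed in simp_all)
  define E where "E = \<lparr>h_obj = ?I, h_mult = mu, h_unit = e \<cdot> h_unit A, h_comult = d,
    h_counit = h_counit B \<cdot> m, h_antipode = S\<rparr>"
  note sub = mu(1,3) d(1,3) S(1,3) em(3) ea ma ed A B fs(6) fm[of "h_unit A"]
  have E: "chopf E"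
    by (rule chopf_sub(1)[OF B em(2)]) (use sub in \<open>simp_all add: E_def\<close>)
  have m: "hopf_hom M E B m"
    by (rule chopf_sub(2)[OF B em(2)]) (use sub in \<open>simp_all add: E_def\<close>)
  have "hopf_hom M A E e"
    by (rule hopf_hom_lift[OF m em(2)]) (use ea ed em(4) f A B E in \<open>simp_all add: E_def\<close>)
  then show thesis
    using that E m em by blast
qed

end

section \<open>Equalizers and cotensor products\<close>

context preadditive_category
begin

lemma additive_functor_zero:
  assumes "additive_functor C C F" "A \<in> Ob C" "B \<in> Ob C"
  shows "FA F (\<zero> A B) = \<zero> (FO F A) (FO F B)"
proof -
  have F: "FA F (\<zero> A B) \<in> Hom C (FO F A) (FO F B)"
    using assms zero_simps[OF assms(2,3)] unfolding additive_functor_def is_functor_def by metis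
  have "parallel C (\<zero> A B) (\<zero> A B)"
    using assms(2,3) by (simp add: parallel_def)
  then have "FA F (\<zero> A B) \<oplus> FA F (\<zero> A B) = FA F (\<zero> A B \<oplus> \<zero> A B)"
    using assms(1) unfolding additive_functor_def by metis
  also have "\<dots> = \<zero> (FO F A) (FO F B) \<oplus> FA F (\<zero> A B)"
    using F assms(2,3) by simp
  finally show ?thesis
    using F dom_ob[of "FA F (\<zero> A B)"] cod_ob[of "FA F (\<zero> A B)"] by - (rule add_cancel, auto)
qed

end

section \<open>Comodules, graphs and module comonoids induced by morphisms\<close>

context symmetric_monoidal_category
begin

lemma pr2_whiskered:
  assumes C: "coc C" and D: "coc D" and Z: "Z \<in> Ob M"
  shows "pr2 C D \<otimes>\<^sub>a \<i> Z = del (co_counit C) (co_obj D \<otimes>\<^sub>o Z) \<cdot> \<a> (co_obj C) (co_obj D) Z"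
proof -
  have "pr2 C D \<otimes>\<^sub>a \<i> Z = (\<l> (co_obj D) \<otimes>\<^sub>a \<i> Z) \<cdot> ((co_counit C \<otimes>\<^sub>a \<i> (co_obj D)) \<otimes>\<^sub>a \<i> Z)"
    using assms by (simp add: pr2_def)
  then show ?thesis
    using assms by (simp add: lunit_tensor[symmetric] del_def naturality)
qed

lemma pr2_comult:
  assumes C: "coc C" and D: "coc D"
  shows "(pr2 C D \<otimes>\<^sub>a \<i> (co_obj C \<otimes>\<^sub>o co_obj D)) \<cdot> co_comult (C \<boxtimes> D)
    = swap (co_obj C) (co_obj D) (co_obj D) \<cdot> (\<i> (co_obj C) \<otimes>\<^sub>a co_comult D)"
proof -
  let ?A = "co_obj C" and ?B = "co_obj D"
  have "(pr2 C D \<otimes>\<^sub>a \<i> (?A \<otimes>\<^sub>o ?B)) \<cdot> co_comult (C \<boxtimes> D)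
    = (del (co_counit C) (?B \<otimes>\<^sub>o (?A \<otimes>\<^sub>o ?B)) \<cdot> (\<i> ?A \<otimes>\<^sub>a (swap ?A ?B ?B \<cdot> (\<i> ?A \<otimes>\<^sub>a co_comult D)))) \<cdot>
      dup ?A (co_comult C) ?B"
    using assms by (simp add: pr2_whiskered tensor_comult_nested)
  also have "\<dots> = (swap ?A ?B ?B \<cdot> (\<i> ?A \<otimes>\<^sub>a co_comult D)) \<cdot> (del (co_counit C) (?A \<otimes>\<^sub>o ?B) \<cdot> dup ?A (co_comult C) ?B)"
    using assms by (simp add: del_nat del: whisker_left_comp)
  finally show ?thesis
    using assms by (simp add: coc_laws)
qed

text \<open>On elements: if \<open>x\<^sub>1 \<otimes> g(x\<^sub>2) \<otimes> a = x \<otimes> p(a\<^sub>1) \<otimes> a\<^sub>2\<close> then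
  \<open>(x\<^sub>1 \<otimes> a) \<otimes> g(x\<^sub>2) = (x \<otimes> a\<^sub>1) \<otimes> p(a\<^sub>2)\<close>, by cocommutativity.\<close>

lemma cotensor_equalizes:
  assumes X: "coc X" and A: "coc A" and Q: "coc Q" and g: "chom X Q g" and p: "chom A Q p"
    and j: "j \<in> Ar M" "Cod M j = co_obj X \<otimes>\<^sub>o co_obj A"
    and eq: "\<a> (co_obj X) (co_obj Q) (co_obj A) \<cdot> (((\<i> (co_obj X) \<otimes>\<^sub>a g) \<cdot> co_comult X) \<otimes>\<^sub>a \<i> (co_obj A)) \<cdot> j
      = (\<i> (co_obj X) \<otimes>\<^sub>a ((p \<otimes>\<^sub>a \<i> (co_obj A)) \<cdot> co_comult A)) \<cdot> j"
  shows "pair (X \<boxtimes> A) (\<i> (co_obj X \<otimes>\<^sub>o co_obj A)) (g \<cdot> pr1 X A) \<cdot> j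
    = pair (X \<boxtimes> A) (\<i> (co_obj X \<otimes>\<^sub>o co_obj A)) (p \<cdot> pr2 X A) \<cdot> j"
proof -
  let ?X = "co_obj X" and ?A = "co_obj A" and ?Q = "co_obj Q" and ?T = "co_obj X \<otimes>\<^sub>o co_obj A"
  let ?\<Delta> = "co_comult (X \<boxtimes> A)"
  note gs = chomD(1-3)[OF g] and ps = chomD(1-3)[OF p] and T = tensor_coc[OF X A]
  \<comment> \<open>The laws \<open>pr1_comult\<close> and \<open>pr2_comult\<close> evaluate a
    projection on the first copy, whereas the graph applies \<open>f\<close> to the second.
    Cocommutativity of \<open>X \<boxtimes> A\<close> exchanges the copies.\<close>
  have flip: "pair (X \<boxtimes> A) (\<i> ?T) f = \<s> ?Q ?T \<cdot> (f \<otimes>\<^sub>a \<i> ?T) \<cdot> ?\<Delta>"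
    if "f \<in> Ar M" "Dom M f = ?T" "Cod M f = ?Q" for f
  proof -
    have "\<s> ?Q ?T \<cdot> (f \<otimes>\<^sub>a \<i> ?T) \<cdot> ?\<Delta> = (\<i> ?T \<otimes>\<^sub>a f) \<cdot> (\<s> ?T ?T \<cdot> ?\<Delta>)"
      using that X A Q sym_nat[THEN reassoc, of f "\<i> ?T" ?Q ?T ?\<Delta>] by simp
    then show ?thesis
      using coc_sym[OF T] by (simp add: pair_def)
  qed
  have "((g \<cdot> pr1 X A) \<otimes>\<^sub>a \<i> ?T) \<cdot> ?\<Delta> = (g \<otimes>\<^sub>a \<i> ?T) \<cdot> (swap ?X ?X ?A \<cdot> dup ?X (co_comult X) ?A)"
    using gs X A pr1_comult[OF X A] by (simp add: coc_swap_dup)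
  also have "\<dots> = (swap ?X ?Q ?A \<cdot> (\<i> ?X \<otimes>\<^sub>a (g \<otimes>\<^sub>a \<i> ?A))) \<cdot> dup ?X (co_comult X) ?A"
    using gs X A Q by (simp add: swap_nat)
  also have "\<dots> = swap ?X ?Q ?A \<cdot> (\<a> ?X ?Q ?A \<cdot> (((\<i> ?X \<otimes>\<^sub>a g) \<cdot> co_comult X) \<otimes>\<^sub>a \<i> ?A))"
    using gs X A Q by (simp add: dup_def naturality)
  finally have 1: "((g \<cdot> pr1 X A) \<otimes>\<^sub>a \<i> ?T) \<cdot> ?\<Delta>
    = swap ?X ?Q ?A \<cdot> (\<a> ?X ?Q ?A \<cdot> (((\<i> ?X \<otimes>\<^sub>a g) \<cdot> co_comult X) \<otimes>\<^sub>a \<i> ?A))" .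
  have "((p \<cdot> pr2 X A) \<otimes>\<^sub>a \<i> ?T) \<cdot> ?\<Delta> = ((p \<otimes>\<^sub>a \<i> ?T) \<cdot> swap ?X ?A ?A) \<cdot> (\<i> ?X \<otimes>\<^sub>a co_comult A)"
    using ps X A pr2_comult[OF X A] by simp
  also have "(p \<otimes>\<^sub>a \<i> ?T) \<cdot> swap ?X ?A ?A = swap ?X ?Q ?A \<cdot> (\<i> ?X \<otimes>\<^sub>a (p \<otimes>\<^sub>a \<i> ?A))"
    using ps X A Q by (simp add: swap_nat)
  finally have 2: "((p \<cdot> pr2 X A) \<otimes>\<^sub>a \<i> ?T) \<cdot> ?\<Delta>
    = swap ?X ?Q ?A \<cdot> (\<i> ?X \<otimes>\<^sub>a ((p \<otimes>\<^sub>a \<i> ?A) \<cdot> co_comult A))"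
    using ps X A Q by simp
  have "pair (X \<boxtimes> A) (\<i> ?T) (g \<cdot> pr1 X A) \<cdot> j
    = \<s> ?Q ?T \<cdot> swap ?X ?Q ?A \<cdot>
      (\<a> ?X ?Q ?A \<cdot> (((\<i> ?X \<otimes>\<^sub>a g) \<cdot> co_comult X) \<otimes>\<^sub>a \<i> ?A) \<cdot> j)"
    using gs X A Q j by (subst flip, simp_all only: 1) simp_all
  also have "\<dots> = pair (X \<boxtimes> A) (\<i> ?T) (p \<cdot> pr2 X A) \<cdot> j"
    unfolding eq using ps X A Q j by (subst flip, simp_all only: 2) simp_all
  finally show ?thesis .
qed

text \<open>The coaction is \<open>c \<mapsto> c1 \<otimes> f(c2)\<close>, the comultiplication of
  \<open>C\<close> pushed forward along \<open>f\<close>. All coactions to which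
  \<open>coflat_epic\<close> is applied are of this kind, except the one on the kernel of
  \<open>\<pi>\<close>.\<close>

lemma right_comodule_of_chom:
  assumes C: "coc C" and D: "coc D" and f: "chom C D f"
  shows "is_right_comodule M (co_obj D) (co_comult D) (co_counit D) (co_obj C) ((\<i> (co_obj C) \<otimes>\<^sub>a f) \<cdot> co_comult C)"
proof -
  let ?C = "co_obj C" and ?D = "co_obj D" and ?d = "co_comult C"
  note fs = chomD[OF f]
  have "(((\<i> ?C \<otimes>\<^sub>a f) \<cdot> ?d) \<otimes>\<^sub>a \<i> ?D) \<cdot> (\<i> ?C \<otimes>\<^sub>a f) = ((\<i> ?C \<otimes>\<^sub>a f) \<otimes>\<^sub>a f) \<cdot> (?d \<otimes>\<^sub>a \<i> ?C)"
    using C D fs(1-3) by (simp add: tensor_comp_tensor del: whisker_right_comp)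
  then have "\<a> ?C ?D ?D \<cdot> (((\<i> ?C \<otimes>\<^sub>a f) \<cdot> ?d) \<otimes>\<^sub>a \<i> ?D) \<cdot> ((\<i> ?C \<otimes>\<^sub>a f) \<cdot> ?d)
    = \<a> ?C ?D ?D \<cdot> (((\<i> ?C \<otimes>\<^sub>a f) \<otimes>\<^sub>a f) \<cdot> (?d \<otimes>\<^sub>a \<i> ?C)) \<cdot> ?d"
    using C D fs(1-3) reassoc[of "((\<i> ?C \<otimes>\<^sub>a f) \<cdot> ?d) \<otimes>\<^sub>a \<i> ?D" "\<i> ?C \<otimes>\<^sub>a f" _ ?d]
    by (simp del: whisker_right_comp)
  also have "\<dots> = (\<i> ?C \<otimes>\<^sub>a (f \<otimes>\<^sub>a f)) \<cdot> (dup ?C ?d ?C \<cdot> ?d)"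
    using C D fs(1-3) assoc_nat[THEN reassoc, of "\<i> ?C" f f ?C ?D ?D] by (simp add: dup_def)
  also have "\<dots> = (\<i> ?C \<otimes>\<^sub>a ((f \<otimes>\<^sub>a f) \<cdot> ?d)) \<cdot> ?d"
    unfolding coc_laws(1)[OF C] using C D fs(1-3) by simp
  also have "\<dots> = (\<i> ?C \<otimes>\<^sub>a co_comult D) \<cdot> ((\<i> ?C \<otimes>\<^sub>a f) \<cdot> ?d)"
    unfolding fs(4)[symmetric] using C D fs(1-3) by simp
  finally have 1: "\<a> ?C ?D ?D \<cdot> (((\<i> ?C \<otimes>\<^sub>a f) \<cdot> ?d) \<otimes>\<^sub>a \<i> ?D) \<cdot> ((\<i> ?C \<otimes>\<^sub>a f) \<cdot> ?d)
    = (\<i> ?C \<otimes>\<^sub>a co_comult D) \<cdot> ((\<i> ?C \<otimes>\<^sub>a f) \<cdot> ?d)" .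
  have "\<r> ?C \<cdot> (\<i> ?C \<otimes>\<^sub>a co_counit D) \<cdot> ((\<i> ?C \<otimes>\<^sub>a f) \<cdot> ?d) = \<r> ?C \<cdot> (\<i> ?C \<otimes>\<^sub>a co_counit C) \<cdot> ?d"
    using C D fs(1-3) whisker_left[OF fs(5), THEN reassoc, of ?C ?d] by simp
  then show ?thesis
    unfolding is_right_comodule_def using 1 C D fs(1-3) by (simp add: coc_laws)
qed

text \<open>The graph \<open>x \<mapsto> x\<^sub>1 \<otimes> p(x\<^sub>2)\<close> of \<open>p : P \<rightarrow> A\<close> lands in the cotensor product over \<open>Q\<close>.\<close>

lemma graph_equalizes:
  assumes P: "coc P" and A: "coc A" and Q: "coc Q" and p: "chom P A p" and \<pi>: "chom A Q \<pi>"
  defines "w \<equiv> \<pi> \<cdot> p"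
  shows "\<a> (co_obj P) (co_obj Q) (co_obj A) \<cdot> (((\<i> (co_obj P) \<otimes>\<^sub>a w) \<cdot> co_comult P) \<otimes>\<^sub>a \<i> (co_obj A)) \<cdot>
      ((\<i> (co_obj P) \<otimes>\<^sub>a p) \<cdot> co_comult P)
    = (\<i> (co_obj P) \<otimes>\<^sub>a ((\<pi> \<otimes>\<^sub>a \<i> (co_obj A)) \<cdot> co_comult A)) \<cdot> ((\<i> (co_obj P) \<otimes>\<^sub>a p) \<cdot> co_comult P)"
proof -
  let ?P = "co_obj P" and ?A = "co_obj A" and ?Q = "co_obj Q" and ?d = "co_comult P"
  note ps = chomD[OF p] and pis = chomD(1-3)[OF \<pi>]
  have w: "w \<in> Ar M" "Dom M w = ?P" "Cod M w = ?Q"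
    using ps(1-3) pis by (simp_all add: w_def)
  have "(((\<i> ?P \<otimes>\<^sub>a w) \<cdot> ?d) \<otimes>\<^sub>a \<i> ?A) \<cdot> (\<i> ?P \<otimes>\<^sub>a p) = ((\<i> ?P \<otimes>\<^sub>a w) \<otimes>\<^sub>a p) \<cdot> (?d \<otimes>\<^sub>a \<i> ?P)"
    using P A w ps(1-3) by (simp add: tensor_comp_tensor del: whisker_right_comp)
  then have "\<a> ?P ?Q ?A \<cdot> (((\<i> ?P \<otimes>\<^sub>a w) \<cdot> ?d) \<otimes>\<^sub>a \<i> ?A) \<cdot> ((\<i> ?P \<otimes>\<^sub>a p) \<cdot> ?d)
    = \<a> ?P ?Q ?A \<cdot> (((\<i> ?P \<otimes>\<^sub>a w) \<otimes>\<^sub>a p) \<cdot> (?d \<otimes>\<^sub>a \<i> ?P)) \<cdot> ?d"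
    using P A Q w ps(1-3) reassoc[of "((\<i> ?P \<otimes>\<^sub>a w) \<cdot> ?d) \<otimes>\<^sub>a \<i> ?A" "\<i> ?P \<otimes>\<^sub>a p" _ ?d]
    by (simp del: whisker_right_comp)
  also have "\<dots> = (\<i> ?P \<otimes>\<^sub>a (w \<otimes>\<^sub>a p)) \<cdot> (dup ?P ?d ?P \<cdot> ?d)"
    using P A Q w ps(1-3) assoc_nat[THEN reassoc, of "\<i> ?P" w p ?P ?Q ?A] by (simp add: dup_def)
  also have "\<dots> = (\<i> ?P \<otimes>\<^sub>a ((w \<otimes>\<^sub>a p) \<cdot> ?d)) \<cdot> ?d"
    unfolding coc_laws(1)[OF P] using P A Q w ps(1-3) by simp
  also have "w \<otimes>\<^sub>a p = (\<pi> \<otimes>\<^sub>a \<i> ?A) \<cdot> (p \<otimes>\<^sub>a p)"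
    using A ps(1-3) pis by (simp add: w_def tensor_comp_tensor)
  also have "((\<pi> \<otimes>\<^sub>a \<i> ?A) \<cdot> (p \<otimes>\<^sub>a p)) \<cdot> ?d = (\<pi> \<otimes>\<^sub>a \<i> ?A) \<cdot> (co_comult A \<cdot> p)"
    unfolding ps(4) using P A ps(1-3) pis by simp
  finally show ?thesis
    using P A ps(1-3) pis by simp
qed

text \<open>Faithful coflatness is formulated for quotients of \<open>A\<close> as a module
  comonoid, so \<open>Q\<close> has to be given the action \<open>f(a) q\<close>. Its
  comultiplication is linear because it is multiplicative, \<open>f\<close> preserves
  comultiplications and \<open>interchange\<close> is natural.\<close>

lemma module_comonoid_of_hopf_hom:
  assumes A: "chopf A" and Q: "chopf Q" and f: "hopf_hom M A Q f"
  shows "is_coc_module_comonoid M A \<lparr>q_obj = h_obj Q, q_comult = h_comult Q, q_counit = h_counit Q,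
    q_action = h_mult Q \<cdot> (f \<otimes>\<^sub>a \<i> (h_obj Q))\<rparr>"
proof -
  let ?A = "h_obj A" and ?Q = "h_obj Q" and ?m = "h_mult Q"
  let ?act = "h_mult Q \<cdot> (f \<otimes>\<^sub>a \<i> (h_obj Q))"
  note fs = hopf_homD[OF f] and cQ = chopfD(1)[OF Q]
  have coc: "is_comonoid M ?Q (h_comult Q) (h_counit Q)" "cocommutative M ?Q (h_comult Q)"
    using cQ by (simp_all add: coc_def)
  have "?act \<cdot> (h_mult A \<otimes>\<^sub>a \<i> ?Q) = ?m \<cdot> ((f \<cdot> h_mult A) \<otimes>\<^sub>a \<i> ?Q)"
    using A Q fs(2-4) by simp
  also have "\<dots> = (?m \<cdot> (?m \<otimes>\<^sub>a \<i> ?Q)) \<cdot> ((f \<otimes>\<^sub>a f) \<otimes>\<^sub>a \<i> ?Q)"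
    unfolding fs(5) using A Q fs(2-4) by simp
  also have "\<dots> = ?m \<cdot> ((\<i> ?Q \<otimes>\<^sub>a ?m) \<cdot> (f \<otimes>\<^sub>a (f \<otimes>\<^sub>a \<i> ?Q))) \<cdot> \<a> ?A ?A ?Q"
    unfolding chopfD(4)[OF Q] using A Q fs(2-4) by (simp add: naturality)
  also have "(\<i> ?Q \<otimes>\<^sub>a ?m) \<cdot> (f \<otimes>\<^sub>a (f \<otimes>\<^sub>a \<i> ?Q)) = (f \<otimes>\<^sub>a \<i> ?Q) \<cdot> (\<i> ?A \<otimes>\<^sub>a ?act)"
    using A Q fs(2-4) by (simp add: tensor_comp_tensor del: whisker_left_comp)
  finally have act_mult: "?act \<cdot> (h_mult A \<otimes>\<^sub>a \<i> ?Q) = ?act \<cdot> (\<i> ?A \<otimes>\<^sub>a ?act) \<cdot> \<a> ?A ?A ?Q"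
    using A Q fs(2-4) by simp
  have "?act \<cdot> (h_unit A \<otimes>\<^sub>a \<i> ?Q) = ?m \<cdot> ((f \<cdot> h_unit A) \<otimes>\<^sub>a \<i> ?Q)"
    using A Q fs(2-4) by simp
  then have act_unit: "?act \<cdot> (h_unit A \<otimes>\<^sub>a \<i> ?Q) = \<l> ?Q"
    unfolding fs(6) chopfD(5)[OF Q] .
  have comult: "h_comult Q \<cdot> ?act = diagonal_action M A ?Q ?act \<cdot> (\<i> ?A \<otimes>\<^sub>a h_comult Q)"
  proof -
    let ?I = "interchange M ?Q ?Q ?Q ?Q" and ?J = "interchange M ?A ?A ?Q ?Q"
    have "h_comult Q \<cdot> ?act = (h_comult Q \<cdot> ?m) \<cdot> (f \<otimes>\<^sub>a \<i> ?Q)"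
      using A Q fs(2-4) by simp
    also have "\<dots> = (?m \<otimes>\<^sub>a ?m) \<cdot> ?I \<cdot> ((h_comult Q \<cdot> f) \<otimes>\<^sub>a h_comult Q)"
      using chomD(4)[OF chopfD(2)[OF Q]] A Q fs(2-4)
      by (simp add: tensor_comult tensor_comp_tensor)
    also have "(h_comult Q \<cdot> f) \<otimes>\<^sub>a h_comult Q
      = ((f \<otimes>\<^sub>a f) \<otimes>\<^sub>a (\<i> ?Q \<otimes>\<^sub>a \<i> ?Q)) \<cdot> (h_comult A \<otimes>\<^sub>a h_comult Q)"
      unfolding fs(7) using A Q fs(2-4) by (simp add: tensor_comp_tensor)
    also have "(?m \<otimes>\<^sub>a ?m) \<cdot> ?I \<cdot> \<dots>
      = (?m \<otimes>\<^sub>a ?m) \<cdot> (?I \<cdot> ((f \<otimes>\<^sub>a f) \<otimes>\<^sub>a (\<i> ?Q \<otimes>\<^sub>a \<i> ?Q))) \<cdot> (h_comult A \<otimes>\<^sub>a h_comult Q)"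
      using A Q fs(2-4) by simp
    also have "?I \<cdot> ((f \<otimes>\<^sub>a f) \<otimes>\<^sub>a (\<i> ?Q \<otimes>\<^sub>a \<i> ?Q)) = ((f \<otimes>\<^sub>a \<i> ?Q) \<otimes>\<^sub>a (f \<otimes>\<^sub>a \<i> ?Q)) \<cdot> ?J"
      using A Q fs(2-4) by (subst interchange_nat) simp_all
    also have "h_comult A \<otimes>\<^sub>a h_comult Q = (h_comult A \<otimes>\<^sub>a \<i> (?Q \<otimes>\<^sub>o ?Q)) \<cdot> (\<i> ?A \<otimes>\<^sub>a h_comult Q)"
      using A Q by (simp add: tensor_comp_tensor del: tensor_ide)
    also have "(?m \<otimes>\<^sub>a ?m) \<cdot> (((f \<otimes>\<^sub>a \<i> ?Q) \<otimes>\<^sub>a (f \<otimes>\<^sub>a \<i> ?Q)) \<cdot> ?J) \<cdot>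
        ((h_comult A \<otimes>\<^sub>a \<i> (?Q \<otimes>\<^sub>o ?Q)) \<cdot> (\<i> ?A \<otimes>\<^sub>a h_comult Q))
      = ((?m \<otimes>\<^sub>a ?m) \<cdot> ((f \<otimes>\<^sub>a \<i> ?Q) \<otimes>\<^sub>a (f \<otimes>\<^sub>a \<i> ?Q))) \<cdot> ?J \<cdot>
        (h_comult A \<otimes>\<^sub>a \<i> (?Q \<otimes>\<^sub>o ?Q)) \<cdot> (\<i> ?A \<otimes>\<^sub>a h_comult Q)"
      using A Q fs(2-4) by simp
    also have "(?m \<otimes>\<^sub>a ?m) \<cdot> ((f \<otimes>\<^sub>a \<i> ?Q) \<otimes>\<^sub>a (f \<otimes>\<^sub>a \<i> ?Q)) = ?act \<otimes>\<^sub>a ?act"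
      using A Q fs(2-4) by (simp add: tensor_comp_tensor)
    finally show ?thesis
      using A Q fs(2-4) by (simp add: diagonal_action_def)
  qed
  have counit: "h_counit Q \<cdot> ?act = trivial_action M A \<cdot> (\<i> ?A \<otimes>\<^sub>a h_counit Q)"
  proof -
    have "h_counit Q \<cdot> ?act = (h_counit Q \<cdot> ?m) \<cdot> (f \<otimes>\<^sub>a \<i> ?Q)"
      using A Q fs(2-4) by simp
    also have "\<dots> = \<l> \<I> \<cdot> (h_counit A \<otimes>\<^sub>a h_counit Q)"
      using chomD(5)[OF chopfD(2)[OF Q]] A Q fs(2-4,8) by (simp add: tensor_counit tensor_comp_tensor)
    also have "\<dots> = \<r> \<I> \<cdot> (h_counit A \<otimes>\<^sub>a \<i> \<I>) \<cdot> (\<i> ?A \<otimes>\<^sub>a h_counit Q)"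
      using A Q by (simp add: lunit_eq_runit tensor_comp_tensor)
    finally show ?thesis
      using A Q by (simp add: trivial_action_def naturality)
  qed
  show ?thesis
    unfolding is_coc_module_comonoid_def is_left_module_def left_linear_def
    using coc act_mult act_unit comult counit A Q fs(2-4) by simp
qed

lemma quotient_in_Comon_coc:
  assumes A: "chopf A" and Q: "chopf Q" and f: "hopf_hom M A Q f"
  shows "(regular_module_comonoid A, f, \<lparr>q_obj = h_obj Q, q_comult = h_comult Q,
    q_counit = h_counit Q, q_action = h_mult Q \<cdot> (f \<otimes>\<^sub>a \<i> (h_obj Q))\<rparr>) \<in> Ar (Comon_coc M A)"
proof -
  note fs = hopf_homD[OF f]
  \<comment> \<open>The regular action is the case of the identity morphism.\<close>
  have 1: "is_coc_module_comonoid M A (regular_module_comonoid A)"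
    using module_comonoid_of_hopf_hom[OF A A hopf_hom_ide[OF A]] A
    by (simp add: regular_module_comonoid_def)
  have 2: "f \<cdot> h_mult A = (h_mult Q \<cdot> (f \<otimes>\<^sub>a \<i> (h_obj Q))) \<cdot> (\<i> (h_obj A) \<otimes>\<^sub>a f)"
    using fs(2-5) A Q by (simp add: tensor_comp_tensor)
  show ?thesis
    unfolding Comon_coc_def structured_cat_def
    using 1 2 module_comonoid_of_hopf_hom[OF A Q f] f
    by (simp add: regular_module_comonoid_def hopf_hom_def left_linear_def)
qed

end

section \<open>Equalizers of Hopf morphisms\<close>

context abelian_symmetric_monoidal_category
begin

lemma tensor_zero:
  assumes "A \<in> Ob M" "B \<in> Ob M" "X \<in> Ob M"
  shows "\<zero> A B \<otimes>\<^sub>a \<i> X = \<zero> (A \<otimes>\<^sub>o X) (B \<otimes>\<^sub>o X)"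
  using additive_functor_zero[OF tensor_right_additive[OF assms(3)] assms(1,2)]
  by (simp add: tensor_right_def)

lemma tensor_add:
  assumes "f \<in> Hom M A B" "g \<in> Hom M A B" "X \<in> Ob M"
  shows "(f \<oplus> g) \<otimes>\<^sub>a \<i> X = (f \<otimes>\<^sub>a \<i> X) \<oplus> (g \<otimes>\<^sub>a \<i> X)"
proof -
  have "parallel M f g"
    using assms by (simp add: parallel_def)
  then show ?thesis
    using tensor_right_additive[OF assms(3)] unfolding additive_functor_def tensor_right_def by simp
qed

text \<open>With \<open>u(h)\<close> the graph of \<open>h\<close>, coassociativity expresses
  \<open>u(h)\<close> applied to one factor of the comultiplication through \<open>u(h)\<close>
  itself. Hence the comultiplication restricted along \<open>e\<close> has both factors in the
  equalizer of the graphs. All other operations restrict because they are compatible with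
  \<open>f\<close> and \<open>g\<close>.\<close>

lemma hopf_equalizer:
  assumes f: "hopf_hom M A B f" and g: "hopf_hom M A B g" and A: "chopf A" and B: "chopf B"
  obtains E e where "chopf E" "hopf_hom M E A e" "f \<cdot> e = g \<cdot> e"
    "is_equalizer M e (pair (hopf_comonoid A) (\<i> (h_obj A)) f) (pair (hopf_comonoid A) (\<i> (h_obj A)) g)"
proof -
  let ?A = "h_obj A" and ?B = "h_obj B" and ?d = "h_comult A" and ?C = "hopf_comonoid A"
  let ?u = "\<lambda>f. pair (hopf_comonoid A) (\<i> (h_obj A)) f"
  note fs = hopf_homD[OF f] and gs = hopf_homD[OF g]
  note C = chopfD(1)[OF A] and D = chopfD(1)[OF B]
  have u: "?u h \<in> Ar M" "Dom M (?u h) = ?A" "Cod M (?u h) = ?A \<otimes>\<^sub>o ?B" "?u h = (\<i> ?A \<otimes>\<^sub>a h) \<cdot> ?d"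
    "pr2 ?C (hopf_comonoid B) \<cdot> ?u h = h"
    if "hopf_hom M A B h" for h
    using hopf_homD[OF that] C D A chom_ide[OF C] pr2_pair[OF C C D, of h "\<i> ?A"]
    by (simp_all add: pair_def)
  note uf = u[OF f] and ug = u[OF g]
  obtain e where e: "is_equalizer M e (?u f) (?u g)"
    using ex_equalizer[of "?u f" ?A "?A \<otimes>\<^sub>o ?B" "?u g"] uf ug by auto
  note es = equalizer_simps[OF e] and em = equalizer_monic[OF e]
  let ?E = "Dom M e"
  have t: "e \<in> Ar M" "Cod M e = ?A" "?E \<in> Ob M" "?u f \<cdot> e = ?u g \<cdot> e"
    using es uf dom_ob[of e] by simp_all
  \<comment> \<open>The second projection recovers an arrow from its graph, so equality of the
    graphs on \<open>e\<close> implies equality of \<open>f\<close> and \<open>g\<close>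
    there.\<close>
  have "pr2 ?C (hopf_comonoid B) \<cdot> (?u f \<cdot> e) = f \<cdot> e" "pr2 ?C (hopf_comonoid B) \<cdot> (?u g \<cdot> e) = g \<cdot> e"
    using reassoc[OF uf(5), of e] reassoc[OF ug(5), of e] uf(1-3) ug(1-3) t C D by simp_all
  then have fe: "f \<cdot> e = g \<cdot> e"
    unfolding t(4) by simp
  \<comment> \<open>Precomposing a graph with \<open>h\<close> in this way requires \<open>h\<close>
    to be a comonoid morphism; for such \<open>h\<close>, equalizing \<open>f\<close> and
    \<open>g\<close> is enough to equalize the graphs.\<close>
  have lift: "\<exists>k \<in> Hom M (co_obj X) ?E. e \<cdot> k = h"
    if "coc X" "chom X ?C h" "f \<cdot> h = g \<cdot> h" for X h
  proof -
    note hs = chomD(1-3)[OF that(2)]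
    have eq: "?u f \<cdot> h = ?u g \<cdot> h"
      using pair_comp[OF that(2,1) C, of "\<i> ?A" f] pair_comp[OF that(2,1) C, of "\<i> ?A" g]
        A hs fs(2,3) gs(2,3) that(3) by simp
    have "Cod M h = Cod M e"
      using hs t(2) by simp
    then show ?thesis
      unfolding hs(2)[symmetric] by (rule equalizer_lift[OF e hs(1) _ eq]) (rule bexI)
  qed
  \<comment> \<open>By coassociativity the left hand side depends on \<open>h\<close> only through
    \<open>?u h \<cdot> e\<close>, which is the same for \<open>f\<close> and
    \<open>g\<close>.\<close>
  have left: "(\<i> ?A \<otimes>\<^sub>a ?u h) \<cdot> (?d \<cdot> e) = dup ?A ?d ?B \<cdot> (?u h \<cdot> e)" if h: "hopf_hom M A B h" for h
  proof -
    note hs = hopf_homD(2-4)[OF h] and uh = u[OF h]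
    have "(\<i> ?A \<otimes>\<^sub>a ?u h) \<cdot> (?d \<cdot> e) = (\<i> ?A \<otimes>\<^sub>a (\<i> ?A \<otimes>\<^sub>a h)) \<cdot> ((\<i> ?A \<otimes>\<^sub>a ?d) \<cdot> ?d) \<cdot> e"
      unfolding uh(4) using hs A t by simp
    also have "(\<i> ?A \<otimes>\<^sub>a ?d) \<cdot> ?d = dup ?A ?d ?A \<cdot> ?d"
      using coc_laws(1)[OF C] by simp
    also have "(\<i> ?A \<otimes>\<^sub>a (\<i> ?A \<otimes>\<^sub>a h)) \<cdot> (dup ?A ?d ?A \<cdot> ?d) \<cdot> e = (dup ?A ?d ?B \<cdot> (\<i> ?A \<otimes>\<^sub>a h)) \<cdot> ?d \<cdot> e"
      using hs A t by (simp add: dup_nat)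
    also have "\<dots> = dup ?A ?d ?B \<cdot> (?u h \<cdot> e)"
      unfolding uh(4) using hs A B t by simp
    finally show ?thesis .
  qed
  have right: "(?u h \<otimes>\<^sub>a \<i> ?A) \<cdot> (?d \<cdot> e) = \<s> ?A (?A \<otimes>\<^sub>o ?B) \<cdot> ((\<i> ?A \<otimes>\<^sub>a ?u h) \<cdot> (?d \<cdot> e))"
    if h: "hopf_hom M A B h" for h
  proof -
    have "(?u h \<otimes>\<^sub>a \<i> ?A) \<cdot> ((\<s> ?A ?A \<cdot> ?d) \<cdot> e) = \<s> ?A (?A \<otimes>\<^sub>o ?B) \<cdot> ((\<i> ?A \<otimes>\<^sub>a ?u h) \<cdot> (?d \<cdot> e))"
      using u[OF h] A B t sym_nat[THEN reassoc, of "\<i> ?A" "?u h" ?A "?A \<otimes>\<^sub>o ?B" "?d \<cdot> e"] by simp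
    then show ?thesis
      using coc_sym[OF C] by simp
  qed
  \<comment> \<open>Tensoring with \<open>A\<close> preserves the equalizer, so the comultiplication
    first lifts to \<open>A \<otimes> E\<close>, and then, in the next step, to
    \<open>E \<otimes> E\<close>.\<close>
  obtain k where k: "k \<in> Hom M ?E (?A \<otimes>\<^sub>o ?E)" "(\<i> ?A \<otimes>\<^sub>a e) \<cdot> k = ?d \<cdot> e"
  proof (rule equalizer_lift[OF tensor_equalizer(1)[OF e]])
    show "(\<i> ?A \<otimes>\<^sub>a ?u f) \<cdot> (?d \<cdot> e) = (\<i> ?A \<otimes>\<^sub>a ?u g) \<cdot> (?d \<cdot> e)"
      unfolding left[OF f] left[OF g] t(4) ..
  qed (use A t in simp_all)
  obtain d where d: "d \<in> Hom M ?E (?E \<otimes>\<^sub>o ?E)" "(e \<otimes>\<^sub>a \<i> ?E) \<cdot> d = k"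
  proof (rule equalizer_lift[OF tensor_equalizer(2)[OF e]])
    show "(?u f \<otimes>\<^sub>a \<i> ?E) \<cdot> k = (?u g \<otimes>\<^sub>a \<i> ?E) \<cdot> k"
    \<comment> \<open>Whiskering \<open>e\<close> on the other factor brings back the
      comultiplication of \<open>A\<close>, for which \<open>right\<close> and \<open>left\<close>
      apply.\<close>
    proof (rule monic_cancel[OF tensor_monic(1)[OF em]])
      have swap: "(\<i> (?A \<otimes>\<^sub>o ?B) \<otimes>\<^sub>a e) \<cdot> ((?u h \<otimes>\<^sub>a \<i> ?E) \<cdot> k) = (?u h \<otimes>\<^sub>a \<i> ?A) \<cdot> (?d \<cdot> e)"
        if h: "hopf_hom M A B h" for h
        unfolding k(2)[symmetric]
        using u[OF h] A B t k(1) interchange_law[of "?u h" e ?A "?A \<otimes>\<^sub>o ?B" ?E ?A, THEN reassoc, of k]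
        by simp
      show "(\<i> (?A \<otimes>\<^sub>o ?B) \<otimes>\<^sub>a e) \<cdot> ((?u f \<otimes>\<^sub>a \<i> ?E) \<cdot> k) = (\<i> (?A \<otimes>\<^sub>o ?B) \<otimes>\<^sub>a e) \<cdot> ((?u g \<otimes>\<^sub>a \<i> ?E) \<cdot> k)"
        unfolding swap[OF f] swap[OF g] right[OF f] right[OF g] left[OF f] left[OF g] t(4) ..
    qed (use A B t k uf ug in simp_all)
  qed (use A t k in simp_all)
  have de: "?d \<cdot> e = (e \<otimes>\<^sub>a e) \<cdot> d"
  proof -
    have "?d \<cdot> e = ((\<i> ?A \<otimes>\<^sub>a e) \<cdot> (e \<otimes>\<^sub>a \<i> ?E)) \<cdot> d"
      unfolding k(2)[symmetric] d(2)[symmetric] using A t d by simp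
    then show ?thesis
      using A t by (simp add: tensor_comp_tensor)
  qed
  define C' where "C' = \<lparr>co_obj = ?E, co_comult = d, co_counit = h_counit A \<cdot> e\<rparr>"
  have C': "coc C'" "chom C' ?C e"
    using coc_sub[OF C em, of C'] t d(1) de by (simp_all add: C'_def)
  have ob: "co_obj C' = ?E"
    by (simp add: C'_def)
  have m1: "chom (C' \<boxtimes> C') ?C (h_mult A \<cdot> (e \<otimes>\<^sub>a e))"
    by (rule chom_comp[OF chom_tensor[OF C'(2) C'(2)] chopfD(2)[OF A]]) (intro C C' tensor_coc)+
  have m2: "f \<cdot> (h_mult A \<cdot> (e \<otimes>\<^sub>a e)) = g \<cdot> (h_mult A \<cdot> (e \<otimes>\<^sub>a e))"
  proof -
    have "h \<cdot> (h_mult A \<cdot> (e \<otimes>\<^sub>a e)) = h_mult B \<cdot> ((h \<cdot> e) \<otimes>\<^sub>a (h \<cdot> e))" if h: "hopf_hom M A B h" for h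
      using hopf_homD(2-5)[OF h] A B t reassoc[OF hopf_homD(5)[OF h], of "e \<otimes>\<^sub>a e"]
      by (simp add: tensor_comp_tensor)
    from this[OF f] this[OF g] show ?thesis
      unfolding fe by simp
  qed
  obtain mu where mu: "mu \<in> Hom M (?E \<otimes>\<^sub>o ?E) ?E" "e \<cdot> mu = h_mult A \<cdot> (e \<otimes>\<^sub>a e)"
    using lift[OF tensor_coc[OF C'(1) C'(1)] m1 m2] unfolding tensor_comonoid_obj ob by (rule bexE)
  obtain v where v: "v \<in> Hom M \<I> ?E" "e \<cdot> v = h_unit A"
    using lift[OF unit_coc chopfD(3)[OF A]] unfolding fs(6) gs(6) unit_comonoid_simps by blast
  have S1: "chom C' ?C (h_antipode A \<cdot> e)"
    using chom_comp[OF C'(2) chom_antipode[OF A] C'(1) C C] .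
  have S2: "f \<cdot> (h_antipode A \<cdot> e) = g \<cdot> (h_antipode A \<cdot> e)"
  proof -
    have "h \<cdot> (h_antipode A \<cdot> e) = h_antipode B \<cdot> (h \<cdot> e)" if h: "hopf_hom M A B h" for h
      using hopf_homD(2-4)[OF h] A B t reassoc[OF hopf_hom_antipode[OF h A B], of e] by simp
    from this[OF f] this[OF g] show ?thesis
      unfolding fe by simp
  qed
  obtain S where S: "S \<in> Hom M ?E ?E" "e \<cdot> S = h_antipode A \<cdot> e"
    using lift[OF C'(1) S1 S2] unfolding ob by (rule bexE)
  define E where "E = \<lparr>h_obj = ?E, h_mult = mu, h_unit = v, h_comult = d,
    h_counit = h_counit A \<cdot> e, h_antipode = S\<rparr>"
  have E: "chopf E"
    by (rule chopf_sub(1)[OF A em]) (use mu v S d(1) de t in \<open>simp_all add: E_def\<close>)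
  have "hopf_hom M E A e"
    by (rule chopf_sub(2)[OF A em]) (use mu v S d(1) de t in \<open>simp_all add: E_def\<close>)
  then show thesis
    using that E fe e by blast
qed

section \<open>Epimorphisms of comodules and their detection by faithful coflatness\<close>

lemma right_comoduleD:
  assumes "is_right_comodule M Q d e V c"
  shows "V \<in> Ob M" "c \<in> Ar M" "Dom M c = V" "Cod M c = V \<otimes>\<^sub>o Q"
    "\<a> V Q Q \<cdot> (c \<otimes>\<^sub>a \<i> Q) \<cdot> c = (\<i> V \<otimes>\<^sub>a d) \<cdot> c" "\<r> V \<cdot> (\<i> V \<otimes>\<^sub>a e) \<cdot> c = \<i> V"
  using assms by (simp_all add: is_right_comodule_def)

text \<open>The cokernel in \<open>M\<close> of a comodule morphism is again a comodule.\<close>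

lemma comodule_epic:
  assumes Q: "is_comonoid M Q d e"
    and V: "is_right_comodule M Q d e V c" and W: "is_right_comodule M Q d e W c'"
    and f: "f \<in> Hom M V W" "c' \<cdot> f = (f \<otimes>\<^sub>a \<i> Q) \<cdot> c"
    and epic: "epic (Right_comodules M Q d e) ((V, c), f, (W, c'))"
  shows "epic M f"
proof -
  note Qs = is_comonoid_simps[OF Q] and Vs = right_comoduleD[OF V] and Ws = right_comoduleD[OF W]
  obtain q where q: "is_cokernel M q f"
    using has_cokernels f by auto
  note qs = cokernel_simps[OF q] and qe = cokernel_epic[OF q]
  let ?C = "Cod M q"
  have t: "q \<in> Ar M" "Dom M q = W" "?C \<in> Ob M" "f \<in> Ar M" "Dom M f = V" "Cod M f = W"
    using qs f cod_ob[of q] by simp_all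
  have qf: "q \<cdot> f = \<zero> V ?C"
    using qs(4) t by simp
  \<comment> \<open>Colinearity turns this composite into one that contains
    \<open>q \<cdot> f\<close>, which is zero. The coaction of \<open>W\<close> therefore descends
    along \<open>q\<close>.\<close>
  have "((q \<otimes>\<^sub>a \<i> Q) \<cdot> c') \<cdot> f = ((q \<cdot> f) \<otimes>\<^sub>a \<i> Q) \<cdot> c"
    using t Qs Vs Ws f(2) by simp
  also have "\<dots> = \<zero> V (?C \<otimes>\<^sub>o Q)"
    unfolding qf using t Qs Vs by (simp add: tensor_zero)
  finally have eq: "((q \<otimes>\<^sub>a \<i> Q) \<cdot> c') \<cdot> f = \<zero> V (?C \<otimes>\<^sub>o Q)" .
  obtain g where g: "g \<in> Hom M ?C (?C \<otimes>\<^sub>o Q)" "g \<cdot> q = (q \<otimes>\<^sub>a \<i> Q) \<cdot> c'"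
  proof (rule cokernel_desc[OF q])
    show "((q \<otimes>\<^sub>a \<i> Q) \<cdot> c') \<cdot> f = \<zero> (Dom M f) (Cod M ((q \<otimes>\<^sub>a \<i> Q) \<cdot> c'))"
      using eq t Qs Ws by simp
  qed (use t Qs Ws in simp_all)
  have gt: "g \<in> Ar M" "Dom M g = ?C" "Cod M g = ?C \<otimes>\<^sub>o Q"
    using g by simp_all
  have coassoc: "\<a> ?C Q Q \<cdot> (g \<otimes>\<^sub>a \<i> Q) \<cdot> g = (\<i> ?C \<otimes>\<^sub>a d) \<cdot> g"
  proof (rule epic_cancel[OF qe])
    have "(\<a> ?C Q Q \<cdot> (g \<otimes>\<^sub>a \<i> Q) \<cdot> g) \<cdot> q = \<a> ?C Q Q \<cdot> ((g \<otimes>\<^sub>a \<i> Q) \<cdot> (q \<otimes>\<^sub>a \<i> Q)) \<cdot> c'"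
      using t Qs Ws gt g(2) by simp
    also have "(g \<otimes>\<^sub>a \<i> Q) \<cdot> (q \<otimes>\<^sub>a \<i> Q) = ((q \<otimes>\<^sub>a \<i> Q) \<cdot> c') \<otimes>\<^sub>a \<i> Q"
      by (rule whisker_right[OF g(2)]) (use t Qs gt in simp_all)
    also have "\<a> ?C Q Q \<cdot> \<dots> \<cdot> c' = (q \<otimes>\<^sub>a \<i> (Q \<otimes>\<^sub>o Q)) \<cdot> (\<a> W Q Q \<cdot> (c' \<otimes>\<^sub>a \<i> Q) \<cdot> c')"
      using t Qs Ws(1-4) by (simp add: naturality)
    also have "\<dots> = ((q \<otimes>\<^sub>a \<i> (Q \<otimes>\<^sub>o Q)) \<cdot> (\<i> W \<otimes>\<^sub>a d)) \<cdot> c'"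
      unfolding Ws(5) using t Qs Ws(1-4) by simp
    also have "(q \<otimes>\<^sub>a \<i> (Q \<otimes>\<^sub>o Q)) \<cdot> (\<i> W \<otimes>\<^sub>a d) = (\<i> ?C \<otimes>\<^sub>a d) \<cdot> (q \<otimes>\<^sub>a \<i> Q)"
      using t Qs Ws(1) by (simp add: tensor_comp_tensor del: tensor_ide)
    also have "\<dots> \<cdot> c' = ((\<i> ?C \<otimes>\<^sub>a d) \<cdot> g) \<cdot> q"
      using t Qs Ws(1-4) gt g(2) by simp
    finally show "(\<a> ?C Q Q \<cdot> (g \<otimes>\<^sub>a \<i> Q) \<cdot> g) \<cdot> q = ((\<i> ?C \<otimes>\<^sub>a d) \<cdot> g) \<cdot> q" .
  qed (use t Qs gt in simp_all)
  have counit: "\<r> ?C \<cdot> (\<i> ?C \<otimes>\<^sub>a e) \<cdot> g = \<i> ?C"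
  proof (rule epic_cancel[OF qe])
    have "(\<r> ?C \<cdot> (\<i> ?C \<otimes>\<^sub>a e) \<cdot> g) \<cdot> q = \<r> ?C \<cdot> ((\<i> ?C \<otimes>\<^sub>a e) \<cdot> (q \<otimes>\<^sub>a \<i> Q)) \<cdot> c'"
      using t Qs Ws(1-4) gt g(2) by simp
    also have "(\<i> ?C \<otimes>\<^sub>a e) \<cdot> (q \<otimes>\<^sub>a \<i> Q) = (q \<otimes>\<^sub>a \<i> \<I>) \<cdot> (\<i> W \<otimes>\<^sub>a e)"
      using t Qs Ws(1) by (simp add: tensor_comp_tensor)
    also have "\<r> ?C \<cdot> ((q \<otimes>\<^sub>a \<i> \<I>) \<cdot> (\<i> W \<otimes>\<^sub>a e)) \<cdot> c' = q \<cdot> (\<r> W \<cdot> (\<i> W \<otimes>\<^sub>a e) \<cdot> c')"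
      using t Qs Ws(1-4) by (simp add: naturality)
    finally show "(\<r> ?C \<cdot> (\<i> ?C \<otimes>\<^sub>a e) \<cdot> g) \<cdot> q = \<i> ?C \<cdot> q"
      unfolding Ws(6) using t by simp
  qed (use t Qs gt in simp_all)
  have C: "is_right_comodule M Q d e ?C g"
    unfolding is_right_comodule_def using t gt coassoc counit by simp
  let ?R = "Right_comodules M Q d e"
  \<comment> \<open>Both \<open>q\<close> and the zero arrow are colinear and agree after
    \<open>f\<close>. Since \<open>f\<close> is epic among comodules, its cokernel \<open>q\<close>
    in \<open>M\<close> is zero.\<close>
  have "((W, c'), q, (?C, g)) \<in> Hom ?R (W, c') (?C, g)"
    unfolding Hom_def Right_comodules_def structured_cat_def using t C W g(2) by simp
  moreover have "((W, c'), \<zero> W ?C, (?C, g)) \<in> Hom ?R (W, c') (?C, g)"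
    unfolding Hom_def Right_comodules_def structured_cat_def using t C W gt Qs Ws
    by (simp add: tensor_zero)
  moreover have "Comp ?R ((W, c'), q, (?C, g)) ((V, c), f, (W, c'))
    = Comp ?R ((W, c'), \<zero> W ?C, (?C, g)) ((V, c), f, (W, c'))"
    unfolding Right_comodules_def structured_cat_def using t qf Ws by simp
  moreover have "Cod ?R ((V, c), f, (W, c')) = (W, c')"
    by (simp add: Right_comodules_def structured_cat_def)
  ultimately have "((W, c'), q, (?C, g)) = ((W, c'), \<zero> W ?C, (?C, g))"
    using epic unfolding epic_def by metis
  then have q0: "q = \<zero> W ?C"
    by simp
  show ?thesis
  proof (rule epic_if_cokernel_trivial[OF f(1)])
    fix X x
    assume x: "x \<in> Hom M W X" "x \<cdot> f = \<zero> V X"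
    have "\<exists>l \<in> Hom M ?C X. l \<cdot> q = x"
    proof -
      have "x \<in> Ar M" "Dom M x = Dom M q" "x \<cdot> f = \<zero> (Dom M f) (Cod M x)" and X: "Cod M x = X"
        using x t by simp_all
      then show ?thesis
        using cokernel_desc[OF q] by blast
    qed
    then obtain l where l: "l \<in> Hom M ?C X" "l \<cdot> q = x"
      by (rule bexE)
    have "x = l \<cdot> \<zero> W ?C"
      using l(2) arg_cong[OF q0, of "\<lambda>y. l \<cdot> y"] by (rule trans[OF sym])
    then show "x = \<zero> W X"
      using l(1) Ws(1) by simp
  qed
qed

text \<open>The arrow \<open>s\<close> provides a section of \<open>f \<box>\<^sub>Q A\<close>.\<close>

lemma coflat_epic:
  assumes coflat: "faithful_coflatness M" and A: "chopf A" and Q: "chopf Q"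
    and \<pi>: "hopf_hom M A Q \<pi>" "epic M \<pi>"
    and V: "is_right_comodule M (h_obj Q) (h_comult Q) (h_counit Q) V c"
    and W: "is_right_comodule M (h_obj Q) (h_comult Q) (h_counit Q) W c'"
    and f: "f \<in> Hom M V W" "c' \<cdot> f = (f \<otimes>\<^sub>a \<i> (h_obj Q)) \<cdot> c"
    and sect: "\<And>j. is_equalizer M j (\<a> W (h_obj Q) (h_obj A) \<cdot> (c' \<otimes>\<^sub>a \<i> (h_obj A)))
        (\<i> W \<otimes>\<^sub>a ((\<pi> \<otimes>\<^sub>a \<i> (h_obj A)) \<cdot> h_comult A)) \<Longrightarrow>
      \<exists>s. s \<in> Ar M \<and> Cod M s = V \<otimes>\<^sub>o h_obj A \<and> (f \<otimes>\<^sub>a \<i> (h_obj A)) \<cdot> s = j \<and>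
        \<a> V (h_obj Q) (h_obj A) \<cdot> (c \<otimes>\<^sub>a \<i> (h_obj A)) \<cdot> s
          = (\<i> V \<otimes>\<^sub>a ((\<pi> \<otimes>\<^sub>a \<i> (h_obj A)) \<cdot> h_comult A)) \<cdot> s"
  shows "epic M f"
proof -
  let ?A = "h_obj A" and ?Q = "h_obj Q" and ?cA = "(\<pi> \<otimes>\<^sub>a \<i> (h_obj A)) \<cdot> h_comult A"
  let ?R = "Right_comodules M ?Q (h_comult Q) (h_counit Q)" and ?F = "cotensor M ?Q ?A ?cA"
  note pis = hopf_homD(2-4)[OF \<pi>(1)] and Vs = right_comoduleD[OF V] and Ws = right_comoduleD[OF W]
  have cA: "?cA \<in> Ar M" "Dom M ?cA = ?A" "Cod M ?cA = ?Q \<otimes>\<^sub>o ?A"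
    using pis A by simp_all
  have incl: "is_equalizer M (cotensor_incl M ?Q ?A ?cA (U, b))
      (\<a> U ?Q ?A \<cdot> (b \<otimes>\<^sub>a \<i> ?A)) (\<i> U \<otimes>\<^sub>a ?cA)"
    if U: "is_right_comodule M ?Q (h_comult Q) (h_counit Q) U b" for U b
  proof -
    note Us = right_comoduleD[OF U]
    obtain e where "is_equalizer M e (\<a> U ?Q ?A \<cdot> (b \<otimes>\<^sub>a \<i> ?A)) (\<i> U \<otimes>\<^sub>a ?cA)"
      by (rule ex_equalizer[where A = "U \<otimes>\<^sub>o ?A" and B = "U \<otimes>\<^sub>o (?Q \<otimes>\<^sub>o ?A)"
            and f = "\<a> U ?Q ?A \<cdot> (b \<otimes>\<^sub>a \<i> ?A)" and g = "\<i> U \<otimes>\<^sub>a ?cA"])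
        (use Us(1-4) A Q cA pis in auto)
    then show ?thesis
      unfolding cotensor_incl_def prod.case by (rule someI)
  qed
  \<comment> \<open>The embeddings of the cotensor products are fixed by Hilbert choice. For this
    reason the hypothesis \<open>sect\<close> is stated for every equalizer \<open>j\<close>; it is
    applied to \<open>w\<close>.\<close>
  define v where "v = cotensor_incl M ?Q ?A ?cA (V, c)"
  define w where "w = cotensor_incl M ?Q ?A ?cA (W, c')"
  have v: "is_equalizer M v (\<a> V ?Q ?A \<cdot> (c \<otimes>\<^sub>a \<i> ?A)) (\<i> V \<otimes>\<^sub>a ?cA)"
    unfolding v_def by (rule incl[OF V])
  have w: "is_equalizer M w (\<a> W ?Q ?A \<cdot> (c' \<otimes>\<^sub>a \<i> ?A)) (\<i> W \<otimes>\<^sub>a ?cA)"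
    unfolding w_def by (rule incl[OF W])
  note vs = equalizer_simps[OF v] and ws = equalizer_simps[OF w]
  have vt: "v \<in> Ar M" "Cod M v = V \<otimes>\<^sub>o ?A" and wt: "w \<in> Ar M" "Cod M w = W \<otimes>\<^sub>o ?A"
    using vs(1,4) ws(1,4) Vs(1-4) Ws(1-4) A Q by simp_all
  have ft: "f \<in> Ar M" "Dom M f = V" "Cod M f = W"
    using f by simp_all
  have "(\<a> W ?Q ?A \<cdot> (c' \<otimes>\<^sub>a \<i> ?A)) \<cdot> ((f \<otimes>\<^sub>a \<i> ?A) \<cdot> v)
    = \<a> W ?Q ?A \<cdot> ((c' \<cdot> f) \<otimes>\<^sub>a \<i> ?A) \<cdot> v"
    using ft vt Ws(1-4) A Q by simp
  also have "\<dots> = (f \<otimes>\<^sub>a \<i> (?Q \<otimes>\<^sub>o ?A)) \<cdot> ((\<a> V ?Q ?A \<cdot> (c \<otimes>\<^sub>a \<i> ?A)) \<cdot> v)"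
    unfolding f(2) using ft vt Vs(1-4) Ws(1) A Q by (simp add: naturality)
  also have "\<dots> = ((f \<otimes>\<^sub>a \<i> (?Q \<otimes>\<^sub>o ?A)) \<cdot> (\<i> V \<otimes>\<^sub>a ?cA)) \<cdot> v"
    unfolding vs(7) using ft vt Vs(1-4) A Q pis by simp
  also have "(f \<otimes>\<^sub>a \<i> (?Q \<otimes>\<^sub>o ?A)) \<cdot> (\<i> V \<otimes>\<^sub>a ?cA) = (\<i> W \<otimes>\<^sub>a ?cA) \<cdot> (f \<otimes>\<^sub>a \<i> ?A)"
    using ft Vs(1) Ws(1) A Q cA by (simp add: tensor_comp_tensor del: tensor_ide whisker_left_comp)
  finally have eq: "(\<a> W ?Q ?A \<cdot> (c' \<otimes>\<^sub>a \<i> ?A)) \<cdot> ((f \<otimes>\<^sub>a \<i> ?A) \<cdot> v) = (\<i> W \<otimes>\<^sub>a ?cA) \<cdot> ((f \<otimes>\<^sub>a \<i> ?A) \<cdot> v)"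
    using ft vt Ws(1) A Q pis by simp
  \<comment> \<open>The action of \<open>cotensor\<close> on arrows is a definite description, which
    says something only after unique existence is known.\<close>
  have "\<exists>!g. g \<in> Hom M (Dom M v) (Dom M w) \<and> w \<cdot> g = (f \<otimes>\<^sub>a \<i> ?A) \<cdot> v"
  proof (rule equalizer_ex1[OF w _ eq])
    show "(f \<otimes>\<^sub>a \<i> ?A) \<cdot> v \<in> Hom M (Dom M v) (Dom M (\<a> W ?Q ?A \<cdot> (c' \<otimes>\<^sub>a \<i> ?A)))"
      using ft vt Ws(1-4) A Q by simp
  qed
  from theI'[OF this]
  have g: "FA ?F ((V, c), f, (W, c')) \<in> Hom M (Dom M v) (Dom M w)"
    "w \<cdot> FA ?F ((V, c), f, (W, c')) = (f \<otimes>\<^sub>a \<i> ?A) \<cdot> v"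
    unfolding cotensor_def v_def w_def by simp_all
  define g where "g = FA ?F ((V, c), f, (W, c'))"
  have gt: "g \<in> Ar M" "Dom M g = Dom M v" "Cod M g = Dom M w" "w \<cdot> g = (f \<otimes>\<^sub>a \<i> ?A) \<cdot> v"
    using g unfolding g_def by simp_all
  obtain s where s: "s \<in> Ar M" "Cod M s = V \<otimes>\<^sub>o ?A" "(f \<otimes>\<^sub>a \<i> ?A) \<cdot> s = w"
    "\<a> V ?Q ?A \<cdot> (c \<otimes>\<^sub>a \<i> ?A) \<cdot> s = (\<i> V \<otimes>\<^sub>a ?cA) \<cdot> s"
    using sect[OF w] by blast
  \<comment> \<open>\<open>s\<close> satisfies the condition that defines the cotensor product of
    \<open>V\<close> with \<open>A\<close>, so it factors through \<open>v\<close>. The factor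
    \<open>r\<close> is the section of \<open>g\<close>, as is seen after the monomorphism
    \<open>w\<close>.\<close>
  have "(\<a> V ?Q ?A \<cdot> (c \<otimes>\<^sub>a \<i> ?A)) \<cdot> s = (\<i> V \<otimes>\<^sub>a ?cA) \<cdot> s"
    unfolding s(4)[symmetric] using s(1,2) Vs(1-4) A Q by simp
  moreover have "Cod M s = Cod M v"
    using s vt by simp
  ultimately obtain r where r: "r \<in> Hom M (Dom M s) (Dom M v)" "v \<cdot> r = s"
    using equalizer_lift[OF v s(1)] by blast
  have ds: "Dom M s = Dom M w"
    using s ft A comp_simps(2)[OF s(1), of "f \<otimes>\<^sub>a \<i> ?A"] by simp
  have "epic M g"
  proof (rule split_epic)
    show "g \<cdot> r = \<i> (Cod M g)"
    proof (rule monic_cancel[OF equalizer_monic[OF w]])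
      have "w \<cdot> (g \<cdot> r) = ((f \<otimes>\<^sub>a \<i> ?A) \<cdot> v) \<cdot> r"
        unfolding gt(4)[symmetric] using gt(1-3) r(1) wt by simp
      then show "w \<cdot> (g \<cdot> r) = w \<cdot> \<i> (Cod M g)"
        using ft vt r s(3) gt(3) wt A by simp
    qed (use gt r(1) ds wt in simp_all)
  qed (use gt r(1) in simp_all)
  moreover have "reflects_epis ?R M ?F"
  proof -
    have "A \<in> Ob (Hopf_coc M)"
      using A by (simp add: Hopf_coc_def structured_cat_def chopf_def)
    then show ?thesis
      using coflat quotient_in_Comon_coc[OF A Q \<pi>(1)] \<pi>(2)
      unfolding faithful_coflatness_def Let_def by fastforce
  qed
  moreover have "((V, c), f, (W, c')) \<in> Ar ?R"
    unfolding Right_comodules_def structured_cat_def using V W f by simp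
  ultimately have "epic ?R ((V, c), f, (W, c'))"
    unfolding reflects_epis_def g_def by blast
  then show ?thesis
    using comodule_epic[OF _ V W f] coc_comonoid[OF chopfD(1)[OF Q]] by simp
qed

text \<open>The base change of an epimorphism \<open>\<pi> : A \<rightarrow> Q\<close> along \<open>g : X \<rightarrow> Q\<close> becomes split after
  cotensoring with \<open>A\<close>, the section being \<open>(x, a) \<mapsto> (x, a, a)\<close>.\<close>

lemma base_change_epic:
  assumes coflat: "faithful_coflatness M" and A: "chopf A" and Q: "chopf Q" and X: "chopf X" and P: "chopf P"
    and \<pi>: "hopf_hom M A Q \<pi>" "epic M \<pi>" and g: "hopf_hom M X Q g"
    and p: "hopf_hom M P A p" and q: "hopf_hom M P X q" and comm: "g \<cdot> q = \<pi> \<cdot> p"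
    and universal: "\<And>j. is_equalizer M j
        (\<a> (h_obj X) (h_obj Q) (h_obj A) \<cdot> (((\<i> (h_obj X) \<otimes>\<^sub>a g) \<cdot> h_comult X) \<otimes>\<^sub>a \<i> (h_obj A)))
        (\<i> (h_obj X) \<otimes>\<^sub>a ((\<pi> \<otimes>\<^sub>a \<i> (h_obj A)) \<cdot> h_comult A)) \<Longrightarrow>
      \<exists>k \<in> Hom M (Dom M j) (h_obj P). pair (hopf_comonoid P) q p \<cdot> k = j"
  shows "epic M q"
proof (rule coflat_epic[OF coflat A Q \<pi>])
  let ?A = "h_obj A" and ?Q = "h_obj Q" and ?X = "h_obj X" and ?P = "h_obj P" and ?w = "\<pi> \<cdot> p"
  note cA = chopfD(1)[OF A] and cQ = chopfD(1)[OF Q] and cX = chopfD(1)[OF X] and cP = chopfD(1)[OF P]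
  note ps = hopf_homD[OF p] and qs = hopf_homD[OF q] and gs = hopf_homD[OF g] and pis = hopf_homD[OF \<pi>(1)]
  have w: "chom (hopf_comonoid P) (hopf_comonoid Q) ?w"
    by (rule chom_comp[OF ps(1) pis(1) cP cA cQ])
  note ws = chomD(1-3)[OF w, simplified]
  show "is_right_comodule M ?Q (h_comult Q) (h_counit Q) ?P ((\<i> ?P \<otimes>\<^sub>a ?w) \<cdot> h_comult P)"
    using right_comodule_of_chom[OF cP cQ w] by simp
  show "is_right_comodule M ?Q (h_comult Q) (h_counit Q) ?X ((\<i> ?X \<otimes>\<^sub>a g) \<cdot> h_comult X)"
    using right_comodule_of_chom[OF cX cQ gs(1)] by simp
  show "q \<in> Hom M ?P ?X"
    using qs by simp
  \<comment> \<open>\<open>q\<close> is colinear because the coaction of \<open>P\<close> is induced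
    by the common composite \<open>g \<cdot> q = \<pi> \<cdot> p\<close>.\<close>
  have "((\<i> ?X \<otimes>\<^sub>a g) \<cdot> h_comult X) \<cdot> q = ((\<i> ?X \<otimes>\<^sub>a g) \<cdot> (q \<otimes>\<^sub>a q)) \<cdot> h_comult P"
    using X P Q qs(2-4,7) gs(2-4) by simp
  also have "(\<i> ?X \<otimes>\<^sub>a g) \<cdot> (q \<otimes>\<^sub>a q) = (q \<otimes>\<^sub>a \<i> ?Q) \<cdot> (\<i> ?P \<otimes>\<^sub>a (g \<cdot> q))"
    using X P Q qs(2-4) gs(2-4) by (simp add: tensor_comp_tensor del: whisker_left_comp)
  also have "((q \<otimes>\<^sub>a \<i> ?Q) \<cdot> (\<i> ?P \<otimes>\<^sub>a (g \<cdot> q))) \<cdot> h_comult P = (q \<otimes>\<^sub>a \<i> ?Q) \<cdot> ((\<i> ?P \<otimes>\<^sub>a (g \<cdot> q)) \<cdot> h_comult P)"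
    using X P Q qs(2-4) gs(2-4) by simp
  finally show "((\<i> ?X \<otimes>\<^sub>a g) \<cdot> h_comult X) \<cdot> q = (q \<otimes>\<^sub>a \<i> ?Q) \<cdot> ((\<i> ?P \<otimes>\<^sub>a ?w) \<cdot> h_comult P)"
    unfolding comm .
  fix j
  assume j: "is_equalizer M j (\<a> ?X ?Q ?A \<cdot> (((\<i> ?X \<otimes>\<^sub>a g) \<cdot> h_comult X) \<otimes>\<^sub>a \<i> ?A))
    (\<i> ?X \<otimes>\<^sub>a ((\<pi> \<otimes>\<^sub>a \<i> ?A) \<cdot> h_comult A))"
  obtain k where k: "k \<in> Hom M (Dom M j) ?P" "pair (hopf_comonoid P) q p \<cdot> k = j"
    using universal[OF j] by blast
  \<comment> \<open>\<open>k\<close> regards a pair \<open>(x, a)\<close> of the cotensor product as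
    an element of \<open>P\<close>, and the graph of \<open>p\<close> appends another copy of
    \<open>a\<close>; the witness is the composite of the two.\<close>
  let ?graph = "(\<i> ?P \<otimes>\<^sub>a p) \<cdot> h_comult P"
  have "\<a> ?P ?Q ?A \<cdot> (((\<i> ?P \<otimes>\<^sub>a ?w) \<cdot> h_comult P) \<otimes>\<^sub>a \<i> ?A) \<cdot> (?graph \<cdot> k)
    = (\<a> ?P ?Q ?A \<cdot> (((\<i> ?P \<otimes>\<^sub>a ?w) \<cdot> h_comult P) \<otimes>\<^sub>a \<i> ?A) \<cdot> ?graph) \<cdot> k"
    using A P Q ps(2-4) pis(2-4) k(1) by simp
  also have "\<dots> = (\<i> ?P \<otimes>\<^sub>a ((\<pi> \<otimes>\<^sub>a \<i> ?A) \<cdot> h_comult A)) \<cdot> (?graph \<cdot> k)"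
    using graph_equalizes[OF cP cA cQ ps(1) pis(1)] A P Q ps(2-4) pis(2-4) k(1) by simp
  finally have 1: "\<a> ?P ?Q ?A \<cdot> (((\<i> ?P \<otimes>\<^sub>a ?w) \<cdot> h_comult P) \<otimes>\<^sub>a \<i> ?A) \<cdot> (?graph \<cdot> k)
    = (\<i> ?P \<otimes>\<^sub>a ((\<pi> \<otimes>\<^sub>a \<i> ?A) \<cdot> h_comult A)) \<cdot> (?graph \<cdot> k)" .
  have "(q \<otimes>\<^sub>a \<i> ?A) \<cdot> (\<i> ?P \<otimes>\<^sub>a p) = q \<otimes>\<^sub>a p"
    using A P ps(2-4) qs(2-4) by (simp add: tensor_comp_tensor)
  from reassoc[OF this, of "h_comult P \<cdot> k"] have 2: "(q \<otimes>\<^sub>a \<i> ?A) \<cdot> (?graph \<cdot> k) = j"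
    unfolding k(2)[symmetric] using A P ps(2-4) qs(2-4) k(1) by (simp add: pair_def)
  show "\<exists>s. s \<in> Ar M \<and> Cod M s = ?P \<otimes>\<^sub>o ?A \<and> (q \<otimes>\<^sub>a \<i> ?A) \<cdot> s = j \<and>
    \<a> ?P ?Q ?A \<cdot> (((\<i> ?P \<otimes>\<^sub>a ?w) \<cdot> h_comult P) \<otimes>\<^sub>a \<i> ?A) \<cdot> s
      = (\<i> ?P \<otimes>\<^sub>a ((\<pi> \<otimes>\<^sub>a \<i> ?A) \<cdot> h_comult A)) \<cdot> s"
    using 1 2 A P ps(2-4) k(1) by (intro exI[of _ "?graph \<cdot> k"]) simp
qed

section \<open>Pullbacks as cotensor products, kernel pairs and their coequalizers\<close>

text \<open>The last conclusion concerns arbitrary arrows \<open>j\<close> of \<open>M\<close>,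
  since the embedding of a cotensor product is not known to be a comonoid morphism. It holds because
  \<open>P\<close> is an equalizer of graphs in \<open>M\<close>, and by
  \<open>cotensor_equalizes\<close> an arrow into the cotensor product equalizes these
  graphs.\<close>

lemma hopf_pullback:
  assumes g: "hopf_hom M X Q g" and \<pi>: "hopf_hom M A Q \<pi>" and X: "chopf X" and A: "chopf A" and Q: "chopf Q"
  obtains P q p where "chopf P" "hopf_hom M P X q" "hopf_hom M P A p" "g \<cdot> q = \<pi> \<cdot> p"
    "\<And>Y h k. \<lbrakk>chopf Y; hopf_hom M Y X h; hopf_hom M Y A k; g \<cdot> h = \<pi> \<cdot> k\<rbrakk>
      \<Longrightarrow> \<exists>l. hopf_hom M Y P l \<and> q \<cdot> l = h \<and> p \<cdot> l = k"
    "\<And>j. \<lbrakk>j \<in> Ar M; Cod M j = h_obj X \<otimes>\<^sub>o h_obj A;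
      \<a> (h_obj X) (h_obj Q) (h_obj A) \<cdot> (((\<i> (h_obj X) \<otimes>\<^sub>a g) \<cdot> h_comult X) \<otimes>\<^sub>a \<i> (h_obj A)) \<cdot> j
        = (\<i> (h_obj X) \<otimes>\<^sub>a ((\<pi> \<otimes>\<^sub>a \<i> (h_obj A)) \<cdot> h_comult A)) \<cdot> j\<rbrakk>
      \<Longrightarrow> \<exists>k \<in> Hom M (Dom M j) (h_obj P). pair (hopf_comonoid P) q p \<cdot> k = j"
proof -
  let ?T = "prod_hopf X A"
  note cX = chopfD(1)[OF X] and cA = chopfD(1)[OF A] and cQ = chopfD(1)[OF Q]
  note T = chopf_prod[OF X A] and q0 = hopf_hom_pr1[OF X A] and p0 = hopf_hom_pr2[OF X A]
  have ob: "h_obj ?T = h_obj X \<otimes>\<^sub>o h_obj A"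
    by (simp add: prod_hopf_def Let_def)
  obtain P e where P: "chopf P" and e: "hopf_hom M P ?T e"
    and fe: "(g \<cdot> hpr1 X A) \<cdot> e = (\<pi> \<cdot> hpr2 X A) \<cdot> e"
    and eq: "is_equalizer M e (pair (hopf_comonoid ?T) (\<i> (h_obj ?T)) (g \<cdot> hpr1 X A))
      (pair (hopf_comonoid ?T) (\<i> (h_obj ?T)) (\<pi> \<cdot> hpr2 X A))"
    using hopf_equalizer[OF hopf_hom_comp[OF q0 g T X Q] hopf_hom_comp[OF p0 \<pi> T A Q] T Q] by blast
  note es = hopf_homD[OF e] and gs = hopf_homD[OF g] and pis = hopf_homD[OF \<pi>]
  note cT = chopfD(1)[OF T] and cP = chopfD(1)[OF P]
  let ?q = "hpr1 X A \<cdot> e" and ?p = "hpr2 X A \<cdot> e"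
  have q: "hopf_hom M P X ?q" and p: "hopf_hom M P A ?p"
    using hopf_hom_comp[OF e q0 P T X] hopf_hom_comp[OF e p0 P T A] by auto
  have comm: "g \<cdot> ?q = \<pi> \<cdot> ?p"
    using fe es(2-4) gs(2-4) pis(2-4) cX cA ob by simp
  have pair: "pair (hopf_comonoid P) ?q ?p = e"
    using pair_eta[of "hopf_comonoid P" "hopf_comonoid X" "hopf_comonoid A" e] es(1) cP cX cA
    by (simp add: hopf_comonoid_prod_hopf)
  have universal: "\<exists>l. hopf_hom M Y P l \<and> ?q \<cdot> l = h \<and> ?p \<cdot> l = k"
    if Y: "chopf Y" and h: "hopf_hom M Y X h" and k: "hopf_hom M Y A k" and hk: "g \<cdot> h = \<pi> \<cdot> k" for Y h k
  proof -
    let ?z = "pair (hopf_comonoid Y) h k"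
    note z = hopf_hom_pair[OF X A Y h k] and zs = hopf_homD[OF hopf_hom_pair(1)[OF X A Y h k]]
    have gz: "(g \<cdot> hpr1 X A) \<cdot> ?z = (\<pi> \<cdot> hpr2 X A) \<cdot> ?z"
      using z(2,3) zs(2-4) gs(2-4) pis(2-4) cX cA ob hk by simp
    have "pair (hopf_comonoid ?T) (\<i> (h_obj ?T)) (g \<cdot> hpr1 X A) \<cdot> ?z
      = pair (hopf_comonoid ?T) (\<i> (h_obj ?T)) (\<pi> \<cdot> hpr2 X A) \<cdot> ?z"
      using pair_comp[OF zs(1) chopfD(1)[OF Y] cT, of "\<i> (h_obj ?T)" "g \<cdot> hpr1 X A"]
        pair_comp[OF zs(1) chopfD(1)[OF Y] cT, of "\<i> (h_obj ?T)" "\<pi> \<cdot> hpr2 X A"]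
        T X A gz gs(2-4) pis(2-4) cX cA ob by simp
    moreover have "Cod M ?z = Cod M e"
      using zs(4) es(4) by simp
    ultimately obtain l where l: "l \<in> Hom M (Dom M ?z) (Dom M e)" "e \<cdot> l = ?z"
      using equalizer_lift[OF eq zs(2)] by blast
    have lt: "l \<in> Ar M" "Dom M l = h_obj Y" "Cod M l = h_obj P"
      using l(1) zs(3) es(3) by simp_all
    have "hopf_hom M Y P l"
      by (rule hopf_hom_lift[OF e equalizer_monic[OF eq] lt _ Y P T]) (unfold l(2), rule z)
    moreover have "?q \<cdot> l = h" "?p \<cdot> l = k"
      using l(2) lt es(2-4) cX cA ob z(2,3) by simp_all
    ultimately show ?thesis
      by blast
  qed
  have lift: "\<exists>k \<in> Hom M (Dom M j) (h_obj P). pair (hopf_comonoid P) ?q ?p \<cdot> k = j"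
    if j: "j \<in> Ar M" "Cod M j = h_obj X \<otimes>\<^sub>o h_obj A"
      and cot: "\<a> (h_obj X) (h_obj Q) (h_obj A) \<cdot> (((\<i> (h_obj X) \<otimes>\<^sub>a g) \<cdot> h_comult X) \<otimes>\<^sub>a \<i> (h_obj A)) \<cdot> j
        = (\<i> (h_obj X) \<otimes>\<^sub>a ((\<pi> \<otimes>\<^sub>a \<i> (h_obj A)) \<cdot> h_comult A)) \<cdot> j" for j
  proof -
    have "pair (hopf_comonoid ?T) (\<i> (h_obj ?T)) (g \<cdot> hpr1 X A) \<cdot> j
      = pair (hopf_comonoid ?T) (\<i> (h_obj ?T)) (\<pi> \<cdot> hpr2 X A) \<cdot> j"
      using cotensor_equalizes[OF cX cA cQ gs(1) pis(1), of j] j cot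
      by (simp add: hopf_comonoid_prod_hopf ob)
    moreover have "Cod M j = Cod M e"
      using j es(4) ob by simp
    ultimately obtain k where "k \<in> Hom M (Dom M j) (Dom M e)" "e \<cdot> k = j"
      using equalizer_lift[OF eq j(1)] by blast
    then show ?thesis
      unfolding pair es(3) by blast
  qed
  show thesis
    by (rule that[OF P q p comm universal lift])
qed

text \<open>The comodule laws are tested after \<open>k\<close> and after
  \<open>k \<otimes> (Q \<otimes> Q)\<close>, which is monic by exactness.\<close>

lemma comodule_sub:
  assumes Q: "is_comonoid M Q d e" and V: "is_right_comodule M Q d e V c"
    and k: "monic M k" "k \<in> Hom M N V" and b: "b \<in> Hom M N (N \<otimes>\<^sub>o Q)" "(k \<otimes>\<^sub>a \<i> Q) \<cdot> b = c \<cdot> k"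
  shows "is_right_comodule M Q d e N b"
proof -
  note Qs = is_comonoid_simps[OF Q] and Vs = right_comoduleD[OF V]
  have t: "k \<in> Ar M" "Dom M k = N" "Cod M k = V" "b \<in> Ar M" "Dom M b = N" "Cod M b = N \<otimes>\<^sub>o Q" "N \<in> Ob M"
    using k b(1) dom_ob[of b] by simp_all
  have QQ: "Q \<otimes>\<^sub>o Q \<in> Ob M"
    using Qs(1) by simp
  have "\<a> N Q Q \<cdot> (b \<otimes>\<^sub>a \<i> Q) \<cdot> b = (\<i> N \<otimes>\<^sub>a d) \<cdot> b"
  proof (rule monic_cancel[OF tensor_monic(2)[OF k(1) QQ]])
    have "(k \<otimes>\<^sub>a \<i> (Q \<otimes>\<^sub>o Q)) \<cdot> (\<a> N Q Q \<cdot> (b \<otimes>\<^sub>a \<i> Q) \<cdot> b)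
      = \<a> V Q Q \<cdot> (((k \<otimes>\<^sub>a \<i> Q) \<otimes>\<^sub>a \<i> Q) \<cdot> (b \<otimes>\<^sub>a \<i> Q)) \<cdot> b"
      using t Qs(1-7) Vs(1) assoc_nat[THEN reassoc, of k "\<i> Q" "\<i> Q" V Q Q "(b \<otimes>\<^sub>a \<i> Q) \<cdot> b"] by simp
    also have "((k \<otimes>\<^sub>a \<i> Q) \<otimes>\<^sub>a \<i> Q) \<cdot> (b \<otimes>\<^sub>a \<i> Q) = (c \<cdot> k) \<otimes>\<^sub>a \<i> Q"
      by (rule whisker_right[OF b(2)]) (use t Qs(1) in simp_all)
    also have "\<a> V Q Q \<cdot> \<dots> \<cdot> b = \<a> V Q Q \<cdot> (c \<otimes>\<^sub>a \<i> Q) \<cdot> ((k \<otimes>\<^sub>a \<i> Q) \<cdot> b)"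
      using t Qs(1) Vs(1-4) by simp
    also have "\<dots> = (\<a> V Q Q \<cdot> (c \<otimes>\<^sub>a \<i> Q) \<cdot> c) \<cdot> k"
      unfolding b(2) using t Qs(1) Vs(1-4) by simp
    also have "\<dots> = (\<i> V \<otimes>\<^sub>a d) \<cdot> ((k \<otimes>\<^sub>a \<i> Q) \<cdot> b)"
      unfolding Vs(5) b(2) using t Qs(1-7) Vs(1-4) by simp
    also have "\<dots> = ((\<i> V \<otimes>\<^sub>a d) \<cdot> (k \<otimes>\<^sub>a \<i> Q)) \<cdot> b"
      using t Qs(1-7) Vs(1) by simp
    also have "(\<i> V \<otimes>\<^sub>a d) \<cdot> (k \<otimes>\<^sub>a \<i> Q) = (k \<otimes>\<^sub>a \<i> (Q \<otimes>\<^sub>o Q)) \<cdot> (\<i> N \<otimes>\<^sub>a d)"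
      by (rule interchange_law) (use t Qs(1-7) in simp_all)
    finally show "(k \<otimes>\<^sub>a \<i> (Q \<otimes>\<^sub>o Q)) \<cdot> (\<a> N Q Q \<cdot> (b \<otimes>\<^sub>a \<i> Q) \<cdot> b)
      = (k \<otimes>\<^sub>a \<i> (Q \<otimes>\<^sub>o Q)) \<cdot> ((\<i> N \<otimes>\<^sub>a d) \<cdot> b)"
      using t Qs(1-7) by simp
  qed (use t Qs(1-7) in simp_all)
  moreover have "\<r> N \<cdot> (\<i> N \<otimes>\<^sub>a e) \<cdot> b = \<i> N"
  proof (rule monic_cancel[OF k(1)])
    have "k \<cdot> (\<r> N \<cdot> (\<i> N \<otimes>\<^sub>a e) \<cdot> b) = \<r> V \<cdot> ((k \<otimes>\<^sub>a \<i> \<I>) \<cdot> (\<i> N \<otimes>\<^sub>a e)) \<cdot> b"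
      using t Qs(1-7) Vs(1) runit_nat[THEN reassoc, of k V "(\<i> N \<otimes>\<^sub>a e) \<cdot> b"] by simp
    also have "(k \<otimes>\<^sub>a \<i> \<I>) \<cdot> (\<i> N \<otimes>\<^sub>a e) = (\<i> V \<otimes>\<^sub>a e) \<cdot> (k \<otimes>\<^sub>a \<i> Q)"
      by (rule interchange_law[symmetric]) (use t Qs(1-7) in simp_all)
    also have "\<r> V \<cdot> \<dots> \<cdot> b = \<r> V \<cdot> (\<i> V \<otimes>\<^sub>a e) \<cdot> ((k \<otimes>\<^sub>a \<i> Q) \<cdot> b)"
      using t Qs(1-7) Vs(1) by simp
    also have "\<dots> = (\<r> V \<cdot> (\<i> V \<otimes>\<^sub>a e) \<cdot> c) \<cdot> k"
      unfolding b(2) using t Qs(1-7) Vs(1-4) by simp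
    finally show "k \<cdot> (\<r> N \<cdot> (\<i> N \<otimes>\<^sub>a e) \<cdot> b) = k \<cdot> \<i> N"
      unfolding Vs(6) using t Vs(1) by simp
  qed (use t Qs(1-7) in simp_all)
  ultimately show ?thesis
    unfolding is_right_comodule_def using t by simp
qed

text \<open>For the kernel pair \<open>p\<^sub>1, p\<^sub>2\<close> of \<open>\<pi>\<close>, the corestriction \<open>d'\<close> of \<open>p\<^sub>1 - p\<^sub>2\<close> to the kernel \<open>k\<close> of
  \<open>\<pi>\<close> is an epimorphism: after cotensoring with \<open>A\<close> it has the section \<open>(x, a) \<mapsto> (x, a, a)\<close>, because
  the second summand \<open>(a, a)\<close> vanishes on the kernel.\<close>

lemma kernel_pair_coequalizer:
  assumes coflat: "faithful_coflatness M" and A: "chopf A" and Q: "chopf Q"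
    and \<pi>: "hopf_hom M A Q \<pi>" "epic M \<pi>"
  obtains P p1 p2 where "chopf P" "hopf_hom M P A p1" "hopf_hom M P A p2" "\<pi> \<cdot> p1 = \<pi> \<cdot> p2"
    "\<And>h. \<lbrakk>h \<in> Ar M; Dom M h = h_obj A; h \<cdot> p1 = h \<cdot> p2\<rbrakk> \<Longrightarrow> \<exists>l \<in> Hom M (h_obj Q) (Cod M h). l \<cdot> \<pi> = h"
proof -
  let ?A = "h_obj A" and ?Q = "h_obj Q"
  obtain P p1 p2 where P: "chopf P" and p1: "hopf_hom M P A p1" and p2: "hopf_hom M P A p2"
    and comm: "\<pi> \<cdot> p1 = \<pi> \<cdot> p2"
    and lift: "\<And>j. \<lbrakk>j \<in> Ar M; Cod M j = ?A \<otimes>\<^sub>o ?A;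
      \<a> ?A ?Q ?A \<cdot> (((\<i> ?A \<otimes>\<^sub>a \<pi>) \<cdot> h_comult A) \<otimes>\<^sub>a \<i> ?A) \<cdot> j = (\<i> ?A \<otimes>\<^sub>a ((\<pi> \<otimes>\<^sub>a \<i> ?A) \<cdot> h_comult A)) \<cdot> j\<rbrakk>
      \<Longrightarrow> \<exists>k \<in> Hom M (Dom M j) (h_obj P). pair (hopf_comonoid P) p1 p2 \<cdot> k = j"
    using hopf_pullback[OF \<pi>(1) \<pi>(1) A A Q] by metis
  let ?P = "h_obj P" and ?dP = "h_comult P"
  note cA = chopfD(1)[OF A] and cQ = chopfD(1)[OF Q] and cP = chopfD(1)[OF P]
  note pis = hopf_homD[OF \<pi>(1)] and p1s = hopf_homD[OF p1] and p2s = hopf_homD[OF p2]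
  obtain k where k: "is_kernel M k \<pi>"
    using has_kernels pis(2) by blast
  note ks = kernel_simps[OF k] and km = kernel_monic[OF k]
  let ?N = "Dom M k"
  have kt: "k \<in> Ar M" "Cod M k = ?A" "?N \<in> Ob M" "\<pi> \<cdot> k = \<zero> ?N ?Q"
    using ks pis(3,4) dom_ob[of k] by simp_all
  \<comment> \<open>\<open>d\<close> stands for \<open>p1 - p2\<close>. Vanishing on
    \<open>d\<close> and equalizing the kernel pair thereby become the same condition.\<close>
  obtain d where d: "d \<in> Hom M ?P ?A" "d \<oplus> p2 = p1"
    using ex_difference[of p1 ?P ?A p2] p1s(2-4) p2s(2-4) by auto
  have dt: "d \<in> Ar M" "Dom M d = ?P" "Cod M d = ?A"
    using d by simp_all
  have diff: "x \<cdot> d = \<zero> ?P Y \<longleftrightarrow> x \<cdot> p1 = x \<cdot> p2" if "x \<in> Hom M ?A Y" for x Y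
    using comp_difference_eq_zero_iff[OF d(1) _ that, of p2] p2s(2-4) d(2) by simp
  have "\<pi> \<cdot> d = \<zero> ?P ?Q"
    using diff[of \<pi> ?Q] comm pis(2-4) by simp
  then obtain d' where d': "d' \<in> Hom M (Dom M d) ?N" "k \<cdot> d' = d"
    using kernel_lift[OF k dt(1)] dt kt pis(4) by (metis (no_types))
  have dt': "d' \<in> Ar M" "Dom M d' = ?P" "Cod M d' = ?N"
    using d' dt by simp_all
  let ?cA = "(\<i> ?A \<otimes>\<^sub>a \<pi>) \<cdot> h_comult A" and ?w = "\<pi> \<cdot> p2"
  let ?cP = "(\<i> ?P \<otimes>\<^sub>a (\<pi> \<cdot> p2)) \<cdot> h_comult P" and ?c = "(\<pi> \<otimes>\<^sub>a \<i> ?A) \<cdot> h_comult A"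
  have cAt: "?cA \<in> Ar M" "Dom M ?cA = ?A" "Cod M ?cA = ?A \<otimes>\<^sub>o ?Q"
    and cPt: "?cP \<in> Ar M" "Dom M ?cP = ?P" "Cod M ?cP = ?P \<otimes>\<^sub>o ?Q"
    and ct: "?c \<in> Ar M" "Dom M ?c = ?A" "Cod M ?c = ?Q \<otimes>\<^sub>o ?A"
    using A P Q pis(2-4) p2s(2-4) by simp_all
  have comodA: "is_right_comodule M ?Q (h_comult Q) (h_counit Q) ?A ?cA"
    using right_comodule_of_chom[OF cA cQ pis(1)] by simp
  have comodP: "is_right_comodule M ?Q (h_comult Q) (h_counit Q) ?P ?cP"
    using right_comodule_of_chom[OF cP cQ chom_comp[OF p2s(1) pis(1) cP cA cQ]] by simp
  have kQ: "is_kernel M (k \<otimes>\<^sub>a \<i> ?Q) (\<pi> \<otimes>\<^sub>a \<i> ?Q)"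
    using exact_functor_kernel[OF tensor_right_exact k, of ?Q] Q by (simp add: tensor_right_def)
  \<comment> \<open>The kernel is a subcomodule: \<open>\<pi>\<close> on both factors of the
    comultiplication is the comultiplication of \<open>Q\<close> after \<open>\<pi>\<close>, which
    vanishes on \<open>k\<close>.\<close>
  have "(\<pi> \<otimes>\<^sub>a \<i> ?Q) \<cdot> (?cA \<cdot> k) = ((\<pi> \<otimes>\<^sub>a \<pi>) \<cdot> h_comult A) \<cdot> k"
  proof -
    have "(\<pi> \<otimes>\<^sub>a \<i> ?Q) \<cdot> (\<i> ?A \<otimes>\<^sub>a \<pi>) = \<pi> \<otimes>\<^sub>a \<pi>"
      using A Q pis(2-4) by (simp add: tensor_comp_tensor)
    from reassoc[OF this, of "h_comult A \<cdot> k"] show ?thesis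
      using A Q pis(2-4) kt by simp
  qed
  also have "\<dots> = h_comult Q \<cdot> (\<pi> \<cdot> k)"
    unfolding pis(7)[symmetric] using A Q pis(2-4) kt by simp
  also have "\<dots> = \<zero> ?N (?Q \<otimes>\<^sub>o ?Q)"
    unfolding kt(4) using Q kt by simp
  finally have pick: "(\<pi> \<otimes>\<^sub>a \<i> ?Q) \<cdot> (?cA \<cdot> k) = \<zero> ?N (?Q \<otimes>\<^sub>o ?Q)" .
  obtain b where b: "b \<in> Hom M ?N (?N \<otimes>\<^sub>o ?Q)" "(k \<otimes>\<^sub>a \<i> ?Q) \<cdot> b = ?cA \<cdot> k"
  proof (rule kernel_lift[OF kQ])
    show "(\<pi> \<otimes>\<^sub>a \<i> ?Q) \<cdot> (?cA \<cdot> k) = \<zero> (Dom M (?cA \<cdot> k)) (Cod M (\<pi> \<otimes>\<^sub>a \<i> ?Q))"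
      unfolding pick using A Q pis(2-4) kt by simp
  qed (use A Q pis(2-4) kt in simp_all)
  have bt: "b \<in> Ar M" "Dom M b = ?N" "Cod M b = ?N \<otimes>\<^sub>o ?Q"
    using b by simp_all
  have comodN: "is_right_comodule M ?Q (h_comult Q) (h_counit Q) ?N b"
    using comodule_sub[OF _ comodA km _ b] coc_comonoid[OF cQ] kt by simp
  \<comment> \<open>\<open>p1\<close> and \<open>p2\<close> are colinear for one and the same
    coaction on \<open>P\<close>, because their composites with \<open>\<pi>\<close> agree. Their
    difference is then colinear too.\<close>
  have colin: "?cA \<cdot> p = (p \<otimes>\<^sub>a \<i> ?Q) \<cdot> ?cP" if p: "hopf_hom M P A p" and "\<pi> \<cdot> p = ?w" for p
  proof -
    note ps = hopf_homD[OF p]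
    have "(\<i> ?A \<otimes>\<^sub>a \<pi>) \<cdot> (p \<otimes>\<^sub>a p) = (p \<otimes>\<^sub>a \<i> ?Q) \<cdot> (\<i> ?P \<otimes>\<^sub>a ?w)"
      unfolding that(2)[symmetric] using A P Q pis(2-4) ps(2-4)
      by (simp add: tensor_comp_tensor del: whisker_left_comp)
    from reassoc[OF this, of "h_comult P"] show ?thesis
      using A P Q pis(2-4) ps(2-4,7) p2s(2-4) by simp
  qed
  have add_tensor: "(d \<otimes>\<^sub>a \<i> Z) \<cdot> x \<oplus> (p2 \<otimes>\<^sub>a \<i> Z) \<cdot> x = (p1 \<otimes>\<^sub>a \<i> Z) \<cdot> x"
    if x: "x \<in> Hom M J (?P \<otimes>\<^sub>o Z)" and Z: "Z \<in> Ob M" for x J Z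
  proof -
    have "(p1 \<otimes>\<^sub>a \<i> Z) \<cdot> x = ((d \<otimes>\<^sub>a \<i> Z) \<oplus> (p2 \<otimes>\<^sub>a \<i> Z)) \<cdot> x"
      unfolding d(2)[symmetric] using tensor_add[OF d(1) _ Z, of p2] p2s(2-4) by simp
    also have "\<dots> = (d \<otimes>\<^sub>a \<i> Z) \<cdot> x \<oplus> (p2 \<otimes>\<^sub>a \<i> Z) \<cdot> x"
      by (rule comp_add_left[OF x, where D = "?A \<otimes>\<^sub>o Z"]) (use dt p2s(2-4) Z in simp_all)
    finally show ?thesis ..
  qed
  have cAd: "?cA \<cdot> d = (d \<otimes>\<^sub>a \<i> ?Q) \<cdot> ?cP"
  proof (rule add_cancel[where h = "?cA \<cdot> p2" and A = ?P and B = "?A \<otimes>\<^sub>o ?Q"])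
    have "?cA \<cdot> d \<oplus> ?cA \<cdot> p2 = ?cA \<cdot> p1"
      unfolding d(2)[symmetric]
      by (rule comp_add_right[symmetric, where A = ?P and B = ?A and D = "?A \<otimes>\<^sub>o ?Q"])
        (use dt p2s(2-4) cAt in simp_all)
    also have "\<dots> = (p1 \<otimes>\<^sub>a \<i> ?Q) \<cdot> ?cP"
      by (rule colin[OF p1 comm])
    also have "\<dots> = (d \<otimes>\<^sub>a \<i> ?Q) \<cdot> ?cP \<oplus> (p2 \<otimes>\<^sub>a \<i> ?Q) \<cdot> ?cP"
      by (rule add_tensor[symmetric, where J = ?P]) (use cPt Q in simp_all)
    also have "(p2 \<otimes>\<^sub>a \<i> ?Q) \<cdot> ?cP = ?cA \<cdot> p2"
      by (rule colin[OF p2 refl, symmetric])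
    finally show "?cA \<cdot> d \<oplus> ?cA \<cdot> p2 = (d \<otimes>\<^sub>a \<i> ?Q) \<cdot> ?cP \<oplus> ?cA \<cdot> p2" .
  qed (use dt cAt cPt p2s(2-4) Q in simp_all)
  have bd': "b \<cdot> d' = (d' \<otimes>\<^sub>a \<i> ?Q) \<cdot> ?cP"
  proof (rule monic_cancel[OF kernel_monic[OF kQ]])
    have "(k \<otimes>\<^sub>a \<i> ?Q) \<cdot> (b \<cdot> d') = ((k \<otimes>\<^sub>a \<i> ?Q) \<cdot> b) \<cdot> d'"
      using kt bt dt' Q by simp
    also have "\<dots> = ?cA \<cdot> d"
      unfolding b(2) d'(2)[symmetric] using kt cAt dt' by (intro assoc) simp_all
    also have "\<dots> = ((k \<cdot> d') \<otimes>\<^sub>a \<i> ?Q) \<cdot> ?cP"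
      unfolding cAd d'(2) ..
    also have "\<dots> = (k \<otimes>\<^sub>a \<i> ?Q) \<cdot> ((d' \<otimes>\<^sub>a \<i> ?Q) \<cdot> ?cP)"
      using kt dt' cPt Q by (simp del: whisker_left_comp)
    finally show "(k \<otimes>\<^sub>a \<i> ?Q) \<cdot> (b \<cdot> d') = (k \<otimes>\<^sub>a \<i> ?Q) \<cdot> ((d' \<otimes>\<^sub>a \<i> ?Q) \<cdot> ?cP)" .
  qed (use kt bt dt' cPt Q in simp_all)
  have d'_epic: "epic M d'"
  proof (rule coflat_epic[OF coflat A Q \<pi> comodP comodN _ bd'])
    show "d' \<in> Hom M ?P ?N"
      using dt' by simp
    fix j
    assume j: "is_equalizer M j (\<a> ?N ?Q ?A \<cdot> (b \<otimes>\<^sub>a \<i> ?A)) (\<i> ?N \<otimes>\<^sub>a ?c)"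
    note js = equalizer_simps[OF j]
    have jt: "j \<in> Ar M" "Cod M j = ?N \<otimes>\<^sub>o ?A"
      using js(1,4) bt kt A Q by simp_all
    have jeq: "\<a> ?N ?Q ?A \<cdot> (b \<otimes>\<^sub>a \<i> ?A) \<cdot> j = (\<i> ?N \<otimes>\<^sub>a ?c) \<cdot> j"
      using js(7) jt bt kt A Q by simp
    let ?kj = "(k \<otimes>\<^sub>a \<i> ?A) \<cdot> j"
    have kjt: "?kj \<in> Ar M" "Dom M ?kj = Dom M j" "Cod M ?kj = ?A \<otimes>\<^sub>o ?A"
      using kt jt A by simp_all
    have "(?cA \<otimes>\<^sub>a \<i> ?A) \<cdot> (k \<otimes>\<^sub>a \<i> ?A) = ((k \<otimes>\<^sub>a \<i> ?Q) \<cdot> b) \<otimes>\<^sub>a \<i> ?A"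
      unfolding b(2) by (rule whisker_right[OF refl]) (use kt cAt A in simp_all)
    then have "(?cA \<otimes>\<^sub>a \<i> ?A) \<cdot> (k \<otimes>\<^sub>a \<i> ?A) = ((k \<otimes>\<^sub>a \<i> ?Q) \<otimes>\<^sub>a \<i> ?A) \<cdot> (b \<otimes>\<^sub>a \<i> ?A)"
      using kt bt A Q by simp
    then have "(?cA \<otimes>\<^sub>a \<i> ?A) \<cdot> ?kj = (((k \<otimes>\<^sub>a \<i> ?Q) \<otimes>\<^sub>a \<i> ?A) \<cdot> (b \<otimes>\<^sub>a \<i> ?A)) \<cdot> j"
      by (rule reassoc) (use kt cAt jt A in \<open>simp_all del: whisker_right_comp\<close>)
    then have "\<a> ?A ?Q ?A \<cdot> (?cA \<otimes>\<^sub>a \<i> ?A) \<cdot> ?kj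
      = \<a> ?A ?Q ?A \<cdot> (((k \<otimes>\<^sub>a \<i> ?Q) \<otimes>\<^sub>a \<i> ?A) \<cdot> (b \<otimes>\<^sub>a \<i> ?A)) \<cdot> j"
      by (rule arg_cong)
    also have "\<dots> = (k \<otimes>\<^sub>a \<i> (?Q \<otimes>\<^sub>o ?A)) \<cdot> (\<a> ?N ?Q ?A \<cdot> (b \<otimes>\<^sub>a \<i> ?A) \<cdot> j)"
      using kt bt jt A Q by (simp add: naturality)
    also have "\<dots> = ((k \<otimes>\<^sub>a \<i> (?Q \<otimes>\<^sub>o ?A)) \<cdot> (\<i> ?N \<otimes>\<^sub>a ?c)) \<cdot> j"
      unfolding jeq using kt ct jt A Q by (simp del: whisker_left_comp)
    also have "(k \<otimes>\<^sub>a \<i> (?Q \<otimes>\<^sub>o ?A)) \<cdot> (\<i> ?N \<otimes>\<^sub>a ?c) = (\<i> ?A \<otimes>\<^sub>a ?c) \<cdot> (k \<otimes>\<^sub>a \<i> ?A)"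
      by (rule interchange_law[symmetric]) (use kt ct in simp_all)
    also have "\<dots> \<cdot> j = (\<i> ?A \<otimes>\<^sub>a ?c) \<cdot> ?kj"
      using kt ct jt A by (simp del: whisker_left_comp)
    finally have kjeq: "\<a> ?A ?Q ?A \<cdot> (?cA \<otimes>\<^sub>a \<i> ?A) \<cdot> ?kj = (\<i> ?A \<otimes>\<^sub>a ?c) \<cdot> ?kj" .
    \<comment> \<open>The cotensor product of the kernel with \<open>A\<close>, embedded by
      \<open>k\<close>, lies in that of \<open>A\<close> with itself, which is the kernel
      pair.\<close>
    obtain r where r: "r \<in> Hom M (Dom M ?kj) ?P" "pair (hopf_comonoid P) p1 p2 \<cdot> r = ?kj"
      using lift[OF kjt(1,3) kjeq] by blast
    have rt: "r \<in> Ar M" "Dom M r = Dom M j" "Cod M r = ?P"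
      using r(1) kjt by simp_all
    \<comment> \<open>On an element \<open>(x, a)\<close> of the kernel pair this appends a second
      copy of \<open>a\<close>. Applying \<open>p1\<close> or \<open>p2\<close> to the first factor
      returns \<open>(x, a)\<close> or \<open>(a, a)\<close>.\<close>
    let ?s = "(\<i> ?P \<otimes>\<^sub>a p2) \<cdot> ?dP \<cdot> r"
    have st: "?s \<in> Ar M" "Dom M ?s = Dom M j" "Cod M ?s = ?P \<otimes>\<^sub>o ?A"
      using rt P A p2s(2-4) by simp_all
    have graph: "\<a> ?P ?Q ?A \<cdot> (?cP \<otimes>\<^sub>a \<i> ?A) \<cdot> ((\<i> ?P \<otimes>\<^sub>a p2) \<cdot> ?dP) = (\<i> ?P \<otimes>\<^sub>a ?c) \<cdot> ((\<i> ?P \<otimes>\<^sub>a p2) \<cdot> ?dP)"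
      using graph_equalizes[OF cP cA cQ p2s(1) pis(1)] by simp
    have "\<a> ?P ?Q ?A \<cdot> (?cP \<otimes>\<^sub>a \<i> ?A) \<cdot> ?s = (\<a> ?P ?Q ?A \<cdot> (?cP \<otimes>\<^sub>a \<i> ?A) \<cdot> ((\<i> ?P \<otimes>\<^sub>a p2) \<cdot> ?dP)) \<cdot> r"
      using rt cPt P A Q p2s(2-4) by (simp del: whisker_right_comp)
    also have "\<dots> = (\<i> ?P \<otimes>\<^sub>a ?c) \<cdot> ?s"
      unfolding graph using rt ct P A Q p2s(2-4) by (simp del: whisker_left_comp)
    finally have s_eq: "\<a> ?P ?Q ?A \<cdot> (?cP \<otimes>\<^sub>a \<i> ?A) \<cdot> ?s = (\<i> ?P \<otimes>\<^sub>a ?c) \<cdot> ?s" .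
    have ps: "(p \<otimes>\<^sub>a \<i> ?A) \<cdot> ?s = pair (hopf_comonoid P) p p2 \<cdot> r" if p: "hopf_hom M P A p" for p
    proof -
      note pp = hopf_homD(2-4)[OF p]
      have "(p \<otimes>\<^sub>a \<i> ?A) \<cdot> (\<i> ?P \<otimes>\<^sub>a p2) = p \<otimes>\<^sub>a p2"
        using pp p2s(2-4) A P by (simp add: tensor_comp_tensor)
      from reassoc[OF this, of "?dP \<cdot> r"] show ?thesis
        using pp p2s(2-4) A P rt by (simp add: pair_def)
    qed
    have "pr2 (hopf_comonoid A) (hopf_comonoid A) \<cdot> (pair (hopf_comonoid P) p1 p2 \<cdot> r)
      = (pr2 (hopf_comonoid A) (hopf_comonoid A) \<cdot> pair (hopf_comonoid P) p1 p2) \<cdot> r"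
      using cA cP p1s(2-4) p2s(2-4) rt by simp
    also have "\<dots> = p2 \<cdot> r"
      using pr2_pair[OF cP cA cA, of p2 p1] p1s(1) p2s(2-4) by simp
    finally have p2r: "p2 \<cdot> r = pr2 (hopf_comonoid A) (hopf_comonoid A) \<cdot> ?kj"
      unfolding r(2) ..
    \<comment> \<open>The counit of \<open>A\<close> is that of \<open>Q\<close> after
      \<open>\<pi>\<close> and so kills \<open>k\<close>. Now \<open>p2 \<cdot> r\<close> is
      obtained by erasing the kernel factor with this counit, hence is zero.\<close>
    have ek: "h_counit A \<cdot> k = \<zero> ?N \<I>"
      using reassoc[OF pis(8), of k] kt pis(2-4) Q by simp
    have "(h_counit A \<otimes>\<^sub>a \<i> ?A) \<cdot> (k \<otimes>\<^sub>a \<i> ?A) = \<zero> ?N \<I> \<otimes>\<^sub>a \<i> ?A"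
      by (rule whisker_right[OF ek]) (use kt A in simp_all)
    from reassoc[OF this, of j] have "(h_counit A \<otimes>\<^sub>a \<i> ?A) \<cdot> ?kj = \<zero> (Dom M j) (\<I> \<otimes>\<^sub>o ?A)"
      using kt jt A by (simp add: tensor_zero)
    then have p2r0: "p2 \<cdot> r = \<zero> (Dom M j) ?A"
      unfolding p2r using kt jt A by (simp add: pr2_def)
    \<comment> \<open>The summand \<open>(a, a)\<close> is the comultiplication of \<open>A\<close>
      applied to \<open>p2 \<cdot> r\<close>, so it vanishes and only the \<open>p1\<close> part of
      the difference survives.\<close>
    have "pair (hopf_comonoid P) p2 p2 \<cdot> r = (h_comult A \<cdot> p2) \<cdot> r"
      unfolding p2s(7) by (simp add: pair_def)
    also have "\<dots> = h_comult A \<cdot> (p2 \<cdot> r)"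
      using rt p2s(2-4) A by simp
    also have "\<dots> = \<zero> (Dom M j) (?A \<otimes>\<^sub>o ?A)"
      unfolding p2r0 using jt A by simp
    finally have zero: "(p2 \<otimes>\<^sub>a \<i> ?A) \<cdot> ?s = \<zero> (Dom M j) (?A \<otimes>\<^sub>o ?A)"
      unfolding ps[OF p2] .
    have sh: "?s \<in> Hom M (Dom M j) (?P \<otimes>\<^sub>o ?A)"
      using st by simp
    have "(d' \<otimes>\<^sub>a \<i> ?A) \<cdot> ?s = j"
    proof (rule monic_cancel[OF tensor_monic(2)[OF km]])
      have "(k \<otimes>\<^sub>a \<i> ?A) \<cdot> (d' \<otimes>\<^sub>a \<i> ?A) = d \<otimes>\<^sub>a \<i> ?A"
        by (rule whisker_right[OF d'(2)]) (use kt dt' A in simp_all)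
      then have "(k \<otimes>\<^sub>a \<i> ?A) \<cdot> ((d' \<otimes>\<^sub>a \<i> ?A) \<cdot> ?s) = (d \<otimes>\<^sub>a \<i> ?A) \<cdot> ?s"
        by (rule reassoc) (use kt dt' st A in simp_all)
      also have "\<dots> = ?kj"
      proof (rule add_cancel[where h = "(p2 \<otimes>\<^sub>a \<i> ?A) \<cdot> ?s" and A = "Dom M j" and B = "?A \<otimes>\<^sub>o ?A"])
        have "(d \<otimes>\<^sub>a \<i> ?A) \<cdot> ?s \<oplus> (p2 \<otimes>\<^sub>a \<i> ?A) \<cdot> ?s = (p1 \<otimes>\<^sub>a \<i> ?A) \<cdot> ?s"
          by (rule add_tensor[OF sh]) (use A in simp)
        also have "\<dots> = ?kj"
          unfolding ps[OF p1] by (rule r)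
        also have "\<dots> = ?kj \<oplus> \<zero> (Dom M j) (?A \<otimes>\<^sub>o ?A)"
        proof -
          interpret G: comm_group "\<lparr>carrier = Hom M (Dom M j) (?A \<otimes>\<^sub>o ?A), monoid.mult = (\<oplus>),
              one = \<zero> (Dom M j) (?A \<otimes>\<^sub>o ?A)\<rparr>"
            using jt A by (intro hom_group) simp_all
          show ?thesis
            using G.r_one[of ?kj] kjt by simp
        qed
        finally show "(d \<otimes>\<^sub>a \<i> ?A) \<cdot> ?s \<oplus> (p2 \<otimes>\<^sub>a \<i> ?A) \<cdot> ?s = ?kj \<oplus> (p2 \<otimes>\<^sub>a \<i> ?A) \<cdot> ?s"
          unfolding zero .
      qed (use st dt kjt p2s(2-4) A in simp_all)
      finally show "(k \<otimes>\<^sub>a \<i> ?A) \<cdot> ((d' \<otimes>\<^sub>a \<i> ?A) \<cdot> ?s) = (k \<otimes>\<^sub>a \<i> ?A) \<cdot> j" .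
    qed (use kt jt dt' st A in simp_all)
    then show "\<exists>s. s \<in> Ar M \<and> Cod M s = ?P \<otimes>\<^sub>o ?A \<and> (d' \<otimes>\<^sub>a \<i> ?A) \<cdot> s = j \<and>
      \<a> ?P ?Q ?A \<cdot> (?cP \<otimes>\<^sub>a \<i> ?A) \<cdot> s = (\<i> ?P \<otimes>\<^sub>a ?c) \<cdot> s"
      using st(1,3) s_eq by blast
  qed
  have "\<exists>l \<in> Hom M ?Q (Cod M h). l \<cdot> \<pi> = h"
    if h: "h \<in> Ar M" "Dom M h = ?A" "h \<cdot> p1 = h \<cdot> p2" for h
  proof -
    \<comment> \<open>An arrow that coequalizes the kernel pair kills
      \<open>d = k \<cdot> d'\<close>. Cancelling the epimorphism \<open>d'\<close> shows that it
      kills \<open>k\<close>, and \<open>\<pi>\<close> is the cokernel of \<open>k\<close>.\<close>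
    have "h \<cdot> (k \<cdot> d') = \<zero> ?P (Cod M h)"
      unfolding d'(2) using diff[of h "Cod M h"] h by simp
    then have "h \<cdot> k = \<zero> ?N (Cod M h)"
      using h(1,2) kt(1-3) dt' by - (rule epic_cancel[OF d'_epic], simp_all)
    moreover have "Dom M h = Dom M \<pi>"
      using h(2) pis(3) by simp
    ultimately show ?thesis
      using cokernel_desc[OF epic_cokernel_kernel[OF \<pi>(2) k] h(1)] pis(4) by metis
  qed
  then show thesis
    using that[OF P p1 p2 comm] by blast
qed

text \<open>Compatibilities are tested after \<open>\<pi>\<close> and
  \<open>\<pi> \<otimes> \<pi>\<close>, both epic. A factorization found in \<open>M\<close> is thus
  automatically one of Hopf monoids.\<close>

lemma hopf_hom_desc:
  assumes \<pi>: "hopf_hom M A Q \<pi>" "epic M \<pi>" and h: "hopf_hom M A X h"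
    and l: "l \<in> Ar M" "Dom M l = h_obj Q" "Cod M l = h_obj X" "l \<cdot> \<pi> = h"
    and A: "chopf A" and Q: "chopf Q" and X: "chopf X"
  shows "hopf_hom M Q X l"
proof (rule hopf_homI)
  note pis = hopf_homD[OF \<pi>(1)] and hs = hopf_homD[OF h]
  have ll: "(l \<otimes>\<^sub>a l) \<cdot> (\<pi> \<otimes>\<^sub>a \<pi>) = h \<otimes>\<^sub>a h"
    using l pis(2-4) by (simp add: tensor_comp_tensor)
  show "chom (hopf_comonoid Q) (hopf_comonoid X) l"
  proof (rule chomI)
    show "co_comult (hopf_comonoid X) \<cdot> l = (l \<otimes>\<^sub>a l) \<cdot> co_comult (hopf_comonoid Q)"
    proof (rule epic_cancel[OF \<pi>(2)])
      show "(co_comult (hopf_comonoid X) \<cdot> l) \<cdot> \<pi> = ((l \<otimes>\<^sub>a l) \<cdot> co_comult (hopf_comonoid Q)) \<cdot> \<pi>"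
        using l pis(2-4,7) hs(7) A Q X reassoc[OF ll, of "h_comult A"] by simp
    qed (use l pis(2-4) Q X in simp_all)
    show "co_counit (hopf_comonoid X) \<cdot> l = co_counit (hopf_comonoid Q)"
      using l pis(2-4,8) hs(8) Q X by - (rule epic_cancel[OF \<pi>(2)], simp_all)
  qed (use l in simp_all)
  show "l \<cdot> h_mult Q = h_mult X \<cdot> (l \<otimes>\<^sub>a l)"
  proof (rule epic_cancel[OF tensor_epic_epic[OF \<pi>(2) \<pi>(2)]])
    have "(l \<cdot> h_mult Q) \<cdot> (\<pi> \<otimes>\<^sub>a \<pi>) = (l \<cdot> \<pi>) \<cdot> h_mult A"
      using l(1-3) pis(2-5) A Q by simp
    also have "\<dots> = (h_mult X \<cdot> (l \<otimes>\<^sub>a l)) \<cdot> (\<pi> \<otimes>\<^sub>a \<pi>)"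
      unfolding l(4) hs(5) using l(1-3) pis(2-4) X ll by simp
    finally show "(l \<cdot> h_mult Q) \<cdot> (\<pi> \<otimes>\<^sub>a \<pi>) = (h_mult X \<cdot> (l \<otimes>\<^sub>a l)) \<cdot> (\<pi> \<otimes>\<^sub>a \<pi>)" .
  qed (use l pis(2-4) Q X in simp_all)
  have "l \<cdot> h_unit Q = (l \<cdot> \<pi>) \<cdot> h_unit A"
    unfolding pis(6)[symmetric] using l(1-3) pis(2-4) A by simp
  then show "l \<cdot> h_unit Q = h_unit X"
    unfolding l(4) hs(6) .
qed

end

section \<open>Regularity\<close>

context category
begin

text \<open>Two inductions replace the usual single equalizer between large products: one collects
  the objects of the diagram, the other imposes its arrows one at a time. Both carry the full
  universal property along.\<close>

lemma finite_limits_from_products_and_equalizers: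
  assumes terminal: "\<exists>T \<in> Ob C. \<forall>X \<in> Ob C. \<exists>!h. h \<in> Hom C X T"
    and products: "\<And>A B. \<lbrakk>A \<in> Ob C; B \<in> Ob C\<rbrakk> \<Longrightarrow> \<exists>P p q. p \<in> Hom C P A \<and> q \<in> Hom C P B \<and>
      (\<forall>X. \<forall>f \<in> Hom C X A. \<forall>g \<in> Hom C X B. \<exists>!h. h \<in> Hom C X P \<and> p \<cdot> h = f \<and> q \<cdot> h = g)"
    and equalizers: "\<And>f g. parallel C f g \<Longrightarrow> \<exists>e. is_equalizer C e f g"
  shows "has_finite_limits C"
  unfolding has_finite_limits_def
proof (intro allI impI, elim conjE)
  fix J :: "(nat, nat) cat" and F :: "(nat, nat, 'o, 'm) cat_functor"
  assume J: "category J" and fin: "finite (Ar J)" and F: "is_functor J C F"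
  interpret J: category J
    by (rule J)
  have FO: "FO F i \<in> Ob C" if "i \<in> Ob J" for i
    using F that unfolding is_functor_def by blast
  have FA: "FA F u \<in> Hom C (FO F (Dom J u)) (FO F (Cod J u))" if "u \<in> Ar J" for u
    using F that unfolding is_functor_def by blast
  have "Ob J \<subseteq> Dom J ` Ar J"
  proof
    fix i
    assume "i \<in> Ob J"
    then have "i = Dom J (Ide J i)" "Ide J i \<in> Ar J"
      by simp_all
    then show "i \<in> Dom J ` Ar J"
      by (rule image_eqI)
  qed
  then have finO: "finite (Ob J)"
    using fin finite_subset by blast
  have "\<exists>L p. L \<in> Ob C \<and> (\<forall>i \<in> S. p i \<in> Hom C L (FO F i)) \<and>
      (\<forall>X q. X \<in> Ob C \<longrightarrow> (\<forall>i \<in> S. q i \<in> Hom C X (FO F i)) \<longrightarrow>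
        (\<exists>!h. h \<in> Hom C X L \<and> (\<forall>i \<in> S. p i \<cdot> h = q i)))"
    if "finite S" "S \<subseteq> Ob J" for S
    using that
  proof (induction S rule: finite_induct)
    case empty
    obtain T where "T \<in> Ob C" "\<forall>X \<in> Ob C. \<exists>!h. h \<in> Hom C X T"
      using terminal by (rule bexE)
    then show ?case
      by (intro exI[of _ T]) simp
  next
    case (insert i S)
    have S: "S \<subseteq> Ob J"
      using insert.prems by blast
    obtain L p where L: "L \<in> Ob C" and p': "\<forall>j \<in> S. p j \<in> Hom C L (FO F j)"
      and univ': "\<forall>X q. X \<in> Ob C \<longrightarrow> (\<forall>j \<in> S. q j \<in> Hom C X (FO F j)) \<longrightarrow>
        (\<exists>!h. h \<in> Hom C X L \<and> (\<forall>j \<in> S. p j \<cdot> h = q j))"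
      using insert.IH[OF S] by (elim exE conjE) (rule that)
    note p = p'[THEN bspec] and univ = univ'[THEN spec, THEN spec, THEN mp, THEN mp]
    have i: "FO F i \<in> Ob C"
      using insert.prems FO by blast
    obtain P a b where a: "a \<in> Hom C P L" and b: "b \<in> Hom C P (FO F i)"
      and ab': "\<forall>X. \<forall>f \<in> Hom C X L. \<forall>g \<in> Hom C X (FO F i).
        \<exists>!h. h \<in> Hom C X P \<and> a \<cdot> h = f \<and> b \<cdot> h = g"
      using products[OF L i] by (elim exE conjE) (rule that)
    note ab = ab'[THEN spec, THEN bspec, THEN bspec]
    let ?p = "\<lambda>j. if j = i then b else p j \<cdot> a"
    have PO: "P \<in> Ob C"
      using a by auto
    have Pp: "\<forall>j \<in> insert i S. ?p j \<in> Hom C P (FO F j)"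
      using a b p by auto
    have Pu: "\<exists>!h. h \<in> Hom C X P \<and> (\<forall>j \<in> insert i S. ?p j \<cdot> h = q j)"
      if X: "X \<in> Ob C" and q: "\<forall>j \<in> insert i S. q j \<in> Hom C X (FO F j)" for X q
    proof -
      have qS: "\<forall>j \<in> S. q j \<in> Hom C X (FO F j)" and qi: "q i \<in> Hom C X (FO F i)"
        using q by blast+
      obtain h0 where h0: "h0 \<in> Hom C X L" "\<forall>j \<in> S. p j \<cdot> h0 = q j"
        using univ[OF X qS] by blast
      obtain h where h: "h \<in> Hom C X P" "a \<cdot> h = h0" "b \<cdot> h = q i"
        using ab[OF h0(1) qi] by blast
      have pa: "(p j \<cdot> a) \<cdot> k = p j \<cdot> (a \<cdot> k)" if "j \<in> S" "k \<in> Hom C X P" for j k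
        using comp_assoc[OF that(2) a p[OF that(1)]] .
      have "?p j \<cdot> h = q j" if "j \<in> insert i S" for j
      proof (cases "j = i")
        case False
        then have "j \<in> S"
          using that by blast
        then show ?thesis
          using False pa[OF _ h(1)] h(2) h0(2) by simp
      qed (use h in simp)
      moreover have "k = h" if k: "k \<in> Hom C X P" "\<forall>j \<in> insert i S. ?p j \<cdot> k = q j" for k
      proof -
        have "p j \<cdot> (a \<cdot> k) = q j" if "j \<in> S" for j
        proof -
          have "j \<noteq> i"
            using that insert.hyps by blast
          then show ?thesis
            using k(2) pa[OF that k(1)] that by force
        qed
        moreover have "a \<cdot> k \<in> Hom C X L"
          using comp_in[OF k(1) a] .
        ultimately have "a \<cdot> k = h0"
          using univ[OF X qS] h0 by blast
        moreover have "b \<cdot> k = q i"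
          using k(2) by simp
        ultimately show ?thesis
          using ab[OF h0(1) qi] h k(1) by blast
      qed
      ultimately show ?thesis
        using h(1) by blast
    qed
    show ?case
      by (intro exI[of _ P] exI[of _ ?p] conjI allI impI PO Pp Pu)
  qed
  from this[OF finO subset_refl] obtain L0 p0 where L0: "L0 \<in> Ob C"
    and p0: "\<forall>i \<in> Ob J. p0 i \<in> Hom C L0 (FO F i)"
    and univ0: "\<forall>X q. X \<in> Ob C \<longrightarrow> (\<forall>i \<in> Ob J. q i \<in> Hom C X (FO F i)) \<longrightarrow>
        (\<exists>!h. h \<in> Hom C X L0 \<and> (\<forall>i \<in> Ob J. p0 i \<cdot> h = q i))"
    by (elim exE conjE) (rule that)
  \<comment> \<open>Adding an arrow \<open>u\<close> replaces the limit reached so far by the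
    equalizer of the two arrows into \<open>FO F (Cod J u)\<close>; the equations imposed earlier
    persist after precomposition.\<close>
  have "\<exists>L p. L \<in> Ob C \<and> (\<forall>i \<in> Ob J. p i \<in> Hom C L (FO F i)) \<and>
      (\<forall>u \<in> U. FA F u \<cdot> p (Dom J u) = p (Cod J u)) \<and>
      (\<forall>X q. X \<in> Ob C \<longrightarrow> (\<forall>i \<in> Ob J. q i \<in> Hom C X (FO F i)) \<longrightarrow>
        (\<forall>u \<in> U. FA F u \<cdot> q (Dom J u) = q (Cod J u)) \<longrightarrow>
        (\<exists>!h. h \<in> Hom C X L \<and> (\<forall>i \<in> Ob J. p i \<cdot> h = q i)))"
    if "finite U" "U \<subseteq> Ar J" for U
    using that
  proof (induction U rule: finite_induct)
    case empty
    then show ?case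
      using L0 p0 univ0 by (intro exI[of _ L0] exI[of _ p0]) blast
  next
    case (insert u U)
    have U: "U \<subseteq> Ar J"
      using insert.prems by blast
    obtain L p where L: "L \<in> Ob C" and p': "\<forall>i \<in> Ob J. p i \<in> Hom C L (FO F i)"
      and cone': "\<forall>v \<in> U. FA F v \<cdot> p (Dom J v) = p (Cod J v)"
      and univ': "\<forall>X q. X \<in> Ob C \<longrightarrow> (\<forall>i \<in> Ob J. q i \<in> Hom C X (FO F i)) \<longrightarrow>
        (\<forall>v \<in> U. FA F v \<cdot> q (Dom J v) = q (Cod J v)) \<longrightarrow>
        (\<exists>!h. h \<in> Hom C X L \<and> (\<forall>i \<in> Ob J. p i \<cdot> h = q i))"
      using insert.IH[OF U] by (elim exE conjE) (rule that)
    note p = p'[THEN bspec] and cone = cone'[THEN bspec]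
      and univ = univ'[THEN spec, THEN spec, THEN mp, THEN mp, THEN mp]
    have u: "u \<in> Ar J" "Dom J u \<in> Ob J" "Cod J u \<in> Ob J"
      using insert.prems by auto
    let ?f = "FA F u \<cdot> p (Dom J u)" and ?g = "p (Cod J u)"
    have f: "?f \<in> Hom C L (FO F (Cod J u))"
      using comp_in[OF p[OF u(2)] FA[OF u(1)]] .
    have "parallel C ?f ?g"
      using f p[OF u(3)] by (simp add: parallel_def)
    then obtain e where e: "is_equalizer C e ?f ?g"
      using equalizers by blast
    note es = equalizer_simps[OF e] and em = equalizer_monic[OF e]
    let ?E = "Dom C e" and ?p = "\<lambda>i. p i \<cdot> e"
    have eh: "e \<in> Hom C ?E L"
      using es(1,4) f by simp
    have EO: "?E \<in> Ob C"
      using es(1) by simp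
    have Ep: "\<forall>i \<in> Ob J. ?p i \<in> Hom C ?E (FO F i)"
      using comp_in[OF eh p] by blast
    have Ec: "FA F v \<cdot> ?p (Dom J v) = ?p (Cod J v)" if "v \<in> insert u U" for v
    proof -
      have v: "v \<in> Ar J"
        using that u U by blast
      then have "FA F v \<cdot> ?p (Dom J v) = (FA F v \<cdot> p (Dom J v)) \<cdot> e"
        using comp_assoc[OF eh p FA] by simp
      then show ?thesis
        using that cone es(7) by auto
    qed
    have Eu: "\<exists>!h. h \<in> Hom C X ?E \<and> (\<forall>i \<in> Ob J. ?p i \<cdot> h = q i)"
      if X: "X \<in> Ob C" and q: "\<forall>i \<in> Ob J. q i \<in> Hom C X (FO F i)"
        and qc: "\<forall>v \<in> insert u U. FA F v \<cdot> q (Dom J v) = q (Cod J v)" for X q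
    proof -
      obtain h where h: "h \<in> Hom C X L" "\<forall>i \<in> Ob J. p i \<cdot> h = q i"
        using univ[OF X q] qc by blast
      have "?f \<cdot> h = FA F u \<cdot> (p (Dom J u) \<cdot> h)"
        using comp_assoc[OF h(1) p[OF u(2)] FA[OF u(1)]] .
      then have "?f \<cdot> h = ?g \<cdot> h"
        using h(2) qc u by simp
      moreover have "h \<in> Hom C X (Dom C ?f)"
        using h(1) f by simp
      ultimately obtain k where k: "k \<in> Hom C X ?E" "e \<cdot> k = h"
        using equalizer_ex1[OF e] by blast
      have pe: "(p i \<cdot> e) \<cdot> x = p i \<cdot> (e \<cdot> x)" if "i \<in> Ob J" "x \<in> Hom C X ?E" for i x
        using comp_assoc[OF that(2) eh p[OF that(1)]] .
      have "l = k" if l: "l \<in> Hom C X ?E" "\<forall>i \<in> Ob J. ?p i \<cdot> l = q i" for l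
      proof -
        have "\<forall>i \<in> Ob J. p i \<cdot> (e \<cdot> l) = q i"
          using l pe by simp
        then have "e \<cdot> l = h"
          using univ[OF X q] qc h comp_in[OF l(1) eh] by blast
        then show ?thesis
          using k l(1) eh by - (rule monic_cancel[OF em], simp_all)
      qed
      moreover have "\<forall>i \<in> Ob J. ?p i \<cdot> k = q i"
        using pe k h(2) by simp
      ultimately show ?thesis
        using k(1) by blast
    qed
    show ?case
      by (intro exI[of _ ?E] exI[of _ ?p] conjI allI ballI impI EO Ep[THEN bspec] Ec Eu) blast+
  qed
  from this[OF fin subset_refl] obtain L p where "L \<in> Ob C"
    "\<forall>i \<in> Ob J. p i \<in> Hom C L (FO F i)" "\<forall>u \<in> Ar J. FA F u \<cdot> p (Dom J u) = p (Cod J u)"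
    "\<forall>X q. X \<in> Ob C \<longrightarrow> (\<forall>i \<in> Ob J. q i \<in> Hom C X (FO F i)) \<longrightarrow>
        (\<forall>u \<in> Ar J. FA F u \<cdot> q (Dom J u) = q (Cod J u)) \<longrightarrow>
        (\<exists>!h. h \<in> Hom C X L \<and> (\<forall>i \<in> Ob J. p i \<cdot> h = q i))"
    by (elim exE conjE) (rule that)
  then have "is_limit J C F L p"
    unfolding is_limit_def is_cone_def by blast
  then show "\<exists>L p. is_limit J C F L p"
    by blast
qed

end

section \<open>Regularity of the category of cocommutative Hopf monoids\<close>

context abelian_symmetric_monoidal_category
begin

lemma Hopf_coc_Ob [simp]: "A \<in> Ob (Hopf_coc M) \<longleftrightarrow> chopf A"
  by (simp add: Hopf_coc_def structured_cat_def chopf_def)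

lemma Hopf_coc_Ar [simp]: "(A, f, B) \<in> Ar (Hopf_coc M) \<longleftrightarrow> chopf A \<and> chopf B \<and> hopf_hom M A B f"
  by (auto simp: Hopf_coc_def structured_cat_def chopf_def)

lemma Hopf_coc_simps [simp]:
  "Dom (Hopf_coc M) (A, f, B) = A" "Cod (Hopf_coc M) (A, f, B) = B"
  "Ide (Hopf_coc M) A = (A, \<i> (h_obj A), A)"
  "Comp (Hopf_coc M) (B', g, D) (A, f, B) = (A, g \<cdot> f, D)"
  by (simp_all add: Hopf_coc_def structured_cat_def)

lemma Hopf_coc_Hom:
  "x \<in> Hom (Hopf_coc M) A B \<longleftrightarrow> (\<exists>f. x = (A, f, B) \<and> chopf A \<and> chopf B \<and> hopf_hom M A B f)"
  unfolding Hom_def by (cases x) auto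

lemma category_Hopf_coc: "category (Hopf_coc M)"
proof
  show "Dom (Hopf_coc M) f \<in> Ob (Hopf_coc M)" "Cod (Hopf_coc M) f \<in> Ob (Hopf_coc M)"
    if "f \<in> Ar (Hopf_coc M)" for f
    using that by (cases f; simp)+
  show "Ide (Hopf_coc M) A \<in> Hom (Hopf_coc M) A A" if "A \<in> Ob (Hopf_coc M)" for A
    using that hopf_hom_ide by (simp add: Hopf_coc_Hom)
  show "Comp (Hopf_coc M) g f \<in> Hom (Hopf_coc M) A D"
    if "f \<in> Hom (Hopf_coc M) A B" "g \<in> Hom (Hopf_coc M) B D" for f g A B D
    using that hopf_hom_comp by (auto simp: Hopf_coc_Hom)
  show "Comp (Hopf_coc M) (Ide (Hopf_coc M) B) f = f" "Comp (Hopf_coc M) f (Ide (Hopf_coc M) A) = f"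
    if "f \<in> Hom (Hopf_coc M) A B" for f A B
    using that by (auto simp: Hopf_coc_Hom hopf_homD(2-4))
  show "Comp (Hopf_coc M) (Comp (Hopf_coc M) h g) f = Comp (Hopf_coc M) h (Comp (Hopf_coc M) g f)"
    if "f \<in> Hom (Hopf_coc M) A B" "g \<in> Hom (Hopf_coc M) B D" "h \<in> Hom (Hopf_coc M) D E"
    for f g h A B D E
    using that by (auto simp: Hopf_coc_Hom hopf_homD(2-4))
qed

lemma hopf_hom_eqI:
  assumes "monic M e" "hopf_hom M E A e" "hopf_hom M X E h" "hopf_hom M X E k" "e \<cdot> h = e \<cdot> k"
  shows "h = k"
  by (rule monic_cancel[OF assms(1,5)])
    (use hopf_homD(2-4)[OF assms(2)] hopf_homD(2-4)[OF assms(3)] hopf_homD(2-4)[OF assms(4)] in simp_all)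

lemma has_finite_limits_Hopf_coc: "has_finite_limits (Hopf_coc M)"
proof (rule category.finite_limits_from_products_and_equalizers[OF category_Hopf_coc])
  let ?H = "Hopf_coc M"
  have "\<exists>!h. h \<in> Hom ?H X unit_hopf" if "chopf X" for X
  proof (rule ex1I)
    show "(X, h_counit X, unit_hopf) \<in> Hom ?H X unit_hopf"
      using that hopf_hom_counit chopf_unit by (simp add: Hopf_coc_Hom)
    show "h = (X, h_counit X, unit_hopf)" if "h \<in> Hom ?H X unit_hopf" for h
      using that hopf_hom_unit_unique \<open>chopf X\<close> by (auto simp: Hopf_coc_Hom)
  qed
  then show "\<exists>T \<in> Ob ?H. \<forall>X \<in> Ob ?H. \<exists>!h. h \<in> Hom ?H X T"
    using chopf_unit by (intro bexI[of _ unit_hopf]) simp_all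
  show "\<exists>P p q. p \<in> Hom ?H P A \<and> q \<in> Hom ?H P B \<and>
      (\<forall>X. \<forall>f \<in> Hom ?H X A. \<forall>g \<in> Hom ?H X B. \<exists>!h. h \<in> Hom ?H X P \<and> Comp ?H p h = f \<and> Comp ?H q h = g)"
    if "A \<in> Ob ?H" "B \<in> Ob ?H" for A B
  proof -
    have A: "chopf A" and B: "chopf B"
      using that by simp_all
    let ?P = "prod_hopf A B"
    note P = chopf_prod[OF A B]
    have "\<exists>!h. h \<in> Hom ?H X ?P \<and> Comp ?H (?P, hpr1 A B, A) h = f \<and> Comp ?H (?P, hpr2 A B, B) h = g"
      if fg: "f \<in> Hom ?H X A" "g \<in> Hom ?H X B" for X f g
    proof -
      obtain f' g' where f: "f = (X, f', A)" "hopf_hom M X A f'" and g: "g = (X, g', B)" "hopf_hom M X B g'"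
        and X: "chopf X"
        using fg by (auto simp: Hopf_coc_Hom)
      note h = hopf_hom_pair[OF A B X f(2) g(2)]
      show ?thesis
      proof (rule ex1I)
        show "(X, pair (hopf_comonoid X) f' g', ?P) \<in> Hom ?H X ?P \<and>
          Comp ?H (?P, hpr1 A B, A) (X, pair (hopf_comonoid X) f' g', ?P) = f \<and>
          Comp ?H (?P, hpr2 A B, B) (X, pair (hopf_comonoid X) f' g', ?P) = g"
          using h X P by (simp add: Hopf_coc_Hom f(1) g(1))
        fix k
        assume k: "k \<in> Hom ?H X ?P \<and> Comp ?H (?P, hpr1 A B, A) k = f \<and> Comp ?H (?P, hpr2 A B, B) k = g"
        then obtain k' where k': "k = (X, k', ?P)" "hopf_hom M X ?P k'"
          by (auto simp: Hopf_coc_Hom)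
        have "k' = pair (hopf_comonoid X) f' g'"
          by (rule hopf_hom_prod_eqI[OF k'(2) h(1) X A B])
            (use k h(2,3) in \<open>simp_all add: k'(1) f(1) g(1)\<close>)
        then show "k = (X, pair (hopf_comonoid X) f' g', ?P)"
          using k' by simp
      qed
    qed
    moreover have "(?P, hpr1 A B, A) \<in> Hom ?H ?P A" "(?P, hpr2 A B, B) \<in> Hom ?H ?P B"
      using P A B hopf_hom_pr1[OF A B] hopf_hom_pr2[OF A B] by (simp_all add: Hopf_coc_Hom)
    ultimately show ?thesis
      by blast
  qed
  show "\<exists>e. is_equalizer ?H e x y" if par: "parallel ?H x y" for x y
  proof -
    obtain A B f g where xy: "x = (A, f, B)" "y = (A, g, B)" and A: "chopf A" and B: "chopf B"
      and f: "hopf_hom M A B f" and g: "hopf_hom M A B g"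
      using par by (cases x; cases y) (auto simp: parallel_def)
    let ?u = "pair (hopf_comonoid A) (\<i> (h_obj A))"
    obtain E e where E: "chopf E" and e: "hopf_hom M E A e" "f \<cdot> e = g \<cdot> e"
      and eq: "is_equalizer M e (?u f) (?u g)"
      using hopf_equalizer[OF f g A B] by blast
    note fs = hopf_homD(2-4)[OF f] and gs = hopf_homD(2-4)[OF g] and es = hopf_homD(2-4)[OF e(1)]
    note em = equalizer_monic[OF eq]
    have "is_equalizer ?H (E, e, A) x y"
    proof (rule category.equalizerI[OF category_Hopf_coc])
      show "x \<in> Hom ?H A B" "y \<in> Hom ?H A B"
        using xy A B f g by (simp_all add: Hopf_coc_Hom)
      show "Cod ?H (E, e, A) = A" "Comp ?H x (E, e, A) = Comp ?H y (E, e, A)"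
        using xy e(2) by simp_all
      show "monic ?H (E, e, A)"
        unfolding monic_def using E A e(1) hopf_hom_eqI[OF em e(1)] by (auto simp: Hopf_coc_Hom)
      fix z
      assume z: "z \<in> Ar ?H" "Cod ?H z = A" "Comp ?H x z = Comp ?H y z"
      obtain X h where zh: "z = (X, h, A)" and X: "chopf X" and h: "hopf_hom M X A h" and fh: "f \<cdot> h = g \<cdot> h"
        using z by (cases z) (auto simp: xy)
      note hs = hopf_homD[OF h] and cX = chopfD(1)[OF X] and cA = chopfD(1)[OF A]
      have "?u f \<cdot> h = ?u g \<cdot> h"
        using pair_comp[OF hs(1) cX cA, of "\<i> (h_obj A)" f] pair_comp[OF hs(1) cX cA, of "\<i> (h_obj A)" g]
          A fs gs fh by simp
      moreover have "Cod M h = Cod M e"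
        using hs(4) es(3) by simp
      ultimately obtain l where l: "l \<in> Hom M (Dom M h) (Dom M e)" "e \<cdot> l = h"
        using equalizer_lift[OF eq hs(2)] by blast
      have "hopf_hom M X E l"
        by (rule hopf_hom_lift[OF e(1) em _ _ _ _ X E A]) (use l h hs(3) es(2) in simp_all)
      then show "\<exists>k \<in> Hom ?H (Dom ?H z) (Dom ?H (E, e, A)). Comp ?H (E, e, A) k = z"
        using X E l(2) by (intro bexI[of _ "(X, l, E)"]) (simp_all add: zh Hopf_coc_Hom)
    qed
    then show ?thesis
      by blast
  qed
qed

text \<open>From right to left, the factorization through the kernel pair's coequalizer exists in
  \<open>M\<close> and is a Hopf morphism. From left to right, the image of \<open>q\<close> in
  \<open>M\<close> is compared with \<open>Q\<close> by the universal property of the given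
  coequalizer.\<close>

lemma regular_epi_Hopf_coc_iff:
  assumes coflat: "faithful_coflatness M" and A: "chopf A" and Q: "chopf Q" and q: "hopf_hom M A Q q"
  shows "regular_epi (Hopf_coc M) (A, q, Q) \<longleftrightarrow> epic M q"
proof
  let ?H = "Hopf_coc M"
  interpret H: category ?H
    by (rule category_Hopf_coc)
  note qs = hopf_homD(2-4)[OF q]
  assume "epic M q"
  then obtain P p1 p2 where P: "chopf P" and p1: "hopf_hom M P A p1" and p2: "hopf_hom M P A p2"
    and comm: "q \<cdot> p1 = q \<cdot> p2"
    and desc: "\<And>h. \<lbrakk>h \<in> Ar M; Dom M h = h_obj A; h \<cdot> p1 = h \<cdot> p2\<rbrakk>
      \<Longrightarrow> \<exists>l \<in> Hom M (h_obj Q) (Cod M h). l \<cdot> q = h"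
    using kernel_pair_coequalizer[OF coflat A Q q] by blast
  have univ: "\<exists>!k. k \<in> Hom ?H Q X \<and> Comp ?H k (A, q, Q) = z"
    if z: "z \<in> Hom ?H A X" "Comp ?H z (P, p1, A) = Comp ?H z (P, p2, A)" for X z
  proof -
    obtain h where zh: "z = (A, h, X)" and X: "chopf X" and h: "hopf_hom M A X h" and hp: "h \<cdot> p1 = h \<cdot> p2"
      using z unfolding Hopf_coc_Hom by auto
    note hs = hopf_homD(2-4)[OF h]
    obtain l where l: "l \<in> Hom M (h_obj Q) (Cod M h)" "l \<cdot> q = h"
      using desc[OF hs(1,2) hp] by blast
    have l_hom: "hopf_hom M Q X l"
      by (rule hopf_hom_desc[OF q \<open>epic M q\<close> h _ _ _ _ A Q X]) (use l hs(3) in simp_all)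
    show ?thesis
    proof (rule ex1I)
      show "(Q, l, X) \<in> Hom ?H Q X \<and> Comp ?H (Q, l, X) (A, q, Q) = z"
        using Q X l_hom l(2) by (simp add: zh Hopf_coc_Hom)
      fix k
      assume "k \<in> Hom ?H Q X \<and> Comp ?H k (A, q, Q) = z"
      then obtain k' where k': "k = (Q, k', X)" "hopf_hom M Q X k'" "k' \<cdot> q = h"
        unfolding Hopf_coc_Hom zh by auto
      have "k' = l"
        using hopf_homD(2-4)[OF k'(2)] hopf_homD(2-4)[OF l_hom] qs k'(3) l(2)
        by - (rule epic_cancel[OF \<open>epic M q\<close>], simp_all)
      then show "k = (Q, l, X)"
        using k' by simp
    qed
  qed
  have "is_coequalizer ?H (A, q, Q) (P, p1, A) (P, p2, A)"
    unfolding is_coequalizer_def parallel_def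
  proof (intro conjI allI ballI impI)
    fix X z
    assume "z \<in> Hom ?H (Cod ?H (P, p1, A)) X" "Comp ?H z (P, p1, A) = Comp ?H z (P, p2, A)"
    then show "\<exists>!k. k \<in> Hom ?H (Cod ?H (A, q, Q)) X \<and> Comp ?H k (A, q, Q) = z"
      using univ[of z X] by (simp only: Hopf_coc_simps)
  qed (use A Q P q p1 p2 comm in simp_all)
  then show "regular_epi ?H (A, q, Q)"
    unfolding regular_epi_def by blast
next
  let ?H = "Hopf_coc M"
  interpret H: category ?H
    by (rule category_Hopf_coc)
  assume "regular_epi ?H (A, q, Q)"
  then obtain x y where xy: "is_coequalizer ?H (A, q, Q) x y"
    unfolding regular_epi_def by blast
  note cs = H.coequalizer_simps[OF xy]
  obtain P f g where fg: "x = (P, f, A)" "y = (P, g, A)" and P: "chopf P"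
    and f: "hopf_hom M P A f" and g: "hopf_hom M P A g" and eq: "q \<cdot> f = q \<cdot> g"
    using cs by (cases x; cases y) auto
  obtain E e m where E: "chopf E" and e: "hopf_hom M A E e" and m: "hopf_hom M E Q m"
    and ee: "epic M e" and mm: "monic M m" and me: "m \<cdot> e = q"
    using hopf_image[OF q A Q] by blast
  note es = hopf_homD(2-4)[OF e] and ms = hopf_homD(2-4)[OF m] and fs = hopf_homD(2-4)[OF f]
    and gs = hopf_homD(2-4)[OF g] and qs = hopf_homD(2-4)[OF q]
  \<comment> \<open>The monic part \<open>m\<close> of the image factorization can be cancelled, so
    \<open>e\<close> coequalizes the same pair as \<open>q\<close> and factors through it.\<close>
  have "m \<cdot> (e \<cdot> f) = m \<cdot> (e \<cdot> g)"
    using reassoc[OF me, of f] reassoc[OF me, of g] eq es ms fs gs by simp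
  then have ef: "e \<cdot> f = e \<cdot> g"
    using es ms fs gs by - (rule monic_cancel[OF mm], simp_all)
  obtain z where z: "z \<in> Hom ?H (Cod ?H (A, q, Q)) (Cod ?H (A, e, E))" "Comp ?H z (A, q, Q) = (A, e, E)"
  proof (rule H.coequalizer_desc[OF xy])
    show "(A, e, E) \<in> Ar ?H" "Dom ?H (A, e, E) = Dom ?H (A, q, Q)"
      "Comp ?H (A, e, E) x = Comp ?H (A, e, E) y"
      using A E e ef fg by simp_all
  qed
  then obtain k where k: "hopf_hom M Q E k" "k \<cdot> q = e"
    unfolding Hopf_coc_Hom by auto
  note ks = hopf_homD(2-4)[OF k(1)]
  \<comment> \<open>Cancelling the coequalizer makes \<open>k\<close> a right inverse of
    \<open>m\<close>; then \<open>m\<close> is epic, and so is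
    \<open>q = m \<cdot> e\<close>.\<close>
  have "(Q, m \<cdot> k, Q) = (Q, \<i> (h_obj Q), Q)"
  proof (rule H.epic_cancel[OF H.coequalizer_epic[OF xy]])
    have "(m \<cdot> k) \<cdot> q = m \<cdot> e"
      using k(2) ks ms qs by simp
    then show "Comp ?H (Q, m \<cdot> k, Q) (A, q, Q) = Comp ?H (Q, \<i> (h_obj Q), Q) (A, q, Q)"
      using me qs by simp
  qed (use Q hopf_hom_comp[OF k(1) m Q E Q] hopf_hom_ide[OF Q] in simp_all)
  then have "epic M m"
    using ks ms by (intro split_epic[of m k]) simp_all
  then show "epic M q"
    unfolding me[symmetric] using ee es ms by (intro epic_comp) simp_all
qed

text \<open>The given pullback is only known to be universal for Hopf morphisms, whereas
  \<open>base_change_epic\<close> requires liftings of arbitrary arrows of \<open>M\<close>. These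
  are taken from the constructed pullback \<open>P0\<close> and transported along the comparison
  morphism \<open>t\<close>.\<close>

lemma regular_epi_pullback_Hopf_coc:
  assumes coflat: "faithful_coflatness M"
    and pb: "is_pullback (Hopf_coc M) x y z w" and reg: "regular_epi (Hopf_coc M) x"
  shows "regular_epi (Hopf_coc M) w"
proof -
  let ?H = "Hopf_coc M"
  obtain A Q X P \<pi> g p q where eqs: "x = (A, \<pi>, Q)" "y = (X, g, Q)" "z = (P, p, A)" "w = (P, q, X)"
    and A: "chopf A" and Q: "chopf Q" and X: "chopf X" and P: "chopf P"
    and \<pi>: "hopf_hom M A Q \<pi>" and g: "hopf_hom M X Q g" and p: "hopf_hom M P A p" and q: "hopf_hom M P X q"
    and comm: "\<pi> \<cdot> p = g \<cdot> q"
    using pb by (cases x; cases y; cases z; cases w) (auto simp: is_pullback_def)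
  have \<pi>_epic: "epic M \<pi>"
    using reg regular_epi_Hopf_coc_iff[OF coflat A Q \<pi>] eqs by simp
  obtain P0 q0 p0 where P0: "chopf P0" and q0: "hopf_hom M P0 X q0" and p0: "hopf_hom M P0 A p0"
    and comm0: "g \<cdot> q0 = \<pi> \<cdot> p0"
    and lift: "\<And>j. \<lbrakk>j \<in> Ar M; Cod M j = h_obj X \<otimes>\<^sub>o h_obj A;
      \<a> (h_obj X) (h_obj Q) (h_obj A) \<cdot> (((\<i> (h_obj X) \<otimes>\<^sub>a g) \<cdot> h_comult X) \<otimes>\<^sub>a \<i> (h_obj A)) \<cdot> j
        = (\<i> (h_obj X) \<otimes>\<^sub>a ((\<pi> \<otimes>\<^sub>a \<i> (h_obj A)) \<cdot> h_comult A)) \<cdot> j\<rbrakk>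
      \<Longrightarrow> \<exists>k \<in> Hom M (Dom M j) (h_obj P0). pair (hopf_comonoid P0) q0 p0 \<cdot> k = j"
    using hopf_pullback[OF g \<pi> X A Q] by metis
  have "\<forall>h \<in> Hom ?H P0 A. \<forall>k \<in> Hom ?H P0 X. Comp ?H x h = Comp ?H y k \<longrightarrow>
      (\<exists>!l. l \<in> Hom ?H P0 P \<and> Comp ?H z l = h \<and> Comp ?H w l = k)"
    using pb unfolding is_pullback_def eqs by simp
  moreover have "(P0, p0, A) \<in> Hom ?H P0 A" "(P0, q0, X) \<in> Hom ?H P0 X"
    "Comp ?H x (P0, p0, A) = Comp ?H y (P0, q0, X)"
    using P0 A X p0 q0 comm0 by (simp_all add: Hopf_coc_Hom eqs)
  ultimately obtain l where "l \<in> Hom ?H P0 P" "Comp ?H z l = (P0, p0, A)" "Comp ?H w l = (P0, q0, X)"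
    by blast
  then obtain t where t: "hopf_hom M P0 P t" "p \<cdot> t = p0" "q \<cdot> t = q0"
    by (auto simp: Hopf_coc_Hom eqs)
  note ts = hopf_homD[OF t(1)] and ps = hopf_homD(2-4)[OF p] and qs = hopf_homD(2-4)[OF q]
  \<comment> \<open>The comparison commutes with the maps into \<open>X \<otimes> A\<close>, so a
    lifting to \<open>P0\<close> followed by \<open>t\<close> is a lifting to
    \<open>P\<close>.\<close>
  have pt: "pair (hopf_comonoid P) q p \<cdot> t = pair (hopf_comonoid P0) q0 p0"
    using pair_comp[OF ts(1) chopfD(1)[OF P0] chopfD(1)[OF P], of q p] ps qs t(2,3) by simp
  have "epic M q"
  proof (rule base_change_epic[OF coflat A Q X P \<pi> \<pi>_epic g p q comm[symmetric]])
    fix j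
    assume j: "is_equalizer M j
      (\<a> (h_obj X) (h_obj Q) (h_obj A) \<cdot> (((\<i> (h_obj X) \<otimes>\<^sub>a g) \<cdot> h_comult X) \<otimes>\<^sub>a \<i> (h_obj A)))
      (\<i> (h_obj X) \<otimes>\<^sub>a ((\<pi> \<otimes>\<^sub>a \<i> (h_obj A)) \<cdot> h_comult A))"
    note js = equalizer_simps[OF j] and gs = hopf_homD(2-4)[OF g] and pis = hopf_homD(2-4)[OF \<pi>]
    have jt: "j \<in> Ar M" "Cod M j = h_obj X \<otimes>\<^sub>o h_obj A"
      using js(1,4) X A Q gs by simp_all
    have "\<a> (h_obj X) (h_obj Q) (h_obj A) \<cdot> (((\<i> (h_obj X) \<otimes>\<^sub>a g) \<cdot> h_comult X) \<otimes>\<^sub>a \<i> (h_obj A)) \<cdot> j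
      = (\<i> (h_obj X) \<otimes>\<^sub>a ((\<pi> \<otimes>\<^sub>a \<i> (h_obj A)) \<cdot> h_comult A)) \<cdot> j"
      using js(7) jt X A Q gs by simp
    then obtain k where k: "k \<in> Hom M (Dom M j) (h_obj P0)" "pair (hopf_comonoid P0) q0 p0 \<cdot> k = j"
      using lift[OF jt] by blast
    show "\<exists>k \<in> Hom M (Dom M j) (h_obj P). pair (hopf_comonoid P) q p \<cdot> k = j"
    proof (rule bexI)
      show "pair (hopf_comonoid P) q p \<cdot> (t \<cdot> k) = j"
        using reassoc[OF pt, of k] k ts(2-4) ps qs chopfD(1)[OF P] by simp
      show "t \<cdot> k \<in> Hom M (Dom M j) (h_obj P)"
        using k(1) ts(2-4) by simp
    qed
  qed
  then show ?thesis
    using regular_epi_Hopf_coc_iff[OF coflat P X q] eqs by simp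
qed

text \<open>The required factorization is the image in \<open>M\<close>: its epic part is regular by
  the characterization above, and a Hopf morphism that is monic in \<open>M\<close> stays monic
  among Hopf monoids.\<close>

lemma regular_category_Hopf_coc:
  assumes coflat: "faithful_coflatness M"
  shows "regular_category (Hopf_coc M)"
proof (intro regular_category.intro regular_category_axioms.intro)
  let ?H = "Hopf_coc M"
  show "category ?H"
    by (rule category_Hopf_coc)
  show "has_finite_limits ?H"
    by (rule has_finite_limits_Hopf_coc)
  show "regular_epi ?H w" if "is_pullback ?H x y z w" "regular_epi ?H x" for x y z w
    by (rule regular_epi_pullback_Hopf_coc[OF coflat that])
  show "\<exists>e m. regular_epi ?H e \<and> monic ?H m \<and> Cod ?H e = Dom ?H m \<and> x = Comp ?H m e"
    if x_in: "x \<in> Ar ?H" for x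
  proof -
    obtain A f B where x: "x = (A, f, B)" and A: "chopf A" and B: "chopf B" and f: "hopf_hom M A B f"
      using x_in by (cases x) auto
    obtain E e m where E: "chopf E" and e: "hopf_hom M A E e" "epic M e" and m: "hopf_hom M E B m" "monic M m"
      and me: "m \<cdot> e = f"
      using hopf_image[OF f A B] by blast
    have "regular_epi ?H (A, e, E)"
      using regular_epi_Hopf_coc_iff[OF coflat A E e(1)] e(2) by simp
    moreover have "monic ?H (E, m, B)"
      unfolding monic_def using E B m(1) hopf_hom_eqI[OF m(2,1)] by (auto simp: Hopf_coc_Hom)
    ultimately show ?thesis
      using x me by (intro exI[of _ "(A, e, E)"] exI[of _ "(E, m, B)"]) simp
  qed
qed

end

theorem theorem7p23:
  fixes M :: "('o, 'm) sym_mon_cat"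
  assumes "abelian_symmetric_monoidal_category M"
    and "faithful_coflatness M"
    and "faithful_flatness M"
  shows "regular_category (Hopf_coc M)"
  using abelian_symmetric_monoidal_category.regular_category_Hopf_coc[OF assms(1,2)] .

end
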